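(* Let $h:L\to M$ and $g:N\to M$ be morphisms of DGLAs over $\mathbb{C}$. Equip the suspended mapping cone $C^\cdot_{(h,g)}$ with the $L_\infty$ structure defined in the context, and let $H_{(h,g)}$ be the DGLA associated with $(h,g)$. Then there is an isomorphism of functors $\mathbf{Art}\to\mathbf{Set}$ $$\operatorname{Def}^\infty_{C^\cdot_{(h,g)}}\cong\operatorname{Def}_{H_{(h,g)}}.$$
   Context: $\mathbf{Art}$ is the category of local Artinian $\mathbb{C}$-algebras $(A,m_A)$ with residue field $\mathbb{C}$. DGLA means differential graded Lie algebra (differential of degree $+1$) over $\mathbb{C}$. $V[1]^i=V^{i+1}$. **Deformation functor of a DGLA.** $\operatorname{MC}_L(A)=\{x\in L^1\otimes m_A\mid dx+\frac12[x,x]=0\}$; for $a\in L^0\otimes m_A$, $e^a*x=x+\sum_{n\ge0}\frac{[a,-]^n}{(n+1)!}([a,x]-da)$; $\operatorname{Def}_L(A)=\operatorname{MC}_L(A)/\exp(L^0\otimes m_A)$. **$L_\infty$-algebras.** An $L_\infty$ structure on a graded vector space $V$ is a system of degree-one linear maps $q_k:\bigodot^k(V[1])\to V[1]$, $k\ge1$, such that the induced coderivation $Q$ of $\bigoplus_{n\ge1}\bigodot^nV[1]$ satisfies $Q\circ Q=0$. A DGLA is an $L_\infty$-algebra with $q_1(v)=-dv$, $q_2(v\odot w)=(-1)^{\deg v}[v,w]$ ($\deg v$ the unshifted degree), $q_k=0$ for $k\ge3$. For an $L_\infty$-algebra $T$ with multiplications $\langle\ \rangle_j$, $\operatorname{MC}^\infty_T(A)=\{\gamma\in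 T^1\otimes m_A\mid\sum_{j\ge1}\frac{\langle\gamma^{\odot j}\rangle_j}{j!}=0\}$. Elements $x,y\in\operatorname{MC}^\infty_T(A)$ are homotopy equivalent if there is $\xi(s,ds)\in\operatorname{MC}^\infty_{T[s,ds]}(A)$ with $\xi(0)=x$, $\xi(1)=y$, where $T[s,ds]=T\otimes\mathbb{C}[s,ds]$ ($\mathbb{C}[s,ds]$ the polynomial differential forms on the affine line) with the naturally extended $L_\infty$ structure. $\operatorname{Def}^\infty_T=\operatorname{MC}^\infty_T/\text{homotopy}$. **$H_{(h,g)}$ and the $L_\infty$ structure on the cone.** $C^i_{(h,g)}=L^i\oplus N^i\oplus M^{i-1}$ with differential $D(l,n,m)=(dl,dn,-dm-g(n)+h(l))$. Let $M[t,dt]=M\otimes\mathbb{C}[t,dt]$, with evaluations $e_a:M[t,dt]\to M$, $e_a(\sum m_it^i+n_it^idt)=\sum m_ia^i$, and let $H_{(h,g)}=\{(l,n,m(t,dt))\in L\times N\times M[t,dt]\mid h(l)=e_1(m(t,dt)),\ g(n)=e_0(m(t,dt))\}$, a DGLA with componentwise structure, regarded as an $L_\infty$-algebra with maps $q_1(l,n,m(t,dt))=(-dl,-dn,-dm(t,dt))$, $q_2((l_1,n_1,m_1(t,dt))\odot(l_2,n_2,m_2(t,dt)))=(-1)^{\deg(l_1,n_1,m_1(t,dt))}([l_1,l_2],[n_1,n_2],[m_1(t,dt),m_2(t,dt)])$ (where $\deg$ is the unshifted degree in $H_{(h,g)}$) and $q_k=0$ for $k\ge3$. Integration $\int_a^b:M[t,dt]\to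 M$ is $\int_a^b(\sum_it^im_i+t^idt\cdot n_i)=\sum_i(\int_a^bt^idt)n_i$. Define $\imath:C^\cdot_{(h,g)}[1]\to H_{(h,g)}[1]$, $\imath(l,n,m)=(l,n,(1-t)g(n)+th(l)+dt\,m)$; $\pi:H_{(h,g)}[1]\to C^\cdot_{(h,g)}[1]$, $\pi(l,n,m(t,dt))=(l,n,\int_0^1m(t,dt))$; $K:H_{(h,g)}[1]\to H_{(h,g)}[1]$, $K(l,n,m(t,dt))=(0,0,t\int_0^1m(t,dt)-\int_0^tm(t,dt))$. The $L_\infty$ structure on $C^\cdot_{(h,g)}$ (obtained by homotopy transfer from $H_{(h,g)}$; it is quasi-isomorphic to $H_{(h,g)}$ via an $L_\infty$-quasi-isomorphism with linear part $\imath$) is $\langle(l,n,m)\rangle_1=(-dl,-dn,dm+g(n)-h(l))$ and, for $r\ge2$, $$\langle\gamma_1\odot\cdots\odot\gamma_r\rangle_r=\frac{(-1)^{r-2}}{2}\sum_{\sigma\in\Sigma_r}\varepsilon(\sigma)\,\pi q_2(\imath(\gamma_{\sigma(1)})\odot Kq_2(\imath(\gamma_{\sigma(2)})\odot\cdots\odot Kq_2(\imath(\gamma_{\sigma(r-1)})\odot\imath(\gamma_{\sigma(r)}))\cdots)),$$ where $\varepsilon(\sigma)$ is the Koszul sign. *)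

theory Defs
  imports
    Complex_Main
    "HOL-Library.Product_Plus"
    "HOL-Computational_Algebra.Polynomial"
    "HOL-Combinatorics.Permutations"
    "HOL-Algebra.QuotRing"
    "HOL-Algebra.Module"
begin

section \<open>Graded vector spaces, DGLAs and \<open>L\<infinity>\<close>-algebras\<close>

text \<open>
  A graded vector space is a family of complex vector spaces indexed by the integers; the
  homogeneous pieces are realised as subspaces of one ambient space of type \<open>'v\<close>.  Only
  homogeneous elements are ever used, and every operation receives the degree of its arguments,
  so it is not necessary for the pieces to be independent in the ambient space.
\<close>

record 'v graded =
  gcomp :: "int \<Rightarrow> 'v set"
  gscale :: "complex \<Rightarrow> 'v \<Rightarrow> 'v"

record 'v dgla = "'v graded" +
  diff :: "int \<Rightarrow> 'v \<Rightarrow> 'v"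
  brkt :: "int \<Rightarrow> int \<Rightarrow> 'v \<Rightarrow> 'v \<Rightarrow> 'v"

text \<open>
  \<open>lmult T [(i\<^sub>1,v\<^sub>1),\<dots>,(i\<^sub>k,v\<^sub>k)]\<close> is the value of the \<open>k\<close>-th multiplication on
  \<open>v\<^sub>1 \<odot> \<dots> \<odot> v\<^sub>k\<close>, where \<open>i\<^sub>j\<close> is the degree of \<open>v\<^sub>j\<close> in \<open>V[1]\<close>; thus \<open>v\<^sub>j\<close> lies in
  \<open>gcomp T (i\<^sub>j + 1)\<close>.
\<close>

record 'v linf = "'v graded" +
  lmult :: "(int \<times> 'v) list \<Rightarrow> 'v"

definition ksgn :: "int \<Rightarrow> complex" where
  "ksgn n = (if even n then 1 else - 1)"

definition graded_space :: "('v::ab_group_add, 'z) graded_scheme \<Rightarrow> bool" where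
  "graded_space V \<longleftrightarrow> vector_space (gscale V) \<and>
     (\<forall>i. Modules.module.subspace (gscale V) (gcomp V i))"

definition linear_between ::
  "(complex \<Rightarrow> 'v::ab_group_add \<Rightarrow> 'v) \<Rightarrow> 'v set \<Rightarrow>
   (complex \<Rightarrow> 'w::ab_group_add \<Rightarrow> 'w) \<Rightarrow> 'w set \<Rightarrow> ('v \<Rightarrow> 'w) \<Rightarrow> bool" where
  "linear_between s V s' W f \<longleftrightarrow>
     (\<forall>x\<in>V. f x \<in> W) \<and>
     (\<forall>x\<in>V. \<forall>y\<in>V. f (x + y) = f x + f y) \<and>
     (\<forall>c. \<forall>x\<in>V. f (s c x) = s' c (f x))"

definition is_dgla :: "'v::ab_group_add dgla \<Rightarrow> bool" where
  "is_dgla L \<longleftrightarrow> graded_space L \<and>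
     (\<forall>i. linear_between (gscale L) (gcomp L i) (gscale L) (gcomp L (i + 1)) (diff L i)) \<and>
     (\<forall>i. \<forall>x\<in>gcomp L i. diff L (i + 1) (diff L i x) = 0) \<and>
     (\<forall>i j. \<forall>x\<in>gcomp L i.
        linear_between (gscale L) (gcomp L j) (gscale L) (gcomp L (i + j)) (\<lambda>y. brkt L i j x y)) \<and>
     (\<forall>i j. \<forall>y\<in>gcomp L j.
        linear_between (gscale L) (gcomp L i) (gscale L) (gcomp L (i + j)) (\<lambda>x. brkt L i j x y)) \<and>
     (\<forall>i j. \<forall>x\<in>gcomp L i. \<forall>y\<in>gcomp L j.
        brkt L i j x y = - gscale L (ksgn (i * j)) (brkt L j i y x)) \<and>
     (\<forall>i j k. \<forall>x\<in>gcomp L i. \<forall>y\<in>gcomp L j. \<forall>z\<in>gcomp L k.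
        brkt L i (j + k) x (brkt L j k y z) =
          brkt L (i + j) k (brkt L i j x y) z +
          gscale L (ksgn (i * j)) (brkt L j (i + k) y (brkt L i k x z))) \<and>
     (\<forall>i j. \<forall>x\<in>gcomp L i. \<forall>y\<in>gcomp L j.
        diff L (i + j) (brkt L i j x y) =
          brkt L (i + 1) j (diff L i x) y +
          gscale L (ksgn i) (brkt L i (j + 1) x (diff L j y)))"

definition dgla_hom ::
  "(int \<Rightarrow> 'l::ab_group_add \<Rightarrow> 'm::ab_group_add) \<Rightarrow> 'l dgla \<Rightarrow> 'm dgla \<Rightarrow> bool" where
  "dgla_hom h L M \<longleftrightarrow>
     (\<forall>i. linear_between (gscale L) (gcomp L i) (gscale M) (gcomp M i) (h i)) \<and>
     (\<forall>i. \<forall>x\<in>gcomp L i. h (i + 1) (diff L i x) = diff M i (h i x)) \<and>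
     (\<forall>i j. \<forall>x\<in>gcomp L i. \<forall>y\<in>gcomp L j.
        h (i + j) (brkt L i j x y) = brkt M i j (h i x) (h j y))"

definition linf_of_dgla :: "'v::ab_group_add dgla \<Rightarrow> 'v linf" where
  "linf_of_dgla L =
     \<lparr> gcomp = gcomp L, gscale = gscale L,
       lmult = (\<lambda>xs. case xs of
           [(i, v)] \<Rightarrow> - diff L (i + 1) v
         | [(i, v), (j, w)] \<Rightarrow> gscale L (ksgn (i + 1)) (brkt L (i + 1) (j + 1) v w)
         | _ \<Rightarrow> 0) \<rparr>"

section \<open>Polynomial differential forms with coefficients\<close>

text \<open>
  An element \<open>p(t) + dt q(t)\<close> of \<open>V[t,dt]\<close> is the pair \<open>(p, q)\<close> of polynomials with coefficients
  in \<open>V\<close>.  Forms are written to the left of coefficients, so \<open>t\<^sup>i dt n = (-1)\<^sup>|\<^sup>n\<^sup>| n t\<^sup>i dt\<close>; all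
  signs below follow from the Koszul rule for this convention.  In particular
  \<open>d(p + dt q) = d p + dt (p' - d q)\<close>.
\<close>

type_synonym 'v forms = "'v poly \<times> 'v poly"

definition poly_deriv :: "(complex \<Rightarrow> 'v::ab_group_add \<Rightarrow> 'v) \<Rightarrow> 'v poly \<Rightarrow> 'v poly" where
  "poly_deriv s p = (\<Sum>i\<le>degree p. monom (s (of_nat i) (coeff p i)) (i - 1))"

definition poly_eval :: "(complex \<Rightarrow> 'v::ab_group_add \<Rightarrow> 'v) \<Rightarrow> complex \<Rightarrow> 'v poly \<Rightarrow> 'v" where
  "poly_eval s a p = (\<Sum>i\<le>degree p. s (a ^ i) (coeff p i))"

definition poly_integral ::
  "(complex \<Rightarrow> 'v::ab_group_add \<Rightarrow> 'v) \<Rightarrow> complex \<Rightarrow> complex \<Rightarrow> 'v poly \<Rightarrow> 'v" where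
  "poly_integral s a b q =
     (\<Sum>i\<le>degree q. s ((b ^ (i + 1) - a ^ (i + 1)) / of_nat (i + 1)) (coeff q i))"

text \<open>\<open>\<integral>\<^sub>0\<^sup>t\<close> as a polynomial in the upper limit \<open>t\<close>\<close>

definition poly_primitive :: "(complex \<Rightarrow> 'v::ab_group_add \<Rightarrow> 'v) \<Rightarrow> 'v poly \<Rightarrow> 'v poly" where
  "poly_primitive s q = (\<Sum>i\<le>degree q. monom (s (1 / of_nat (i + 1)) (coeff q i)) (i + 1))"

definition poly_conv :: "('v::ab_group_add \<Rightarrow> 'v \<Rightarrow> 'v) \<Rightarrow> 'v poly \<Rightarrow> 'v poly \<Rightarrow> 'v poly" where
  "poly_conv b p q =
     (\<Sum>i\<le>degree p. \<Sum>j\<le>degree q. monom (b (coeff p i) (coeff q j)) (i + j))"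

definition poly_multiconv :: "('v::ab_group_add list \<Rightarrow> 'v) \<Rightarrow> 'v poly list \<Rightarrow> 'v poly" where
  "poly_multiconv b ps =
     (\<Sum>is\<in>listset (map (\<lambda>p. {..degree p}) ps). monom (b (map2 coeff ps is)) (sum_list is))"

definition forms_comp :: "(int \<Rightarrow> 'v::ab_group_add set) \<Rightarrow> int \<Rightarrow> 'v forms set" where
  "forms_comp V i = {(p, q). (\<forall>k. coeff p k \<in> V i) \<and> (\<forall>k. coeff q k \<in> V (i - 1))}"

definition forms_scale ::
  "(complex \<Rightarrow> 'v::ab_group_add \<Rightarrow> 'v) \<Rightarrow> complex \<Rightarrow> 'v forms \<Rightarrow> 'v forms" where
  "forms_scale s c = (\<lambda>(p, q). (map_poly (s c) p, map_poly (s c) q))"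

definition forms_eval ::
  "(complex \<Rightarrow> 'v::ab_group_add \<Rightarrow> 'v) \<Rightarrow> complex \<Rightarrow> 'v forms \<Rightarrow> 'v" where
  "forms_eval s a = (\<lambda>(p, q). poly_eval s a p)"

definition forms_integral ::
  "(complex \<Rightarrow> 'v::ab_group_add \<Rightarrow> 'v) \<Rightarrow> complex \<Rightarrow> complex \<Rightarrow> 'v forms \<Rightarrow> 'v" where
  "forms_integral s a b = (\<lambda>(p, q). poly_integral s a b q)"

definition forms_dgla :: "'m::ab_group_add dgla \<Rightarrow> 'm forms dgla" where
  "forms_dgla M =
     \<lparr> gcomp = forms_comp (gcomp M),
       gscale = forms_scale (gscale M),
       diff = (\<lambda>i (p, q).
         (map_poly (diff M i) p,
          poly_deriv (gscale M) p - map_poly (diff M (i - 1)) q)),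
       brkt = (\<lambda>i j (p, q) (p', q').
         (poly_conv (brkt M i j) p p',
          map_poly (gscale M (ksgn i)) (poly_conv (brkt M i (j - 1)) p q')
            + poly_conv (brkt M (i - 1) j) q p')) \<rparr>"

text \<open>
  The extension of an \<open>L\<infinity>\<close> structure to \<open>T[s,ds]\<close>: for forms \<open>\<omega>\<^sub>j\<close> and elements \<open>v\<^sub>j\<close> of \<open>T[1]\<close>,
  \<open>\<langle>\<omega>\<^sub>1v\<^sub>1 \<odot> \<dots> \<odot> \<omega>\<^sub>kv\<^sub>k\<rangle> = \<plusminus> \<omega>\<^sub>1\<dots>\<omega>\<^sub>k \<langle>v\<^sub>1 \<odot> \<dots> \<odot> v\<^sub>k\<rangle>\<close> with the Koszul sign, the operation itself
  having degree one, and for \<open>k = 1\<close> there is the additional term \<open>- d\<omega> v\<close>, in accordance with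
  \<open>q\<^sub>1 = - d\<close> for DGLAs.  As \<open>ds ds = 0\<close>, at most one of the arguments contributes its
  \<open>ds\<close>-part.
\<close>

definition linf_forms :: "'v::ab_group_add linf \<Rightarrow> 'v forms linf" where
  "linf_forms T =
     \<lparr> gcomp = forms_comp (gcomp T),
       gscale = forms_scale (gscale T),
       lmult = (\<lambda>xs.
         let is = map fst xs; ps = map (fst \<circ> snd) xs; qs = map (snd \<circ> snd) xs in
         (poly_multiconv (\<lambda>vs. lmult T (zip is vs)) ps,
          (\<Sum>j<length xs.
             map_poly (gscale T (ksgn (1 + (\<Sum>i<j. is ! i))))
               (poly_multiconv (\<lambda>vs. lmult T (zip (is[j := is ! j - 1]) vs)) (ps[j := qs ! j])))
          - (if length xs = 1 then poly_deriv (gscale T) (hd ps) else 0))) \<rparr>"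

section \<open>The DGLA \<open>H\<close> and the \<open>L\<infinity>\<close> structure on the suspended mapping cone\<close>

definition H_dgla ::
  "'l::ab_group_add dgla \<Rightarrow> 'n::ab_group_add dgla \<Rightarrow> 'm::ab_group_add dgla \<Rightarrow>
   (int \<Rightarrow> 'l \<Rightarrow> 'm) \<Rightarrow> (int \<Rightarrow> 'n \<Rightarrow> 'm) \<Rightarrow> ('l \<times> 'n \<times> 'm forms) dgla" where
  "H_dgla L N M h g =
     \<lparr> gcomp = (\<lambda>i. {(l, n, m). l \<in> gcomp L i \<and> n \<in> gcomp N i \<and> m \<in> gcomp (forms_dgla M) i \<and>
          h i l = forms_eval (gscale M) 1 m \<and> g i n = forms_eval (gscale M) 0 m}),
       gscale = (\<lambda>c (l, n, m). (gscale L c l, gscale N c n, gscale (forms_dgla M) c m)),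
       diff = (\<lambda>i (l, n, m). (diff L i l, diff N i n, diff (forms_dgla M) i m)),
       brkt = (\<lambda>i j (l, n, m) (l', n', m').
          (brkt L i j l l', brkt N i j n n', brkt (forms_dgla M) i j m m')) \<rparr>"

text \<open>
  The maps \<open>\<imath>\<close>, \<open>\<pi>\<close>, \<open>K\<close>; the integer argument of \<open>cone_incl\<close> is the degree in the shifted
  complex.
\<close>

definition cone_incl ::
  "(int \<Rightarrow> 'l \<Rightarrow> 'm) \<Rightarrow> (int \<Rightarrow> 'n \<Rightarrow> 'm) \<Rightarrow> int \<Rightarrow>
   'l \<times> 'n \<times> 'm::ab_group_add \<Rightarrow> 'l \<times> 'n \<times> 'm forms" where
  "cone_incl h g k =
     (\<lambda>(l, n, m). (l, n, ([: g (k + 1) n, h (k + 1) l - g (k + 1) n :], [: m :])))"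

definition cone_proj ::
  "'m::ab_group_add dgla \<Rightarrow> 'l \<times> 'n \<times> 'm forms \<Rightarrow> 'l \<times> 'n \<times> 'm" where
  "cone_proj M = (\<lambda>(l, n, m). (l, n, forms_integral (gscale M) 0 1 m))"

definition cone_homotopy ::
  "'m::ab_group_add dgla \<Rightarrow> 'l::zero \<times> 'n::zero \<times> 'm forms \<Rightarrow> 'l \<times> 'n \<times> 'm forms" where
  "cone_homotopy M = (\<lambda>(l, n, (p, q)).
     (0, 0, (monom (poly_integral (gscale M) 0 1 q) 1 - poly_primitive (gscale M) q, 0)))"

text \<open>
  \<open>q2 (x\<^sub>1 \<odot> K q2 (x\<^sub>2 \<odot> \<dots> \<odot> K q2 (x\<^sub>r\<^sub>-\<^sub>1 \<odot> x\<^sub>r)))\<close>; since \<open>K\<close> and \<open>q2\<close> have degrees \<open>-1\<close> and \<open>1\<close>,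
  the composite \<open>K q2\<close> adds degrees.
\<close>

fun iterate_q2 :: "((int \<times> 'v) list \<Rightarrow> 'v) \<Rightarrow> ('v \<Rightarrow> 'v) \<Rightarrow> (int \<times> 'v) list \<Rightarrow> 'v::zero" where
  "iterate_q2 q2 K (x # y # z # zs) =
     q2 [x, (sum_list (map fst (y # z # zs)), K (iterate_q2 q2 K (y # z # zs)))]"
| "iterate_q2 q2 K [x, y] = q2 [x, y]"
| "iterate_q2 q2 K _ = 0"

text \<open>
  \<open>v\<^sub>0 \<odot> \<dots> \<odot> v\<^sub>r\<^sub>-\<^sub>1 = koszul_sign ds \<sigma> \<cdot> v\<^sub>\<sigma>\<^sub>(\<^sub>0\<^sub>) \<odot> \<dots> \<odot> v\<^sub>\<sigma>\<^sub>(\<^sub>r\<^sub>-\<^sub>1\<^sub>)\<close> for \<open>v\<^sub>i\<close> of degree \<open>ds ! i\<close>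
\<close>

definition koszul_sign :: "int list \<Rightarrow> (nat \<Rightarrow> nat) \<Rightarrow> complex" where
  "koszul_sign ds \<sigma> =
     (\<Prod>(i, j) \<in> {(i, j). i < j \<and> j < length ds \<and> \<sigma> j < \<sigma> i}. ksgn (ds ! \<sigma> i * ds ! \<sigma> j))"

definition cone_linf ::
  "'l::ab_group_add dgla \<Rightarrow> 'n::ab_group_add dgla \<Rightarrow> 'm::ab_group_add dgla \<Rightarrow>
   (int \<Rightarrow> 'l \<Rightarrow> 'm) \<Rightarrow> (int \<Rightarrow> 'n \<Rightarrow> 'm) \<Rightarrow> ('l \<times> 'n \<times> 'm) linf" where
  "cone_linf L N M h g =
     (let s = (\<lambda>c (l, n, m). (gscale L c l, gscale N c n, gscale M c m)) in
      \<lparr> gcomp = (\<lambda>i. gcomp L i \<times> gcomp N i \<times> gcomp M (i - 1)),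
        gscale = s,
        lmult = (\<lambda>xs. case xs of
            [] \<Rightarrow> 0
          | [(k, (l, n, m))] \<Rightarrow>
              (- diff L (k + 1) l, - diff N (k + 1) n,
               diff M k m + g (k + 1) n - h (k + 1) l)
          | _ \<Rightarrow>
              s ((- 1) ^ (length xs - 2) / 2)
                (\<Sum>\<sigma> | \<sigma> permutes {..<length xs}.
                   s (koszul_sign (map fst xs) \<sigma>)
                     (cone_proj M
                       (iterate_q2 (lmult (linf_of_dgla (H_dgla L N M h g))) (cone_homotopy M)
                         (map (\<lambda>i. case xs ! \<sigma> i of (k, x) \<Rightarrow> (k, cone_incl h g k x))
                              [0..<length xs]))))) \<rparr>)"

section \<open>Local Artinian algebras\<close>

definition complex_field :: "complex ring" where
  "complex_field =
     \<lparr> carrier = UNIV, mult = (*), one = 1, ring.zero = 0, add = (+) \<rparr>"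

type_synonym 'a calgebra = "(complex, 'a) module"

definition local_ring :: "('a, 'b) ring_scheme \<Rightarrow> bool" where
  "local_ring A \<longleftrightarrow> (\<exists>!I. maximalideal I A)"

definition max_ideal :: "('a, 'b) ring_scheme \<Rightarrow> 'a set" where
  "max_ideal A = (THE I. maximalideal I A)"

definition artinian :: "('a, 'b) ring_scheme \<Rightarrow> bool" where
  "artinian A \<longleftrightarrow>
     (\<forall>I :: nat \<Rightarrow> 'a set. (\<forall>n. ideal (I n) A \<and> I (Suc n) \<subseteq> I n) \<longrightarrow> (\<exists>n0. \<forall>n\<ge>n0. I n = I n0))"

text \<open>
  Objects and morphisms of \<open>Art\<close>.  The carriers range over subsets of a type \<open>'a\<close>, which serves
  as the universe of the category.  A homomorphism of such algebras is automatically local.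
\<close>

definition Art :: "'a calgebra set" where
  "Art = {A. algebra complex_field A \<and> local_ring A \<and> artinian A \<and>
     (\<lambda>c. max_ideal A +>\<^bsub>A\<^esub> (c \<odot>\<^bsub>A\<^esub> \<one>\<^bsub>A\<^esub>)) \<in> ring_iso complex_field (A Quot max_ideal A)}"

definition Art_hom :: "'a calgebra \<Rightarrow> 'a calgebra \<Rightarrow> ('a \<Rightarrow> 'a) set" where
  "Art_hom A B =
     {f \<in> ring_hom A B. \<forall>c. \<forall>a\<in>carrier A. f (c \<odot>\<^bsub>A\<^esub> a) = c \<odot>\<^bsub>B\<^esub> f a}"

section \<open>Tensor products with the maximal ideal\<close>

text \<open>
  The tensor product of \<open>V\<close> and \<open>m\<^sub>A\<close> is the set of finite formal sums of pairs, represented by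
  lists, modulo the congruence generated by commutativity and bilinearity.
\<close>

type_synonym ('v, 'a) fsum = "('v \<times> 'a) list"

inductive tensor_eq ::
  "(complex \<Rightarrow> 'v::ab_group_add \<Rightarrow> 'v) \<Rightarrow> 'v set \<Rightarrow> 'a calgebra \<Rightarrow>
   ('v, 'a) fsum \<Rightarrow> ('v, 'a) fsum \<Rightarrow> bool"
  for s V A where
  refl: "x \<in> lists (V \<times> max_ideal A) \<Longrightarrow> tensor_eq s V A x x"
| sym: "tensor_eq s V A x y \<Longrightarrow> tensor_eq s V A y x"
| trans: "tensor_eq s V A x y \<Longrightarrow> tensor_eq s V A y z \<Longrightarrow> tensor_eq s V A x z"
| append: "tensor_eq s V A x y \<Longrightarrow> tensor_eq s V A x' y' \<Longrightarrow> tensor_eq s V A (x @ x') (y @ y')"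
| comm: "x \<in> lists (V \<times> max_ideal A) \<Longrightarrow> y \<in> lists (V \<times> max_ideal A) \<Longrightarrow>
    tensor_eq s V A (x @ y) (y @ x)"
| zero: "a \<in> max_ideal A \<Longrightarrow> tensor_eq s V A [(0, a)] []"
| add_left: "v \<in> V \<Longrightarrow> w \<in> V \<Longrightarrow> a \<in> max_ideal A \<Longrightarrow>
    tensor_eq s V A [(v + w, a)] [(v, a), (w, a)]"
| add_right: "v \<in> V \<Longrightarrow> a \<in> max_ideal A \<Longrightarrow> b \<in> max_ideal A \<Longrightarrow>
    tensor_eq s V A [(v, a \<oplus>\<^bsub>A\<^esub> b)] [(v, a), (v, b)]"
| scale: "v \<in> V \<Longrightarrow> a \<in> max_ideal A \<Longrightarrow> tensor_eq s V A [(s c v, a)] [(v, c \<odot>\<^bsub>A\<^esub> a)]"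

definition fsums :: "('v, 'z) graded_scheme \<Rightarrow> 'a calgebra \<Rightarrow> int \<Rightarrow> ('v, 'a) fsum set" where
  "fsums V A i = lists (gcomp V i \<times> max_ideal A)"

abbreviation teq ::
  "('v::ab_group_add, 'z) graded_scheme \<Rightarrow> 'a calgebra \<Rightarrow> int \<Rightarrow>
   ('v, 'a) fsum \<Rightarrow> ('v, 'a) fsum \<Rightarrow> bool" where
  "teq V A i \<equiv> tensor_eq (gscale V) (gcomp V i) A"

text \<open>The element of the tensor product of \<open>V\<^sup>i\<close> and \<open>m\<^sub>A\<close> represented by a formal sum\<close>

definition tclass ::
  "('v::ab_group_add, 'z) graded_scheme \<Rightarrow> 'a calgebra \<Rightarrow> int \<Rightarrow>
   ('v, 'a) fsum \<Rightarrow> ('v, 'a) fsum set" where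
  "tclass V A i x = {y. teq V A i x y}"

definition tmap :: "('v \<Rightarrow> 'w) \<Rightarrow> ('v, 'a) fsum \<Rightarrow> ('w, 'a) fsum" where
  "tmap f x = map (\<lambda>(v, a). (f v, a)) x"

text \<open>
  The infinite series of the definitions are finite sums because \<open>m\<^sub>A\<close> is nilpotent: their value is
  the eventual value of the partial sums.
\<close>

definition tseries ::
  "('v::ab_group_add, 'z) graded_scheme \<Rightarrow> 'a calgebra \<Rightarrow> int \<Rightarrow>
   (nat \<Rightarrow> ('v, 'a) fsum) \<Rightarrow> ('v, 'a) fsum \<Rightarrow> bool" where
  "tseries V A i f y \<longleftrightarrow>
     eventually (\<lambda>n. teq V A i (concat (map f [0..<n])) y) sequentially"

definition tbrkt ::
  "'v dgla \<Rightarrow> 'a calgebra \<Rightarrow> int \<Rightarrow> int \<Rightarrow>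
   ('v, 'a) fsum \<Rightarrow> ('v, 'a) fsum \<Rightarrow> ('v, 'a) fsum" where
  "tbrkt L A i j x y = [(brkt L i j v w, a \<otimes>\<^bsub>A\<^esub> b). (v, a) \<leftarrow> x, (w, b) \<leftarrow> y]"

text \<open>\<open>\<langle>\<gamma>\<^sup>\<odot>\<^sup>k\<rangle>\<^sub>k\<close> for \<open>\<gamma>\<close> of degree one, i.e. of degree zero after the shift\<close>

definition tpower ::
  "'v linf \<Rightarrow> 'a calgebra \<Rightarrow> nat \<Rightarrow> ('v, 'a) fsum \<Rightarrow> ('v, 'a) fsum" where
  "tpower T A k x =
     map (\<lambda>ws. (lmult T (map (\<lambda>w. (0, fst w)) ws),
                foldr (\<lambda>w b. snd w \<otimes>\<^bsub>A\<^esub> b) ws \<one>\<^bsub>A\<^esub>))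
       (List.n_lists k x)"

section \<open>Set-valued functors on \<open>Art\<close>\<close>

record ('a, 'x) art_functor =
  fobj :: "'a calgebra \<Rightarrow> 'x set"
  fmap :: "'a calgebra \<Rightarrow> 'a calgebra \<Rightarrow> ('a \<Rightarrow> 'a) \<Rightarrow> 'x \<Rightarrow> 'x"

text \<open>
  Morphisms are determined by their values on the carrier, hence the third condition.
\<close>

definition is_functor :: "('a, 'x) art_functor \<Rightarrow> bool" where
  "is_functor F \<longleftrightarrow>
     (\<forall>A\<in>Art. \<forall>x\<in>fobj F A. fmap F A A (\<lambda>a. a) x = x) \<and>
     (\<forall>A\<in>Art. \<forall>B\<in>Art. \<forall>f\<in>Art_hom A B. \<forall>x\<in>fobj F A. fmap F A B f x \<in> fobj F B) \<and>
     (\<forall>A\<in>Art. \<forall>B\<in>Art. \<forall>f\<in>Art_hom A B. \<forall>f'\<in>Art_hom A B. (\<forall>a\<in>carrier A. f a = f' a) \<longrightarrow>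
        (\<forall>x\<in>fobj F A. fmap F A B f x = fmap F A B f' x)) \<and>
     (\<forall>A\<in>Art. \<forall>B\<in>Art. \<forall>C\<in>Art. \<forall>f\<in>Art_hom A B. \<forall>k\<in>Art_hom B C. \<forall>x\<in>fobj F A.
        fmap F A C (k \<circ> f) x = fmap F B C k (fmap F A B f x))"

definition functor_iso :: "('a, 'x) art_functor \<Rightarrow> ('a, 'y) art_functor \<Rightarrow> bool" where
  "functor_iso F G \<longleftrightarrow> is_functor F \<and> is_functor G \<and>
     (\<exists>\<Phi>. (\<forall>A\<in>Art. bij_betw (\<Phi> A) (fobj F A) (fobj G A)) \<and>
          (\<forall>A\<in>Art. \<forall>B\<in>Art. \<forall>f\<in>Art_hom A B. \<forall>x\<in>fobj F A.
             \<Phi> B (fmap F A B f x) = fmap G A B f (\<Phi> A x)))"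

text \<open>
  The map induced by \<open>f : A \<rightarrow> B\<close> on the tensor products with the maximal ideals, and the map it
  induces on quotients by relations: a class \<open>c\<close> is sent to the \<open>r\<close>-class of the image of any of its
  members.
\<close>

definition tpush ::
  "('v::ab_group_add, 'z) graded_scheme \<Rightarrow> 'a calgebra \<Rightarrow> int \<Rightarrow> ('a \<Rightarrow> 'a) \<Rightarrow>
   ('v, 'a) fsum set \<Rightarrow> ('v, 'a) fsum set" where
  "tpush V B i f X = (\<Union>x\<in>X. tclass V B i (map (\<lambda>(v, a). (v, f a)) x))"

definition quot_push :: "('y \<times> 'y) set \<Rightarrow> ('x \<Rightarrow> 'y) \<Rightarrow> 'x set \<Rightarrow> 'y set" where
  "quot_push r f c = r `` (f ` c)"

section \<open>Deformation functors\<close>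

definition MC_eq_dgla :: "'v::ab_group_add dgla \<Rightarrow> 'a calgebra \<Rightarrow> ('v, 'a) fsum \<Rightarrow> bool" where
  "MC_eq_dgla L A x \<longleftrightarrow>
     teq L A 2 (tmap (diff L 1) x @ tmap (gscale L (1 / 2)) (tbrkt L A 1 1 x x)) []"

definition MC_dgla :: "'v::ab_group_add dgla \<Rightarrow> 'a calgebra \<Rightarrow> ('v, 'a) fsum set set" where
  "MC_dgla L A = {tclass L A 1 x | x. x \<in> fsums L A 1 \<and> MC_eq_dgla L A x}"

text \<open>\<open>y = e\<^sup>a * x\<close>\<close>

definition gauge_act ::
  "'v::ab_group_add dgla \<Rightarrow> 'a calgebra \<Rightarrow>
   ('v, 'a) fsum \<Rightarrow> ('v, 'a) fsum \<Rightarrow> ('v, 'a) fsum \<Rightarrow> bool" where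
  "gauge_act L A a x y \<longleftrightarrow>
     (let u = tbrkt L A 0 1 a x @ tmap (\<lambda>v. - diff L 0 v) a in
      \<exists>z \<in> fsums L A 1.
        tseries L A 1
          (\<lambda>n. tmap (gscale L (1 / fact (n + 1))) ((tbrkt L A 0 1 a ^^ n) u)) z \<and>
        teq L A 1 y (x @ z))"

definition gauge_rel ::
  "'v::ab_group_add dgla \<Rightarrow> 'a calgebra \<Rightarrow> (('v, 'a) fsum set \<times> ('v, 'a) fsum set) set" where
  "gauge_rel L A =
     {(tclass L A 1 x, tclass L A 1 y) | x y.
        tclass L A 1 x \<in> MC_dgla L A \<and> tclass L A 1 y \<in> MC_dgla L A \<and>
        x \<in> fsums L A 1 \<and> y \<in> fsums L A 1 \<and>
        (\<exists>a \<in> fsums L A 0. gauge_act L A a x y)}"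

definition Def_dgla ::
  "'v::ab_group_add dgla \<Rightarrow> ('a, ('v, 'a) fsum set set) art_functor" where
  "Def_dgla L =
     \<lparr> fobj = (\<lambda>A. MC_dgla L A // gauge_rel L A),
       fmap = (\<lambda>A B f. quot_push (gauge_rel L B) (tpush L B 1 f)) \<rparr>"

definition MC_eq_linf :: "'v::ab_group_add linf \<Rightarrow> 'a calgebra \<Rightarrow> ('v, 'a) fsum \<Rightarrow> bool" where
  "MC_eq_linf T A x \<longleftrightarrow>
     tseries T A 2 (\<lambda>n. tmap (gscale T (1 / fact (n + 1))) (tpower T A (n + 1) x)) []"

definition MC_linf :: "'v::ab_group_add linf \<Rightarrow> 'a calgebra \<Rightarrow> ('v, 'a) fsum set set" where
  "MC_linf T A = {tclass T A 1 x | x. x \<in> fsums T A 1 \<and> MC_eq_linf T A x}"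

definition homotopy_rel ::
  "'v::ab_group_add linf \<Rightarrow> 'a calgebra \<Rightarrow> (('v, 'a) fsum set \<times> ('v, 'a) fsum set) set" where
  "homotopy_rel T A =
     {(tclass T A 1 x, tclass T A 1 y) | x y.
        tclass T A 1 x \<in> MC_linf T A \<and> tclass T A 1 y \<in> MC_linf T A \<and>
        x \<in> fsums T A 1 \<and> y \<in> fsums T A 1 \<and>
        (\<exists>\<xi> \<in> fsums (linf_forms T) A 1. MC_eq_linf (linf_forms T) A \<xi> \<and>
           teq T A 1 (tmap (forms_eval (gscale T) 0) \<xi>) x \<and>
           teq T A 1 (tmap (forms_eval (gscale T) 1) \<xi>) y)}"

definition Def_linf ::
  "'v::ab_group_add linf \<Rightarrow> ('a, ('v, 'a) fsum set set) art_functor" where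
  "Def_linf T =
     \<lparr> fobj = (\<lambda>A. MC_linf T A // homotopy_rel T A),
       fmap = (\<lambda>A B f. quot_push (homotopy_rel T B) (tpush T B 1 f)) \<rparr>"

end

theory Submission
  imports Defs "HOL-Library.Function_Algebras" "HOL-Algebra.Ideal_Product"
begin

text \<open>
  The ideal \<open>\<mm>\<close> of an Artinian algebra \<open>A\<close> is nilpotent, so \<open>H \<otimes> \<mm>\<close> is a nilpotent DGLA, on which \<open>\<imath>\<close>, \<open>\<pi>\<close>
  and \<open>K\<close> induce a contraction onto \<open>C \<otimes> \<mm>\<close> with \<open>K\<^sup>2 = 0\<close>, \<open>K\<imath> = 0\<close>, \<open>\<pi>K = 0\<close>. Moreover \<open>[K x, K y]\<close> is
  killed by \<open>K\<close> and \<open>\<pi>\<close>, whence only right-nested brackets occur in the transferred structure.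
  The equation \<open>x = \<imath>\<gamma> + K[x,x]/2\<close> has a unique solution \<open>x\<close> for every \<open>\<gamma>\<close>, and \<open>\<gamma>\<close> is a
  Maurer-Cartan element of \<open>C\<close> iff \<open>x\<close> is one of \<open>H\<close>; in this way the Maurer-Cartan elements of \<open>C\<close>
  correspond to those \<open>x\<close> of \<open>H\<close> with \<open>K x = 0\<close>. The same applies to \<open>H[s,ds]\<close> and \<open>C[s,ds]\<close>.

  A gauge argument shows that for every \<open>x\<close> there is a unique \<open>a\<close> in the image of \<open>K\<close> with
  \<open>K(e\<^sup>a * x) = 0\<close>. Hence every gauge class of \<open>H\<close> is hit. Applied to \<open>H[s,ds]\<close>, it moves a path
  \<open>e\<^sup>s\<^sup>a * x\<close> between elements with \<open>K x = 0\<close> into the kernel of \<open>K\<close> without moving its endpoints, so that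
  gauge equivalence in \<open>H\<close> implies homotopy in \<open>C\<close>. Applied to \<open>H[s,ds]\<close> with the integration
  homotopy in place of \<open>K\<close>, it makes a path constant, so that homotopy implies gauge equivalence; the
  same two statements also replace the Baker-Campbell-Hausdorff formula in the proof that gauge
  equivalence is an equivalence relation.
\<close>

text \<open>The argument stays elementary because of a special feature of the cone: \<open>K\<close>
  reads only the \<open>dt\<close>-part of a form and returns a form without \<open>dt\<close>, and
  a product of forms without \<open>dt\<close> has none either. So a general sum over binary trees
  never has to be handled, and the factor 1/2 in the multiplications belongs to the two equal
  arguments at the innermost vertex. The obstacle is that homotopies live in \<open>T[s,ds]\<close>,
  whose operations are defined by extension of scalars and not by transfer: it must be shown that,
  for the elements entering the Maurer-Cartan equation, they agree with the structure transferred
  from \<open>H[s,ds]\<close> along the contraction extended with Koszul signs. Naturality in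
  \<open>A\<close> needs no chosen lifts, since the correspondence is expressed by the fixed point
  equation between formal sums, which every change of coefficients preserves. As tensor products are
  given by generators and relations, a separate argument shows that congruence of formal sums can be
  tested on bilinear forms.\<close>

lemma linear_betweenI:
  assumes "\<And>x. x \<in> V \<Longrightarrow> f x \<in> W"
    and "\<And>x y. x \<in> V \<Longrightarrow> y \<in> V \<Longrightarrow> f (x + y) = f x + f y"
    and "\<And>c x. x \<in> V \<Longrightarrow> f (s c x) = s' c (f x)"
  shows "linear_between s V s' W f"
  using assms by (auto simp: linear_between_def)

lemma linear_betweenD:
  assumes "linear_between s V s' W f"
  shows "x \<in> V \<Longrightarrow> f x \<in> W"
    and "x \<in> V \<Longrightarrow> y \<in> V \<Longrightarrow> f (x + y) = f x + f y"
    and "x \<in> V \<Longrightarrow> f (s c x) = s' c (f x)"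
  using assms by (auto simp: linear_between_def)

section \<open>Subspaces of complex vector spaces and linear maps defined on them\<close>

locale csub = vector_space s for s :: "complex \<Rightarrow> 'v::ab_group_add \<Rightarrow> 'v" +
  fixes V :: "'v set"
  assumes subspace_V: "subspace V"
begin

lemma zero_in [simp, intro]: "0 \<in> V"
  and add_in [simp, intro]: "x \<in> V \<Longrightarrow> y \<in> V \<Longrightarrow> x + y \<in> V"
  and scale_in [simp, intro]: "x \<in> V \<Longrightarrow> s c x \<in> V"
  and minus_in [simp, intro]: "x \<in> V \<Longrightarrow> - x \<in> V"
  and diff_in [simp, intro]: "x \<in> V \<Longrightarrow> y \<in> V \<Longrightarrow> x - y \<in> V"
  and sum_in [simp, intro]: "(\<And>i. i \<in> S \<Longrightarrow> g i \<in> V) \<Longrightarrow> sum g S \<in> V"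
  using subspace_V by (auto intro: subspace_0 subspace_add subspace_scale subspace_neg subspace_diff
    subspace_sum)

lemma linear_between_0:
  "linear_between s V s' W f \<Longrightarrow> f 0 = 0"
  using linear_betweenD(2)[of s V s' W f 0 0] by simp

lemma linear_between_minus:
  assumes "linear_between s V s' W f" "x \<in> V"
  shows "f (- x) = - f x"
  using linear_betweenD(2)[OF assms(1), of x "- x"] linear_between_0[OF assms(1)] assms(2)
  by (simp add: eq_neg_iff_add_eq_0 add.commute)

lemma linear_between_diff:
  assumes "linear_between s V s' W f" "x \<in> V" "y \<in> V"
  shows "f (x - y) = f x - f y"
  using linear_betweenD(2)[OF assms(1), of x "- y"] linear_between_minus[OF assms(1), of y] assms
  by simp

lemma linear_between_sum:
  assumes "linear_between s V s' W f" "\<And>i. i \<in> S \<Longrightarrow> g i \<in> V"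
  shows "f (sum g S) = (\<Sum>i\<in>S. f (g i))"
  using assms(2)
proof (induction S rule: infinite_finite_induct)
  case (insert i S)
  then show ?case using linear_betweenD(2)[OF assms(1), of "g i" "sum g S"] by auto
qed (use linear_between_0[OF assms(1)] in auto)

end

lemma linear_between_compose:
  "linear_between s V s' W f \<Longrightarrow> linear_between s' W s'' X g \<Longrightarrow>
   linear_between s V s'' X (\<lambda>x. g (f x))"
  by (auto simp: linear_between_def)

definition bilinear_between ::
  "(complex \<Rightarrow> 'u::ab_group_add \<Rightarrow> 'u) \<Rightarrow> 'u set \<Rightarrow> (complex \<Rightarrow> 'v::ab_group_add \<Rightarrow> 'v) \<Rightarrow> 'v set \<Rightarrow>
   (complex \<Rightarrow> 'w::ab_group_add \<Rightarrow> 'w) \<Rightarrow> 'w set \<Rightarrow> ('u \<Rightarrow> 'v \<Rightarrow> 'w) \<Rightarrow> bool" where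
  "bilinear_between s U s' V s'' W b \<longleftrightarrow>
     (\<forall>x\<in>U. linear_between s' V s'' W (b x)) \<and> (\<forall>y\<in>V. linear_between s U s'' W (\<lambda>x. b x y))"

lemma bilinear_betweenD:
  assumes "bilinear_between s U s' V s'' W b"
  shows "x \<in> U \<Longrightarrow> linear_between s' V s'' W (b x)"
    and "y \<in> V \<Longrightarrow> linear_between s U s'' W (\<lambda>x. b x y)"
  using assms by (auto simp: bilinear_between_def)

section \<open>Polynomials with coefficients in a vector space\<close>

definition pcoeffs :: "'v::zero set \<Rightarrow> 'v poly set" where
  "pcoeffs V = {p. \<forall>k. coeff p k \<in> V}"

lemma pcoeffsI: "(\<And>k. coeff p k \<in> V) \<Longrightarrow> p \<in> pcoeffs V"
  by (simp add: pcoeffs_def)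

lemma pcoeffsD [simp]: "p \<in> pcoeffs V \<Longrightarrow> coeff p k \<in> V"
  by (simp add: pcoeffs_def)

lemma poly_evalI:
  assumes "vector_space s" "degree p \<le> D"
  shows "poly_eval s a p = (\<Sum>i\<le>D. s (a ^ i) (coeff p i))"
proof -
  interpret vector_space s by fact
  show ?thesis unfolding poly_eval_def
    by (rule sum.mono_neutral_left) (use assms in \<open>auto simp: coeff_eq_0\<close>)
qed

text \<open>Kept apart from \<open>csub\<close>: evaluation, derivative and primitive of polynomials
  obey their rules for arbitrary coefficients, so these rules carry no membership
  conditions.\<close>

locale cvec = vector_space s for s :: "complex \<Rightarrow> 'v::ab_group_add \<Rightarrow> 'v"
begin

lemma coeff_poly_deriv: "coeff (poly_deriv s p) n = s (of_nat (Suc n)) (coeff p (Suc n))"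
proof -
  have "coeff (poly_deriv s p) n = (\<Sum>i\<le>degree p. if i = Suc n then s (of_nat i) (coeff p i) else 0)"
    unfolding poly_deriv_def coeff_sum coeff_monom by (rule sum.cong) auto
  also have "\<dots> = s (of_nat (Suc n)) (coeff p (Suc n))"
    by (simp add: sum.delta coeff_eq_0 del: of_nat_Suc)
  finally show ?thesis .
qed

lemma coeff_poly_primitive:
  "coeff (poly_primitive s p) n = (if n = 0 then 0 else s (1 / of_nat n) (coeff p (n - 1)))"
proof -
  have "coeff (poly_primitive s p) n =
      (\<Sum>i\<le>degree p. if i = n - 1 then (if n = 0 then 0 else s (1 / of_nat n) (coeff p i)) else 0)"
    unfolding poly_primitive_def coeff_sum coeff_monom by (rule sum.cong) auto
  also have "\<dots> = (if n = 0 then 0 else s (1 / of_nat n) (coeff p (n - 1)))"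
    by (simp add: sum.delta coeff_eq_0)
  finally show ?thesis .
qed

lemma coeff_map_scale [simp]: "coeff (map_poly (s c) p) n = s c (coeff p n)"
  by (simp add: coeff_map_poly)

lemma poly_eval_0 [simp]: "poly_eval s a 0 = 0"
  by (simp add: poly_eval_def)

lemma poly_eval_add: "poly_eval s a (p + q) = poly_eval s a p + poly_eval s a q"
proof -
  define D where "D = max (degree p) (degree q)"
  have "degree p \<le> D" "degree q \<le> D" "degree (p + q) \<le> D"
    by (auto simp: D_def intro: degree_add_le)
  then show ?thesis
    by (simp add: poly_evalI[OF vector_space_axioms, of _ D] scale_right_distrib sum.distrib)
qed

lemma poly_eval_minus: "poly_eval s a (- p) = - poly_eval s a p"
  by (simp add: poly_eval_def sum_negf)

lemma poly_eval_diff: "poly_eval s a (p - q) = poly_eval s a p - poly_eval s a q"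
  using poly_eval_add[of a p "- q"] by (simp add: poly_eval_minus)

lemma poly_eval_sum: "poly_eval s a (sum f S) = (\<Sum>i\<in>S. poly_eval s a (f i))"
  by (induction S rule: infinite_finite_induct) (auto simp: poly_eval_add)

lemma poly_eval_monom: "poly_eval s a (monom v n) = s (a ^ n) v"
proof -
  have "poly_eval s a (monom v n) = (\<Sum>i\<le>n. s (a ^ i) (coeff (monom v n) i))"
    by (rule poly_evalI[OF vector_space_axioms degree_monom_le])
  also have "\<dots> = (\<Sum>i\<le>n. if i = n then s (a ^ i) v else 0)"
    by (rule sum.cong) (auto simp: coeff_monom)
  finally show ?thesis by simp
qed

lemma poly_eval_const: "poly_eval s a [:v:] = v"
  using poly_eval_monom[of a v 0] by (simp add: monom_0)

lemma poly_eval_at_0: "poly_eval s 0 p = coeff p 0"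
proof -
  have "poly_eval s 0 p = (\<Sum>i\<le>degree p. if i = 0 then coeff p i else 0)"
    unfolding poly_eval_def by (rule sum.cong) (auto simp: power_0_left)
  then show ?thesis by simp
qed

lemma poly_eval_linear: "poly_eval s a [:v, w:] = v + s a w"
proof -
  have "[:v, w:] = [:v:] + monom w 1"
    by (simp add: monom_Suc monom_0)
  then show ?thesis
    by (simp only: poly_eval_add poly_eval_const poly_eval_monom power_one_right)
qed

lemma poly_eval_sum_monom: "poly_eval s a (\<Sum>i\<in>S. monom (f i) (g i)) = (\<Sum>i\<in>S. s (a ^ g i) (f i))"
  by (simp add: poly_eval_sum poly_eval_monom)

text \<open>Replacing \<open>p(a)\<close> by \<open>p(2a) - 2\<^sup>n p(a)\<close> removes the coefficient of degree \<open>n\<close>.\<close>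

lemma poly_coeffs_zero_of_values:
  "(\<And>a. (\<Sum>i\<le>n. s (a ^ i) (v i)) = 0) \<Longrightarrow> i \<le> n \<Longrightarrow> v i = 0"
proof (induction n arbitrary: v i)
  case 0
  from 0(1)[of 0] 0(2) show ?case by simp
next
  case (Suc n)
  have less: "v j = 0" if "j \<le> n" for j
  proof -
    define w where "w j = s (2 ^ j - 2 ^ Suc n) (v j)" for j
    have "(\<Sum>i\<le>n. s (a ^ i) (w i)) = 0" for a
    proof -
      have "(\<Sum>i\<le>n. s (a ^ i) (w i)) = (\<Sum>i\<le>Suc n. s (a ^ i) (w i))"
        by (simp add: w_def)
      also have "\<dots> = (\<Sum>i\<le>Suc n. s ((2 * a) ^ i) (v i) - s (2 ^ Suc n) (s (a ^ i) (v i)))"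
        by (rule sum.cong)
          (auto simp: w_def scale_left_diff_distrib scale_right_diff_distrib power_mult_distrib ac_simps
            simp del: power_Suc)
      also have "\<dots> = (\<Sum>i\<le>Suc n. s ((2 * a) ^ i) (v i)) - s (2 ^ Suc n) (\<Sum>i\<le>Suc n. s (a ^ i) (v i))"
        by (simp only: sum_subtractf scale_sum_right)
      also have "\<dots> = 0" by (simp only: Suc.prems(1)) simp
      finally show ?thesis .
    qed
    from Suc.IH[OF this that] have "s (2 ^ j - 2 ^ Suc n) (v j) = 0" by (simp add: w_def)
    moreover have "(2::complex) ^ j \<noteq> 2 ^ Suc n"
    proof
      assume "(2::complex) ^ j = 2 ^ Suc n"
      then have "norm ((2::complex) ^ j) = norm ((2::complex) ^ Suc n)" by simp
      then have "(2::real) ^ j = 2 ^ Suc n" by (simp only: norm_power norm_numeral)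
      then have "j = Suc n" by (metis power_inject_exp one_less_numeral_iff semiring_norm(76))
      with that show False by simp
    qed
    ultimately show ?thesis by simp
  qed
  show ?case
  proof (cases "i \<le> n")
    case False
    with Suc.prems(2) have i: "i = Suc n" by simp
    have "(\<Sum>j\<le>n. s (1 ^ j) (v j)) = 0"
      by (rule sum.neutral) (simp add: less)
    then have *: "(\<Sum>j\<le>Suc n. s (1 ^ j) (v j)) = v (Suc n)" by simp
    have "v (Suc n) = 0" by (rule HOL.trans[OF *[symmetric] Suc.prems(1)])
    then show ?thesis by (simp only: i)
  qed (rule less)
qed

text \<open>Complex scalars suffice to separate polynomials with vector coefficients. Evaluation
  commutes with coefficientwise linear maps and turns convolution into the bilinear map itself, so
  identities between forms become, value by value, identities in the coefficient algebra.\<close>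

lemma poly_eqI_eval:
  assumes "\<And>a. poly_eval s a p = poly_eval s a q"
  shows "p = q"
proof -
  have "poly_eval s a (p - q) = 0" for a by (simp add: poly_eval_diff assms)
  then have "coeff (p - q) i = 0" if "i \<le> degree (p - q)" for i
    using poly_coeffs_zero_of_values[where n = "degree (p - q)" and v = "coeff (p - q)"] that
    by (simp add: poly_eval_def)
  then have "p - q = 0" by (metis leading_coeff_0_iff order_refl)
  then show ?thesis by simp
qed

end

sublocale csub \<subseteq> cvec ..

context csub
begin

lemma pcoeffs_0 [simp]: "0 \<in> pcoeffs V"
  and pcoeffs_add [simp]: "p \<in> pcoeffs V \<Longrightarrow> q \<in> pcoeffs V \<Longrightarrow> p + q \<in> pcoeffs V"
  and pcoeffs_minus [simp]: "p \<in> pcoeffs V \<Longrightarrow> - p \<in> pcoeffs V"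
  and pcoeffs_diff [simp]: "p \<in> pcoeffs V \<Longrightarrow> q \<in> pcoeffs V \<Longrightarrow> p - q \<in> pcoeffs V"
  and pcoeffs_scale [simp]: "p \<in> pcoeffs V \<Longrightarrow> map_poly (s c) p \<in> pcoeffs V"
  and pcoeffs_monom [simp]: "v \<in> V \<Longrightarrow> monom v n \<in> pcoeffs V"
  and pcoeffs_const [simp]: "v \<in> V \<Longrightarrow> [:v:] \<in> pcoeffs V"
  and pcoeffs_deriv [simp]: "p \<in> pcoeffs V \<Longrightarrow> poly_deriv s p \<in> pcoeffs V"
  and pcoeffs_primitive [simp]: "p \<in> pcoeffs V \<Longrightarrow> poly_primitive s p \<in> pcoeffs V"
  by (auto intro!: pcoeffsI simp: coeff_monom coeff_pCons coeff_poly_deriv coeff_poly_primitive split: nat.split)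

lemma pcoeffs_sum: "(\<And>i. i \<in> S \<Longrightarrow> f i \<in> pcoeffs V) \<Longrightarrow> sum f S \<in> pcoeffs V"
  by (auto intro!: pcoeffsI simp: coeff_sum)

lemma poly_eval_in [simp]: "p \<in> pcoeffs V \<Longrightarrow> poly_eval s a p \<in> V"
  by (auto simp: poly_eval_def)

lemma coeff_map_linear:
  "linear_between s V s' W f \<Longrightarrow> coeff (map_poly f p) n = f (coeff p n)"
  by (simp add: coeff_map_poly linear_between_0)

lemma map_linear_in:
  "linear_between s V s' W f \<Longrightarrow> p \<in> pcoeffs V \<Longrightarrow> map_poly f p \<in> pcoeffs W"
  by (auto intro!: pcoeffsI simp: coeff_map_linear linear_betweenD)

lemma degree_map_linear_le: "degree (map_poly f p) \<le> degree p"
  by (simp add: map_poly_degree_leq)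

lemma poly_eval_map_linear:
  assumes f: "linear_between s V s' W f" and "vector_space s'" and p: "p \<in> pcoeffs V"
  shows "poly_eval s' a (map_poly f p) = f (poly_eval s a p)"
proof -
  have "poly_eval s' a (map_poly f p) = (\<Sum>i\<le>degree p. s' (a ^ i) (f (coeff p i)))"
    by (simp add: poly_evalI[OF assms(2) degree_map_linear_le] coeff_map_linear[OF f])
  also have "\<dots> = f (poly_eval s a p)"
    unfolding poly_eval_def using p
    by (subst linear_between_sum[OF f]) (auto simp: linear_betweenD(3)[OF f])
  finally show ?thesis .
qed

end

lemma poly_eval_conv:
  assumes U: "csub s U" and V: "csub s' V" and W: "csub s'' W"
    and b: "bilinear_between s U s' V s'' W b" and p: "p \<in> pcoeffs U" and q: "q \<in> pcoeffs V"
  shows "poly_eval s'' a (poly_conv b p q) = b (poly_eval s a p) (poly_eval s' a q)"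
proof -
  interpret U: csub s U by fact
  interpret V: csub s' V by fact
  interpret W: csub s'' W by fact
  note bD = bilinear_betweenD[OF b]
  have "b (poly_eval s a p) (poly_eval s' a q) =
      (\<Sum>i\<le>degree p. b (s (a ^ i) (coeff p i)) (poly_eval s' a q))"
    unfolding poly_eval_def[of s] using p q by (subst U.linear_between_sum[OF bD(2)]) auto
  also have "\<dots> = (\<Sum>i\<le>degree p. \<Sum>j\<le>degree q. s'' (a ^ (i + j)) (b (coeff p i) (coeff q j)))"
  proof (rule sum.cong[OF HOL.refl])
    fix i
    have "b (s (a ^ i) (coeff p i)) (poly_eval s' a q) = s'' (a ^ i) (b (coeff p i) (poly_eval s' a q))"
      using p q by (simp add: linear_betweenD(3)[OF bD(2)])
    also have "b (coeff p i) (poly_eval s' a q) = (\<Sum>j\<le>degree q. s'' (a ^ j) (b (coeff p i) (coeff q j)))"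
      unfolding poly_eval_def using p q
      by (subst V.linear_between_sum[OF bD(1)]) (auto simp: linear_betweenD(3)[OF bD(1)])
    finally show "b (s (a ^ i) (coeff p i)) (poly_eval s' a q) =
        (\<Sum>j\<le>degree q. s'' (a ^ (i + j)) (b (coeff p i) (coeff q j)))"
      by (simp add: W.scale_sum_right power_add)
  qed
  also have "\<dots> = poly_eval s'' a (poly_conv b p q)"
    by (simp add: poly_conv_def W.poly_eval_sum W.poly_eval_monom)
  finally show ?thesis by simp
qed

lemma poly_conv_in:
  assumes W: "csub s'' W"
    and b: "bilinear_between s U s' V s'' W b" and p: "p \<in> pcoeffs U" and q: "q \<in> pcoeffs V"
  shows "poly_conv b p q \<in> pcoeffs W"
proof -
  interpret W: csub s'' W by fact
  show ?thesis unfolding poly_conv_def using p q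
    by (intro W.pcoeffs_sum W.pcoeffs_monom)
      (auto intro: linear_betweenD(1)[OF bilinear_betweenD(1)[OF b]])
qed

text \<open>Evaluation at a point does not determine the derivative there, so the Leibniz rule for
  \<open>poly_deriv\<close> is proved on the coefficients themselves.\<close>

lemma coeff_poly_conv:
  assumes U: "csub s U" and V: "csub s' V"
    and b: "bilinear_between s U s' V s'' W b" and p: "p \<in> pcoeffs U" and q: "q \<in> pcoeffs V"
  shows "coeff (poly_conv b p q) n = (\<Sum>i\<le>n. b (coeff p i) (coeff q (n - i)))"
proof -
  interpret U: csub s U by fact
  interpret V: csub s' V by fact
  note bD = bilinear_betweenD[OF b]
  have z: "b (coeff p i) 0 = 0" "b 0 (coeff q j) = 0" for i j
    using p q V.linear_between_0[OF bD(1)] U.linear_between_0[OF bD(2)] by auto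
  have inner: "(\<Sum>j\<le>degree q. coeff (monom (b (coeff p i) (coeff q j)) (i + j)) n) =
      (if i \<le> n then b (coeff p i) (coeff q (n - i)) else 0)" for i
  proof -
    have "(\<Sum>j\<le>degree q. coeff (monom (b (coeff p i) (coeff q j)) (i + j)) n) =
      (\<Sum>j\<le>degree q. if j = n - i then (if i \<le> n then b (coeff p i) (coeff q j) else 0) else 0)"
      by (rule sum.cong) (auto simp: coeff_monom)
    then show ?thesis using z by (auto simp: coeff_eq_0)
  qed
  have "coeff (poly_conv b p q) n =
      (\<Sum>i\<le>degree p. if i \<le> n then b (coeff p i) (coeff q (n - i)) else 0)"
    unfolding poly_conv_def coeff_sum inner ..
  also have "\<dots> = (\<Sum>i\<le>n + degree p. if i \<le> n then b (coeff p i) (coeff q (n - i)) else 0)"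
    by (rule sum.mono_neutral_left) (auto simp: coeff_eq_0 z)
  also have "\<dots> = (\<Sum>i\<le>n. b (coeff p i) (coeff q (n - i)))"
    by (rule sum.mono_neutral_cong_right) auto
  finally show ?thesis .
qed

lemma poly_deriv_conv:
  assumes U: "csub s U" and V: "csub s' V" and W: "csub s'' W"
    and b: "bilinear_between s U s' V s'' W b" and p: "p \<in> pcoeffs U" and q: "q \<in> pcoeffs V"
  shows "poly_deriv s'' (poly_conv b p q) =
    poly_conv b (poly_deriv s p) q + poly_conv b p (poly_deriv s' q)"
proof (rule poly_eqI)
  fix n
  interpret U: csub s U by fact
  interpret V: csub s' V by fact
  interpret W: csub s'' W by fact
  note bD = bilinear_betweenD[OF b]
  note co = coeff_poly_conv[OF U V b]
  define f where "f i = b (coeff p i) (coeff q (Suc n - i))" for i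
  have "coeff (poly_deriv s'' (poly_conv b p q)) n = (\<Sum>i\<le>Suc n. s'' (of_nat (Suc n)) (f i))"
    using p q by (simp add: W.coeff_poly_deriv co W.scale_sum_right f_def del: of_nat_Suc sum.atMost_Suc)
  \<comment> \<open>The Leibniz rule on monomials: the factor n + 1 is the sum of the exponents i
    and n + 1 - i.\<close>
  also have "\<dots> = (\<Sum>i\<le>Suc n. s'' (of_nat i) (f i) + s'' (of_nat (Suc n - i)) (f i))"
  proof (rule sum.cong[OF HOL.refl])
    fix i assume "i \<in> {..Suc n}"
    then have "of_nat (Suc n) = (of_nat i + of_nat (Suc n - i) :: complex)"
      by (metis atMost_iff le_add_diff_inverse of_nat_add)
    then show "s'' (of_nat (Suc n)) (f i) = s'' (of_nat i) (f i) + s'' (of_nat (Suc n - i)) (f i)"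
      by (simp only: W.scale_left_distrib)
  qed
  also have "\<dots> = (\<Sum>i\<le>Suc n. s'' (of_nat i) (f i)) + (\<Sum>i\<le>Suc n. s'' (of_nat (Suc n - i)) (f i))"
    by (rule sum.distrib)
  \<comment> \<open>The summand i = 0 carries the factor 0, so the sum starts at 1 and can be
    shifted.\<close>
  also have "(\<Sum>i\<le>Suc n. s'' (of_nat i) (f i)) = (\<Sum>i\<le>n. s'' (of_nat (Suc i)) (f (Suc i)))"
    by (simp add: sum.atMost_Suc_shift del: of_nat_Suc sum.atMost_Suc)
  also have "\<dots> = coeff (poly_conv b (poly_deriv s p) q) n"
    unfolding co[OF U.pcoeffs_deriv[OF p] q]
  proof (rule sum.cong[OF HOL.refl])
    fix i
    show "s'' (of_nat (Suc i)) (f (Suc i)) = b (coeff (poly_deriv s p) i) (coeff q (n - i))"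
      using linear_betweenD(3)[OF bD(2), of "coeff q (n - i)" "coeff p (Suc i)"] p q
      by (simp add: f_def U.coeff_poly_deriv del: of_nat_Suc)
  qed
  also have "(\<Sum>i\<le>Suc n. s'' (of_nat (Suc n - i)) (f i)) = (\<Sum>i\<le>n. s'' (of_nat (Suc n - i)) (f i))"
    by simp
  also have "\<dots> = coeff (poly_conv b p (poly_deriv s' q)) n"
    unfolding co[OF p V.pcoeffs_deriv[OF q]]
  proof (rule sum.cong[OF HOL.refl])
    fix i assume "i \<in> {..n}"
    then have "Suc n - i = Suc (n - i)" by (simp add: Suc_diff_le)
    then show "s'' (of_nat (Suc n - i)) (f i) = b (coeff p i) (coeff (poly_deriv s' q) (n - i))"
      using linear_betweenD(3)[OF bD(1), of "coeff p i" "coeff q (Suc (n - i))"] p q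
      by (simp add: f_def V.coeff_poly_deriv del: of_nat_Suc)
  qed
  finally show "coeff (poly_deriv s'' (poly_conv b p q)) n =
      coeff (poly_conv b (poly_deriv s p) q + poly_conv b p (poly_deriv s' q)) n"
    by simp
qed

section \<open>DGLAs\<close>

lemma csub_of_graded: "graded_space V \<Longrightarrow> csub (gscale V) (gcomp V i)"
  by (simp add: graded_space_def csub_def csub_axioms_def)

lemma is_dglaI:
  assumes "graded_space L"
    and "\<And>i. linear_between (gscale L) (gcomp L i) (gscale L) (gcomp L (i + 1)) (diff L i)"
    and "\<And>i x. x \<in> gcomp L i \<Longrightarrow> diff L (i + 1) (diff L i x) = 0"
    and "\<And>i j. bilinear_between (gscale L) (gcomp L i) (gscale L) (gcomp L j)
          (gscale L) (gcomp L (i + j)) (brkt L i j)"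
    and "\<And>i j x y. x \<in> gcomp L i \<Longrightarrow> y \<in> gcomp L j \<Longrightarrow>
          brkt L i j x y = - gscale L (ksgn (i * j)) (brkt L j i y x)"
    and "\<And>i j k x y z. x \<in> gcomp L i \<Longrightarrow> y \<in> gcomp L j \<Longrightarrow> z \<in> gcomp L k \<Longrightarrow>
          brkt L i (j + k) x (brkt L j k y z) =
          brkt L (i + j) k (brkt L i j x y) z +
          gscale L (ksgn (i * j)) (brkt L j (i + k) y (brkt L i k x z))"
    and "\<And>i j x y. x \<in> gcomp L i \<Longrightarrow> y \<in> gcomp L j \<Longrightarrow>
          diff L (i + j) (brkt L i j x y) =
          brkt L (i + 1) j (diff L i x) y + gscale L (ksgn i) (brkt L i (j + 1) x (diff L j y))"
  shows "is_dgla L"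
proof -
  have 1: "linear_between (gscale L) (gcomp L j) (gscale L) (gcomp L (i + j)) (brkt L i j x)"
    if "x \<in> gcomp L i" for i j x
    by (rule bilinear_betweenD(1)[OF assms(4) that])
  have 2: "linear_between (gscale L) (gcomp L i) (gscale L) (gcomp L (i + j)) (\<lambda>x. brkt L i j x y)"
    if "y \<in> gcomp L j" for i j y
    by (rule bilinear_betweenD(2)[OF assms(4) that])
  show ?thesis
    unfolding is_dgla_def by (intro conjI allI ballI assms(1,2,3,5,6,7) 1 2)
qed

locale dgla =
  fixes L :: "'v::ab_group_add dgla"
  assumes dgla: "is_dgla L"
begin

lemma graded: "graded_space L"
  using dgla unfolding is_dgla_def by blast

lemma csub [simp, intro]: "csub (gscale L) (gcomp L i)"
  by (rule csub_of_graded[OF graded])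

sublocale csub "gscale L" "gcomp L i" for i
  by (rule csub)

lemma linear_diff: "linear_between (gscale L) (gcomp L i) (gscale L) (gcomp L (i + 1)) (diff L i)"
  by (rule dgla[unfolded is_dgla_def, THEN conjunct2, THEN conjunct1, rule_format])

lemma diff_diff: "x \<in> gcomp L i \<Longrightarrow> diff L (i + 1) (diff L i x) = 0"
  by (rule dgla[unfolded is_dgla_def, THEN conjunct2, THEN conjunct2, THEN conjunct1, rule_format])

lemma bilinear_brkt: "bilinear_between (gscale L) (gcomp L i) (gscale L) (gcomp L j)
    (gscale L) (gcomp L (i + j)) (brkt L i j)"
  using dgla unfolding is_dgla_def bilinear_between_def by blast

lemma brkt_anti: "x \<in> gcomp L i \<Longrightarrow> y \<in> gcomp L j \<Longrightarrow>
    brkt L i j x y = - gscale L (ksgn (i * j)) (brkt L j i y x)"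
  using dgla unfolding is_dgla_def by blast

lemma jacobi: "x \<in> gcomp L i \<Longrightarrow> y \<in> gcomp L j \<Longrightarrow> z \<in> gcomp L k \<Longrightarrow>
    brkt L i (j + k) x (brkt L j k y z) =
    brkt L (i + j) k (brkt L i j x y) z +
    gscale L (ksgn (i * j)) (brkt L j (i + k) y (brkt L i k x z))"
  using dgla unfolding is_dgla_def by blast

lemma leibniz: "x \<in> gcomp L i \<Longrightarrow> y \<in> gcomp L j \<Longrightarrow>
    diff L (i + j) (brkt L i j x y) =
    brkt L (i + 1) j (diff L i x) y + gscale L (ksgn i) (brkt L i (j + 1) x (diff L j y))"
  using dgla unfolding is_dgla_def by blast

lemma diff_in: "x \<in> gcomp L i \<Longrightarrow> k = i + 1 \<Longrightarrow> diff L i x \<in> gcomp L k"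
  using linear_betweenD(1)[OF linear_diff] by simp

lemma diff_add: "x \<in> gcomp L i \<Longrightarrow> y \<in> gcomp L i \<Longrightarrow> diff L i (x + y) = diff L i x + diff L i y"
  and diff_scale: "x \<in> gcomp L i \<Longrightarrow> diff L i (gscale L c x) = gscale L c (diff L i x)"
  and diff_minus: "x \<in> gcomp L i \<Longrightarrow> diff L i (- x) = - diff L i x"
  and diff_sub: "x \<in> gcomp L i \<Longrightarrow> y \<in> gcomp L i \<Longrightarrow> diff L i (x - y) = diff L i x - diff L i y"
  and diff_0 [simp]: "diff L i 0 = 0"
  using linear_betweenD[OF linear_diff] linear_between_minus[OF linear_diff]
    linear_between_diff[OF linear_diff] linear_between_0[OF linear_diff] by auto

lemma brkt_in: "x \<in> gcomp L i \<Longrightarrow> y \<in> gcomp L j \<Longrightarrow> k = i + j \<Longrightarrow> brkt L i j x y \<in> gcomp L k"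
  using linear_betweenD(1)[OF bilinear_betweenD(1)[OF bilinear_brkt]] by simp

lemma brkt_right:
  assumes "x \<in> gcomp L i"
  shows "y \<in> gcomp L j \<Longrightarrow> z \<in> gcomp L j \<Longrightarrow> brkt L i j x (y + z) = brkt L i j x y + brkt L i j x z"
    and "y \<in> gcomp L j \<Longrightarrow> z \<in> gcomp L j \<Longrightarrow> brkt L i j x (y - z) = brkt L i j x y - brkt L i j x z"
    and "y \<in> gcomp L j \<Longrightarrow> brkt L i j x (gscale L c y) = gscale L c (brkt L i j x y)"
    and "y \<in> gcomp L j \<Longrightarrow> brkt L i j x (- y) = - brkt L i j x y"
    and "brkt L i j x 0 = 0"
    and "(\<And>a. a \<in> S \<Longrightarrow> f a \<in> gcomp L j) \<Longrightarrow> brkt L i j x (sum f S) = (\<Sum>a\<in>S. brkt L i j x (f a))"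
proof -
  note l = bilinear_betweenD(1)[OF bilinear_brkt assms]
  note b = linear_betweenD[OF l] linear_between_minus[OF l] linear_between_diff[OF l]
    linear_between_0[OF l] linear_between_sum[OF l]
  show "y \<in> gcomp L j \<Longrightarrow> z \<in> gcomp L j \<Longrightarrow> brkt L i j x (y + z) = brkt L i j x y + brkt L i j x z"
    and "y \<in> gcomp L j \<Longrightarrow> z \<in> gcomp L j \<Longrightarrow> brkt L i j x (y - z) = brkt L i j x y - brkt L i j x z"
    and "y \<in> gcomp L j \<Longrightarrow> brkt L i j x (gscale L c y) = gscale L c (brkt L i j x y)"
    and "y \<in> gcomp L j \<Longrightarrow> brkt L i j x (- y) = - brkt L i j x y"
    and "brkt L i j x 0 = 0"
    and "(\<And>a. a \<in> S \<Longrightarrow> f a \<in> gcomp L j) \<Longrightarrow> brkt L i j x (sum f S) = (\<Sum>a\<in>S. brkt L i j x (f a))"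
    by (simp_all only: b)
qed

lemma brkt_left:
  assumes "x \<in> gcomp L j"
  shows "y \<in> gcomp L i \<Longrightarrow> z \<in> gcomp L i \<Longrightarrow> brkt L i j (y + z) x = brkt L i j y x + brkt L i j z x"
    and "y \<in> gcomp L i \<Longrightarrow> z \<in> gcomp L i \<Longrightarrow> brkt L i j (y - z) x = brkt L i j y x - brkt L i j z x"
    and "y \<in> gcomp L i \<Longrightarrow> brkt L i j (gscale L c y) x = gscale L c (brkt L i j y x)"
    and "y \<in> gcomp L i \<Longrightarrow> brkt L i j (- y) x = - brkt L i j y x"
    and "brkt L i j 0 x = 0"
    and "(\<And>a. a \<in> S \<Longrightarrow> f a \<in> gcomp L i) \<Longrightarrow> brkt L i j (sum f S) x = (\<Sum>a\<in>S. brkt L i j (f a) x)"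
proof -
  note l = bilinear_betweenD(2)[OF bilinear_brkt assms]
  note b = linear_betweenD[OF l] linear_between_minus[OF l] linear_between_diff[OF l]
    linear_between_0[OF l] linear_between_sum[OF l]
  show "y \<in> gcomp L i \<Longrightarrow> z \<in> gcomp L i \<Longrightarrow> brkt L i j (y + z) x = brkt L i j y x + brkt L i j z x"
    and "y \<in> gcomp L i \<Longrightarrow> z \<in> gcomp L i \<Longrightarrow> brkt L i j (y - z) x = brkt L i j y x - brkt L i j z x"
    and "y \<in> gcomp L i \<Longrightarrow> brkt L i j (gscale L c y) x = gscale L c (brkt L i j y x)"
    and "y \<in> gcomp L i \<Longrightarrow> brkt L i j (- y) x = - brkt L i j y x"
    and "brkt L i j 0 x = 0"
    and "(\<And>a. a \<in> S \<Longrightarrow> f a \<in> gcomp L i) \<Longrightarrow> brkt L i j (sum f S) x = (\<Sum>a\<in>S. brkt L i j (f a) x)"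
    by (simp_all only: b)
qed

lemma poly_brkt_in: "p \<in> pcoeffs (gcomp L i) \<Longrightarrow> q \<in> pcoeffs (gcomp L j) \<Longrightarrow> k = i + j \<Longrightarrow>
    poly_conv (brkt L i j) p q \<in> pcoeffs (gcomp L k)"
  using poly_conv_in[OF csub bilinear_brkt] by simp

lemma poly_eval_brkt: "p \<in> pcoeffs (gcomp L i) \<Longrightarrow> q \<in> pcoeffs (gcomp L j) \<Longrightarrow>
    poly_eval (gscale L) a (poly_conv (brkt L i j) p q) =
    brkt L i j (poly_eval (gscale L) a p) (poly_eval (gscale L) a q)"
  by (rule poly_eval_conv[OF csub csub csub bilinear_brkt])

lemma poly_deriv_brkt: "p \<in> pcoeffs (gcomp L i) \<Longrightarrow> q \<in> pcoeffs (gcomp L j) \<Longrightarrow>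
    poly_deriv (gscale L) (poly_conv (brkt L i j) p q) =
    poly_conv (brkt L i j) (poly_deriv (gscale L) p) q +
    poly_conv (brkt L i j) p (poly_deriv (gscale L) q)"
  by (rule poly_deriv_conv[OF csub csub csub bilinear_brkt])

lemma poly_diff_in: "p \<in> pcoeffs (gcomp L i) \<Longrightarrow> k = i + 1 \<Longrightarrow>
    map_poly (diff L i) p \<in> pcoeffs (gcomp L k)"
  using map_linear_in[OF linear_diff] by simp

lemma poly_eval_diff_map: "p \<in> pcoeffs (gcomp L i) \<Longrightarrow>
    poly_eval (gscale L) a (map_poly (diff L i) p) = diff L i (poly_eval (gscale L) a p)"
  by (rule poly_eval_map_linear[OF linear_diff vector_space_axioms])

lemma poly_eval_scale_map:
  "poly_eval (gscale L) a (map_poly (gscale L c) p) = gscale L c (poly_eval (gscale L) a p)"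
proof -
  \<comment> \<open>The whole type is a subspace on which scaling is linear, so no condition on the
    coefficients of \<open>p\<close> arises.\<close>
  interpret U: csub "gscale L" UNIV by unfold_locales simp
  show ?thesis
    by (rule U.poly_eval_map_linear[where W = UNIV])
      (auto intro!: pcoeffsI linear_betweenI simp: scale_right_distrib vector_space_axioms mult.commute)
qed

end

lemma (in csub) poly_deriv_map_linear:
  assumes f: "linear_between s V s' W f" and "vector_space s'" and p: "p \<in> pcoeffs V"
  shows "poly_deriv s' (map_poly f p) = map_poly f (poly_deriv s p)"
proof (rule poly_eqI)
  fix n
  interpret V': cvec s' using assms(2) by (simp add: cvec_def)
  show "coeff (poly_deriv s' (map_poly f p)) n = coeff (map_poly f (poly_deriv s p)) n"
    using p by (simp add: V'.coeff_poly_deriv coeff_map_linear[OF f] coeff_poly_deriv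
      linear_betweenD(3)[OF f] del: of_nat_Suc)
qed

lemma (in cvec) poly_deriv_add: "poly_deriv s (p + q) = poly_deriv s p + poly_deriv s q"
  by (rule poly_eqI) (simp add: coeff_poly_deriv scale_right_distrib del: of_nat_Suc)

lemma (in cvec) poly_deriv_scale: "poly_deriv s (map_poly (s c) p) = map_poly (s c) (poly_deriv s p)"
  by (rule poly_eqI) (simp add: coeff_poly_deriv mult.commute del: of_nat_Suc)

section \<open>Differential forms on the line with values in a DGLA\<close>

lemma forms_comp_iff [simp]:
  "(p, q) \<in> forms_comp V i \<longleftrightarrow> p \<in> pcoeffs (V i) \<and> q \<in> pcoeffs (V (i - 1))"
  by (auto simp: forms_comp_def intro: pcoeffsI)

lemma forms_scale_simp [simp]: "forms_scale s c (p, q) = (map_poly (s c) p, map_poly (s c) q)"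
  by (simp add: forms_scale_def)

lemma vector_space_forms_scale:
  assumes "vector_space s"
  shows "vector_space (forms_scale s)"
proof -
  interpret cvec s using assms by (simp add: cvec_def)
  show ?thesis
    by unfold_locales
      (auto simp: forms_scale_def poly_eq_iff scale_left_distrib scale_right_distrib)
qed

lemma csub_forms_comp:
  assumes "\<And>i. csub s (V i)"
  shows "csub (forms_scale s) (forms_comp V i)"
proof -
  interpret A: csub s "V i" by fact
  interpret B: csub s "V (i - 1)" by fact
  interpret F: vector_space "forms_scale s"
    by (rule vector_space_forms_scale) (rule A.vector_space_axioms)
  show ?thesis
    by unfold_locales (auto simp: F.subspace_def zero_prod_def)
qed

text \<open>Evaluating both components at an arbitrary point reduces each axiom to axioms of
  \<open>M\<close> in neighbouring degrees, the coefficient of \<open>dt\<close> having degree one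
  less. A product with two \<open>dt\<close> vanishes, so an identity in several arguments splits
  into one for the functions and one for each argument that may carry \<open>dt\<close>. The parity
  splits evaluate the signs of the convention that forms stand on the left.\<close>

lemma is_dgla_forms:
  fixes M :: "'m::ab_group_add dgla"
  assumes "is_dgla M"
  shows "is_dgla (forms_dgla M)"
proof -
  interpret dgla M by unfold_locales fact
  let ?s = "gscale M" and ?e = "poly_eval (gscale M)" and ?P = "\<lambda>i. pcoeffs (gcomp M i)"
  have [simp]: "gscale (forms_dgla M) = forms_scale ?s" "gcomp (forms_dgla M) = forms_comp (gcomp M)"
    "diff (forms_dgla M) i (p, q) =
      (map_poly (diff M i) p, poly_deriv ?s p - map_poly (diff M (i - 1)) q)"
    "brkt (forms_dgla M) i j (p, q) (p', q') = (poly_conv (brkt M i j) p p',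
      map_poly (?s (ksgn i)) (poly_conv (brkt M i (j - 1)) p q') + poly_conv (brkt M (i - 1) j) q p')"
    for i j p q p' q'
    by (simp_all add: forms_dgla_def)
  have C: "csub (forms_scale ?s) (forms_comp (gcomp M) i)" for i
    by (rule csub_forms_comp) simp
  note ev = poly_eval_brkt poly_eval_diff_map poly_eval_scale_map poly_eval_add poly_eval_diff
    poly_eval_minus
  note ins = poly_brkt_in poly_diff_in brkt_in diff_in
  show ?thesis
  proof (rule is_dglaI)
    show "graded_space (forms_dgla M)"
      using C by (simp add: graded_space_def csub_def csub_axioms_def)
  next
    fix i
    show "linear_between (gscale (forms_dgla M)) (gcomp (forms_dgla M) i) (gscale (forms_dgla M))
      (gcomp (forms_dgla M) (i + 1)) (diff (forms_dgla M) i)"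
    proof (rule linear_betweenI)
      fix x assume "x \<in> gcomp (forms_dgla M) i"
      then show "diff (forms_dgla M) i x \<in> gcomp (forms_dgla M) (i + 1)"
        by (cases x) (simp add: ins)
    next
      fix x y assume "x \<in> gcomp (forms_dgla M) i" "y \<in> gcomp (forms_dgla M) i"
      then show "diff (forms_dgla M) i (x + y) = diff (forms_dgla M) i x + diff (forms_dgla M) i y"
        by (cases x; cases y) (auto simp: poly_deriv_add ev ins diff_add intro!: poly_eqI_eval)
    next
      fix c x assume "x \<in> gcomp (forms_dgla M) i"
      then show "diff (forms_dgla M) i (gscale (forms_dgla M) c x) =
          gscale (forms_dgla M) c (diff (forms_dgla M) i x)"
        by (cases x) (auto simp: poly_deriv_scale ev ins diff_scale scale_right_diff_distrib
          intro!: poly_eqI_eval)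
    qed
  next
    fix i x assume "x \<in> gcomp (forms_dgla M) i"
    moreover obtain p q where "x = (p, q)" by (cases x)
    ultimately have x: "x = (p, q)" "p \<in> ?P i" "q \<in> ?P (i - 1)" by auto
    \<comment> \<open>The mixed term in the square of the differential: deriving in t and applying
      \<open>d\<close> to the coefficients commute, and the two occurrences have opposite
      signs.\<close>
    have "poly_deriv ?s (map_poly (diff M i) p) = map_poly (diff M i) (poly_deriv ?s p)"
      by (rule poly_deriv_map_linear[OF linear_diff vector_space_axioms x(2)])
    then show "diff (forms_dgla M) (i + 1) (diff (forms_dgla M) i x) = 0"
      using diff_diff[of _ "i - 1"] x(2,3)
      by (auto simp: x(1) zero_prod_def ev ins diff_diff diff_sub intro!: poly_eqI_eval)
  next
    fix i j
    show "bilinear_between (gscale (forms_dgla M)) (gcomp (forms_dgla M) i) (gscale (forms_dgla M))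
      (gcomp (forms_dgla M) j) (gscale (forms_dgla M)) (gcomp (forms_dgla M) (i + j))
      (brkt (forms_dgla M) i j)"
      unfolding bilinear_between_def
    proof (intro conjI ballI linear_betweenI)
      fix x y z c assume x: "x \<in> gcomp (forms_dgla M) i" and y: "y \<in> gcomp (forms_dgla M) j"
        and z: "z \<in> gcomp (forms_dgla M) j"
      show "brkt (forms_dgla M) i j x (y + z) =
          brkt (forms_dgla M) i j x y + brkt (forms_dgla M) i j x z"
        using x y z by (cases x; cases y; cases z)
          (auto simp: ev ins brkt_right scale_right_distrib intro!: poly_eqI_eval)
      show "brkt (forms_dgla M) i j x (gscale (forms_dgla M) c y) =
          gscale (forms_dgla M) c (brkt (forms_dgla M) i j x y)"
        using x y by (cases x; cases y)
          (auto simp: ev ins brkt_right brkt_left scale_right_distrib mult.commute intro!: poly_eqI_eval)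
    next
      fix x y z c assume x: "x \<in> gcomp (forms_dgla M) j" and y: "y \<in> gcomp (forms_dgla M) i"
        and z: "z \<in> gcomp (forms_dgla M) i"
      show "brkt (forms_dgla M) i j (y + z) x =
          brkt (forms_dgla M) i j y x + brkt (forms_dgla M) i j z x"
        using x y z by (cases x; cases y; cases z)
          (auto simp: ev ins brkt_left scale_right_distrib intro!: poly_eqI_eval)
      show "brkt (forms_dgla M) i j (gscale (forms_dgla M) c y) x =
          gscale (forms_dgla M) c (brkt (forms_dgla M) i j y x)"
        using x y by (cases x; cases y)
          (auto simp: ev ins brkt_left brkt_right scale_right_distrib mult.commute intro!: poly_eqI_eval)
    next
      fix x y assume "x \<in> gcomp (forms_dgla M) i" "y \<in> gcomp (forms_dgla M) j"
      then show "brkt (forms_dgla M) i j x y \<in> gcomp (forms_dgla M) (i + j)"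
        by (cases x; cases y) (simp add: ins)
      then show "brkt (forms_dgla M) i j x y \<in> gcomp (forms_dgla M) (i + j)" .
    qed
  next
    fix i j x y assume "x \<in> gcomp (forms_dgla M) i" "y \<in> gcomp (forms_dgla M) j"
    moreover obtain p q p' q' where "x = (p, q)" "y = (p', q')" by (cases x; cases y)
    ultimately have x: "x = (p, q)" "p \<in> ?P i" "q \<in> ?P (i - 1)"
      and y: "y = (p', q')" "p' \<in> ?P j" "q' \<in> ?P (j - 1)" by auto
    have an: "brkt M i j (?e a p) (?e a p') = - ?s (ksgn (i * j)) (brkt M j i (?e a p') (?e a p))"
      "brkt M i (j - 1) (?e a p) (?e a q') = - ?s (ksgn (i * (j - 1))) (brkt M (j - 1) i (?e a q') (?e a p))"
      "brkt M (i - 1) j (?e a q) (?e a p') = - ?s (ksgn ((i - 1) * j)) (brkt M j (i - 1) (?e a p') (?e a q))"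
      for a
      using x(2,3) y(2,3) by (auto intro!: brkt_anti)
    show "brkt (forms_dgla M) i j x y =
        - gscale (forms_dgla M) (ksgn (i * j)) (brkt (forms_dgla M) j i y x)"
      unfolding x(1) y(1)
      apply (cases "even i"; cases "even j")
      using x(2,3) y(2,3)
      by (auto simp: ev ins an ksgn_def scale_right_distrib intro!: poly_eqI_eval)
  next
    fix i j k x y z
    assume "x \<in> gcomp (forms_dgla M) i" "y \<in> gcomp (forms_dgla M) j" "z \<in> gcomp (forms_dgla M) k"
    moreover obtain p q p' q' p'' q'' where "x = (p, q)" "y = (p', q')" "z = (p'', q'')"
      by (cases x; cases y; cases z)
    ultimately have x: "x = (p, q)" "p \<in> ?P i" "q \<in> ?P (i - 1)"
      and y: "y = (p', q')" "p' \<in> ?P j" "q' \<in> ?P (j - 1)"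
      and z: "z = (p'', q'')" "p'' \<in> ?P k" "q'' \<in> ?P (k - 1)" by auto
    \<comment> \<open>The Jacobi identity without \<open>dt\<close>, and with \<open>dt\<close> on
      the third, the second and the first argument.\<close>
    have J: "brkt M i (j + k) (?e a p) (brkt M j k (?e a p') (?e a p'')) =
        brkt M (i + j) k (brkt M i j (?e a p) (?e a p')) (?e a p'') +
        ?s (ksgn (i * j)) (brkt M j (i + k) (?e a p') (brkt M i k (?e a p) (?e a p'')))"
      "brkt M i (j + (k - 1)) (?e a p) (brkt M j (k - 1) (?e a p') (?e a q'')) =
        brkt M (i + j) (k - 1) (brkt M i j (?e a p) (?e a p')) (?e a q'') +
        ?s (ksgn (i * j)) (brkt M j (i + (k - 1)) (?e a p') (brkt M i (k - 1) (?e a p) (?e a q'')))"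
      "brkt M i (j - 1 + k) (?e a p) (brkt M (j - 1) k (?e a q') (?e a p'')) =
        brkt M (i + (j - 1)) k (brkt M i (j - 1) (?e a p) (?e a q')) (?e a p'') +
        ?s (ksgn (i * (j - 1))) (brkt M (j - 1) (i + k) (?e a q') (brkt M i k (?e a p) (?e a p'')))"
      "brkt M (i - 1) (j + k) (?e a q) (brkt M j k (?e a p') (?e a p'')) =
        brkt M (i - 1 + j) k (brkt M (i - 1) j (?e a q) (?e a p')) (?e a p'') +
        ?s (ksgn ((i - 1) * j)) (brkt M j (i - 1 + k) (?e a p') (brkt M (i - 1) k (?e a q) (?e a p'')))"
      for a
      using x(2,3) y(2,3) z(2,3) by (auto intro!: jacobi)
    \<comment> \<open>Degrees are arguments of the operations, so arithmetically equal degrees must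
      be brought to one form before the terms match.\<close>
    have idx: "j + (k - 1) = j + k - 1" "j - 1 + k = j + k - 1" "i - 1 + j = i + j - 1"
      "i + (j - 1) = i + j - 1" "i + (k - 1) = i + k - 1" "i - 1 + k = i + k - 1" by auto
    show "brkt (forms_dgla M) i (j + k) x (brkt (forms_dgla M) j k y z) =
          brkt (forms_dgla M) (i + j) k (brkt (forms_dgla M) i j x y) z +
          gscale (forms_dgla M) (ksgn (i * j))
            (brkt (forms_dgla M) j (i + k) y (brkt (forms_dgla M) i k x z))"
      unfolding x(1) y(1) z(1)
      apply (cases "even i"; cases "even j")
      using x(2,3) y(2,3) z(2,3) J[unfolded idx]
      by (auto simp: ev ins idx brkt_right brkt_left ksgn_def scale_right_distrib
        intro!: poly_eqI_eval)
  next
    fix i j x y assume "x \<in> gcomp (forms_dgla M) i" "y \<in> gcomp (forms_dgla M) j"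
    moreover obtain p q p' q' where "x = (p, q)" "y = (p', q')" by (cases x; cases y)
    ultimately have x: "x = (p, q)" "p \<in> ?P i" "q \<in> ?P (i - 1)"
      and y: "y = (p', q')" "p' \<in> ?P j" "q' \<in> ?P (j - 1)" by auto
    have D: "diff M (i + (j - 1)) (brkt M i (j - 1) u v) =
      brkt M (i + 1) (j - 1) (diff M i u) v + ?s (ksgn i) (brkt M i (j - 1 + 1) u (diff M (j - 1) v))"
      if "u \<in> gcomp M i" "v \<in> gcomp M (j - 1)" for u v
      by (rule leibniz[OF that])
    have D': "diff M (i - 1 + j) (brkt M (i - 1) j u v) =
      brkt M (i - 1 + 1) j (diff M (i - 1) u) v + ?s (ksgn (i - 1)) (brkt M (i - 1) (j + 1) u (diff M j v))"
      if "u \<in> gcomp M (i - 1)" "v \<in> gcomp M j" for u v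
      by (rule leibniz[OF that])
    have idx: "i - 1 + j = i + j - 1" "i + (j - 1) = i + j - 1" by auto
    show "diff (forms_dgla M) (i + j) (brkt (forms_dgla M) i j x y) =
        brkt (forms_dgla M) (i + 1) j (diff (forms_dgla M) i x) y +
        gscale (forms_dgla M) (ksgn i) (brkt (forms_dgla M) i (j + 1) x (diff (forms_dgla M) j y))"
      unfolding x(1) y(1)
      apply (cases "even i")
      using x(2,3) y(2,3) D D'
      by (auto simp: ev ins idx brkt_right brkt_left leibniz poly_deriv_brkt diff_add diff_scale
        diff_sub diff_minus ksgn_def scale_right_distrib scale_right_diff_distrib intro!: poly_eqI_eval)
  qed
qed

lemma forms_dgla_simps:
  "gscale (forms_dgla M) = forms_scale (gscale M)"
  "gcomp (forms_dgla M) = forms_comp (gcomp M)"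
  "diff (forms_dgla M) i (p, q) =
    (map_poly (diff M i) p, poly_deriv (gscale M) p - map_poly (diff M (i - 1)) q)"
  "brkt (forms_dgla M) i j (p, q) (p', q') = (poly_conv (brkt M i j) p p',
    map_poly (gscale M (ksgn i)) (poly_conv (brkt M i (j - 1)) p q') + poly_conv (brkt M (i - 1) j) q p')"
  by (simp_all add: forms_dgla_def)

lemma dgla_homI:
  assumes "\<And>i. linear_between (gscale L) (gcomp L i) (gscale M) (gcomp M i) (h i)"
    and "\<And>i x. x \<in> gcomp L i \<Longrightarrow> h (i + 1) (diff L i x) = diff M i (h i x)"
    and "\<And>i j x y. x \<in> gcomp L i \<Longrightarrow> y \<in> gcomp L j \<Longrightarrow>
        h (i + j) (brkt L i j x y) = brkt M i j (h i x) (h j y)"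
  shows "dgla_hom h L M"
  unfolding dgla_hom_def by (intro conjI allI ballI assms)

lemma dgla_homD:
  assumes "dgla_hom h L M"
  shows "linear_between (gscale L) (gcomp L i) (gscale M) (gcomp M i) (h i)"
    and "x \<in> gcomp L i \<Longrightarrow> h (i + 1) (diff L i x) = diff M i (h i x)"
    and "x \<in> gcomp L i \<Longrightarrow> y \<in> gcomp L j \<Longrightarrow>
        h (i + j) (brkt L i j x y) = brkt M i j (h i x) (h j y)"
  using assms unfolding dgla_hom_def by blast+

lemma dgla_hom_forms_eval:
  assumes "is_dgla M"
  shows "dgla_hom (\<lambda>i. forms_eval (gscale M) a) (forms_dgla M) M"
proof -
  interpret dgla M by unfold_locales fact
  show ?thesis
  proof (rule dgla_homI)
    fix i
    show "linear_between (gscale (forms_dgla M)) (gcomp (forms_dgla M) i) (gscale M) (gcomp M i)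
        (forms_eval (gscale M) a)"
      by (auto intro!: linear_betweenI simp: forms_dgla_simps forms_eval_def poly_eval_add
        poly_eval_scale_map)
  next
    fix i x assume "x \<in> gcomp (forms_dgla M) i"
    then show "forms_eval (gscale M) a (diff (forms_dgla M) i x) = diff M i (forms_eval (gscale M) a x)"
      by (cases x) (auto simp: forms_dgla_simps forms_eval_def poly_eval_diff_map)
  next
    fix i j x y assume "x \<in> gcomp (forms_dgla M) i" "y \<in> gcomp (forms_dgla M) j"
    then show "forms_eval (gscale M) a (brkt (forms_dgla M) i j x y) =
        brkt M i j (forms_eval (gscale M) a x) (forms_eval (gscale M) a y)"
      by (cases x; cases y) (auto simp: forms_dgla_simps forms_eval_def poly_eval_brkt)
  qed
qed

context cvec
begin

lemma poly_deriv_primitive: "poly_deriv s (poly_primitive s q) = q"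
  by (rule poly_eqI) (simp add: coeff_poly_deriv coeff_poly_primitive del: of_nat_Suc)

lemma poly_primitive_deriv: "poly_primitive s (poly_deriv s p) = p - [:coeff p 0:]"
  by (rule poly_eqI) (simp add: coeff_poly_deriv coeff_poly_primitive coeff_pCons split: nat.split
    del: of_nat_Suc)

lemma poly_primitive_add: "poly_primitive s (p + q) = poly_primitive s p + poly_primitive s q"
  and poly_primitive_diff: "poly_primitive s (p - q) = poly_primitive s p - poly_primitive s q"
  and poly_primitive_minus: "poly_primitive s (- p) = - poly_primitive s p"
  and poly_primitive_0 [simp]: "poly_primitive s 0 = 0"
  and poly_primitive_scale: "poly_primitive s (map_poly (s c) p) = map_poly (s c) (poly_primitive s p)"
  and poly_primitive_const: "poly_primitive s [:v:] = monom v 1"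
  by (rule poly_eqI, auto simp: coeff_poly_primitive scale_right_distrib scale_right_diff_distrib
    coeff_pCons coeff_monom mult.commute Suc_le_eq gr0_conv_Suc split: nat.split)+

lemma poly_deriv_diff: "poly_deriv s (p - q) = poly_deriv s p - poly_deriv s q"
  and poly_deriv_minus: "poly_deriv s (- p) = - poly_deriv s p"
  and poly_deriv_0 [simp]: "poly_deriv s 0 = 0"
  and poly_deriv_monom_1: "poly_deriv s (monom v 1) = [:v:]"
  and poly_deriv_linear: "poly_deriv s [:v, w:] = [:w:]"
  and poly_deriv_const: "poly_deriv s [:v:] = 0"
  by (rule poly_eqI, auto simp: coeff_poly_deriv scale_right_distrib scale_right_diff_distrib
    coeff_pCons coeff_monom split: nat.split)+

lemma poly_integral_eq: "poly_integral s 0 1 q = poly_eval s 1 (poly_primitive s q)"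
  unfolding poly_primitive_def poly_eval_sum_monom poly_integral_def by simp

lemma poly_eval_primitive_at_0: "poly_eval s 0 (poly_primitive s q) = 0"
  by (simp add: poly_eval_at_0 coeff_poly_primitive)

end

lemma (in csub) poly_primitive_map_linear:
  assumes f: "linear_between s V s' W f" and "vector_space s'" and p: "p \<in> pcoeffs V"
  shows "poly_primitive s' (map_poly f p) = map_poly f (poly_primitive s p)"
proof (rule poly_eqI)
  fix n
  interpret V': cvec s' using assms(2) by (simp add: cvec_def)
  show "coeff (poly_primitive s' (map_poly f p)) n = coeff (map_poly f (poly_primitive s p)) n"
    using p by (simp add: V'.coeff_poly_primitive coeff_map_linear[OF f] coeff_poly_primitive
      linear_betweenD(3)[OF f] linear_between_0[OF f])
qed

section \<open>The DGLA \<open>H\<close>\<close>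

lemma vector_space_triple:
  assumes "vector_space s" "vector_space s'" "vector_space s''"
  shows "vector_space (\<lambda>c (l, n, m). (s c l, s' c n, s'' c m))"
proof -
  interpret A: vector_space s by fact
  interpret B: vector_space s' by fact
  interpret C: vector_space s'' by fact
  show ?thesis
    by unfold_locales
      (auto simp: A.scale_left_distrib B.scale_left_distrib C.scale_left_distrib
        A.scale_right_distrib B.scale_right_distrib C.scale_right_distrib)
qed

text \<open>The fibre product of \<open>L \<times> N\<close> and \<open>P\<close> over
  \<open>M \<times> M\<close>; \<open>H\<close> is the case of the forms \<open>M[t,dt]\<close> with
  the evaluations at 1 and 0. The axioms hold componentwise, and the two matching conditions are
  preserved because the four maps are homomorphisms.\<close>

definition fibre_dgla ::
  "'l::ab_group_add dgla \<Rightarrow> 'n::ab_group_add dgla \<Rightarrow> 'p::ab_group_add dgla \<Rightarrow>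
   (int \<Rightarrow> 'l \<Rightarrow> 'm) \<Rightarrow> (int \<Rightarrow> 'n \<Rightarrow> 'm) \<Rightarrow> (int \<Rightarrow> 'p \<Rightarrow> 'm) \<Rightarrow> (int \<Rightarrow> 'p \<Rightarrow> 'm) \<Rightarrow> ('l \<times> 'n \<times> 'p) dgla" where
  "fibre_dgla L N P h g e f =
     \<lparr> gcomp = (\<lambda>i. {(l, n, m). l \<in> gcomp L i \<and> n \<in> gcomp N i \<and> m \<in> gcomp P i \<and>
          h i l = e i m \<and> g i n = f i m}),
       gscale = (\<lambda>c (l, n, m). (gscale L c l, gscale N c n, gscale P c m)),
       diff = (\<lambda>i (l, n, m). (diff L i l, diff N i n, diff P i m)),
       brkt = (\<lambda>i j (l, n, m) (l', n', m').
          (brkt L i j l l', brkt N i j n n', brkt P i j m m')) \<rparr>"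

lemma is_dgla_fibre:
  fixes M :: "'m::ab_group_add dgla"
  assumes "is_dgla L" "is_dgla N" "is_dgla P" "is_dgla M"
    and hom_h: "dgla_hom h L M" and hom_g: "dgla_hom g N M"
    and hom_e: "dgla_hom e P M" and hom_f: "dgla_hom f P M"
  shows "is_dgla (fibre_dgla L N P h g e f)" (is "is_dgla ?H")
proof -
  interpret L: dgla L by unfold_locales fact
  interpret N: dgla N by unfold_locales fact
  interpret P: dgla P by unfold_locales fact
  note hs = linear_betweenD[OF dgla_homD(1)[OF hom_h]] L.linear_between_0[OF dgla_homD(1)[OF hom_h]]
    dgla_homD(2,3)[OF hom_h]
    linear_betweenD[OF dgla_homD(1)[OF hom_g]] N.linear_between_0[OF dgla_homD(1)[OF hom_g]]
    dgla_homD(2,3)[OF hom_g]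
    linear_betweenD[OF dgla_homD(1)[OF hom_e]] P.linear_between_0[OF dgla_homD(1)[OF hom_e]]
    dgla_homD(2,3)[OF hom_e]
    linear_betweenD[OF dgla_homD(1)[OF hom_f]] P.linear_between_0[OF dgla_homD(1)[OF hom_f]]
    dgla_homD(2,3)[OF hom_f]
  have H: "(l, n, m) \<in> gcomp ?H i \<longleftrightarrow> l \<in> gcomp L i \<and> n \<in> gcomp N i \<and> m \<in> gcomp P i \<and>
       h i l = e i m \<and> g i n = f i m"
    "gscale ?H c (l, n, m) = (gscale L c l, gscale N c n, gscale P c m)"
    "diff ?H i (l, n, m) = (diff L i l, diff N i n, diff P i m)"
    "brkt ?H i j (l, n, m) (l', n', m') = (brkt L i j l l', brkt N i j n n', brkt P i j m m')"
    for i j c l n m l' n' m'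
    by (simp_all add: fibre_dgla_def)
  show ?thesis
  proof (rule is_dglaI)
    have vs: "vector_space (gscale ?H)"
      unfolding fibre_dgla_def
      using vector_space_triple[OF L.vector_space_axioms N.vector_space_axioms P.vector_space_axioms]
      by simp
    interpret vector_space "gscale ?H" by fact
    have 0: "0 = (0, 0, 0)" by (simp add: zero_prod_def)
    have "subspace (gcomp ?H i)" for i
      unfolding subspace_def 0 by (auto simp: H hs)
    with vs show "graded_space ?H" by (simp add: graded_space_def)
    fix i j k :: int
    show "linear_between (gscale ?H) (gcomp ?H i) (gscale ?H) (gcomp ?H (i + 1)) (diff ?H i)"
      by (rule linear_betweenI)
        (auto simp: H L.diff_in N.diff_in P.diff_in hs L.diff_add N.diff_add
          P.diff_add L.diff_scale N.diff_scale P.diff_scale)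
    show "diff ?H (i + 1) (diff ?H i x) = 0" if "x \<in> gcomp ?H i" for x
      using that by (cases x) (auto simp: H L.diff_diff N.diff_diff P.diff_diff zero_prod_def)
    have "brkt ?H i j x y \<in> gcomp ?H (i + j)" if "x \<in> gcomp ?H i" "y \<in> gcomp ?H j" for x y
      using that by (cases x; cases y) (auto simp: H L.brkt_in N.brkt_in P.brkt_in hs)
    then show "bilinear_between (gscale ?H) (gcomp ?H i) (gscale ?H) (gcomp ?H j) (gscale ?H)
        (gcomp ?H (i + j)) (brkt ?H i j)"
      unfolding bilinear_between_def
      by (intro conjI ballI linear_betweenI)
        (auto simp: H L.brkt_right N.brkt_right P.brkt_right L.brkt_left N.brkt_left P.brkt_left)
    show "brkt ?H i j x y = - gscale ?H (ksgn (i * j)) (brkt ?H j i y x)"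
      if "x \<in> gcomp ?H i" "y \<in> gcomp ?H j" for x y
    proof -
      obtain l n m l' n' m' where xy: "x = (l, n, m)" "y = (l', n', m')" by (metis prod_cases3)
      from that show ?thesis
        unfolding xy H uminus_prod_def fst_conv snd_conv
        by (intro arg_cong2[of _ _ _ _ Pair] L.brkt_anti N.brkt_anti P.brkt_anti) auto
    qed
    show "brkt ?H i (j + k) x (brkt ?H j k y z) = brkt ?H (i + j) k (brkt ?H i j x y) z +
        gscale ?H (ksgn (i * j)) (brkt ?H j (i + k) y (brkt ?H i k x z))"
      if "x \<in> gcomp ?H i" "y \<in> gcomp ?H j" "z \<in> gcomp ?H k" for x y z
    proof -
      obtain l n m l' n' m' l'' n'' m'' where xy: "x = (l, n, m)" "y = (l', n', m')" "z = (l'', n'', m'')"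
        by (metis prod_cases3)
      from that show ?thesis
        unfolding xy H add_Pair
        by (intro arg_cong2[of _ _ _ _ Pair] L.jacobi N.jacobi P.jacobi) auto
    qed
    show "diff ?H (i + j) (brkt ?H i j x y) = brkt ?H (i + 1) j (diff ?H i x) y +
        gscale ?H (ksgn i) (brkt ?H i (j + 1) x (diff ?H j y))"
      if "x \<in> gcomp ?H i" "y \<in> gcomp ?H j" for x y
    proof -
      obtain l n m l' n' m' where xy: "x = (l, n, m)" "y = (l', n', m')" by (metis prod_cases3)
      from that show ?thesis
        unfolding xy H add_Pair
        by (intro arg_cong2[of _ _ _ _ Pair] L.leibniz N.leibniz P.leibniz) auto
    qed
  qed
qed

locale cone_data = L: dgla L + N: dgla N + M: dgla M
  for L :: "'l::ab_group_add dgla" and N :: "'n::ab_group_add dgla" and M :: "'m::ab_group_add dgla" +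
  fixes h :: "int \<Rightarrow> 'l \<Rightarrow> 'm" and g :: "int \<Rightarrow> 'n \<Rightarrow> 'm"
  assumes hom_h: "dgla_hom h L M" and hom_g: "dgla_hom g N M"
begin

abbreviation "H \<equiv> H_dgla L N M h g"
abbreviation "C \<equiv> cone_linf L N M h g"

lemmas h_lin = dgla_homD(1)[OF hom_h] and g_lin = dgla_homD(1)[OF hom_g]
lemmas h_simps = linear_betweenD(2,3)[OF h_lin] L.linear_between_minus[OF h_lin]
  L.linear_between_diff[OF h_lin] L.linear_between_0[OF h_lin] dgla_homD(2,3)[OF hom_h]
lemmas g_simps = linear_betweenD(2,3)[OF g_lin] N.linear_between_minus[OF g_lin]
  N.linear_between_diff[OF g_lin] N.linear_between_0[OF g_lin] dgla_homD(2,3)[OF hom_g]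
lemmas hg_in = linear_betweenD(1)[OF h_lin] linear_betweenD(1)[OF g_lin]

sublocale FM: dgla "forms_dgla M"
  by unfold_locales (rule is_dgla_forms[OF M.dgla])

lemmas ev_hom = dgla_hom_forms_eval[OF M.dgla]

lemma H_simps:
  "(l, n, m) \<in> gcomp H i \<longleftrightarrow> l \<in> gcomp L i \<and> n \<in> gcomp N i \<and> m \<in> gcomp (forms_dgla M) i \<and>
     h i l = forms_eval (gscale M) 1 m \<and> g i n = forms_eval (gscale M) 0 m"
  "gscale H c (l, n, m) = (gscale L c l, gscale N c n, gscale (forms_dgla M) c m)"
  "diff H i (l, n, m) = (diff L i l, diff N i n, diff (forms_dgla M) i m)"
  "brkt H i j (l, n, m) (l', n', m') =
     (brkt L i j l l', brkt N i j n n', brkt (forms_dgla M) i j m m')"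
  by (simp_all add: H_dgla_def)

lemma C_simps:
  "(l, n, m) \<in> gcomp C i \<longleftrightarrow> l \<in> gcomp L i \<and> n \<in> gcomp N i \<and> m \<in> gcomp M (i - 1)"
  "gscale C c (l, n, m) = (gscale L c l, gscale N c n, gscale M c m)"
  by (simp_all add: cone_linf_def Let_def)

lemma graded_C: "graded_space C"
proof -
  have vs: "vector_space (gscale C)"
    using vector_space_triple[OF L.vector_space_axioms N.vector_space_axioms M.vector_space_axioms]
    by (simp add: cone_linf_def Let_def)
  interpret vector_space "gscale C" by fact
  have "subspace (gcomp C i)" for i
    unfolding subspace_def zero_prod_def by (auto simp: C_simps)
  with vs show ?thesis by (simp add: graded_space_def)
qed

lemma is_dgla_H: "is_dgla H"
proof -
  have "H = fibre_dgla L N (forms_dgla M) h g (\<lambda>i. forms_eval (gscale M) 1) (\<lambda>i. forms_eval (gscale M) 0)"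
    by (simp add: H_dgla_def fibre_dgla_def)
  then show ?thesis
    using is_dgla_fibre[OF L.dgla N.dgla FM.dgla M.dgla hom_h hom_g ev_hom ev_hom] by simp
qed

end

section \<open>Contractions of DGLAs\<close>

text \<open>A strong deformation retract of \<open>H\<close> onto \<open>V\<close>, with the sign
  convention dK + Kd = \<iota>\<pi> - 1 and its side conditions. The last two assumptions are the
  extra property of the cone; their degrees read \<open>i - 1 + (j - 1)\<close> because
  \<open>K\<close> lowers degrees by one. \<open>V\<close> is a graded space with a differential
  \<open>dV\<close> and carries no bracket.\<close>

locale contraction = dgla H
  for H :: "'h::ab_group_add dgla" +
  fixes V :: "('c::ab_group_add, 'z) graded_scheme"
    and dV :: "int \<Rightarrow> 'c \<Rightarrow> 'c" and \<iota> :: "int \<Rightarrow> 'c \<Rightarrow> 'h" and \<pi> :: "int \<Rightarrow> 'h \<Rightarrow> 'c" and K :: "int \<Rightarrow> 'h \<Rightarrow> 'h"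
  assumes graded_V: "graded_space V"
    and linear_dV: "linear_between (gscale V) (gcomp V i) (gscale V) (gcomp V (i + 1)) (dV i)"
    and linear_incl: "linear_between (gscale V) (gcomp V i) (gscale H) (gcomp H i) (\<iota> i)"
    and linear_proj: "linear_between (gscale H) (gcomp H i) (gscale V) (gcomp V i) (\<pi> i)"
    and linear_K: "linear_between (gscale H) (gcomp H i) (gscale H) (gcomp H (i - 1)) (K i)"
    and diff_incl: "v \<in> gcomp V i \<Longrightarrow> diff H i (\<iota> i v) = \<iota> (i + 1) (dV i v)"
    and homotopy: "x \<in> gcomp H i \<Longrightarrow> diff H (i - 1) (K i x) + K (i + 1) (diff H i x) = \<iota> i (\<pi> i x) - x"
    and K_incl: "v \<in> gcomp V i \<Longrightarrow> K i (\<iota> i v) = 0"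
    and K_K: "x \<in> gcomp H i \<Longrightarrow> K (i - 1) (K i x) = 0"
    and proj_incl: "v \<in> gcomp V i \<Longrightarrow> \<pi> i (\<iota> i v) = v"
    and proj_K: "x \<in> gcomp H i \<Longrightarrow> \<pi> (i - 1) (K i x) = 0"
    and K_brkt: "x \<in> gcomp H i \<Longrightarrow> y \<in> gcomp H j \<Longrightarrow>
      K (i - 1 + (j - 1)) (brkt H (i - 1) (j - 1) (K i x) (K j y)) = 0"
    and proj_brkt: "x \<in> gcomp H i \<Longrightarrow> y \<in> gcomp H j \<Longrightarrow>
      \<pi> (i - 1 + (j - 1)) (brkt H (i - 1) (j - 1) (K i x) (K j y)) = 0"
begin

sublocale V: csub "gscale V" "gcomp V i" for i
  by (rule csub_of_graded[OF graded_V])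

end

text \<open>The differential D of the mapping cone, which is minus the multiplication with one
  argument.\<close>

definition cone_diff ::
  "'l::ab_group_add dgla \<Rightarrow> 'n::ab_group_add dgla \<Rightarrow> 'm::ab_group_add dgla \<Rightarrow>
   (int \<Rightarrow> 'l \<Rightarrow> 'm) \<Rightarrow> (int \<Rightarrow> 'n \<Rightarrow> 'm) \<Rightarrow> int \<Rightarrow> 'l \<times> 'n \<times> 'm \<Rightarrow> 'l \<times> 'n \<times> 'm" where
  "cone_diff L N M h g i = (\<lambda>(l, n, m). (diff L i l, diff N i n, h i l - g i n - diff M (i - 1) m))"

context cone_data
begin

text \<open>The homotopy formula is the fundamental theorem of calculus: integrating p' up to t
  gives p(t) - p(0). The linear correction in \<open>K\<close> makes its values vanish at both ends,
  as membership in \<open>H\<close> requires of an element whose first two components are 0.\<close>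

lemma contraction_cone:
  "contraction H C (cone_diff L N M h g) (\<lambda>i. cone_incl h g (i - 1)) (\<lambda>i. cone_proj M)
     (\<lambda>i. cone_homotopy M)"
proof -
  interpret H: dgla H by unfold_locales (rule is_dgla_H)
  let ?s = "gscale M"
  note simps = H_simps C_simps forms_dgla_simps cone_diff_def cone_incl_def cone_proj_def cone_homotopy_def
    forms_eval_def forms_integral_def M.poly_eval_add M.poly_eval_diff M.poly_eval_minus
    M.poly_integral_eq M.poly_primitive_add M.poly_primitive_diff M.poly_primitive_scale
    M.poly_eval_scale_map M.poly_eval_monom M.poly_eval_linear M.poly_eval_const
    M.poly_eval_primitive_at_0 M.poly_primitive_const
  have pc: "[:v, w:] \<in> pcoeffs (gcomp M i)" if "v \<in> gcomp M i" "w \<in> gcomp M i" for v w i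
    using that by (auto intro!: pcoeffsI simp: coeff_pCons split: nat.split)
  have pe: "p = q" if "\<And>a. poly_eval ?s a p = poly_eval ?s a q" for p q
    by (rule M.poly_eqI_eval) (rule that)
  show ?thesis
  proof (unfold_locales)
    fix i j :: int
    show "graded_space C" by (rule graded_C)
    show "linear_between (gscale C) (gcomp C i) (gscale C) (gcomp C (i + 1)) (cone_diff L N M h g i)"
      using M.diff_in[of _ "i - 1" i]
      by (auto intro!: linear_betweenI simp: simps L.diff_in N.diff_in hg_in h_simps g_simps
        L.diff_add N.diff_add M.diff_add L.diff_scale N.diff_scale M.diff_scale
        M.scale_right_diff_distrib)
    show "linear_between (gscale C) (gcomp C i) (gscale H) (gcomp H i) (cone_incl h g (i - 1))"
      by (auto intro!: linear_betweenI pe pc simp: simps hg_in h_simps g_simps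
        M.scale_right_diff_distrib M.scale_right_distrib mult.commute)
    show "linear_between (gscale H) (gcomp H i) (gscale C) (gcomp C i) (cone_proj M)"
      by (auto intro!: linear_betweenI simp: simps)
    show "linear_between (gscale H) (gcomp H i) (gscale H) (gcomp H (i - 1)) (cone_homotopy M)"
      by (auto intro!: linear_betweenI pe simp: simps h_simps g_simps zero_prod_def
        M.scale_right_diff_distrib M.scale_right_distrib mult.commute)
    show "diff H i (cone_incl h g (i - 1) v) = cone_incl h g (i + 1 - 1) (cone_diff L N M h g i v)"
      if "v \<in> gcomp C i" for v
      using that
      by (cases v) (auto intro!: pe simp: simps h_simps g_simps hg_in pc M.poly_eval_diff_map
        M.diff_add M.diff_scale M.diff_sub M.poly_deriv_linear M.scale_right_diff_distrib)
    show "diff H (i - 1) (cone_homotopy M x) + cone_homotopy M (diff H i x) =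
        cone_incl h g (i - 1) (cone_proj M x) - x" if x: "x \<in> gcomp H i" for x
    proof -
      obtain l n p q where xx: "x = (l, n, (p, q))" by (metis prod.collapse)
      with x have in': "p \<in> pcoeffs (gcomp M i)" "q \<in> pcoeffs (gcomp M (i - 1))"
        and hl: "h i l = poly_eval ?s 1 p" and gn: "g i n = poly_eval ?s 0 p"
        by (auto simp: simps)
      let ?P = "poly_primitive ?s"
      \<comment> \<open>Integration in t commutes with the differential of the coefficients, so
        these terms cancel in the homotopy formula.\<close>
      have dq: "?P (map_poly (diff M (i - 1)) q) = map_poly (diff M (i - 1)) (?P q)"
        by (rule M.poly_primitive_map_linear[OF M.linear_diff M.vector_space_axioms in'(2)])
      have "linear_between ?s (gcomp M (i - 1)) ?s (gcomp M (i - 1 + 1)) (diff M (i - 1))"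
        by (rule M.linear_diff)
      from in' show ?thesis
        unfolding xx
        by (auto intro!: pe simp: simps hl gn dq M.poly_primitive_deriv M.poly_deriv_primitive
          M.poly_deriv_diff M.poly_deriv_monom_1 M.poly_eval_diff_map M.diff_sub M.diff_scale
          M.poly_eval_at_0 M.scale_right_diff_distrib M.scale_right_distrib M.poly_deriv_monom_1[simplified])
    qed
    show "cone_homotopy M (cone_incl h g (i - 1) v) = 0" if "v \<in> gcomp C i" for v
      by (cases v) (auto simp: simps zero_prod_def)
    show "cone_homotopy M (cone_homotopy M x) = 0" if "x \<in> gcomp H i" for x
      by (cases x) (auto simp: simps zero_prod_def)
    show "cone_proj M (cone_incl h g (i - 1) v) = v" if "v \<in> gcomp C i" for v
      by (cases v) (auto simp: simps)
    show "cone_proj M (cone_homotopy M x) = 0" if "x \<in> gcomp H i" for x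
      by (cases x) (auto simp: simps zero_prod_def)
    have z: "poly_conv b 0 q = 0" "poly_conv b p 0 = 0" if "\<And>x. b 0 x = 0" "\<And>x. b x 0 = 0"
      for b :: "'m \<Rightarrow> 'm \<Rightarrow> 'm" and p q
      using that by (simp_all add: poly_conv_def)
    have K: "cone_homotopy M x \<in> {(0, 0, (p, 0)) | p. p \<in> pcoeffs (gcomp M (i - 1))}"
      if "x \<in> gcomp H i" for x i
      using that by (cases x) (auto simp: simps)
    \<comment> \<open>Convolution with a zero \<open>dt\<close>-part is zero. Hence the product of
      two elements of the image of \<open>K\<close> has no \<open>dt\<close>-part, and this part is
      all that \<open>K\<close> and the third component of \<open>\<pi>\<close> see.\<close>
    have conv0: "poly_conv (brkt M a b) p 0 = 0" "poly_conv (brkt M b a) 0 p = 0"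
      if "p \<in> pcoeffs (gcomp M a)" for a b p
      using that by (auto intro!: pe simp: M.poly_eval_brkt M.brkt_right M.brkt_left)
    show "cone_homotopy M (brkt H (i - 1) (j - 1) (cone_homotopy M x) (cone_homotopy M y)) = 0"
      and "cone_proj M (brkt H (i - 1) (j - 1) (cone_homotopy M x) (cone_homotopy M y)) = 0"
      if x: "x \<in> gcomp H i" and y: "y \<in> gcomp H j" for x y
    proof -
      obtain p p' where *: "cone_homotopy M x = (0, 0, (p, 0))" "cone_homotopy M y = (0, 0, (p', 0))"
        "p \<in> pcoeffs (gcomp M (i - 1))" "p' \<in> pcoeffs (gcomp M (j - 1))"
        using K[OF x] K[OF y] by blast
      from *(3,4) show "cone_homotopy M (brkt H (i - 1) (j - 1) (cone_homotopy M x) (cone_homotopy M y)) = 0"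
        and "cone_proj M (brkt H (i - 1) (j - 1) (cone_homotopy M x) (cone_homotopy M y)) = 0"
        unfolding *(1,2) by (auto simp: simps conv0 zero_prod_def L.brkt_left N.brkt_left)
    qed
  qed
qed

end

section \<open>Extension of a contraction to differential forms on the line\<close>

definition forms_map :: "(int \<Rightarrow> 'v::zero \<Rightarrow> 'w::zero) \<Rightarrow> int \<Rightarrow> 'v forms \<Rightarrow> 'w forms" where
  "forms_map f i = (\<lambda>(p, q). (map_poly (f i) p, map_poly (f (i - 1)) q))"

text \<open>The sign on the \<open>dt\<close>-part is the Koszul sign for moving a map of odd degree
  past \<open>dt\<close>.\<close>

definition forms_map_odd ::
  "(int \<Rightarrow> 'v::ab_group_add \<Rightarrow> 'w::ab_group_add) \<Rightarrow> int \<Rightarrow> 'v forms \<Rightarrow> 'w forms" where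
  "forms_map_odd f i = (\<lambda>(p, q). (map_poly (f i) p, - map_poly (f (i - 1)) q))"

text \<open>The differential of \<open>forms_dgla\<close>, for a graded space that has a
  differential but no bracket.\<close>

definition forms_diff :: "(complex \<Rightarrow> 'v::ab_group_add \<Rightarrow> 'v) \<Rightarrow> (int \<Rightarrow> 'v \<Rightarrow> 'v) \<Rightarrow>
   int \<Rightarrow> 'v forms \<Rightarrow> 'v forms" where
  "forms_diff s d i = (\<lambda>(p, q). (map_poly (d i) p, poly_deriv s p - map_poly (d (i - 1)) q))"

lemma forms_map_simps [simp]:
  "forms_map f i (p, q) = (map_poly (f i) p, map_poly (f (i - 1)) q)"
  "forms_map_odd f i (p, q) = (map_poly (f i) p, - map_poly (f (i - 1)) q)"
  "forms_diff s d i (p, q) = (map_poly (d i) p, poly_deriv s p - map_poly (d (i - 1)) q)"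
  by (simp_all add: forms_map_def forms_map_odd_def forms_diff_def)

context contraction
begin

lemma lin_in:
  "v \<in> gcomp V i \<Longrightarrow> \<iota> i v \<in> gcomp H i"
  "x \<in> gcomp H i \<Longrightarrow> \<pi> i x \<in> gcomp V i"
  "x \<in> gcomp H i \<Longrightarrow> j = i - 1 \<Longrightarrow> K i x \<in> gcomp H j"
  "v \<in> gcomp V i \<Longrightarrow> j = i + 1 \<Longrightarrow> dV i v \<in> gcomp V j"
  using linear_betweenD(1)[OF linear_incl] linear_betweenD(1)[OF linear_proj]
    linear_betweenD(1)[OF linear_K] linear_betweenD(1)[OF linear_dV] by auto

lemmas incl_simps = linear_betweenD(2,3)[OF linear_incl] V.linear_between_minus[OF linear_incl]
  V.linear_between_diff[OF linear_incl] V.linear_between_0[OF linear_incl]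
lemmas proj_simps = linear_betweenD(2,3)[OF linear_proj] linear_between_minus[OF linear_proj]
  linear_between_diff[OF linear_proj] linear_between_0[OF linear_proj]
lemmas K_simps = linear_betweenD(2,3)[OF linear_K] linear_between_minus[OF linear_K]
  linear_between_diff[OF linear_K] linear_between_0[OF linear_K]
lemmas dV_simps = linear_betweenD(2,3)[OF linear_dV] V.linear_between_minus[OF linear_dV]
  V.linear_between_diff[OF linear_dV] V.linear_between_0[OF linear_dV]

lemma map_in:
  "p \<in> pcoeffs (gcomp V i) \<Longrightarrow> map_poly (\<iota> i) p \<in> pcoeffs (gcomp H i)"
  "q \<in> pcoeffs (gcomp H i) \<Longrightarrow> map_poly (\<pi> i) q \<in> pcoeffs (gcomp V i)"
  "q \<in> pcoeffs (gcomp H i) \<Longrightarrow> j = i - 1 \<Longrightarrow> map_poly (K i) q \<in> pcoeffs (gcomp H j)"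
  "p \<in> pcoeffs (gcomp V i) \<Longrightarrow> j = i + 1 \<Longrightarrow> map_poly (dV i) p \<in> pcoeffs (gcomp V j)"
  using V.map_linear_in[OF linear_incl] map_linear_in[OF linear_proj]
    map_linear_in[OF linear_K] V.map_linear_in[OF linear_dV] by auto

lemma eval_maps:
  "p \<in> pcoeffs (gcomp V i) \<Longrightarrow> poly_eval (gscale H) a (map_poly (\<iota> i) p) = \<iota> i (poly_eval (gscale V) a p)"
  "q \<in> pcoeffs (gcomp H i) \<Longrightarrow> poly_eval (gscale V) a (map_poly (\<pi> i) q) = \<pi> i (poly_eval (gscale H) a q)"
  "q \<in> pcoeffs (gcomp H i) \<Longrightarrow> poly_eval (gscale H) a (map_poly (K i) q) = K i (poly_eval (gscale H) a q)"
  "p \<in> pcoeffs (gcomp V i) \<Longrightarrow> poly_eval (gscale V) a (map_poly (dV i) p) = dV i (poly_eval (gscale V) a p)"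
  using V.poly_eval_map_linear[OF linear_incl] poly_eval_map_linear[OF linear_proj]
    poly_eval_map_linear[OF linear_K] V.poly_eval_map_linear[OF linear_dV]
  by (auto simp: vector_space_axioms V.vector_space_axioms)

lemma deriv_maps:
  "p \<in> pcoeffs (gcomp V i) \<Longrightarrow> poly_deriv (gscale H) (map_poly (\<iota> i) p) = map_poly (\<iota> i) (poly_deriv (gscale V) p)"
  "q \<in> pcoeffs (gcomp H i) \<Longrightarrow> poly_deriv (gscale V) (map_poly (\<pi> i) q) = map_poly (\<pi> i) (poly_deriv (gscale H) q)"
  "q \<in> pcoeffs (gcomp H i) \<Longrightarrow> poly_deriv (gscale H) (map_poly (K i) q) = map_poly (K i) (poly_deriv (gscale H) q)"
  using V.poly_deriv_map_linear[OF linear_incl] poly_deriv_map_linear[OF linear_proj]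
    poly_deriv_map_linear[OF linear_K]
  by (auto simp: vector_space_axioms V.vector_space_axioms)

lemma V_eval_scale:
  "poly_eval (gscale V) a (map_poly (gscale V c) p) = gscale V c (poly_eval (gscale V) a p)"
proof -
  interpret U: csub "gscale V" UNIV by unfold_locales simp
  show ?thesis
    by (rule U.poly_eval_map_linear[where W = UNIV])
      (auto intro!: pcoeffsI linear_betweenI simp: V.scale_right_distrib V.vector_space_axioms mult.commute)
qed

text \<open>At every point the function part of each condition is the given one in degree i and the
  \<open>dt\<close>-part the given one in degree i - 1. In the homotopy formula the sign of
  \<open>forms_map_odd\<close> meets the sign of \<open>- d\<close> on \<open>dt\<close>-parts, and
  the two terms containing a derivative in the parameter cancel because \<open>K\<close> acts on
  coefficients only.\<close>

lemma contraction_forms: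
  fixes V' :: "('c forms, 'y) graded_scheme"
  assumes V': "gcomp V' = forms_comp (gcomp V)" "gscale V' = forms_scale (gscale V)"
  shows "contraction (forms_dgla H) V' (forms_diff (gscale V) dV)
    (forms_map \<iota>) (forms_map \<pi>) (forms_map_odd K)"
proof -
  interpret F: dgla "forms_dgla H" by unfold_locales (rule is_dgla_forms[OF dgla])
  note H_eq = poly_eqI_eval and V_eq = V.poly_eqI_eval
  note ev = eval_maps poly_eval_brkt poly_eval_diff_map poly_eval_scale_map poly_eval_add
    poly_eval_diff poly_eval_minus V_eval_scale V.poly_eval_add V.poly_eval_diff V.poly_eval_minus
  note ins = map_in lin_in poly_diff_in diff_in poly_brkt_in brkt_in
  show ?thesis
  proof (unfold_locales)
    fix i j :: int
    have "csub (forms_scale (gscale V)) (forms_comp (gcomp V) k)" for k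
      by (rule csub_forms_comp) (rule csub_of_graded[OF graded_V])
    then show "graded_space V'"
      by (simp add: graded_space_def V' csub_def csub_axioms_def)
    show "linear_between (gscale V') (gcomp V' i) (gscale V') (gcomp V' (i + 1))
        (forms_diff (gscale V) dV i)"
      by (auto intro!: linear_betweenI V_eq simp: V' ins ev dV_simps V.poly_deriv_add V.poly_deriv_scale
        V.scale_right_diff_distrib)
    show "linear_between (gscale V') (gcomp V' i) (gscale (forms_dgla H)) (gcomp (forms_dgla H) i)
        (forms_map \<iota> i)"
      by (auto intro!: linear_betweenI H_eq simp: forms_dgla_simps V' ins ev incl_simps)
    show "linear_between (gscale (forms_dgla H)) (gcomp (forms_dgla H) i) (gscale V') (gcomp V' i)
        (forms_map \<pi> i)"
      by (auto intro!: linear_betweenI V_eq simp: forms_dgla_simps V' ins ev proj_simps)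
    show "linear_between (gscale (forms_dgla H)) (gcomp (forms_dgla H) i) (gscale (forms_dgla H))
        (gcomp (forms_dgla H) (i - 1)) (forms_map_odd K i)"
      by (auto intro!: linear_betweenI H_eq simp: forms_dgla_simps V' ins ev K_simps)
    show "diff (forms_dgla H) i (forms_map \<iota> i v) = forms_map \<iota> (i + 1) (forms_diff (gscale V) dV i v)"
      if v_in: "v \<in> gcomp V' i" for v
    proof -
      obtain p q where v: "v = (p, q)" "p \<in> pcoeffs (gcomp V i)" "q \<in> pcoeffs (gcomp V (i - 1))"
        using v_in by (cases v) (auto simp: V')
      from v(2,3) show ?thesis
        using diff_incl[of _ "i - 1"]
        by (auto intro!: H_eq simp: v(1) forms_dgla_simps ins ev diff_incl deriv_maps incl_simps)
    qed
    show "diff (forms_dgla H) (i - 1) (forms_map_odd K i x) + forms_map_odd K (i + 1) (diff (forms_dgla H) i x) =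
        forms_map \<iota> i (forms_map \<pi> i x) - x" if x_in: "x \<in> gcomp (forms_dgla H) i" for x
    proof -
      obtain p q where x: "x = (p, q)" "p \<in> pcoeffs (gcomp H i)" "q \<in> pcoeffs (gcomp H (i - 1))"
        using x_in by (cases x) (auto simp: forms_dgla_simps)
      have h: "diff H (i - 1) (K i (poly_eval (gscale H) a p)) +
            K (i + 1) (diff H i (poly_eval (gscale H) a p)) =
          \<iota> i (\<pi> i (poly_eval (gscale H) a p)) - poly_eval (gscale H) a p"
        "diff H (i - 2) (K (i - 1) (poly_eval (gscale H) a q)) +
            K i (diff H (i - 1) (poly_eval (gscale H) a q)) =
          \<iota> (i - 1) (\<pi> (i - 1) (poly_eval (gscale H) a q)) - poly_eval (gscale H) a q" for a
        using homotopy[of "poly_eval (gscale H) a p" i] homotopy[of "poly_eval (gscale H) a q" "i - 1"] x(2,3)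
        by auto
      from x(2,3) show ?thesis
        by (auto intro!: H_eq simp: x(1) forms_dgla_simps ins ev deriv_maps diff_minus K_simps
          h[symmetric])
    qed
    show "forms_map_odd K i (forms_map \<iota> i v) = 0" if "v \<in> gcomp V' i" for v
      using that by (cases v) (auto intro!: H_eq simp: V' ins ev K_incl zero_prod_def)
    show "forms_map_odd K (i - 1) (forms_map_odd K i x) = 0" if "x \<in> gcomp (forms_dgla H) i" for x
      using that K_K[of _ "i - 1"]
      by (cases x) (auto intro!: H_eq simp: forms_dgla_simps ins ev K_K K_simps zero_prod_def)
    show "forms_map \<pi> i (forms_map \<iota> i v) = v" if "v \<in> gcomp V' i" for v
      using that by (cases v) (auto intro!: V_eq simp: V' ins ev proj_incl)
    show "forms_map \<pi> (i - 1) (forms_map_odd K i x) = 0" if "x \<in> gcomp (forms_dgla H) i" for x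
      using that proj_K[of _ "i - 1"]
      by (cases x) (auto intro!: V_eq simp: forms_dgla_simps ins ev proj_K proj_simps zero_prod_def)
    fix x y assume "x \<in> gcomp (forms_dgla H) i" "y \<in> gcomp (forms_dgla H) j"
    then obtain p q p' q' where
      x: "x = (p, q)" "p \<in> pcoeffs (gcomp H i)" "q \<in> pcoeffs (gcomp H (i - 1))" and
      y: "y = (p', q')" "p' \<in> pcoeffs (gcomp H j)" "q' \<in> pcoeffs (gcomp H (j - 1))"
      by (cases x; cases y) (auto simp: forms_dgla_simps)
    let ?e = "poly_eval (gscale H)"
    \<comment> \<open>The part without \<open>dt\<close>, and the two parts in which one of the
      arguments contributes its \<open>dt\<close>-coefficient, first for \<open>K\<close> and then
      for \<open>\<pi>\<close>.\<close>
    have z: "K (i - 1 + (j - 1)) (brkt H (i - 1) (j - 1) (K i (?e a p)) (K j (?e a p'))) = 0"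
      "K (i - 1 + (j - 1 - 1)) (brkt H (i - 1) (j - 1 - 1) (K i (?e a p)) (K (j - 1) (?e a q'))) = 0"
      "K (i - 1 - 1 + (j - 1)) (brkt H (i - 1 - 1) (j - 1) (K (i - 1) (?e a q)) (K j (?e a p'))) = 0"
      "\<pi> (i - 1 + (j - 1)) (brkt H (i - 1) (j - 1) (K i (?e a p)) (K j (?e a p'))) = 0"
      "\<pi> (i - 1 + (j - 1 - 1)) (brkt H (i - 1) (j - 1 - 1) (K i (?e a p)) (K (j - 1) (?e a q'))) = 0"
      "\<pi> (i - 1 - 1 + (j - 1)) (brkt H (i - 1 - 1) (j - 1) (K (i - 1) (?e a q)) (K j (?e a p'))) = 0"
      for a
      by (rule K_brkt proj_brkt; simp add: x(2,3) y(2,3))+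
    have idx: "i - 1 + (j - 1) = i + j - 2" "i - 1 + (j - 1 - 1) = i + j - 3"
      "i - 1 - 1 + (j - 1) = i + j - 3" "i - 1 + (j - 2) = i + j - 3" "i - 2 + (j - 1) = i + j - 3"
      "i + j - 2 - 1 = i + j - 3" "i - 1 - 1 = i - 2" "j - 1 - 1 = j - 2"
      by auto
    show "forms_map_odd K (i - 1 + (j - 1))
        (brkt (forms_dgla H) (i - 1) (j - 1) (forms_map_odd K i x) (forms_map_odd K j y)) = 0"
      and "forms_map \<pi> (i - 1 + (j - 1))
        (brkt (forms_dgla H) (i - 1) (j - 1) (forms_map_odd K i x) (forms_map_odd K j y)) = 0"
      using x(2,3) y(2,3) z[unfolded idx]
      by (auto intro!: H_eq V_eq simp: x(1) y(1) forms_dgla_simps idx ins ev K_simps proj_simps zero_prod_def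
        brkt_right brkt_left)
  qed
qed

end

section \<open>Constants, evaluations and the integration homotopy on \<open>L[s,ds]\<close>\<close>

context dgla
begin

lemma dgla_hom_const: "dgla_hom (\<lambda>i v. ([:v:], 0)) L (forms_dgla L)"
proof (rule dgla_homI)
  fix i
  show "linear_between (gscale L) (gcomp L i) (gscale (forms_dgla L)) (gcomp (forms_dgla L) i) (\<lambda>v. ([:v:], 0))"
    by (auto intro!: linear_betweenI poly_eqI_eval simp: forms_dgla_simps poly_eval_const poly_eval_scale_map)
next
  fix i x assume "x \<in> gcomp L i"
  then show "([:diff L i x:], 0) = diff (forms_dgla L) i ([:x:], 0)"
    by (auto intro!: poly_eqI_eval simp: forms_dgla_simps poly_eval_const poly_eval_diff_map
      poly_deriv_const)
next
  fix i j x y assume "x \<in> gcomp L i" "y \<in> gcomp L j"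
  then show "([:brkt L i j x y:], 0) = brkt (forms_dgla L) i j ([:x:], 0) ([:y:], 0)"
    using pcoeffs_0[of "j - 1"] pcoeffs_0[of "i - 1"]
    by (auto intro!: poly_eqI_eval simp: forms_dgla_simps poly_eval_const poly_eval_brkt
      poly_eval_add poly_eval_scale_map brkt_left brkt_right simp del: pcoeffs_0)
qed

text \<open>The homotopy contracting forms on the line onto the constants by evaluation at 0, with
  the same sign convention as for \<open>K\<close>. Its values vanish at 0, so a gauge
  transformation by such a value fixes the start of a path.\<close>

definition line_homotopy :: "'v forms \<Rightarrow> 'v forms" where
  "line_homotopy = (\<lambda>(p, q). (- poly_primitive (gscale L) q, 0))"

definition line_scale :: "'v \<Rightarrow> 'v forms" where
  "line_scale v = (monom v 1, 0)"

definition form_part0 :: "'v forms \<Rightarrow> 'v forms" where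
  "form_part0 = (\<lambda>(p, q). (p, 0))"

definition form_dt_deriv :: "'v forms \<Rightarrow> 'v forms" where
  "form_dt_deriv = (\<lambda>(p, q). (0, - poly_deriv (gscale L) p))"

lemma linear_line_homotopy: "linear_between (gscale (forms_dgla L)) (gcomp (forms_dgla L) i)
    (gscale (forms_dgla L)) (gcomp (forms_dgla L) (i - 1)) line_homotopy"
  by (auto intro!: linear_betweenI poly_eqI_eval simp: forms_dgla_simps line_homotopy_def
    poly_primitive_add poly_primitive_scale poly_eval_scale_map poly_eval_minus poly_eval_add)

lemma linear_line_scale: "linear_between (gscale L) (gcomp L i)
    (gscale (forms_dgla L)) (gcomp (forms_dgla L) i) line_scale"
  by (auto intro!: linear_betweenI poly_eqI_eval simp: forms_dgla_simps line_scale_def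
    poly_eval_monom poly_eval_add poly_eval_scale_map scale_right_distrib mult.commute)

lemma linear_form_part0: "linear_between (gscale (forms_dgla L)) (gcomp (forms_dgla L) i)
    (gscale (forms_dgla L)) (gcomp (forms_dgla L) i) form_part0"
  by (auto intro!: linear_betweenI simp: forms_dgla_simps form_part0_def)

lemma linear_form_dt_deriv: "linear_between (gscale (forms_dgla L)) (gcomp (forms_dgla L) (i - 1))
    (gscale (forms_dgla L)) (gcomp (forms_dgla L) i) form_dt_deriv"
  by (auto intro!: linear_betweenI poly_eqI_eval simp: forms_dgla_simps form_dt_deriv_def poly_deriv_add
    poly_deriv_scale poly_eval_minus poly_eval_scale_map)

lemma linear_forms_integral: "linear_between (gscale (forms_dgla L)) (gcomp (forms_dgla L) i)
    (gscale L) (gcomp L (i - 1)) (forms_integral (gscale L) 0 1)"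
  by (auto intro!: linear_betweenI simp: forms_dgla_simps forms_integral_def poly_integral_eq
    poly_primitive_add poly_primitive_scale poly_eval_scale_map poly_eval_add)

lemma line_homotopy_diff: "x \<in> gcomp (forms_dgla L) i \<Longrightarrow>
    line_homotopy (diff (forms_dgla L) (i - 1) (line_homotopy x)) = - line_homotopy x"
  by (cases x) (auto simp: forms_dgla_simps line_homotopy_def poly_deriv_primitive poly_deriv_minus poly_primitive_minus)

lemma forms_eval_line_homotopy: "forms_eval (gscale L) 0 (line_homotopy x) = 0"
  by (cases x) (simp add: forms_eval_def line_homotopy_def poly_eval_minus poly_eval_primitive_at_0)

lemma forms_eval_line_scale:
  "forms_eval (gscale L) 0 (line_scale v) = 0" "forms_eval (gscale L) 1 (line_scale v) = v"
  by (simp_all add: forms_eval_def line_scale_def poly_eval_monom)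

lemma forms_eval_const: "forms_eval (gscale L) a ([:v:], 0) = v"
  by (simp add: forms_eval_def poly_eval_const)

text \<open>The \<open>dt\<close>-part of a form is a linear function of its
  \<open>line_homotopy\<close>. As an identity of linear maps this survives tensoring, where it
  shows that elements killed by the homotopy have no \<open>dt\<close>-part.\<close>

lemma form_decomposition: "form_part0 x + form_dt_deriv (line_homotopy x) = x"
  by (cases x) (simp add: form_part0_def form_dt_deriv_def line_homotopy_def poly_deriv_minus
    poly_deriv_primitive)

text \<open>The theorem of Stokes on the segment from 0 to 1. The differential of the integral
  enters with a plus sign because the differential of forms carries \<open>- d\<close> on the
  \<open>dt\<close>-part.\<close>

lemma forms_stokes:
  assumes "x \<in> gcomp (forms_dgla L) i"
  shows "forms_eval (gscale L) 1 x - forms_eval (gscale L) 0 x =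
    forms_integral (gscale L) 0 1 (diff (forms_dgla L) i x) + diff L (i - 1) (forms_integral (gscale L) 0 1 x)"
proof -
  obtain p q where x: "x = (p, q)" "p \<in> pcoeffs (gcomp L i)" "q \<in> pcoeffs (gcomp L (i - 1))"
    using assms by (cases x) (auto simp: forms_dgla_simps)
  have "poly_primitive (gscale L) (map_poly (diff L (i - 1)) q) = map_poly (diff L (i - 1)) (poly_primitive (gscale L) q)"
    by (rule poly_primitive_map_linear[OF linear_diff vector_space_axioms x(3)])
  with x(2,3) show ?thesis
    by (simp add: x(1) forms_dgla_simps forms_eval_def forms_integral_def poly_integral_eq
      poly_primitive_diff poly_primitive_deriv poly_eval_diff poly_eval_const poly_eval_at_0
      poly_eval_diff_map)
qed

lemma forms_integral_part0_brkt:
  assumes "x \<in> gcomp (forms_dgla L) i" "y \<in> gcomp (forms_dgla L) j"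
  shows "forms_integral (gscale L) 0 1 (brkt (forms_dgla L) i j (form_part0 x) (form_part0 y)) = 0"
proof -
  have z: "poly_conv (brkt L i k) p 0 = 0" "poly_conv (brkt L k i) 0 p = 0"
    if "p \<in> pcoeffs (gcomp L i)" for i k p
    using that by (auto intro!: poly_eqI_eval simp: poly_eval_brkt brkt_left brkt_right)
  show ?thesis
    using assms by (cases x; cases y)
      (auto simp: forms_dgla_simps form_part0_def forms_integral_def z poly_integral_eq)
qed

text \<open>The integral is recovered from the value of the primitive at 1, so it vanishes on
  elements killed by the homotopy, also after tensoring.\<close>

lemma forms_integral_line_homotopy:
  "forms_integral (gscale L) 0 1 x = - forms_eval (gscale L) 1 (line_homotopy x)"
  by (cases x) (simp add: forms_integral_def forms_eval_def line_homotopy_def poly_integral_eq poly_eval_minus)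

end

section \<open>Local Artinian algebras\<close>

primrec max_ideal_power :: "('a, 'b) ring_scheme \<Rightarrow> nat \<Rightarrow> 'a set" where
  "max_ideal_power A 0 = carrier A"
| "max_ideal_power A (Suc k) = max_ideal A \<cdot>\<^bsub>A\<^esub> max_ideal_power A k"

locale art_algebra =
  fixes A :: "'a calgebra" (structure)
  assumes A_Art: "A \<in> Art"
begin

lemma algebra_A: "algebra complex_field A"
  using A_Art by (simp add: Art_def)

sublocale cring A
  using algebra_A by (rule algebra.M_cring)

lemma smult:
  "x \<in> carrier A \<Longrightarrow> c \<odot> x \<in> carrier A"
  "x \<in> carrier A \<Longrightarrow> (c + d) \<odot> x = c \<odot> x \<oplus> d \<odot> x"
  "x \<in> carrier A \<Longrightarrow> y \<in> carrier A \<Longrightarrow> c \<odot> (x \<oplus> y) = c \<odot> x \<oplus> c \<odot> y"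
  "x \<in> carrier A \<Longrightarrow> (c * d) \<odot> x = c \<odot> (d \<odot> x)"
  "x \<in> carrier A \<Longrightarrow> 1 \<odot> x = x"
  "x \<in> carrier A \<Longrightarrow> y \<in> carrier A \<Longrightarrow> (c \<odot> x) \<otimes> y = c \<odot> (x \<otimes> y)"
  "x \<in> carrier A \<Longrightarrow> 0 \<odot> x = \<zero>"
proof -
  interpret algebra complex_field A by (rule algebra_A)
  have [simp]: "carrier complex_field = UNIV" by (simp add: complex_field_def)
  show "x \<in> carrier A \<Longrightarrow> c \<odot> x \<in> carrier A"
    and "x \<in> carrier A \<Longrightarrow> y \<in> carrier A \<Longrightarrow> c \<odot> (x \<oplus> y) = c \<odot> x \<oplus> c \<odot> y"
    and "x \<in> carrier A \<Longrightarrow> y \<in> carrier A \<Longrightarrow> (c \<odot> x) \<otimes> y = c \<odot> (x \<otimes> y)"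
    by (simp_all add: smult_r_distr smult_assoc2)
  show "x \<in> carrier A \<Longrightarrow> (c + d) \<odot> x = c \<odot> x \<oplus> d \<odot> x"
    and "x \<in> carrier A \<Longrightarrow> (c * d) \<odot> x = c \<odot> (d \<odot> x)"
    and "x \<in> carrier A \<Longrightarrow> 1 \<odot> x = x"
    and "x \<in> carrier A \<Longrightarrow> 0 \<odot> x = \<zero>"
    using smult_l_distr[of c d x] smult_assoc1[of c d x] smult_one[of x] smult_l_null[of x]
    by (simp_all add: complex_field_def)
qed

lemma maximalideal_max_ideal: "maximalideal (max_ideal A) A"
  and maximalideal_unique: "maximalideal I A \<Longrightarrow> I = max_ideal A"
proof -
  have ex1: "\<exists>!I. maximalideal I A"
    using A_Art by (simp add: Art_def local_ring_def)
  show m: "maximalideal (max_ideal A) A"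
    unfolding max_ideal_def by (rule theI'[OF ex1])
  show "maximalideal I A \<Longrightarrow> I = max_ideal A"
    using ex1 m by auto
qed

sublocale m: maximalideal "max_ideal A" A
  by (rule maximalideal_max_ideal)

abbreviation "\<mm> \<equiv> max_ideal A"

lemma in_carrier [simp]: "a \<in> \<mm> \<Longrightarrow> a \<in> carrier A"
  by (rule m.Icarr)

text \<open>Ideals are closed under scalars because scaling is multiplication by the element
  \<open>c \<odot> \<one>\<close>.\<close>

lemma ideal_smult: "ideal I A \<Longrightarrow> a \<in> I \<Longrightarrow> c \<odot> a \<in> I"
proof -
  assume I: "ideal I A" and a: "a \<in> I"
  then have "a \<in> carrier A" by (rule ideal.Icarr)
  then have "c \<odot> a = (c \<odot> \<one>) \<otimes> a" by (simp add: smult)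
  with ideal.I_l_closed[OF I a, of "c \<odot> \<one>"] show ?thesis by (simp add: smult)
qed

lemma m_closed [simp, intro]:
  "\<zero> \<in> \<mm>"
  "a \<in> \<mm> \<Longrightarrow> b \<in> \<mm> \<Longrightarrow> a \<oplus> b \<in> \<mm>"
  "a \<in> \<mm> \<Longrightarrow> c \<odot> a \<in> \<mm>"
  "a \<in> \<mm> \<Longrightarrow> b \<in> carrier A \<Longrightarrow> a \<otimes> b \<in> \<mm>"
  "a \<in> \<mm> \<Longrightarrow> b \<in> carrier A \<Longrightarrow> b \<otimes> a \<in> \<mm>"
  by (auto intro: ideal_smult m.is_ideal m.I_r_closed m.I_l_closed)

lemma ideal_max_ideal_power: "ideal (max_ideal_power A k) A"
  by (induction k) (auto intro: oneideal ideal_prod_is_ideal m.is_ideal)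

lemma max_ideal_power_1: "max_ideal_power A 1 = \<mm>"
  using ideal_prod_one[OF m.is_ideal] by simp

lemma max_ideal_power_Suc_subset: "max_ideal_power A (Suc k) \<subseteq> max_ideal_power A k"
  using ideal_prod_inter[OF m.is_ideal ideal_max_ideal_power] by auto

lemma max_ideal_power_subset: "j \<le> k \<Longrightarrow> max_ideal_power A k \<subseteq> max_ideal_power A j"
  using lift_Suc_antimono_le[of "max_ideal_power A"] max_ideal_power_Suc_subset by blast

lemma max_ideal_power_mult:
  "a \<in> max_ideal_power A j \<Longrightarrow> b \<in> max_ideal_power A k \<Longrightarrow> a \<otimes> b \<in> max_ideal_power A (j + k)"
proof (induction j arbitrary: a)
  case 0
  then show ?case by (simp add: ideal.I_l_closed[OF ideal_max_ideal_power])
next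
  case (Suc j)
  have b: "b \<in> carrier A" using Suc.prems(2) ideal.Icarr[OF ideal_max_ideal_power] by blast
  have "a \<in> \<mm> \<cdot>\<^bsub>A\<^esub> max_ideal_power A j" using Suc.prems(1) by simp
  then have "a \<in> carrier A \<and> a \<otimes> b \<in> \<mm> \<cdot>\<^bsub>A\<^esub> max_ideal_power A (j + k)"
  proof (induction rule: ideal_prod.induct)
    case (prod i x)
    then have "x \<in> carrier A" using ideal.Icarr[OF ideal_max_ideal_power] by blast
    with prod b show ?case
      using ideal_prod.prod[of i \<mm> "x \<otimes> b" "max_ideal_power A (j + k)" A] Suc.IH[OF prod(2) Suc.prems(2)]
      by (simp add: m_assoc)
  next
    case (sum x y)
    then show ?case using b by (auto simp: l_distr intro: ideal_prod.sum)
  qed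
  then show ?case by simp
qed

text \<open>If no ideal inside I with property P were minimal, dependent choice would give a
  strictly descending chain, contrary to \<open>artinian\<close>.\<close>

lemma minimal_ideal_exists:
  assumes "ideal I A" "P I"
  obtains J where "ideal J A" "J \<subseteq> I" "P J" "\<And>J'. ideal J' A \<Longrightarrow> J' \<subseteq> J \<Longrightarrow> P J' \<Longrightarrow> J' = J"
proof (rule ccontr)
  assume no: "\<not> thesis"
  have "\<exists>f. \<forall>n. (ideal (f n) A \<and> f n \<subseteq> I \<and> P (f n)) \<and> f (Suc n) \<subset> f n"
  proof (rule dependent_nat_choice)
    show "\<exists>x. ideal x A \<and> x \<subseteq> I \<and> P x" using assms by blast
    fix J assume J: "ideal J A \<and> J \<subseteq> I \<and> P J"
    with no that have "\<exists>J'. ideal J' A \<and> J' \<subseteq> J \<and> P J' \<and> J' \<noteq> J" by blast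
    with J show "\<exists>y. (ideal y A \<and> y \<subseteq> I \<and> P y) \<and> y \<subset> J" by blast
  qed
  then obtain f where f: "\<And>n. ideal (f n) A" "\<And>n. f (Suc n) \<subset> f n" by blast
  moreover have "artinian A" using A_Art by (simp add: Art_def)
  ultimately obtain n where "\<forall>k\<ge>n. f k = f n" unfolding artinian_def by blast
  then have "f (Suc n) = f n" by (metis le_SucI order_refl)
  with f(2)[of n] show False by simp
qed

text \<open>The annihilator of a generator of a minimal ideal is maximal, hence equal to \<open>\<mm>\<close>.\<close>

lemma eq_zero_of_fixed_by_max_ideal:
  assumes x: "x \<in> carrier A" and y: "y \<in> \<mm>" and xy: "x = x \<otimes> y"
  shows "x = \<zero>"
proof (rule ccontr)
  assume "x \<noteq> \<zero>"
  have Ix: "ideal (PIdl x) A" by (rule cgenideal_ideal[OF x])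
  have "PIdl x \<noteq> {\<zero>}" using cgenideal_self[OF x] \<open>x \<noteq> \<zero>\<close> by auto
  from minimal_ideal_exists[OF Ix, where P = "\<lambda>I. I \<noteq> {\<zero>}", OF this]
  obtain J where J: "ideal J A" "J \<subseteq> PIdl x" "J \<noteq> {\<zero>}"
    and min: "\<And>J'. ideal J' A \<Longrightarrow> J' \<subseteq> J \<Longrightarrow> J' \<noteq> {\<zero>} \<Longrightarrow> J' = J" by blast
  interpret J: ideal J A by (rule J(1))
  from J(3) obtain w where w: "w \<in> J" "w \<noteq> \<zero>" using J.zero_closed by blast
  then have wc: "w \<in> carrier A" by simp
  from w(1) J(2) obtain r where r: "r \<in> carrier A" "w = r \<otimes> x" by (auto simp: cgenideal_def)
  \<comment> \<open>As a multiple of x, the generator w is fixed by y as well; y will turn out to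
    annihilate it.\<close>
  have "w \<otimes> y = r \<otimes> (x \<otimes> y)" unfolding r(2) using x y r(1) by (simp only: m_assoc in_carrier)
  then have wy: "w \<otimes> y = w" by (simp only: xy[symmetric] r(2)[symmetric])
  let ?Ann = "{z \<in> carrier A. z \<otimes> w = \<zero>}"
  have Ann: "ideal ?Ann A"
  proof (rule idealI)
    show "ring A" ..
    show "subgroup ?Ann (add_monoid A)"
    proof (rule add.subgroupI)
      show "?Ann \<subseteq> carrier A" by blast
      show "?Ann \<noteq> {}" using wc l_null by blast
      fix a assume "a \<in> ?Ann"
      then show "\<ominus> a \<in> ?Ann"
        using wc by (simp add: l_minus)
      fix b assume "b \<in> ?Ann"
      with \<open>a \<in> ?Ann\<close> show "a \<oplus> b \<in> ?Ann" using wc by (simp add: l_distr)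
    qed
    show "b \<otimes> a \<in> ?Ann" "a \<otimes> b \<in> ?Ann" if "a \<in> ?Ann" "b \<in> carrier A" for a b
    proof -
      from that have a: "a \<in> carrier A" "a \<otimes> w = \<zero>" by auto
      from a that(2) wc have *: "b \<otimes> a \<otimes> w = \<zero>" by (simp add: m_assoc)
      with a that(2) show "b \<otimes> a \<in> ?Ann" by simp
      from * a that(2) show "a \<otimes> b \<in> ?Ann" by (simp add: m_comm)
    qed
  qed
  have "maximalideal ?Ann A"
  proof (rule maximalidealI[OF Ann])
    show "carrier A \<noteq> ?Ann" using w(2) wc by (metis (mono_tags, lifting) l_one mem_Collect_eq one_closed)
    fix K assume K: "ideal K A" "?Ann \<subseteq> K" "K \<subseteq> carrier A"
    interpret K: ideal K A by (rule K(1))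
    show "K = ?Ann \<or> K = carrier A"
    proof (rule disjCI)
      assume "K \<noteq> carrier A"
      show "K = ?Ann"
      proof (rule ccontr)
        assume "K \<noteq> ?Ann"
        with K(2,3) obtain k where k: "k \<in> K" "k \<otimes> w \<noteq> \<zero>" by auto
        then have kc: "k \<in> carrier A" by simp
        have kw: "k \<otimes> w \<in> J" using w(1) kc by (rule J.I_l_closed)
        \<comment> \<open>An element k outside the annihilator sends w to another generator of the
          minimal ideal J. Solving w = r k w puts 1 - r k into the annihilator, hence 1 into
          K.\<close>
        have "PIdl (k \<otimes> w) = J"
        proof (rule min)
          show "ideal (PIdl (k \<otimes> w)) A" using kc wc by (intro cgenideal_ideal) simp
          show "PIdl (k \<otimes> w) \<subseteq> J" using J(1) kw by (rule cgenideal_minimal)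
          show "PIdl (k \<otimes> w) \<noteq> {\<zero>}" using cgenideal_self[of "k \<otimes> w"] k(2) kc wc by auto
        qed
        with w(1) obtain r where r: "r \<in> carrier A" "w = r \<otimes> (k \<otimes> w)" by (auto simp: cgenideal_def)
        have "(\<one> \<ominus> r \<otimes> k) \<otimes> w = w \<ominus> r \<otimes> (k \<otimes> w)"
          using r(1) kc wc by (simp add: minus_eq l_distr l_minus m_assoc)
        also have "\<dots> = \<zero>" using r(2) wc by (metis r_neg minus_eq)
        finally have "\<one> \<ominus> r \<otimes> k \<in> K" using K(2) r(1) kc by auto
        moreover have "r \<otimes> k \<in> K" using k(1) r(1) by (rule K.I_l_closed)
        ultimately have "\<one> \<ominus> r \<otimes> k \<oplus> r \<otimes> k \<in> K" by (rule K.a_closed)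
        moreover have "\<one> \<ominus> r \<otimes> k \<oplus> r \<otimes> k = \<one>"
          using r(1) kc by (simp add: minus_eq a_assoc l_neg)
        ultimately have "K = carrier A" using K.one_imp_carrier by simp
        with \<open>K \<noteq> carrier A\<close> show False by simp
      qed
    qed
  qed
  then have "?Ann = \<mm>" by (rule maximalideal_unique)
  with y have "y \<otimes> w = \<zero>" by blast
  with wy w(2) wc y show False by (simp add: m_comm)
qed

text \<open>The stable power I of the maximal ideal is contained in the product of I with itself. If
  I were nonzero, an ideal minimal among those not killed by I would have the form x I, so that x =
  x y with y in I; this forces x = 0.\<close>

lemma max_ideal_nilpotent: "\<exists>N. max_ideal_power A N = {\<zero>}"
proof -
  have "artinian A" using A_Art by (simp add: Art_def)
  then obtain n0 where n0: "\<And>n. n \<ge> n0 \<Longrightarrow> max_ideal_power A n = max_ideal_power A n0"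
    unfolding artinian_def using ideal_max_ideal_power max_ideal_power_Suc_subset by meson
  \<comment> \<open>The successor makes the exponent positive, so that the stable power lies in the
    maximal ideal.\<close>
  define n where "n = Suc n0"
  define I where "I = max_ideal_power A n"
  have st: "max_ideal_power A k = I" if "k \<ge> n" for k
  proof -
    have "k \<ge> n0" "n \<ge> n0" using that by (auto simp: n_def)
    then show ?thesis unfolding I_def by (metis n0)
  qed
  have I: "ideal I A" unfolding I_def by (rule ideal_max_ideal_power)
  interpret I: ideal I A by (rule I)
  have "1 \<le> n" by (simp add: n_def)
  then have Im: "I \<subseteq> \<mm>" unfolding I_def max_ideal_power_1[symmetric] by (rule max_ideal_power_subset)
  have pow_prod: "max_ideal_power A (j + k) \<subseteq> max_ideal_power A j \<cdot>\<^bsub>A\<^esub> max_ideal_power A k" for j k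
  proof (induction j)
    case 0
    show ?case
    proof
      fix x assume x: "x \<in> max_ideal_power A (0 + k)"
      then have "x \<in> carrier A" using ideal.Icarr[OF ideal_max_ideal_power] by blast
      with ideal_prod.prod[of \<one> "carrier A" x "max_ideal_power A k" A] x
      show "x \<in> max_ideal_power A 0 \<cdot>\<^bsub>A\<^esub> max_ideal_power A k" by simp
    qed
  next
    case (Suc j)
    have "max_ideal_power A (Suc j + k) = \<mm> \<cdot>\<^bsub>A\<^esub> max_ideal_power A (j + k)" by simp
    also have "\<dots> \<subseteq> \<mm> \<cdot>\<^bsub>A\<^esub> (max_ideal_power A j \<cdot>\<^bsub>A\<^esub> max_ideal_power A k)"
    proof
      fix x assume "x \<in> \<mm> \<cdot>\<^bsub>A\<^esub> max_ideal_power A (j + k)"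
      then show "x \<in> \<mm> \<cdot>\<^bsub>A\<^esub> (max_ideal_power A j \<cdot>\<^bsub>A\<^esub> max_ideal_power A k)"
        by induction (use Suc in \<open>auto intro: ideal_prod.intros\<close>)
    qed
    also have "\<dots> = max_ideal_power A (Suc j) \<cdot>\<^bsub>A\<^esub> max_ideal_power A k"
      by (simp add: ideal_prod_assoc[OF m.is_ideal ideal_max_ideal_power ideal_max_ideal_power])
    finally show ?case .
  qed
  have II: "I \<subseteq> I \<cdot>\<^bsub>A\<^esub> I"
    using pow_prod[of n n] unfolding st[of "n + n", simplified] I_def[symmetric] .
  \<comment> \<open>As I lies in I I, an element killing all products of two elements of I kills
    I.\<close>
  have kill: "x \<otimes> z = \<zero>" if x: "x \<in> carrier A" and z: "z \<in> I"
    and *: "\<And>y y'. y \<in> I \<Longrightarrow> y' \<in> I \<Longrightarrow> x \<otimes> (y \<otimes> y') = \<zero>" for x z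
  proof -
    from z II have "z \<in> I \<cdot>\<^bsub>A\<^esub> I" by blast
    then have "z \<in> carrier A \<and> x \<otimes> z = \<zero>"
      by induction (use x * in \<open>auto simp: r_distr\<close>)
    then show ?thesis by simp
  qed
  have "I = {\<zero>}"
  proof (rule ccontr)
    assume "I \<noteq> {\<zero>}"
    then obtain z0 where z0: "z0 \<in> I" "z0 \<noteq> \<zero>" using I.zero_closed by blast
    define P where "P J \<longleftrightarrow> (\<exists>x\<in>J. \<exists>y\<in>I. x \<otimes> y \<noteq> \<zero>)" for J
    have "P I"
    proof (rule ccontr)
      assume "\<not> P I"
      then have "\<one> \<otimes> (y \<otimes> y') = \<zero>" if "y \<in> I" "y' \<in> I" for y y'
        using that I.Icarr by (simp add: P_def)
      from kill[OF one_closed z0(1) this] z0 I.Icarr[OF z0(1)] show False by simp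
    qed
    from minimal_ideal_exists[where P = P, OF I this] obtain J where
      J: "ideal J A" "P J" and min: "\<And>J'. ideal J' A \<Longrightarrow> J' \<subseteq> J \<Longrightarrow> P J' \<Longrightarrow> J' = J" by blast
    interpret J: ideal J A by (rule J(1))
    from J(2) obtain x y0 where x: "x \<in> J" "y0 \<in> I" "x \<otimes> y0 \<noteq> \<zero>" by (auto simp: P_def)
    then have xc: "x \<in> carrier A" by simp
    let ?J = "(\<lambda>y. x \<otimes> y) ` I"
    have J': "ideal ?J A"
    proof (rule idealI)
      show "ring A" ..
      show "subgroup ?J (add_monoid A)"
      proof (rule add.subgroupI)
        show "?J \<subseteq> carrier A" using xc by auto
        show "?J \<noteq> {}" using z0(1) by blast
        fix a assume "a \<in> ?J"
        then obtain y where y: "y \<in> I" "a = x \<otimes> y" by blast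
        then have "\<ominus> a = x \<otimes> (\<ominus> y)" using xc by (simp add: r_minus)
        with y(1) show "\<ominus> a \<in> ?J" by auto
        fix b assume "b \<in> ?J"
        then obtain y' where y': "y' \<in> I" "b = x \<otimes> y'" by blast
        with y xc have "a \<oplus> b = x \<otimes> (y \<oplus> y')" by (simp add: r_distr)
        with y(1) y'(1) show "a \<oplus> b \<in> ?J" by auto
      qed
      fix a b assume "a \<in> ?J" and b: "b \<in> carrier A"
      then obtain y where y: "y \<in> I" "a = x \<otimes> y" by blast
      with b xc have "b \<otimes> a = x \<otimes> (b \<otimes> y)" "a \<otimes> b = x \<otimes> (b \<otimes> y)"
        by (simp_all add: m_ac)
      moreover have "b \<otimes> y \<in> I" using y(1) b by (rule I.I_l_closed)
      ultimately show "b \<otimes> a \<in> ?J" "a \<otimes> b \<in> ?J" by auto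
    qed
    have "P ?J"
    proof (rule ccontr)
      assume "\<not> P ?J"
      then have "x \<otimes> (y \<otimes> y') = \<zero>" if "y \<in> I" "y' \<in> I" for y y'
        using that xc unfolding P_def by (auto simp: m_assoc)
      from kill[OF xc x(2) this] x(3) show False by simp
    qed
    moreover have "?J \<subseteq> J" using x(1) by (auto intro: J.I_r_closed)
    \<comment> \<open>The ideal x I lies in J and is not killed by I, so by minimality it contains x
      itself.\<close>
    ultimately have "?J = J" using min J' by blast
    with x(1) obtain y where y: "y \<in> I" "x = x \<otimes> y" by blast
    then have "x = \<zero>" using eq_zero_of_fixed_by_max_ideal[OF xc, of y] Im by blast
    with x(2,3) show False by simp
  qed
  then show ?thesis unfolding I_def by blast
qed

end

text \<open>Elements of the maximal ideal are nilpotent, so their images are nilpotent too and lie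
  in the prime ideal \<open>max_ideal B\<close>.\<close>

lemma max_ideal_image:
  assumes A: "A \<in> Art" and B: "B \<in> Art" and f: "f \<in> Art_hom A B" and a: "a \<in> max_ideal A"
  shows "f a \<in> max_ideal B"
proof -
  interpret A: art_algebra A by unfold_locales (rule A)
  interpret B: art_algebra B by unfold_locales (rule B)
  have hom: "f \<in> ring_hom A B" using f by (simp add: Art_hom_def)
  interpret f: ring_hom_cring A B f
    by unfold_locales (rule hom)
  obtain N where N: "max_ideal_power A N = {\<zero>\<^bsub>A\<^esub>}" using A.max_ideal_nilpotent by blast
  have "a [^]\<^bsub>A\<^esub> n \<in> max_ideal_power A n" for n :: nat
  proof (induction n)
    case (Suc n)
    have "a [^]\<^bsub>A\<^esub> Suc n = a \<otimes>\<^bsub>A\<^esub> a [^]\<^bsub>A\<^esub> n"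
      using a by (simp add: A.nat_pow_Suc A.m_comm)
    with Suc a show ?case by (auto intro: ideal_prod.prod)
  qed (use a in simp)
  with N have "a [^]\<^bsub>A\<^esub> N = \<zero>\<^bsub>A\<^esub>" by blast
  moreover have "f (a [^]\<^bsub>A\<^esub> n) = f a [^]\<^bsub>B\<^esub> n" for n :: nat
    by (induction n) (use a in simp_all)
  ultimately have "f a [^]\<^bsub>B\<^esub> N = \<zero>\<^bsub>B\<^esub>" by (metis f.hom_zero)
  then have "f a [^]\<^bsub>B\<^esub> N \<in> max_ideal B" by simp
  moreover have "primeideal (max_ideal B) B"
    by (rule B.maximalideal_prime[OF B.maximalideal_max_ideal])
  ultimately show ?thesis
  proof (induction N)
    case 0
    then have "\<one>\<^bsub>B\<^esub> \<in> max_ideal B" by simp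
    then show ?case using B.m.one_imp_carrier B.m.I_notcarr by simp
  next
    case (Suc N)
    have "f a \<in> carrier B" using a by simp
    with Suc.prems Suc.IH show ?case
      using primeideal.I_prime[OF Suc.prems(2), of "f a [^]\<^bsub>B\<^esub> N" "f a"] by auto
  qed
qed

section \<open>Tensor products with the maximal ideal as bilinear evaluations\<close>

text \<open>
  The class of a formal sum is determined by its values on all bilinear forms. Elements of the
  tensor product are therefore represented by functionals on the set of bilinear forms, extended by
  zero, which makes them elements of a type with an abelian group structure.
\<close>

type_synonym ('v, 'a) tensor = "('v \<times> 'a \<Rightarrow> complex) \<Rightarrow> complex"

definition bilin ::
  "(complex \<Rightarrow> 'v::ab_group_add \<Rightarrow> 'v) \<Rightarrow> 'v set \<Rightarrow> 'a calgebra \<Rightarrow> ('v \<times> 'a \<Rightarrow> complex) \<Rightarrow> bool" where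
  "bilin s V A \<phi> \<longleftrightarrow>
     (\<forall>v\<in>V. \<forall>w\<in>V. \<forall>a\<in>max_ideal A. \<phi> (v + w, a) = \<phi> (v, a) + \<phi> (w, a)) \<and>
     (\<forall>v\<in>V. \<forall>a\<in>max_ideal A. \<forall>b\<in>max_ideal A. \<phi> (v, a \<oplus>\<^bsub>A\<^esub> b) = \<phi> (v, a) + \<phi> (v, b)) \<and>
     (\<forall>c. \<forall>v\<in>V. \<forall>a\<in>max_ideal A. \<phi> (s c v, a) = c * \<phi> (v, a) \<and> \<phi> (v, c \<odot>\<^bsub>A\<^esub> a) = c * \<phi> (v, a))"

lemma bilinD:
  assumes "bilin s V A \<phi>"
  shows "v \<in> V \<Longrightarrow> w \<in> V \<Longrightarrow> a \<in> max_ideal A \<Longrightarrow> \<phi> (v + w, a) = \<phi> (v, a) + \<phi> (w, a)"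
    and "v \<in> V \<Longrightarrow> a \<in> max_ideal A \<Longrightarrow> b \<in> max_ideal A \<Longrightarrow> \<phi> (v, a \<oplus>\<^bsub>A\<^esub> b) = \<phi> (v, a) + \<phi> (v, b)"
    and "v \<in> V \<Longrightarrow> a \<in> max_ideal A \<Longrightarrow> \<phi> (s c v, a) = c * \<phi> (v, a)"
    and "v \<in> V \<Longrightarrow> a \<in> max_ideal A \<Longrightarrow> \<phi> (v, c \<odot>\<^bsub>A\<^esub> a) = c * \<phi> (v, a)"
  using assms unfolding bilin_def by blast+

definition tsum ::
  "(complex \<Rightarrow> 'v::ab_group_add \<Rightarrow> 'v) \<Rightarrow> 'v set \<Rightarrow> 'a calgebra \<Rightarrow> ('v, 'a) fsum \<Rightarrow> ('v, 'a) tensor" where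
  "tsum s V A x = (\<lambda>\<phi>. if bilin s V A \<phi> then sum_list (map \<phi> x) else 0)"

definition tlift ::
  "(complex \<Rightarrow> 'w::ab_group_add \<Rightarrow> 'w) \<Rightarrow> 'w set \<Rightarrow> 'a calgebra \<Rightarrow> ('v \<Rightarrow> 'w) \<Rightarrow>
   ('v, 'a) tensor \<Rightarrow> ('w, 'a) tensor" where
  "tlift s W A f X = (\<lambda>\<phi>. if bilin s W A \<phi> then X (\<lambda>p. \<phi> (f (fst p), snd p)) else 0)"

text \<open>The product of two functionals, contracted with \<open>b\<close> and with the
  multiplication of \<open>A\<close>: X is applied to the function whose value at p is Y applied to
  the form with p held fixed.\<close>

definition tlift2 ::
  "(complex \<Rightarrow> 'w::ab_group_add \<Rightarrow> 'w) \<Rightarrow> 'w set \<Rightarrow> 'a calgebra \<Rightarrow> ('u \<Rightarrow> 'v \<Rightarrow> 'w) \<Rightarrow>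
   ('u, 'a) tensor \<Rightarrow> ('v, 'a) tensor \<Rightarrow> ('w, 'a) tensor" where
  "tlift2 s W A b X Y = (\<lambda>\<phi>. if bilin s W A \<phi>
     then X (\<lambda>p. Y (\<lambda>q. \<phi> (b (fst p) (fst q), snd p \<otimes>\<^bsub>A\<^esub> snd q))) else 0)"

definition tmap2 ::
  "('u \<Rightarrow> 'v \<Rightarrow> 'w) \<Rightarrow> 'a calgebra \<Rightarrow> ('u, 'a) fsum \<Rightarrow> ('v, 'a) fsum \<Rightarrow> ('w, 'a) fsum" where
  "tmap2 b A x y = concat (map (\<lambda>p. map (\<lambda>q. (b (fst p) (fst q), snd p \<otimes>\<^bsub>A\<^esub> snd q)) y) x)"

lemma tbrkt_eq_tmap2: "tbrkt L A i j x y = tmap2 (brkt L i j) A x y"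
  by (simp add: tbrkt_def tmap2_def case_prod_beta' map_concat comp_def)

definition tscale :: "complex \<Rightarrow> ('v, 'a) tensor \<Rightarrow> ('v, 'a) tensor" where
  "tscale c X = (\<lambda>\<phi>. c * X \<phi>)"

lemma tscale_apply [simp]: "tscale c X \<phi> = c * X \<phi>"
  by (simp add: tscale_def)

lemma vector_space_tscale: "vector_space tscale"
  by unfold_locales (auto simp: tscale_def algebra_simps)

lemma tsum_Nil [simp]: "tsum s V A [] = 0"
  by (rule ext) (simp add: tsum_def)

lemma tsum_append [simp]: "tsum s V A (x @ y) = tsum s V A x + tsum s V A y"
  by (rule ext) (simp add: tsum_def)

lemma tmap_simps [simp]:
  "tmap f [] = []" "tmap f ((v, a) # x) = (f v, a) # tmap f x" "tmap f (x @ y) = tmap f x @ tmap f y"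
  "tmap f (tmap g z) = tmap (\<lambda>v. f (g v)) z"
  by (simp_all add: tmap_def case_prod_beta')

lemma tmap_in: "x \<in> lists (V \<times> S) \<Longrightarrow> (\<And>v. v \<in> V \<Longrightarrow> f v \<in> W) \<Longrightarrow> tmap f x \<in> lists (W \<times> S)"
  by (fastforce simp: tmap_def)

lemma tmap_cong: "x \<in> lists (V \<times> S) \<Longrightarrow> (\<And>v. v \<in> V \<Longrightarrow> f v = g v) \<Longrightarrow> tmap f x = tmap g x"
  by (auto simp: tmap_def)

lemma tlift_additive:
  "tlift s W A f (X + Y) = tlift s W A f X + tlift s W A f Y"
  "tlift s W A f (X - Y) = tlift s W A f X - tlift s W A f Y"
  "tlift s W A f (tscale c X) = tscale c (tlift s W A f X)"
  "tlift s W A f 0 = 0"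
  by (auto simp: tlift_def fun_eq_iff)

context art_algebra
begin

lemma teq_lists:
  assumes "csub s V"
  shows "tensor_eq s V A x y \<Longrightarrow> x \<in> lists (V \<times> \<mm>) \<and> y \<in> lists (V \<times> \<mm>)"
proof (induction rule: tensor_eq.induct)
qed (use assms in \<open>auto simp: csub.zero_in csub.add_in csub.scale_in\<close>)

text \<open>The generators of the congruence swap two blocks; moving the wanted entry to the front
  and recursing yields every permutation.\<close>

lemma teq_mset:
  "mset x = mset y \<Longrightarrow> x \<in> lists (V \<times> \<mm>) \<Longrightarrow> tensor_eq s V A x y"
proof (induction x arbitrary: y)
  case Nil
  then show ?case by (auto intro: tensor_eq.refl)
next
  case (Cons p x)
  then have "p \<in> set y" by (metis list.set_intros(1) set_mset_mset)
  then obtain y1 y2 where y: "y = y1 @ p # y2" by (meson split_list)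
  with Cons.prems(1) have m: "mset x = mset (y1 @ y2)" by simp
  have "set y = set (p # x)" using Cons.prems(1) by (metis set_mset_mset)
  then have yl: "y \<in> lists (V \<times> \<mm>)" using Cons.prems(2) by (auto simp: in_lists_conv_set)
  have "tensor_eq s V A ([p] @ x) ([p] @ (y1 @ y2))"
    by (rule tensor_eq.append) (use Cons m in \<open>auto intro: tensor_eq.refl\<close>)
  moreover have "tensor_eq s V A (([p] @ y1) @ y2) ((y1 @ [p]) @ y2)"
    by (rule tensor_eq.append) (use yl y in \<open>auto intro: tensor_eq.refl tensor_eq.comm simp del: append.simps\<close>)
  ultimately show ?case using tensor_eq.trans unfolding y by fastforce
qed

lemma teq_tmap:
  assumes V: "csub s V" and W: "csub s' W" and f: "linear_between s V s' W f"
  shows "tensor_eq s V A x y \<Longrightarrow> tensor_eq s' W A (tmap f x) (tmap f y)"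
proof (induction rule: tensor_eq.induct)
  case (refl x)
  then show ?case by (intro tensor_eq.refl tmap_in[where V = V]) (auto simp: linear_betweenD(1)[OF f])
next
  case (comm x y)
  then show ?case unfolding tmap_simps
    by (intro tensor_eq.comm tmap_in[where V = V]) (auto simp: linear_betweenD(1)[OF f])
qed (auto intro: tensor_eq.intros simp: linear_betweenD[OF f] csub.linear_between_0[OF V f])

text \<open>Formal sums are only a monoid under concatenation; scaling by -1 supplies the inverses
  modulo the congruence.\<close>

lemma teq_neg:
  assumes "csub s V" "x \<in> lists (V \<times> \<mm>)"
  shows "tensor_eq s V A (tmap (s (- 1)) x @ x) []"
  using assms(2)
proof (induction x)
  case Nil
  then show ?case by (auto intro: tensor_eq.refl)
next
  case (Cons p x)
  interpret csub s V by fact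
  obtain v a where p: "p = (v, a)" by (cases p)
  with Cons.hyps have va: "v \<in> V" "a \<in> \<mm>" by auto
  have xl: "x \<in> lists (V \<times> \<mm>)" by fact
  have sl: "tmap (s (- 1)) x \<in> lists (V \<times> \<mm>)" by (rule tmap_in[OF xl]) (rule scale_in)
  have "tensor_eq s V A (tmap (s (- 1)) (p # x) @ p # x) ([(s (- 1) v, a), (v, a)] @ (tmap (s (- 1)) x @ x))"
    by (rule teq_mset) (use va sl xl in \<open>auto simp: p\<close>)
  moreover have "tensor_eq s V A ([(s (- 1) v, a), (v, a)] @ (tmap (s (- 1)) x @ x)) ([] @ [])"
  proof (rule tensor_eq.append)
    have "tensor_eq s V A [(s (- 1) v + v, a)] [(s (- 1) v, a), (v, a)]"
      using va by (intro tensor_eq.add_left scale_in)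
    moreover have "s (- 1) v + v = 0" by simp
    ultimately show "tensor_eq s V A [(s (- 1) v, a), (v, a)] []"
      using tensor_eq.zero[OF va(2)] by (metis tensor_eq.sym tensor_eq.trans)
    show "tensor_eq s V A (tmap (s (- 1)) x @ x) []" by (rule Cons.IH)
  qed
  ultimately show ?case by (metis append_Nil tensor_eq.trans)
qed

section \<open>Bilinear forms separate the classes of formal sums\<close>

lemma tsum_eq_of_teq:
  assumes "csub s V" "tensor_eq s V A x y"
  shows "tsum s V A x = tsum s V A y"
proof
  fix \<phi>
  interpret csub s V by fact
  have "bilin s V A \<phi> \<Longrightarrow> sum_list (map \<phi> x) = sum_list (map \<phi> y)"
    using assms(2)
  proof (induction rule: tensor_eq.induct)
    case (zero a)
    then show ?case using bilinD(1)[of s V A \<phi> 0 0 a] by simp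
  qed (auto simp: bilinD)
  then show "tsum s V A x \<phi> = tsum s V A y \<phi>" by (simp add: tsum_def)
qed

text \<open>Encodes a function u on pairs, supported in the list l, as a formal sum by absorbing
  each weight into the vector. Together with \<open>delta_sum\<close>, the multiplicities of a
  formal sum, it embeds the problem into a complex vector space, where linear functionals are
  available.\<close>

definition weighted_sum :: "(complex \<Rightarrow> 'v \<Rightarrow> 'v) \<Rightarrow> ('v \<times> 'a \<Rightarrow> complex) \<Rightarrow> ('v \<times> 'a) list \<Rightarrow> ('v, 'a) fsum" where
  "weighted_sum s u l = map (\<lambda>p. (s (u p) (fst p), snd p)) l"

definition delta_sum :: "('v, 'a) fsum \<Rightarrow> 'v \<times> 'a \<Rightarrow> complex" where
  "delta_sum x p = of_nat (count_list x p)"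

lemma delta_sum_simps: "delta_sum [] = 0" "delta_sum (p # x) = delta_sum [p] + delta_sum x"
  by (auto simp: delta_sum_def fun_eq_iff)

lemma weighted_sum_in:
  "csub s V \<Longrightarrow> set l \<subseteq> V \<times> \<mm> \<Longrightarrow> weighted_sum s u l \<in> lists (V \<times> \<mm>)"
  by (force simp: weighted_sum_def in_lists_conv_set csub.scale_in)

lemma weighted_sum_add:
  assumes V: "csub s V"
  shows "set l \<subseteq> V \<times> \<mm> \<Longrightarrow>
    tensor_eq s V A (weighted_sum s (u + w) l) (weighted_sum s u l @ weighted_sum s w l)"
proof (induction l)
  case Nil
  then show ?case by (auto simp: weighted_sum_def intro: tensor_eq.refl)
next
  case (Cons p l)
  interpret csub s V by fact
  obtain v a where p: "p = (v, a)" by (cases p)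
  with Cons.prems have va: "v \<in> V" "a \<in> \<mm>" by auto
  have "tensor_eq s V A ([(s (u p) v + s (w p) v, a)] @ weighted_sum s (u + w) l)
      ([(s (u p) v, a), (s (w p) v, a)] @ weighted_sum s u l @ weighted_sum s w l)"
  proof (rule tensor_eq.append)
    show "tensor_eq s V A [(s (u p) v + s (w p) v, a)] [(s (u p) v, a), (s (w p) v, a)]"
      using va by (intro tensor_eq.add_left scale_in)
    show "tensor_eq s V A (weighted_sum s (u + w) l) (weighted_sum s u l @ weighted_sum s w l)"
      by (rule Cons.IH) (use Cons.prems in auto)
  qed
  moreover have "tensor_eq s V A ([(s (u p) v, a), (s (w p) v, a)] @ weighted_sum s u l @ weighted_sum s w l)
      (weighted_sum s u (p # l) @ weighted_sum s w (p # l))"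
    using va Cons.prems weighted_sum_in[OF V, of l]
    by (intro teq_mset) (auto simp: weighted_sum_def p)
  moreover have "weighted_sum s (u + w) (p # l) = [(s (u p) v + s (w p) v, a)] @ weighted_sum s (u + w) l"
    by (simp add: weighted_sum_def p scale_left_distrib)
  ultimately show ?case by (metis tensor_eq.trans)
qed

lemma weighted_sum_scale:
  "csub s V \<Longrightarrow> weighted_sum s (\<lambda>p. c * u p) l = tmap (s c) (weighted_sum s u l)"
proof -
  assume "csub s V"
  then interpret csub s V .
  show ?thesis by (simp add: weighted_sum_def tmap_def)
qed

lemma weighted_sum_drop:
  assumes V: "csub s V"
  shows "set l \<subseteq> V \<times> \<mm> \<Longrightarrow>
    tensor_eq s V A (weighted_sum s u l) (weighted_sum s u (filter (\<lambda>p. u p \<noteq> 0) l))"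
proof (induction l)
  case Nil
  then show ?case by (auto simp: weighted_sum_def intro: tensor_eq.refl)
next
  case (Cons p l)
  interpret csub s V by fact
  obtain v a where p: "p = (v, a)" by (cases p)
  with Cons.prems have va: "v \<in> V" "a \<in> \<mm>" by auto
  have IH: "tensor_eq s V A (weighted_sum s u l) (weighted_sum s u (filter (\<lambda>p. u p \<noteq> 0) l))"
    using Cons by simp
  show ?case
  proof (cases "u p = 0")
    case True
    have "tensor_eq s V A ([(0, a)] @ weighted_sum s u l) ([] @ weighted_sum s u (filter (\<lambda>p. u p \<noteq> 0) l))"
      by (rule tensor_eq.append[OF tensor_eq.zero[OF va(2)] IH])
    with True show ?thesis by (simp add: weighted_sum_def p)
  next
    case False
    have "tensor_eq s V A ([(s (u p) v, a)] @ weighted_sum s u l)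
        ([(s (u p) v, a)] @ weighted_sum s u (filter (\<lambda>p. u p \<noteq> 0) l))"
      using va by (intro tensor_eq.append[OF tensor_eq.refl IH]) auto
    with False show ?thesis by (simp add: weighted_sum_def p)
  qed
qed

text \<open>Once the entries of weight zero are removed, both lists enumerate the support of u and
  are permutations of each other.\<close>

lemma weighted_sum_indep:
  assumes V: "csub s V" and l: "set l \<subseteq> V \<times> \<mm>" "distinct l" and k: "set k \<subseteq> V \<times> \<mm>" "distinct k"
    and u: "\<And>p. p \<notin> set l \<Longrightarrow> u p = 0" "\<And>p. p \<notin> set k \<Longrightarrow> u p = 0"
  shows "tensor_eq s V A (weighted_sum s u l) (weighted_sum s u k)"
proof -
  have "set (filter (\<lambda>p. u p \<noteq> 0) l) = set (filter (\<lambda>p. u p \<noteq> 0) k)"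
    using u by auto
  then have "mset (filter (\<lambda>p. u p \<noteq> 0) l) = mset (filter (\<lambda>p. u p \<noteq> 0) k)"
    using l(2) k(2) by (metis distinct_filter set_eq_iff_mset_eq_distinct)
  then have "mset (weighted_sum s u (filter (\<lambda>p. u p \<noteq> 0) l)) =
      mset (weighted_sum s u (filter (\<lambda>p. u p \<noteq> 0) k))"
    by (simp add: weighted_sum_def)
  moreover have "weighted_sum s u (filter (\<lambda>p. u p \<noteq> 0) l) \<in> lists (V \<times> \<mm>)"
    using l(1) by (intro weighted_sum_in[OF V]) auto
  ultimately have "tensor_eq s V A (weighted_sum s u (filter (\<lambda>p. u p \<noteq> 0) l))
      (weighted_sum s u (filter (\<lambda>p. u p \<noteq> 0) k))" by (rule teq_mset)
  with weighted_sum_drop[OF V l(1), of u] weighted_sum_drop[OF V k(1), of u] show ?thesis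
    by (metis tensor_eq.sym tensor_eq.trans)
qed

lemma weighted_sum_delta:
  assumes V: "csub s V" and l: "set l \<subseteq> V \<times> \<mm>" "distinct l"
  shows "set x \<subseteq> set l \<Longrightarrow> tensor_eq s V A (weighted_sum s (delta_sum x) l) x"
proof (induction x)
  case Nil
  show ?case using weighted_sum_drop[OF V l(1), of "delta_sum []"]
    by (simp add: delta_sum_simps weighted_sum_def)
next
  case (Cons p x)
  interpret csub s V by fact
  obtain v a where p: "p = (v, a)" by (cases p)
  have pin: "p \<in> V \<times> \<mm>" using Cons.prems l(1) by auto
  have "tensor_eq s V A (weighted_sum s (delta_sum [p]) l) (weighted_sum s (delta_sum [p]) [p])"
    by (rule weighted_sum_indep[OF V l]) (use pin Cons.prems in \<open>auto simp: delta_sum_def\<close>)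
  moreover have "weighted_sum s (delta_sum [p]) [p] = [p]"
    by (simp add: weighted_sum_def delta_sum_def p)
  ultimately have "tensor_eq s V A (weighted_sum s (delta_sum [p]) l @ weighted_sum s (delta_sum x) l) ([p] @ x)"
    using Cons by (intro tensor_eq.append) auto
  with weighted_sum_add[OF V l(1), of "delta_sum [p]" "delta_sum x"] show ?case
    unfolding delta_sum_simps(2)[of p x] by (metis append_Cons append_Nil tensor_eq.trans)
qed

text \<open>If x and y were not congruent, some linear functional would vanish on all relations but
  not on their difference. Its values on single pairs form a bilinear form on which x and y
  differ.\<close>

lemma teq_of_tsum_eq:
  assumes V: "csub s V" and x: "x \<in> lists (V \<times> \<mm>)" and y: "y \<in> lists (V \<times> \<mm>)"
    and eq: "tsum s V A x = tsum s V A y"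
  shows "tensor_eq s V A x y"
proof (rule ccontr)
  assume neq: "\<not> tensor_eq s V A x y"
  interpret csub s V by fact
  let ?S = "\<lambda>c (u :: 'b \<times> 'a \<Rightarrow> complex) p. c * u p"
  interpret U: vector_space ?S
    by unfold_locales (auto simp: algebra_simps)
  interpret C: vector_space "(*) :: complex \<Rightarrow> complex \<Rightarrow> complex"
    by unfold_locales (auto simp: algebra_simps)
  interpret P: vector_space_pair ?S "(*) :: complex \<Rightarrow> complex \<Rightarrow> complex" ..
  \<comment> \<open>The space of relations: finitely supported functions whose formal sum is
    congruent to the empty one, for some enumeration l containing the support.\<close>
  define R where "R = {u. \<exists>l. set l \<subseteq> V \<times> \<mm> \<and> distinct l \<and> (\<forall>p. p \<notin> set l \<longrightarrow> u p = 0) \<and>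
    tensor_eq s V A (weighted_sum s u l) []}"
  have lin: "linear_between s V s V (s c)" for c
    by (intro linear_betweenI) (auto simp: scale_right_distrib mult.commute)
  have R0: "U.subspace R"
    unfolding U.subspace_def
  proof (intro conjI ballI allI)
    show "0 \<in> R" unfolding R_def by (auto intro!: exI[of _ "[]"] tensor_eq.refl simp: weighted_sum_def)
    fix u w assume "u \<in> R" "w \<in> R"
    then obtain l k where l: "set l \<subseteq> V \<times> \<mm>" "distinct l" "\<forall>p. p \<notin> set l \<longrightarrow> u p = 0"
        "tensor_eq s V A (weighted_sum s u l) []"
      and k: "set k \<subseteq> V \<times> \<mm>" "distinct k" "\<forall>p. p \<notin> set k \<longrightarrow> w p = 0"
        "tensor_eq s V A (weighted_sum s w k) []" unfolding R_def by blast
    let ?L = "remdups (l @ k)"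
    have L: "set ?L \<subseteq> V \<times> \<mm>" using l k by auto
    have "tensor_eq s V A (weighted_sum s u ?L) (weighted_sum s u l)"
      "tensor_eq s V A (weighted_sum s w ?L) (weighted_sum s w k)"
      using l k by (intro weighted_sum_indep[OF V]; auto)+
    then have "tensor_eq s V A (weighted_sum s u ?L @ weighted_sum s w ?L) ([] @ [])"
      using l(4) k(4) by (intro tensor_eq.append) (metis tensor_eq.trans)+
    then have "tensor_eq s V A (weighted_sum s (u + w) ?L) []"
      using weighted_sum_add[OF V L, of u w] by (metis append_Nil tensor_eq.trans)
    then show "u + w \<in> R" using l k L unfolding R_def by (auto intro!: exI[of _ ?L])
  next
    fix c u assume "u \<in> R"
    then obtain l where l: "set l \<subseteq> V \<times> \<mm>" "distinct l" "\<forall>p. p \<notin> set l \<longrightarrow> u p = 0"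
        "tensor_eq s V A (weighted_sum s u l) []" unfolding R_def by blast
    with teq_tmap[OF V V lin l(4), of c] show "(\<lambda>p. c * u p) \<in> R"
      unfolding R_def by (auto intro!: exI[of _ l] simp: weighted_sum_scale[OF V])
  qed
  have diff_in_R: "delta_sum z - delta_sum z' \<in> R \<longleftrightarrow> tensor_eq s V A z z'"
    if z: "z \<in> lists (V \<times> \<mm>)" "z' \<in> lists (V \<times> \<mm>)" for z z'
  proof -
    let ?L = "remdups (z @ z')" and ?u = "delta_sum z + (\<lambda>p. (- 1) * delta_sum z' p)"
    have L: "set ?L \<subseteq> V \<times> \<mm>" using z by auto
    have u: "?u = delta_sum z - delta_sum z'" by (simp add: fun_eq_iff)
    have nz': "tmap (s (- 1)) z' \<in> lists (V \<times> \<mm>)" by (rule tmap_in[OF z(2)]) (rule scale_in)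
    have 1: "tensor_eq s V A (weighted_sum s ?u ?L) (z @ tmap (s (- 1)) z')"
    proof (rule tensor_eq.trans[OF weighted_sum_add[OF V L]], rule tensor_eq.append)
      show "tensor_eq s V A (weighted_sum s (delta_sum z) ?L) z"
        by (rule weighted_sum_delta[OF V L]) auto
      show "tensor_eq s V A (weighted_sum s (\<lambda>p. - 1 * delta_sum z' p) ?L) (tmap (s (- 1)) z')"
        unfolding weighted_sum_scale[OF V]
        by (rule teq_tmap[OF V V lin], rule weighted_sum_delta[OF V L]) auto
    qed
    have supp: "?u p = 0" if "p \<notin> set ?L" for p using that by (simp add: delta_sum_def)
    show ?thesis
    proof
      assume "delta_sum z - delta_sum z' \<in> R"
      then obtain l where l: "set l \<subseteq> V \<times> \<mm>" "distinct l" "\<forall>p. p \<notin> set l \<longrightarrow> ?u p = 0"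
        "tensor_eq s V A (weighted_sum s ?u l) []" unfolding R_def u by blast
      have "tensor_eq s V A (weighted_sum s ?u l) (weighted_sum s ?u ?L)"
        by (rule weighted_sum_indep[OF V l(1,2) L]) (use l(3) supp in auto)
      with 1 l(4) have "tensor_eq s V A (z @ tmap (s (- 1)) z') []"
        by (metis tensor_eq.sym tensor_eq.trans)
      then have "tensor_eq s V A ((z @ tmap (s (- 1)) z') @ z') ([] @ z')"
        by (rule tensor_eq.append) (rule tensor_eq.refl[OF z(2)])
      moreover have "tensor_eq s V A (z @ (tmap (s (- 1)) z' @ z')) (z @ [])"
        by (rule tensor_eq.append[OF tensor_eq.refl[OF z(1)] teq_neg[OF V z(2)]])
      ultimately show "tensor_eq s V A z z'"
        by (metis append.assoc append_Nil append_Nil2 tensor_eq.sym tensor_eq.trans)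
    next
      assume "tensor_eq s V A z z'"
      then have "tensor_eq s V A (z @ tmap (s (- 1)) z') (z' @ tmap (s (- 1)) z')"
        by (rule tensor_eq.append) (rule tensor_eq.refl[OF nz'])
      moreover have "tensor_eq s V A (z' @ tmap (s (- 1)) z') []"
        using tensor_eq.trans[OF tensor_eq.comm[OF z(2) nz'] teq_neg[OF V z(2)]] .
      ultimately have "tensor_eq s V A (weighted_sum s ?u ?L) []"
        using 1 by (metis tensor_eq.trans)
      then show "delta_sum z - delta_sum z' \<in> R"
        unfolding R_def u[symmetric] using L supp by (auto intro!: exI[of _ ?L] simp del: plus_fun_apply)
    qed
  qed
  let ?z = "delta_sum x - delta_sum y"
  have zR: "?z \<notin> R" using diff_in_R[OF x y] neq by simp
  \<comment> \<open>A basis of R, enlarged by the difference of x and y, carries a functional that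
    is 0 on R and 1 on the difference.\<close>
  obtain B where B: "B \<subseteq> R" "\<not> U.dependent B" "R \<subseteq> U.span B"
    using U.maximal_independent_subset[of R] by blast
  have spB: "U.span B = R" using B R0 by (metis U.span_minimal subset_antisym)
  have ind: "\<not> U.dependent (insert ?z B)"
    using B(2) zR spB by (simp add: U.independent_insertI)
  obtain \<Phi> where \<Phi>: "Vector_Spaces.linear ?S (*) \<Phi>" "\<And>u. u \<in> insert ?z B \<Longrightarrow> \<Phi> u = (if u = ?z then 1 else 0)"
    using P.linear_independent_extend[OF ind, of "\<lambda>u. if u = ?z then 1 else 0"] by blast
  interpret \<Phi>: Vector_Spaces.linear ?S "(*)" \<Phi> by (rule \<Phi>(1))
  have \<Phi>R: "\<Phi> u = 0" if "u \<in> R" for u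
  proof -
    have "?z \<notin> B" using zR B(1) by auto
    then have "\<Phi> b = 0" if "b \<in> B" for b using \<Phi>(2)[of b] that by auto
    then show ?thesis using \<Phi>.eq_0_on_span[of B u] that spB by simp
  qed
  have \<Phi>eq: "\<Phi> (delta_sum z) = \<Phi> (delta_sum z')" if "tensor_eq s V A z z'" for z z'
    using \<Phi>R[of "delta_sum z - delta_sum z'"] diff_in_R[of z z'] teq_lists[OF V that] that
    by (simp add: \<Phi>.diff)
  define \<psi> where "\<psi> p = \<Phi> (delta_sum [p])" for p
  have \<Phi>sum: "\<Phi> (delta_sum z) = sum_list (map \<psi> z)" for z
  proof (induction z)
    case (Cons p z)
    have "\<Phi> (delta_sum (p # z)) = \<Phi> (delta_sum [p]) + \<Phi> (delta_sum z)"
      by (subst delta_sum_simps(2)) (rule \<Phi>.add)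
    with Cons show ?case by (simp only: list.map sum_list.Cons \<psi>_def)
  next
    case Nil
    show ?case unfolding delta_sum_simps by (simp only: \<Phi>.zero list.map sum_list.Nil)
  qed
  \<comment> \<open>Scalar multiples of formal sums do not occur among the generators. That c times
    a pair and the pair with scaled vector differ by a relation is read off from
    \<open>weighted_sum\<close>, where the weight c is moved into the vector.\<close>
  have sc: "\<psi> (s c v, a) = c * \<psi> (v, a)" if va: "v \<in> V" "a \<in> \<mm>" for c v a
  proof -
    let ?L = "remdups [(s c v, a), (v, a)]" and ?u = "(\<lambda>p. c * delta_sum [(v, a)] p) + (\<lambda>p. (- 1) * delta_sum [(s c v, a)] p)"
    have L: "set ?L \<subseteq> V \<times> \<mm>" using va by auto
    have "tensor_eq s V A (weighted_sum s ?u ?L) (tmap (s c) [(v, a)] @ tmap (s (- 1)) [(s c v, a)])"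
      by (rule tensor_eq.trans[OF weighted_sum_add[OF V L]], rule tensor_eq.append;
        subst weighted_sum_scale[OF V]; rule teq_tmap[OF V V lin]; rule weighted_sum_delta[OF V L]) auto
    also have "tensor_eq s V A (tmap (s c) [(v, a)] @ tmap (s (- 1)) [(s c v, a)])
        (tmap (s (- 1)) [(s c v, a)] @ [(s c v, a)])"
      by (rule teq_mset) (use va in auto)
    also (tensor_eq.trans) have "tensor_eq s V A (tmap (s (- 1)) [(s c v, a)] @ [(s c v, a)]) []"
      by (rule teq_neg[OF V]) (use va in auto)
    finally (tensor_eq.trans) have "?u \<in> R" unfolding R_def using L
      by (intro CollectI exI[of _ ?L]) (auto simp: delta_sum_def)
    then have "\<Phi> ?u = 0" by (rule \<Phi>R)
    then have "c * \<Phi> (delta_sum [(v, a)]) - \<Phi> (delta_sum [(s c v, a)]) = 0"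
      using \<Phi>.scale[of c "delta_sum [(v, a)]"] \<Phi>.scale[of "- 1" "delta_sum [(s c v, a)]"]
      by (simp only: \<Phi>.add) simp
    then show ?thesis by (simp add: \<psi>_def)
  qed
  have "bilin s V A \<psi>"
    unfolding bilin_def
  proof (intro conjI ballI allI)
    fix v w a assume "v \<in> V" "w \<in> V" "a \<in> \<mm>"
    from \<Phi>eq[OF tensor_eq.add_left[OF this]] show "\<psi> (v + w, a) = \<psi> (v, a) + \<psi> (w, a)"
      by (simp add: \<Phi>sum)
  next
    fix v a b assume "v \<in> V" "a \<in> \<mm>" "b \<in> \<mm>"
    from \<Phi>eq[OF tensor_eq.add_right[OF this]] show "\<psi> (v, a \<oplus> b) = \<psi> (v, a) + \<psi> (v, b)"
      by (simp add: \<Phi>sum)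
  next
    fix c v a assume va: "v \<in> V" "a \<in> \<mm>"
    show "\<psi> (s c v, a) = c * \<psi> (v, a)" by (rule sc[OF va])
    with \<Phi>eq[OF tensor_eq.scale[OF va], of c] show "\<psi> (v, c \<odot> a) = c * \<psi> (v, a)"
      by (simp add: \<Phi>sum)
  qed
  with fun_cong[OF eq, of \<psi>] have "\<Phi> (delta_sum x) = \<Phi> (delta_sum y)"
    by (simp add: tsum_def \<Phi>sum)
  then have "\<Phi> ?z = 0" by (simp add: \<Phi>.diff)
  with \<Phi>(2)[of ?z] show False by simp
qed

end

section \<open>The tensor product of a DGLA with the maximal ideal\<close>

definition tset :: "(complex \<Rightarrow> 'v::ab_group_add \<Rightarrow> 'v) \<Rightarrow> 'v set \<Rightarrow> 'a calgebra \<Rightarrow> ('v, 'a) tensor set" where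
  "tset s V A = tsum s V A ` lists (V \<times> max_ideal A)"

text \<open>The image of the tensor product of V with the k-th power of the maximal ideal: the
  filtration in which all later series terminate.\<close>

definition tfilt ::
  "(complex \<Rightarrow> 'v::ab_group_add \<Rightarrow> 'v) \<Rightarrow> 'v set \<Rightarrow> 'a calgebra \<Rightarrow> nat \<Rightarrow> ('v, 'a) tensor set" where
  "tfilt s V A k = tsum s V A ` lists (V \<times> max_ideal_power A k)"

definition tens :: "'v::ab_group_add dgla \<Rightarrow> 'a calgebra \<Rightarrow> ('v, 'a) tensor dgla" where
  "tens L A =
     \<lparr> gcomp = (\<lambda>i. tset (gscale L) (gcomp L i) A), gscale = tscale,
       diff = (\<lambda>i. tlift (gscale L) (gcomp L (i + 1)) A (diff L i)),
       brkt = (\<lambda>i j. tlift2 (gscale L) (gcomp L (i + j)) A (brkt L i j)) \<rparr>"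

definition tens_space :: "('v::ab_group_add, 'z) graded_scheme \<Rightarrow> 'a calgebra \<Rightarrow> ('v, 'a) tensor graded" where
  "tens_space V A = \<lparr> gcomp = (\<lambda>i. tset (gscale V) (gcomp V i) A), gscale = tscale \<rparr>"

lemma tens_simps:
  "gcomp (tens L A) i = tset (gscale L) (gcomp L i) A"
  "gscale (tens L A) = tscale"
  "diff (tens L A) i = tlift (gscale L) (gcomp L (i + 1)) A (diff L i)"
  "brkt (tens L A) i j = tlift2 (gscale L) (gcomp L (i + j)) A (brkt L i j)"
  "gcomp (tens_space V A) i = tset (gscale V) (gcomp V i) A"
  "gscale (tens_space V A) = tscale"
  by (simp_all add: tens_def tens_space_def)

lemma tsetI: "x \<in> lists (V \<times> max_ideal A) \<Longrightarrow> tsum s V A x \<in> tset s V A"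
  by (simp add: tset_def)

lemma tsetE:
  assumes "X \<in> tset s V A"
  obtains x where "x \<in> lists (V \<times> max_ideal A)" "X = tsum s V A x"
  using assms by (auto simp: tset_def)

lemma tfiltE:
  assumes "X \<in> tfilt s V A k"
  obtains x where "x \<in> lists (V \<times> max_ideal_power A k)" "X = tsum s V A x"
  using assms by (auto simp: tfilt_def)

lemma sum_list_map_tmap: "sum_list (map \<phi> (tmap f x)) = sum_list (map (\<lambda>p. \<phi> (f (fst p), snd p)) x)"
  by (simp add: tmap_def comp_def case_prod_beta')

lemma sum_list_map_tmap2:
  "sum_list (map \<phi> (tmap2 b A x y)) =
   sum_list (map (\<lambda>p. sum_list (map (\<lambda>q. \<phi> (b (fst p) (fst q), snd p \<otimes>\<^bsub>A\<^esub> snd q)) y)) x)"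
  by (induction x) (simp_all add: tmap2_def comp_def)

lemma sum_list_map_swap:
  fixes f :: "'a \<Rightarrow> 'b \<Rightarrow> 'c::comm_monoid_add"
  shows "sum_list (map (\<lambda>p. sum_list (map (\<lambda>q. f p q) y)) x) = sum_list (map (\<lambda>q. sum_list (map (\<lambda>p. f p q) x)) y)"
  by (induction x) (simp_all add: sum_list_addf)

context art_algebra
begin

lemma tmap2_in:
  assumes "bilinear_between s U s' V s'' W b" "x \<in> lists (U \<times> \<mm>)" "y \<in> lists (V \<times> \<mm>)"
  shows "tmap2 b A x y \<in> lists (W \<times> \<mm>)"
  using assms(2,3) linear_betweenD(1)[OF bilinear_betweenD(1)[OF assms(1)]]
  by (fastforce simp: tmap2_def)

lemma tsum_tmap:
  assumes f: "linear_between s V s' W f" and x: "x \<in> lists (V \<times> \<mm>)"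
  shows "tsum s' W A (tmap f x) = tlift s' W A f (tsum s V A x)"
proof
  fix \<phi>
  have "bilin s V A (\<lambda>p. \<phi> (f (fst p), snd p))" if "bilin s' W A \<phi>"
    unfolding bilin_def fst_conv snd_conv
    by (simp add: linear_betweenD[OF f] bilinD[OF that])
  then show "tsum s' W A (tmap f x) \<phi> = tlift s' W A f (tsum s V A x) \<phi>"
    by (simp add: tsum_def tlift_def sum_list_map_tmap)
qed

lemma sum_list_map_cong: "(\<And>q. q \<in> set y \<Longrightarrow> f q = g q) \<Longrightarrow> sum_list (map f y) = sum_list (map g y)"
  by (simp cong: map_cong)

text \<open>The nested evaluation in \<open>tlift2\<close> gives the expected double sum only if
  both functions met on the way are bilinear, because \<open>tsum\<close> is 0 elsewhere: the form
  in the second pair with the first held fixed, and then the resulting function of the first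
  pair.\<close>

lemma tsum_tmap2:
  assumes U: "csub s U"
    and b: "bilinear_between s U s' V s'' W b" and x: "x \<in> lists (U \<times> \<mm>)" and y: "y \<in> lists (V \<times> \<mm>)"
  shows "tsum s'' W A (tmap2 b A x y) = tlift2 s'' W A b (tsum s U A x) (tsum s' V A y)"
proof
  fix \<phi>
  interpret U: csub s U by fact
  note bl = linear_betweenD[OF bilinear_betweenD(1)[OF b]] linear_betweenD[OF bilinear_betweenD(2)[OF b]]
  show "tsum s'' W A (tmap2 b A x y) \<phi> = tlift2 s'' W A b (tsum s U A x) (tsum s' V A y) \<phi>"
  proof (cases "bilin s'' W A \<phi>")
    case \<phi>: True
    have \<phi>V: "bilin s' V A (\<lambda>q. \<phi> (b v (fst q), a \<otimes> snd q))" if "v \<in> U" "a \<in> \<mm>" for v a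
      unfolding bilin_def fst_conv snd_conv using that
      by (auto simp: bl bilinD[OF \<phi>] r_distr smult m_comm[of a])
    let ?F = "\<lambda>p. tsum s' V A y (\<lambda>q. \<phi> (b (fst p) (fst q), snd p \<otimes> snd q))"
    have F: "?F (v, a) = sum_list (map (\<lambda>q. \<phi> (b v (fst q), a \<otimes> snd q)) y)" if "v \<in> U" "a \<in> \<mm>" for v a
      using \<phi>V[OF that] by (simp add: tsum_def)
    have q: "fst q \<in> V" "snd q \<in> \<mm>" if "q \<in> set y" for q
      using y that by (auto simp: in_lists_conv_set)
    have bF: "bilin s U A ?F"
      unfolding bilin_def
    proof (intro conjI ballI allI)
      fix v w a assume *: "v \<in> U" "w \<in> U" "a \<in> \<mm>"
      then show "?F (v + w, a) = ?F (v, a) + ?F (w, a)"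
        unfolding F[OF U.add_in[OF *(1,2)] *(3)] F[OF *(1,3)] F[OF *(2,3)] sum_list_addf[symmetric]
        by (intro sum_list_map_cong) (auto simp: bl bilinD[OF \<phi>] q)
    next
      fix v a a' assume *: "v \<in> U" "a \<in> \<mm>" "a' \<in> \<mm>"
      then show "?F (v, a \<oplus> a') = ?F (v, a) + ?F (v, a')"
        unfolding F[OF *(1) m_closed(2)[OF *(2,3)]] F[OF *(1,2)] F[OF *(1,3)] sum_list_addf[symmetric]
        by (intro sum_list_map_cong) (auto simp: bl bilinD[OF \<phi>] q l_distr)
    next
      fix c v a assume *: "v \<in> U" "a \<in> \<mm>"
      then show "?F (s c v, a) = c * ?F (v, a)"
        unfolding F[OF U.scale_in[OF *(1)] *(2)] F[OF *] sum_list_const_mult[symmetric]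
        by (intro sum_list_map_cong) (auto simp: bl bilinD[OF \<phi>] q)
      from * show "?F (v, c \<odot> a) = c * ?F (v, a)"
        unfolding F[OF *(1) m_closed(3)[OF *(2)]] F[OF *] sum_list_const_mult[symmetric]
        by (intro sum_list_map_cong) (auto simp: bl bilinD[OF \<phi>] q smult)
    qed
    have "tsum s U A x ?F = sum_list (map ?F x)" using bF by (simp add: tsum_def)
    also have "\<dots> = sum_list (map (\<lambda>p. sum_list (map (\<lambda>q. \<phi> (b (fst p) (fst q), snd p \<otimes> snd q)) y)) x)"
    proof (rule sum_list_map_cong)
      fix p assume "p \<in> set x"
      then have "fst p \<in> U" "snd p \<in> \<mm>" using x by (auto simp: in_lists_conv_set)
      from F[OF this] show "?F p = sum_list (map (\<lambda>q. \<phi> (b (fst p) (fst q), snd p \<otimes> snd q)) y)"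
        by simp
    qed
    finally show ?thesis using \<phi> by (simp add: tsum_def tlift2_def sum_list_map_tmap2)
  qed (simp add: tsum_def tlift2_def)
qed

lemma bilin_simps:
  assumes "csub s V" "bilin s V A \<phi>" "a \<in> \<mm>"
  shows "\<phi> (0, a) = 0" and "v \<in> V \<Longrightarrow> \<phi> (- v, a) = - \<phi> (v, a)"
    and "v \<in> V \<Longrightarrow> w \<in> V \<Longrightarrow> \<phi> (v - w, a) = \<phi> (v, a) - \<phi> (w, a)"
proof -
  interpret csub s V by fact
  show "\<phi> (0, a) = 0" using bilinD(1)[OF assms(2), of 0 0 a] assms(3) by simp
  show m: "\<phi> (- v, a) = - \<phi> (v, a)" if "v \<in> V" for v
    using bilinD(3)[OF assms(2) that assms(3), of "- 1"] by simp
  show "\<phi> (v - w, a) = \<phi> (v, a) - \<phi> (w, a)" if "v \<in> V" "w \<in> V" for v w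
    using bilinD(1)[OF assms(2), of v "- w" a] m[OF that(2)] that assms(3) by simp
qed

lemma tsum_apply: "bilin s V A \<phi> \<Longrightarrow> tsum s V A x \<phi> = sum_list (map \<phi> x)"
  by (simp add: tsum_def)

lemma tsum_scale:
  assumes "x \<in> lists (V \<times> \<mm>)"
  shows "tscale c (tsum s V A x) = tsum s V A (tmap (s c) x)"
proof
  fix \<phi>
  show "tscale c (tsum s V A x) \<phi> = tsum s V A (tmap (s c) x) \<phi>"
  proof (cases "bilin s V A \<phi>")
    case True
    then show ?thesis using assms
      by (auto simp: tsum_apply sum_list_map_tmap sum_list_const_mult[symmetric] bilinD(3)
        in_lists_conv_set intro!: sum_list_map_cong)
  qed (simp add: tsum_def)
qed

lemma tsum_zero:
  assumes W: "csub s W" and x: "x \<in> lists (V \<times> \<mm>)"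
  shows "tsum s W A (tmap (\<lambda>v. 0) x) = 0"
proof
  fix \<phi>
  have "sum_list (map (\<lambda>p. \<phi> (0, snd p)) x) = sum_list (map (\<lambda>p. 0) x)" if "bilin s W A \<phi>"
    using x by (intro sum_list_map_cong bilin_simps(1)[OF W that]) (auto simp: in_lists_conv_set)
  then show "tsum s W A (tmap (\<lambda>v. 0) x) \<phi> = 0 \<phi>"
    by (simp add: tsum_def sum_list_map_tmap)
qed

text \<open>At arguments that are not bilinear, elements of \<open>tset\<close> vanish by
  construction.\<close>

lemma tset_eqI:
  assumes "X \<in> tset s V A" "Y \<in> tset s V A" "\<And>\<phi>. bilin s V A \<phi> \<Longrightarrow> X \<phi> = Y \<phi>"
  shows "X = Y"
proof
  fix \<phi>
  show "X \<phi> = Y \<phi>"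
    using assms by (cases "bilin s V A \<phi>") (auto simp: tset_def tsum_def)
qed

lemma csub_tset: "csub s V \<Longrightarrow> csub tscale (tset s V A)"
proof -
  assume V: "csub s V"
  interpret csub s V by fact
  interpret T: vector_space tscale by (rule vector_space_tscale)
  show ?thesis
  proof (unfold_locales, unfold T.subspace_def, intro conjI ballI allI)
    show "0 \<in> tset s V A" using tsetI[of "[]" V A s] by simp
    fix X Y assume "X \<in> tset s V A" "Y \<in> tset s V A"
    then obtain x y where xy: "x \<in> lists (V \<times> \<mm>)" "X = tsum s V A x"
      "y \<in> lists (V \<times> \<mm>)" "Y = tsum s V A y" by (auto simp: tset_def)
    with tsetI[of "x @ y" V A s] show "X + Y \<in> tset s V A" by simp
  next
    fix c X assume "X \<in> tset s V A"
    then obtain x where x: "x \<in> lists (V \<times> \<mm>)" "X = tsum s V A x" by (rule tsetE)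
    then show "tscale c X \<in> tset s V A"
      unfolding x(2) tsum_scale[OF x(1)] by (intro tsetI tmap_in[OF x(1)] scale_in)
  qed
qed

lemma linear_tlift:
  assumes f: "linear_between s V s' W f"
  shows "linear_between tscale (tset s V A) tscale (tset s' W A) (tlift s' W A f)"
proof (rule linear_betweenI)
  fix X assume "X \<in> tset s V A"
  then obtain x where x: "x \<in> lists (V \<times> \<mm>)" "X = tsum s V A x" by (rule tsetE)
  then show "tlift s' W A f X \<in> tset s' W A"
    unfolding x(2) tsum_tmap[OF f x(1), symmetric]
    by (intro tsetI tmap_in[OF x(1)] linear_betweenD(1)[OF f])
qed (simp_all add: tlift_additive)

text \<open>Linearity in the first argument is built into the definition. In the second it is not,
  since an arbitrary functional X is not additive in its argument; there both arguments are
  represented by formal sums.\<close>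

lemma bilinear_tlift2:
  assumes U: "csub s U" and V: "csub s' V" and W: "csub s'' W" and b: "bilinear_between s U s' V s'' W b"
  shows "bilinear_between tscale (tset s U A) tscale (tset s' V A) tscale (tset s'' W A) (tlift2 s'' W A b)"
proof -
  interpret W: csub s'' W by fact
  note bl = linear_betweenD[OF bilinear_betweenD(1)[OF b]] linear_betweenD[OF bilinear_betweenD(2)[OF b]]
  have in': "tlift2 s'' W A b X Y \<in> tset s'' W A" if X: "X \<in> tset s U A" and Y: "Y \<in> tset s' V A" for X Y
  proof -
    obtain x where x: "x \<in> lists (U \<times> \<mm>)" "X = tsum s U A x" using X by (rule tsetE)
    obtain y where y: "y \<in> lists (V \<times> \<mm>)" "Y = tsum s' V A y" using Y by (rule tsetE)
    show ?thesis
      unfolding x(2) y(2) tsum_tmap2[OF U b x(1) y(1), symmetric]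
      by (rule tsetI[OF tmap2_in[OF b x(1) y(1)]])
  qed
  have left: "tlift2 s'' W A b (X + Y) Z = tlift2 s'' W A b X Z + tlift2 s'' W A b Y Z"
    "tlift2 s'' W A b (tscale c X) Z = tscale c (tlift2 s'' W A b X Z)" for X Y Z c
    by (auto simp: tlift2_def fun_eq_iff)
  have right: "tlift2 s'' W A b X (Y + Z) = tlift2 s'' W A b X Y + tlift2 s'' W A b X Z"
    "tlift2 s'' W A b X (tscale c Y) = tscale c (tlift2 s'' W A b X Y)"
    if X: "X \<in> tset s U A" and Y: "Y \<in> tset s' V A" and Z: "Z \<in> tset s' V A" for X Y Z c
  proof -
    obtain x where x: "x \<in> lists (U \<times> \<mm>)" "X = tsum s U A x" using X by (rule tsetE)
    obtain y where y: "y \<in> lists (V \<times> \<mm>)" "Y = tsum s' V A y" using Y by (rule tsetE)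
    obtain z where z: "z \<in> lists (V \<times> \<mm>)" "Z = tsum s' V A z" using Z by (rule tsetE)
    have yz: "y @ z \<in> lists (V \<times> \<mm>)" using y z by simp
    have cy: "tmap (s' c) y \<in> lists (V \<times> \<mm>)" by (rule tmap_in[OF y(1)]) (rule csub.scale_in[OF V])
    note t = tsum_tmap2[OF U b x(1), symmetric]
    show "tlift2 s'' W A b X (Y + Z) = tlift2 s'' W A b X Y + tlift2 s'' W A b X Z"
      unfolding x(2) y(2) z(2) tsum_append[symmetric] t[OF yz] t[OF y(1)] t[OF z(1)]
      by (rule ext) (simp add: tsum_def sum_list_map_tmap2 sum_list_addf)
    have "tsum s'' W A (tmap2 b A x (tmap (s' c) y)) = tsum s'' W A (tmap (s'' c) (tmap2 b A x y))"
    proof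
      fix \<phi>
      have "b (fst p) (s' c (fst q)) = s'' c (b (fst p) (fst q))" if "p \<in> set x" "q \<in> set y" for p q
      proof -
        have "fst p \<in> U" "fst q \<in> V" using x(1) y(1) that by (auto simp: in_lists_conv_set)
        then show ?thesis by (simp add: bl)
      qed
      then show "tsum s'' W A (tmap2 b A x (tmap (s' c) y)) \<phi> = tsum s'' W A (tmap (s'' c) (tmap2 b A x y)) \<phi>"
        by (simp add: tsum_def sum_list_map_tmap2 sum_list_map_tmap cong: map_cong)
    qed
    then show "tlift2 s'' W A b X (tscale c Y) = tscale c (tlift2 s'' W A b X Y)"
      unfolding x(2) y(2) tsum_scale[OF y(1)] t[OF cy] t[OF y(1)]
        tsum_scale[OF tmap2_in[OF b x(1) y(1)]] .
  qed
  show ?thesis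
    unfolding bilinear_between_def
    by (intro conjI ballI linear_betweenI) (auto intro: in' simp: left right)
qed

text \<open>All arguments are represented by formal sums, and both sides of an axiom are compared on
  an arbitrary bilinear form. Term by term this is the axiom of \<open>L\<close>, with commutativity
  and associativity of \<open>A\<close> matching the coefficients; since \<open>A\<close> sits in
  degree zero no new signs appear.\<close>

lemma is_dgla_tens:
  fixes L :: "'v::ab_group_add dgla"
  assumes "is_dgla L"
  shows "is_dgla (tens L A)"
proof -
  interpret dgla L by unfold_locales fact
  let ?s = "gscale L" and ?T = "\<lambda>i. tset (gscale L) (gcomp L i) A" and ?S = "\<lambda>i. tsum (gscale L) (gcomp L i) A"
  let ?M = "\<lambda>i. lists (gcomp L i \<times> \<mm>)"
  have T: "csub tscale (?T i)" for i by (rule csub_tset) (rule csub)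
  have brS: "brkt (tens L A) i j (?S i x) (?S j y) = ?S (i + j) (tmap2 (brkt L i j) A x y)"
    if "x \<in> ?M i" "y \<in> ?M j" for i j x y
    using tsum_tmap2[OF csub bilinear_brkt that] by (simp add: tens_simps)
  have dS: "diff (tens L A) i (?S i x) = ?S (i + 1) (tmap (diff L i) x)" if "x \<in> ?M i" for i x
    using tsum_tmap[OF linear_diff that] by (simp add: tens_simps)
  have b_in: "tmap2 (brkt L i j) A x y \<in> ?M k" if "x \<in> ?M i" "y \<in> ?M j" "k = i + j" for i j k x y
    using tmap2_in[OF bilinear_brkt that(1,2)] that(3) by simp
  have d_in: "tmap (diff L i) x \<in> ?M k" if "x \<in> ?M i" "k = i + 1" for i k x
    by (rule tmap_in[OF that(1)]) (simp add: diff_in that(2))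
  have mem: "fst p \<in> gcomp L i" "snd p \<in> \<mm>" if "p \<in> set x" "x \<in> ?M i" for p x i
    using that by (auto simp: in_lists_conv_set)
  have m2: "snd p \<otimes> snd q \<in> \<mm>" if "p \<in> set x" "x \<in> ?M i" "q \<in> set y" "y \<in> ?M j" for p q x y i j
    using mem[OF that(1,2)] mem[OF that(3,4)] by auto
  have Mcong: "X \<in> ?M i \<Longrightarrow> i = j \<Longrightarrow> X \<in> ?M j" for X i j by simp
  note ap = tsum_apply sum_list_map_tmap2 sum_list_map_tmap
  have sumneg: "- sum_list (map f l) = sum_list (map (\<lambda>p. - f p) l)" for f :: "'x \<Rightarrow> complex" and l
    by (induction l) auto
  show ?thesis
  proof (rule is_dglaI)
    show "graded_space (tens L A)"
      using T by (simp add: graded_space_def csub_def csub_axioms_def tens_simps)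
    fix i j k :: int
    show "linear_between (gscale (tens L A)) (gcomp (tens L A) i) (gscale (tens L A))
        (gcomp (tens L A) (i + 1)) (diff (tens L A) i)"
      unfolding tens_simps by (rule linear_tlift[OF linear_diff])
    show "bilinear_between (gscale (tens L A)) (gcomp (tens L A) i) (gscale (tens L A))
        (gcomp (tens L A) j) (gscale (tens L A)) (gcomp (tens L A) (i + j)) (brkt (tens L A) i j)"
      unfolding tens_simps by (rule bilinear_tlift2[OF csub csub csub bilinear_brkt])
    show "diff (tens L A) (i + 1) (diff (tens L A) i X) = 0" if "X \<in> gcomp (tens L A) i" for X
    proof -
      from that obtain x where x: "x \<in> ?M i" "X = ?S i x" unfolding tens_simps by (rule tsetE)
      have "diff (tens L A) (i + 1) (diff (tens L A) i X) = ?S (i + 1 + 1) (tmap (\<lambda>v. 0) x)"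
        unfolding x(2) dS[OF x(1)] dS[OF d_in[OF x(1) HOL.refl]] tmap_simps
        by (rule arg_cong[where f = "?S (i + 1 + 1)"], rule tmap_cong[OF x(1)]) (rule diff_diff)
      also have "\<dots> = 0"
        by (rule tsum_zero[OF csub x(1)])
      finally show ?thesis .
    qed
    show "brkt (tens L A) i j X Y = - gscale (tens L A) (ksgn (i * j)) (brkt (tens L A) j i Y X)"
      if X: "X \<in> gcomp (tens L A) i" and Y: "Y \<in> gcomp (tens L A) j" for X Y
    proof -
      obtain x where x: "x \<in> ?M i" "X = ?S i x" using X unfolding tens_simps by (rule tsetE)
      obtain y where y: "y \<in> ?M j" "Y = ?S j y" using Y unfolding tens_simps by (rule tsetE)
      have ji: "?S (j + i) = ?S (i + j)" by (simp add: add.commute)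
      interpret T: csub tscale "?T (i + j)" by (rule T)
      show ?thesis
      proof (rule tset_eqI[of _ ?s "gcomp L (i + j)"])
        show "brkt (tens L A) i j X Y \<in> ?T (i + j)"
          unfolding x(2) y(2) brS[OF x(1) y(1)] by (rule tsetI[OF b_in[OF x(1) y(1) HOL.refl]])
        have "?S (i + j) (tmap2 (brkt L j i) A y x) \<in> ?T (i + j)"
          by (rule tsetI[OF b_in[OF y(1) x(1)]]) simp
        then show "- gscale (tens L A) (ksgn (i * j)) (brkt (tens L A) j i Y X) \<in> ?T (i + j)"
          unfolding x(2) y(2) brS[OF y(1) x(1)] ji tens_simps(2) by (intro T.minus_in T.scale_in)
        fix \<phi> assume \<phi>: "bilin ?s (gcomp L (i + j)) A \<phi>"
        have "sum_list (map (\<lambda>p. sum_list (map (\<lambda>q. \<phi> (brkt L i j (fst p) (fst q), snd p \<otimes> snd q)) y)) x) =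
           sum_list (map (\<lambda>q. sum_list (map (\<lambda>p. - (ksgn (i * j) * \<phi> (brkt L j i (fst q) (fst p), snd q \<otimes> snd p))) x)) y)"
          unfolding sum_list_map_swap[of _ y x]
        proof (intro sum_list_map_cong)
          fix p q assume pq: "p \<in> set x" "q \<in> set y"
          note m = mem[OF pq(1) x(1)] mem[OF pq(2) y(1)]
          have "brkt L i j (fst p) (fst q) = - ?s (ksgn (i * j)) (brkt L j i (fst q) (fst p))"
            using m by (intro brkt_anti)
          moreover have "brkt L j i (fst q) (fst p) \<in> gcomp L (i + j)" using m by (simp add: brkt_in)
          ultimately show "\<phi> (brkt L i j (fst p) (fst q), snd p \<otimes> snd q) =
              - (ksgn (i * j) * \<phi> (brkt L j i (fst q) (fst p), snd q \<otimes> snd p))"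
            using m by (simp add: bilin_simps(2)[OF csub \<phi>] bilinD(3)[OF \<phi>] m_comm)
        qed
        then show "brkt (tens L A) i j X Y \<phi> = (- gscale (tens L A) (ksgn (i * j)) (brkt (tens L A) j i Y X)) \<phi>"
          unfolding x(2) y(2) brS[OF x(1) y(1)] brS[OF y(1) x(1)] ji tens_simps(2)
          by (simp add: ap \<phi> sumneg[symmetric] sum_list_const_mult fun_Compl_def)
      qed
    qed
    show "brkt (tens L A) i (j + k) X (brkt (tens L A) j k Y Z) =
        brkt (tens L A) (i + j) k (brkt (tens L A) i j X Y) Z +
        gscale (tens L A) (ksgn (i * j)) (brkt (tens L A) j (i + k) Y (brkt (tens L A) i k X Z))"
      if X: "X \<in> gcomp (tens L A) i" and Y: "Y \<in> gcomp (tens L A) j" and Z: "Z \<in> gcomp (tens L A) k" for X Y Z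
    proof -
      obtain x where x: "x \<in> ?M i" "X = ?S i x" using X unfolding tens_simps by (rule tsetE)
      obtain y where y: "y \<in> ?M j" "Y = ?S j y" using Y unfolding tens_simps by (rule tsetE)
      obtain z where z: "z \<in> ?M k" "Z = ?S k z" using Z unfolding tens_simps by (rule tsetE)
      have idx: "?S (i + (j + k)) = ?S (i + j + k)" "?S (j + (i + k)) = ?S (i + j + k)"
        by (simp_all add: algebra_simps)
      interpret T: csub tscale "?T (i + j + k)" by (rule T)
      have l1: "brkt (tens L A) i (j + k) X (brkt (tens L A) j k Y Z) =
          ?S (i + j + k) (tmap2 (brkt L i (j + k)) A x (tmap2 (brkt L j k) A y z))"
        unfolding x(2) y(2) z(2) brS[OF y(1) z(1)] brS[OF x(1) b_in[OF y(1) z(1) HOL.refl]] idx ..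
      have l2: "brkt (tens L A) (i + j) k (brkt (tens L A) i j X Y) Z =
          ?S (i + j + k) (tmap2 (brkt L (i + j) k) A (tmap2 (brkt L i j) A x y) z)"
        unfolding x(2) y(2) z(2) brS[OF x(1) y(1)] brS[OF b_in[OF x(1) y(1) HOL.refl] z(1)] ..
      have l3: "brkt (tens L A) j (i + k) Y (brkt (tens L A) i k X Z) =
          ?S (i + j + k) (tmap2 (brkt L j (i + k)) A y (tmap2 (brkt L i k) A x z))"
        unfolding x(2) y(2) z(2) brS[OF x(1) z(1)] brS[OF y(1) b_in[OF x(1) z(1) HOL.refl]] idx ..
      show ?thesis
        unfolding l1 l2 l3 tens_simps(2)
      proof (rule tset_eqI[of _ ?s "gcomp L (i + j + k)"])
        show "?S (i + j + k) (tmap2 (brkt L i (j + k)) A x (tmap2 (brkt L j k) A y z)) \<in> ?T (i + j + k)"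
          by (rule tsetI[OF b_in[OF x(1) b_in[OF y(1) z(1) HOL.refl]]]) simp
        have "?S (i + j + k) (tmap2 (brkt L (i + j) k) A (tmap2 (brkt L i j) A x y) z) \<in> ?T (i + j + k)"
          by (rule tsetI[OF b_in[OF b_in[OF x(1) y(1) HOL.refl] z(1)]]) simp
        moreover have "?S (i + j + k) (tmap2 (brkt L j (i + k)) A y (tmap2 (brkt L i k) A x z)) \<in> ?T (i + j + k)"
          by (rule tsetI[OF b_in[OF y(1) b_in[OF x(1) z(1) HOL.refl]]]) simp
        ultimately show "?S (i + j + k) (tmap2 (brkt L (i + j) k) A (tmap2 (brkt L i j) A x y) z) +
            tscale (ksgn (i * j)) (?S (i + j + k) (tmap2 (brkt L j (i + k)) A y (tmap2 (brkt L i k) A x z)))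
            \<in> ?T (i + j + k)"
          by (intro T.add_in T.scale_in)
        fix \<phi> assume \<phi>: "bilin ?s (gcomp L (i + j + k)) A \<phi>"
        \<comment> \<open>The last Jacobi term runs through the entries of y before those of x;
          after this exchange all three sums run through the same triples.\<close>
        have sw: "sum_list (map (\<lambda>q. sum_list (map (\<lambda>p. sum_list (map (\<lambda>r. f p q r) z)) x)) y) =
            sum_list (map (\<lambda>p. sum_list (map (\<lambda>q. sum_list (map (\<lambda>r. f p q r) z)) y)) x)"
          for f :: "_ \<Rightarrow> _ \<Rightarrow> _ \<Rightarrow> complex" by (rule sum_list_map_swap)
        show "?S (i + j + k) (tmap2 (brkt L i (j + k)) A x (tmap2 (brkt L j k) A y z)) \<phi> =
            (?S (i + j + k) (tmap2 (brkt L (i + j) k) A (tmap2 (brkt L i j) A x y) z) +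
            tscale (ksgn (i * j)) (?S (i + j + k) (tmap2 (brkt L j (i + k)) A y (tmap2 (brkt L i k) A x z)))) \<phi>"
          unfolding plus_fun_apply tscale_apply tsum_apply[OF \<phi>] ap(2) fst_conv snd_conv sw
            sum_list_const_mult[symmetric] sum_list_addf[symmetric]
        proof (intro sum_list_map_cong)
          fix p q r assume pqr: "p \<in> set x" "q \<in> set y" "r \<in> set z"
          note m = mem[OF pqr(1) x(1)] mem[OF pqr(2) y(1)] mem[OF pqr(3) z(1)]
          have "brkt L i (j + k) (fst p) (brkt L j k (fst q) (fst r)) =
              brkt L (i + j) k (brkt L i j (fst p) (fst q)) (fst r) +
              ?s (ksgn (i * j)) (brkt L j (i + k) (fst q) (brkt L i k (fst p) (fst r)))"
            using m by (intro jacobi)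
          moreover have "brkt L (i + j) k (brkt L i j (fst p) (fst q)) (fst r) \<in> gcomp L (i + j + k)"
            "brkt L j (i + k) (fst q) (brkt L i k (fst p) (fst r)) \<in> gcomp L (i + j + k)"
            using m by (auto simp: brkt_in)
          moreover have "snd p \<otimes> (snd q \<otimes> snd r) = snd p \<otimes> snd q \<otimes> snd r"
            "snd q \<otimes> (snd p \<otimes> snd r) = snd p \<otimes> snd q \<otimes> snd r"
            using m by (simp_all add: m_ac)
          ultimately show "\<phi> (brkt L i (j + k) (fst p) (brkt L j k (fst q) (fst r)), snd p \<otimes> (snd q \<otimes> snd r)) =
              \<phi> (brkt L (i + j) k (brkt L i j (fst p) (fst q)) (fst r), snd p \<otimes> snd q \<otimes> snd r) +
              ksgn (i * j) * \<phi> (brkt L j (i + k) (fst q) (brkt L i k (fst p) (fst r)), snd q \<otimes> (snd p \<otimes> snd r))"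
            using m by (simp add: bilinD[OF \<phi>])
        qed
      qed
    qed
    show "diff (tens L A) (i + j) (brkt (tens L A) i j X Y) =
        brkt (tens L A) (i + 1) j (diff (tens L A) i X) Y +
        gscale (tens L A) (ksgn i) (brkt (tens L A) i (j + 1) X (diff (tens L A) j Y))"
      if X: "X \<in> gcomp (tens L A) i" and Y: "Y \<in> gcomp (tens L A) j" for X Y
    proof -
      obtain x where x: "x \<in> ?M i" "X = ?S i x" using X unfolding tens_simps by (rule tsetE)
      obtain y where y: "y \<in> ?M j" "Y = ?S j y" using Y unfolding tens_simps by (rule tsetE)
      have idx: "?S (i + (j + 1)) = ?S (i + j + 1)" "?S (i + 1 + j) = ?S (i + j + 1)"
        by (simp_all add: algebra_simps)
      interpret T: csub tscale "?T (i + j + 1)" by (rule T)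
      have l1: "diff (tens L A) (i + j) (brkt (tens L A) i j X Y) =
          ?S (i + j + 1) (tmap (diff L (i + j)) (tmap2 (brkt L i j) A x y))"
        unfolding x(2) y(2) brS[OF x(1) y(1)] dS[OF b_in[OF x(1) y(1) HOL.refl]] ..
      have l2: "brkt (tens L A) (i + 1) j (diff (tens L A) i X) Y =
          ?S (i + j + 1) (tmap2 (brkt L (i + 1) j) A (tmap (diff L i) x) y)"
        unfolding x(2) y(2) dS[OF x(1)] brS[OF d_in[OF x(1) HOL.refl] y(1)] idx ..
      have l3: "brkt (tens L A) i (j + 1) X (diff (tens L A) j Y) =
          ?S (i + j + 1) (tmap2 (brkt L i (j + 1)) A x (tmap (diff L j) y))"
        unfolding x(2) y(2) dS[OF y(1)] brS[OF x(1) d_in[OF y(1) HOL.refl]] idx ..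
      show ?thesis
        unfolding l1 l2 l3 tens_simps(2)
      proof (rule tset_eqI[of _ ?s "gcomp L (i + j + 1)"])
        show "?S (i + j + 1) (tmap (diff L (i + j)) (tmap2 (brkt L i j) A x y)) \<in> ?T (i + j + 1)"
          by (rule tsetI[OF d_in[OF b_in[OF x(1) y(1) HOL.refl]]]) simp
        have "?S (i + j + 1) (tmap2 (brkt L (i + 1) j) A (tmap (diff L i) x) y) \<in> ?T (i + j + 1)"
          by (rule tsetI[OF b_in[OF d_in[OF x(1) HOL.refl] y(1)]]) simp
        moreover have "?S (i + j + 1) (tmap2 (brkt L i (j + 1)) A x (tmap (diff L j) y)) \<in> ?T (i + j + 1)"
          by (rule tsetI[OF b_in[OF x(1) d_in[OF y(1) HOL.refl]]]) simp
        ultimately show "?S (i + j + 1) (tmap2 (brkt L (i + 1) j) A (tmap (diff L i) x) y) +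
            tscale (ksgn i) (?S (i + j + 1) (tmap2 (brkt L i (j + 1)) A x (tmap (diff L j) y))) \<in> ?T (i + j + 1)"
          by (intro T.add_in T.scale_in)
        fix \<phi> assume \<phi>: "bilin ?s (gcomp L (i + j + 1)) A \<phi>"
        show "?S (i + j + 1) (tmap (diff L (i + j)) (tmap2 (brkt L i j) A x y)) \<phi> =
            (?S (i + j + 1) (tmap2 (brkt L (i + 1) j) A (tmap (diff L i) x) y) +
            tscale (ksgn i) (?S (i + j + 1) (tmap2 (brkt L i (j + 1)) A x (tmap (diff L j) y)))) \<phi>"
          unfolding plus_fun_apply tscale_apply tsum_apply[OF \<phi>] ap(2,3) fst_conv snd_conv
            sum_list_const_mult[symmetric] sum_list_addf[symmetric]
        proof (intro sum_list_map_cong)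
          fix p q assume pq: "p \<in> set x" "q \<in> set y"
          note m = mem[OF pq(1) x(1)] mem[OF pq(2) y(1)]
          have "diff L (i + j) (brkt L i j (fst p) (fst q)) =
              brkt L (i + 1) j (diff L i (fst p)) (fst q) +
              ?s (ksgn i) (brkt L i (j + 1) (fst p) (diff L j (fst q)))"
            using m by (intro leibniz)
          moreover have "brkt L (i + 1) j (diff L i (fst p)) (fst q) \<in> gcomp L (i + j + 1)"
            "brkt L i (j + 1) (fst p) (diff L j (fst q)) \<in> gcomp L (i + j + 1)"
            using m by (auto simp: brkt_in diff_in)
          ultimately show "\<phi> (diff L (i + j) (brkt L i j (fst p) (fst q)), snd p \<otimes> snd q) =
              \<phi> (brkt L (i + 1) j (diff L i (fst p)) (fst q), snd p \<otimes> snd q) +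
              ksgn i * \<phi> (brkt L i (j + 1) (fst p) (diff L j (fst q)), snd p \<otimes> snd q)"
            using m by (simp add: bilinD[OF \<phi>])
        qed
      qed
    qed
  qed
qed

end

section \<open>Identities between linear and bilinear maps after tensoring with the maximal
  ideal\<close>

context art_algebra
begin

lemma tlift_comp:
  assumes "linear_between s' W s'' Z g"
  shows "tlift s'' Z A g (tlift s' W A f X) = tlift s'' Z A (\<lambda>v. g (f v)) X"
proof
  fix \<phi>
  have "bilin s' W A (\<lambda>p. \<phi> (g (fst p), snd p))" if "bilin s'' Z A \<phi>"
    unfolding bilin_def fst_conv snd_conv
    by (simp add: linear_betweenD[OF assms] bilinD[OF that])
  then show "tlift s'' Z A g (tlift s' W A f X) \<phi> = tlift s'' Z A (\<lambda>v. g (f v)) X \<phi>"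
    by (simp add: tlift_def)
qed

lemma tlift_tlift2:
  assumes "linear_between s' W s'' Z g"
  shows "tlift s'' Z A g (tlift2 s' W A b X Y) = tlift2 s'' Z A (\<lambda>v w. g (b v w)) X Y"
proof
  fix \<phi>
  have "bilin s' W A (\<lambda>p. \<phi> (g (fst p), snd p))" if "bilin s'' Z A \<phi>"
    unfolding bilin_def fst_conv snd_conv
    by (simp add: linear_betweenD[OF assms] bilinD[OF that])
  then show "tlift s'' Z A g (tlift2 s' W A b X Y) \<phi> = tlift2 s'' Z A (\<lambda>v w. g (b v w)) X Y \<phi>"
    by (simp add: tlift_def tlift2_def)
qed

lemma tlift_cong:
  assumes "linear_between s V s' W f" "linear_between s V s' W g" "X \<in> tset s V A"
    "\<And>v. v \<in> V \<Longrightarrow> f v = g v"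
  shows "tlift s' W A f X = tlift s' W A g X"
proof -
  obtain x where x: "x \<in> lists (V \<times> \<mm>)" "X = tsum s V A x" using assms(3) by (rule tsetE)
  from assms(4) show ?thesis
    unfolding x(2) tsum_tmap[OF assms(1) x(1), symmetric] tsum_tmap[OF assms(2) x(1), symmetric]
    by (intro arg_cong[where f = "tsum s' W A"] tmap_cong[OF x(1)])
qed

lemma tlift_id: "X \<in> tset s V A \<Longrightarrow> tlift s V A (\<lambda>v. v) X = X"
  by (auto simp: tlift_def tset_def tsum_def)

lemma tlift_zero: "csub s' W \<Longrightarrow> X \<in> tset s V A \<Longrightarrow> tlift s' W A (\<lambda>v. 0) X = 0"
proof -
  assume W: "csub s' W" and X: "X \<in> tset s V A"
  interpret csub s' W by fact
  obtain x where x: "x \<in> lists (V \<times> \<mm>)" "X = tsum s V A x" using X by (rule tsetE)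
  have "linear_between s V s' W (\<lambda>v. 0)" by (intro linear_betweenI) auto
  then show ?thesis unfolding x(2) using tsum_zero[OF W x(1)] by (simp add: tsum_tmap[OF _ x(1), symmetric])
qed

lemma tlift_add:
  assumes "linear_between s V s' W f" "linear_between s V s' W g" "linear_between s V s' W h"
    "X \<in> tset s V A" "\<And>v. v \<in> V \<Longrightarrow> h v = f v + g v"
  shows "tlift s' W A h X = tlift s' W A f X + tlift s' W A g X"
proof -
  obtain x where x: "x \<in> lists (V \<times> \<mm>)" "X = tsum s V A x" using assms(4) by (rule tsetE)
  have "tsum s' W A (tmap h x) \<phi> = (tsum s' W A (tmap f x) + tsum s' W A (tmap g x)) \<phi>" for \<phi>
  proof (cases "bilin s' W A \<phi>")
    case True
    have "sum_list (map (\<lambda>p. \<phi> (h (fst p), snd p)) x) =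
        sum_list (map (\<lambda>p. \<phi> (f (fst p), snd p) + \<phi> (g (fst p), snd p)) x)"
    proof (rule sum_list_map_cong)
      fix p assume "p \<in> set x"
      then have "fst p \<in> V" "snd p \<in> \<mm>" using x(1) by (auto simp: in_lists_conv_set)
      then show "\<phi> (h (fst p), snd p) = \<phi> (f (fst p), snd p) + \<phi> (g (fst p), snd p)"
        by (simp add: assms(5) bilinD(1)[OF True] linear_betweenD(1)[OF assms(1)] linear_betweenD(1)[OF assms(2)])
    qed
    then show ?thesis using True by (simp add: tsum_def sum_list_map_tmap sum_list_addf)
  qed (simp add: tsum_def)
  then show ?thesis
    unfolding x(2) tsum_tmap[OF assms(1) x(1), symmetric] tsum_tmap[OF assms(2) x(1), symmetric]
      tsum_tmap[OF assms(3) x(1), symmetric] by (intro ext)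
qed

lemma tlift2_tlift:
  assumes U: "csub s U" and U': "csub t U'" and b: "bilinear_between t U' t' V' s'' W b"
    and b': "bilinear_between s U s' V s'' W (\<lambda>v w. b (f v) (g w))"
    and f: "linear_between s U t U' f" and g: "linear_between s' V t' V' g"
    and X: "X \<in> tset s U A" and Y: "Y \<in> tset s' V A"
  shows "tlift2 s'' W A b (tlift t U' A f X) (tlift t' V' A g Y) = tlift2 s'' W A (\<lambda>v w. b (f v) (g w)) X Y"
proof -
  obtain x where x: "x \<in> lists (U \<times> \<mm>)" "X = tsum s U A x" using X by (rule tsetE)
  obtain y where y: "y \<in> lists (V \<times> \<mm>)" "Y = tsum s' V A y" using Y by (rule tsetE)
  have fx: "tmap f x \<in> lists (U' \<times> \<mm>)" by (rule tmap_in[OF x(1)]) (rule linear_betweenD(1)[OF f])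
  have gy: "tmap g y \<in> lists (V' \<times> \<mm>)" by (rule tmap_in[OF y(1)]) (rule linear_betweenD(1)[OF g])
  have "tmap2 b A (tmap f x) (tmap g y) = tmap2 (\<lambda>v w. b (f v) (g w)) A x y"
    by (simp add: tmap2_def tmap_def comp_def case_prod_beta')
  then show ?thesis
    unfolding x(2) y(2) tsum_tmap[OF f x(1), symmetric] tsum_tmap[OF g y(1), symmetric]
      tsum_tmap2[OF U' b fx gy, symmetric] tsum_tmap2[OF U b' x(1) y(1), symmetric] by simp
qed

lemma tlift2_cong:
  assumes U: "csub s U" and b: "bilinear_between s U s' V s'' W b" and b': "bilinear_between s U s' V s'' W b'"
    and X: "X \<in> tset s U A" and Y: "Y \<in> tset s' V A"
    and eq: "\<And>v w. v \<in> U \<Longrightarrow> w \<in> V \<Longrightarrow> b v w = b' v w"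
  shows "tlift2 s'' W A b X Y = tlift2 s'' W A b' X Y"
proof -
  obtain x where x: "x \<in> lists (U \<times> \<mm>)" "X = tsum s U A x" using X by (rule tsetE)
  obtain y where y: "y \<in> lists (V \<times> \<mm>)" "Y = tsum s' V A y" using Y by (rule tsetE)
  have "b (fst p) (fst q) = b' (fst p) (fst q)" if "p \<in> set x" "q \<in> set y" for p q
    using x(1) y(1) that by (intro eq) (auto simp: in_lists_conv_set)
  then have "tmap2 b A x y = tmap2 b' A x y"
    by (simp add: tmap2_def cong: map_cong)
  then show ?thesis
    unfolding x(2) y(2) tsum_tmap2[OF U b x(1) y(1), symmetric] tsum_tmap2[OF U b' x(1) y(1), symmetric] by simp
qed

lemma tlift2_zero:
  fixes s'' :: "complex \<Rightarrow> 'w::ab_group_add \<Rightarrow> 'w"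
  assumes U: "csub s U" and W: "csub s'' W"
    and X: "X \<in> tset s U A" and Y: "Y \<in> tset s' V A"
  shows "tlift2 s'' W A (\<lambda>v w. 0) X Y = 0"
proof -
  interpret W: csub s'' W by fact
  have b: "bilinear_between s U s' V s'' W (\<lambda>v w. 0)"
    unfolding bilinear_between_def by (auto intro!: linear_betweenI)
  obtain x where x: "x \<in> lists (U \<times> \<mm>)" "X = tsum s U A x" using X by (rule tsetE)
  obtain y where y: "y \<in> lists (V \<times> \<mm>)" "Y = tsum s' V A y" using Y by (rule tsetE)
  have "tmap2 (\<lambda>v w. 0 :: 'w) A x y = tmap (\<lambda>v :: 'w. 0) (tmap2 (\<lambda>v w. 0) A x y)"
    by (simp add: tmap2_def tmap_def map_concat comp_def)
  then have "tsum s'' W A (tmap2 (\<lambda>v w. 0) A x y) = tsum s'' W A (tmap (\<lambda>v :: 'w. 0) (tmap2 (\<lambda>v w. 0) A x y))"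
    by (rule arg_cong)
  also have "\<dots> = 0" by (rule tsum_zero[OF W tmap2_in[OF b x(1) y(1)]])
  finally show ?thesis
    unfolding x(2) y(2) tsum_tmap2[OF U b x(1) y(1), symmetric] .
qed

lemma bilinear_compose:
  assumes "bilinear_between s U s' V s'' W b" "linear_between s'' W t Z k"
  shows "bilinear_between s U s' V t Z (\<lambda>v w. k (b v w))"
  using assms unfolding bilinear_between_def by (auto intro: linear_between_compose)

lemma bilinear_compose2:
  assumes "bilinear_between t U' t' V' s'' W b" "linear_between s U t U' f" "linear_between s' V t' V' g"
  shows "bilinear_between s U s' V s'' W (\<lambda>v w. b (f v) (g w))"
  using assms unfolding bilinear_between_def linear_between_def by auto

lemma dgla_hom_tens:
  assumes "is_dgla L" "is_dgla M" and f: "dgla_hom f L M"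
  shows "dgla_hom (\<lambda>i. tlift (gscale M) (gcomp M i) A (f i)) (tens L A) (tens M A)"
proof -
  interpret L: dgla L by unfold_locales fact
  interpret M: dgla M by unfold_locales fact
  note fl = dgla_homD(1)[OF f]
  show ?thesis
  proof (rule dgla_homI)
    fix i
    show "linear_between (gscale (tens L A)) (gcomp (tens L A) i) (gscale (tens M A)) (gcomp (tens M A) i)
        (tlift (gscale M) (gcomp M i) A (f i))"
      unfolding tens_simps by (rule linear_tlift[OF fl])
    fix X assume X: "X \<in> gcomp (tens L A) i"
    show "tlift (gscale M) (gcomp M (i + 1)) A (f (i + 1)) (diff (tens L A) i X) =
        diff (tens M A) i (tlift (gscale M) (gcomp M i) A (f i) X)"
      unfolding tens_simps tlift_comp[OF fl] tlift_comp[OF M.linear_diff]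
      by (rule tlift_cong[OF linear_between_compose[OF L.linear_diff fl]
          linear_between_compose[OF fl M.linear_diff] X[unfolded tens_simps]]) (rule dgla_homD(2)[OF f])
  next
    fix i j X Y assume X: "X \<in> gcomp (tens L A) i" and Y: "Y \<in> gcomp (tens L A) j"
    note b1 = bilinear_compose[OF L.bilinear_brkt fl] and b2 = bilinear_compose2[OF M.bilinear_brkt fl fl]
    show "tlift (gscale M) (gcomp M (i + j)) A (f (i + j)) (brkt (tens L A) i j X Y) =
        brkt (tens M A) i j (tlift (gscale M) (gcomp M i) A (f i) X) (tlift (gscale M) (gcomp M j) A (f j) Y)"
      unfolding tens_simps tlift_tlift2[OF fl]
        tlift2_tlift[OF L.csub M.csub M.bilinear_brkt b2 fl fl X[unfolded tens_simps] Y[unfolded tens_simps]]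
      by (rule tlift2_cong[OF L.csub b1 b2 X[unfolded tens_simps] Y[unfolded tens_simps]])
        (rule dgla_homD(3)[OF f])
  qed
qed

text \<open>Every condition is an equation between composites of linear or bilinear maps on
  homogeneous components, and such equations pass to tensor products through
  \<open>tlift_cong\<close> and \<open>tlift2_cong\<close>.\<close>

lemma contraction_tens:
  assumes "contraction H V dV \<iota> \<pi> K"
  shows "contraction (tens H A) (tens_space V A)
    (\<lambda>i. tlift (gscale V) (gcomp V (i + 1)) A (dV i))
    (\<lambda>i. tlift (gscale H) (gcomp H i) A (\<iota> i))
    (\<lambda>i. tlift (gscale V) (gcomp V i) A (\<pi> i))
    (\<lambda>i. tlift (gscale H) (gcomp H (i - 1)) A (K i))"
proof -
  interpret contraction H V dV \<iota> \<pi> K by fact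
  interpret T: dgla "tens H A" by unfold_locales (rule is_dgla_tens[OF dgla])
  have cV: "csub (gscale V) (gcomp V i)" for i by (rule csub_of_graded[OF graded_V])
  note lin = linear_dV linear_incl linear_proj linear_K linear_diff
  note cp = linear_between_compose
  show ?thesis
  proof (unfold_locales)
    fix i j :: int
    have "csub tscale (tset (gscale V) (gcomp V k) A)" for k by (rule csub_tset[OF cV])
    then show "graded_space (tens_space V A)"
      by (simp add: graded_space_def tens_simps csub_def csub_axioms_def)
    show "linear_between (gscale (tens_space V A)) (gcomp (tens_space V A) i) (gscale (tens_space V A))
        (gcomp (tens_space V A) (i + 1)) (tlift (gscale V) (gcomp V (i + 1)) A (dV i))"
      unfolding tens_simps by (rule linear_tlift[OF linear_dV])
    show "linear_between (gscale (tens_space V A)) (gcomp (tens_space V A) i) (gscale (tens H A))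
        (gcomp (tens H A) i) (tlift (gscale H) (gcomp H i) A (\<iota> i))"
      unfolding tens_simps by (rule linear_tlift[OF linear_incl])
    show "linear_between (gscale (tens H A)) (gcomp (tens H A) i) (gscale (tens_space V A))
        (gcomp (tens_space V A) i) (tlift (gscale V) (gcomp V i) A (\<pi> i))"
      unfolding tens_simps by (rule linear_tlift[OF linear_proj])
    show "linear_between (gscale (tens H A)) (gcomp (tens H A) i) (gscale (tens H A))
        (gcomp (tens H A) (i - 1)) (tlift (gscale H) (gcomp H (i - 1)) A (K i))"
      unfolding tens_simps by (rule linear_tlift[OF linear_K])
    show "diff (tens H A) i (tlift (gscale H) (gcomp H i) A (\<iota> i) v) =
        tlift (gscale H) (gcomp H (i + 1)) A (\<iota> (i + 1)) (tlift (gscale V) (gcomp V (i + 1)) A (dV i) v)"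
      if "v \<in> gcomp (tens_space V A) i" for v
      unfolding tens_simps tlift_comp[OF linear_diff] tlift_comp[OF linear_incl]
      by (rule tlift_cong[OF cp[OF linear_incl linear_diff] cp[OF linear_dV linear_incl]
        that[unfolded tens_simps]]) (rule diff_incl)
    have diff': "linear_between (gscale H) (gcomp H (i - 1)) (gscale H) (gcomp H i) (diff H (i - 1))"
      using linear_diff[of "i - 1"] by simp
    have K': "linear_between (gscale H) (gcomp H (i + 1)) (gscale H) (gcomp H i) (K (i + 1))"
      using linear_K[of "i + 1"] by simp
    show "diff (tens H A) (i - 1) (tlift (gscale H) (gcomp H (i - 1)) A (K i) X) +
        tlift (gscale H) (gcomp H (i + 1 - 1)) A (K (i + 1)) (diff (tens H A) i X) =
        tlift (gscale H) (gcomp H i) A (\<iota> i) (tlift (gscale V) (gcomp V i) A (\<pi> i) X) - X"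
      if X: "X \<in> gcomp (tens H A) i" for X
    proof -
      note X' = X[unfolded tens_simps]
      have l1: "linear_between (gscale H) (gcomp H i) (gscale H) (gcomp H i)
          (\<lambda>x. diff H (i - 1) (K i x) + K (i + 1) (diff H i x))"
        using cp[OF linear_K diff'] cp[OF linear_diff K']
        by (intro linear_betweenI) (auto simp: linear_between_def scale_right_distrib algebra_simps)
      have id: "linear_between (gscale H) (gcomp H i) (gscale H) (gcomp H i) (\<lambda>x. x)"
        by (intro linear_betweenI) auto
      have "tlift (gscale H) (gcomp H i) A (\<lambda>x. diff H (i - 1) (K i x)) X +
          tlift (gscale H) (gcomp H i) A (\<lambda>x. K (i + 1) (diff H i x)) X =
          tlift (gscale H) (gcomp H i) A (\<lambda>x. diff H (i - 1) (K i x) + K (i + 1) (diff H i x)) X"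
        by (rule tlift_add[symmetric, OF cp[OF linear_K diff'] cp[OF linear_diff K'] l1 X'])
          (rule HOL.refl)
      \<comment> \<open>The homotopy formula is rearranged to \<iota>\<pi> = (dK + Kd) + 1, a sum of
        linear maps to which \<open>tlift_add\<close> applies.\<close>
      moreover have "tlift (gscale H) (gcomp H i) A (\<lambda>x. \<iota> i (\<pi> i x)) X =
          tlift (gscale H) (gcomp H i) A (\<lambda>x. diff H (i - 1) (K i x) + K (i + 1) (diff H i x)) X +
          tlift (gscale H) (gcomp H i) A (\<lambda>x. x) X"
        by (rule tlift_add[OF l1 id cp[OF linear_proj linear_incl] X']) (simp add: homotopy)
      moreover have "tlift (gscale H) (gcomp H i) A (\<lambda>x. x) X = X" by (rule tlift_id[OF X'])
      ultimately show ?thesis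
        by (simp add: tens_simps tlift_comp[OF diff'] tlift_comp[OF K'] tlift_comp[OF linear_incl])
    qed
    show "tlift (gscale H) (gcomp H (i - 1)) A (K i) (tlift (gscale H) (gcomp H i) A (\<iota> i) v) = 0"
      if v: "v \<in> gcomp (tens_space V A) i" for v
    proof -
      have "tlift (gscale H) (gcomp H (i - 1)) A (\<lambda>v. K i (\<iota> i v)) v = tlift (gscale H) (gcomp H (i - 1)) A (\<lambda>v. 0) v"
        by (rule tlift_cong[OF cp[OF linear_incl linear_K] _ v[unfolded tens_simps]])
          (auto intro!: linear_betweenI simp: K_incl)
      then show ?thesis
        using tlift_zero[OF csub v[unfolded tens_simps]] by (simp add: tlift_comp[OF linear_K])
    qed
    show "tlift (gscale H) (gcomp H (i - 1 - 1)) A (K (i - 1)) (tlift (gscale H) (gcomp H (i - 1)) A (K i) X) = 0"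
      if v: "X \<in> gcomp (tens H A) i" for X
    proof -
      have "tlift (gscale H) (gcomp H (i - 1 - 1)) A (\<lambda>v. K (i - 1) (K i v)) X =
          tlift (gscale H) (gcomp H (i - 1 - 1)) A (\<lambda>v. 0) X"
        by (rule tlift_cong[OF cp[OF linear_K linear_K] _ v[unfolded tens_simps]])
          (auto intro!: linear_betweenI simp: K_K)
      then show ?thesis
        unfolding tlift_comp[OF linear_K] tlift_zero[OF csub v[unfolded tens_simps]] .
    qed
    show "tlift (gscale V) (gcomp V i) A (\<pi> i) (tlift (gscale H) (gcomp H i) A (\<iota> i) v) = v"
      if v: "v \<in> gcomp (tens_space V A) i" for v
    proof -
      have "tlift (gscale V) (gcomp V i) A (\<lambda>v. \<pi> i (\<iota> i v)) v = tlift (gscale V) (gcomp V i) A (\<lambda>v. v) v"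
        by (rule tlift_cong[OF cp[OF linear_incl linear_proj] _ v[unfolded tens_simps]])
          (auto intro!: linear_betweenI simp: proj_incl)
      then show ?thesis
        using tlift_id[OF v[unfolded tens_simps]] by (simp add: tlift_comp[OF linear_proj])
    qed
    show "tlift (gscale V) (gcomp V (i - 1)) A (\<pi> (i - 1)) (tlift (gscale H) (gcomp H (i - 1)) A (K i) X) = 0"
      if v: "X \<in> gcomp (tens H A) i" for X
    proof -
      have "tlift (gscale V) (gcomp V (i - 1)) A (\<lambda>v. \<pi> (i - 1) (K i v)) X =
          tlift (gscale V) (gcomp V (i - 1)) A (\<lambda>v. 0) X"
        by (rule tlift_cong[OF cp[OF linear_K linear_proj] _ v[unfolded tens_simps]])
          (auto intro!: linear_betweenI simp: proj_K)
      then show ?thesis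
        using tlift_zero[OF cV v[unfolded tens_simps]] by (simp add: tlift_comp[OF linear_proj])
    qed
    fix X Y assume X: "X \<in> gcomp (tens H A) i" and Y: "Y \<in> gcomp (tens H A) j"
    note XY = X[unfolded tens_simps] Y[unfolded tens_simps]
    note b = bilinear_compose2[OF bilinear_brkt linear_K linear_K, of i j]
    have z: "bilinear_between (gscale H) (gcomp H i) (gscale H) (gcomp H j) s W (\<lambda>v w. 0)"
      if "csub s W" for s :: "complex \<Rightarrow> 'x::ab_group_add \<Rightarrow> 'x" and W
    proof -
      interpret W: csub s W by fact
      show ?thesis unfolding bilinear_between_def by (auto intro!: linear_betweenI)
    qed
    have br: "brkt (tens H A) (i - 1) (j - 1) (tlift (gscale H) (gcomp H (i - 1)) A (K i) X)
        (tlift (gscale H) (gcomp H (j - 1)) A (K j) Y) =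
        tlift2 (gscale H) (gcomp H (i - 1 + (j - 1))) A (\<lambda>v w. brkt H (i - 1) (j - 1) (K i v) (K j w)) X Y"
      unfolding tens_simps by (rule tlift2_tlift[OF csub csub bilinear_brkt b linear_K linear_K XY])
    show "tlift (gscale H) (gcomp H (i - 1 + (j - 1) - 1)) A (K (i - 1 + (j - 1)))
        (brkt (tens H A) (i - 1) (j - 1) (tlift (gscale H) (gcomp H (i - 1)) A (K i) X)
        (tlift (gscale H) (gcomp H (j - 1)) A (K j) Y)) = 0"
      unfolding br tlift_tlift2[OF linear_K]
      using tlift2_cong[OF csub bilinear_compose[OF b linear_K] z[OF csub] XY] K_brkt
        tlift2_zero[OF csub csub XY] by metis
    show "tlift (gscale V) (gcomp V (i - 1 + (j - 1))) A (\<pi> (i - 1 + (j - 1)))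
        (brkt (tens H A) (i - 1) (j - 1) (tlift (gscale H) (gcomp H (i - 1)) A (K i) X)
        (tlift (gscale H) (gcomp H (j - 1)) A (K j) Y)) = 0"
      unfolding br tlift_tlift2[OF linear_proj]
      using tlift2_cong[OF csub bilinear_compose[OF b linear_proj] z[OF cV] XY] proj_brkt
        tlift2_zero[OF csub cV XY] by metis
  qed
qed

section \<open>The filtration by powers of the maximal ideal\<close>

lemma lists_max_ideal_power: "1 \<le> k \<Longrightarrow> x \<in> lists (V \<times> max_ideal_power A k) \<Longrightarrow> x \<in> lists (V \<times> \<mm>)"
  using max_ideal_power_subset[of 1 k] max_ideal_power_1 by fastforce

lemma tfilt_1: "tfilt s V A 1 = tset s V A"
  unfolding tfilt_def tset_def max_ideal_power_1 ..

lemma tfilt_antimono: "j \<le> k \<Longrightarrow> tfilt s V A k \<subseteq> tfilt s V A j"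
  unfolding tfilt_def using max_ideal_power_subset[of j k] by (intro image_mono lists_mono) auto

lemma csub_tfilt: "csub s V \<Longrightarrow> 1 \<le> k \<Longrightarrow> csub tscale (tfilt s V A k)"
proof -
  assume V: "csub s V" and k: "1 \<le> k"
  interpret csub s V by fact
  interpret T: vector_space tscale by (rule vector_space_tscale)
  show ?thesis
  proof (unfold_locales, unfold T.subspace_def, intro conjI ballI allI)
    show "0 \<in> tfilt s V A k" unfolding tfilt_def by (rule image_eqI[of _ _ "[]"]) auto
    fix X Y assume "X \<in> tfilt s V A k" "Y \<in> tfilt s V A k"
    then obtain x y where xy: "x \<in> lists (V \<times> max_ideal_power A k)" "X = tsum s V A x"
      "y \<in> lists (V \<times> max_ideal_power A k)" "Y = tsum s V A y" by (auto simp: tfilt_def)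
    then show "X + Y \<in> tfilt s V A k" unfolding tfilt_def by (intro image_eqI[of _ _ "x @ y"]) auto
  next
    fix c X assume "X \<in> tfilt s V A k"
    then obtain x where x: "x \<in> lists (V \<times> max_ideal_power A k)" "X = tsum s V A x" by (rule tfiltE)
    then show "tscale c X \<in> tfilt s V A k"
      unfolding x(2) tsum_scale[OF lists_max_ideal_power[OF k x(1)]] tfilt_def
      by (intro imageI tmap_in[OF x(1)] scale_in)
  qed
qed

lemma tlift_tfilt:
  assumes f: "linear_between s V s' W f" and k: "1 \<le> k" and X: "X \<in> tfilt s V A k"
  shows "tlift s' W A f X \<in> tfilt s' W A k"
proof -
  obtain x where x: "x \<in> lists (V \<times> max_ideal_power A k)" "X = tsum s V A x" using X by (rule tfiltE)
  show ?thesis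
    unfolding x(2) tsum_tmap[OF f lists_max_ideal_power[OF k x(1)], symmetric] tfilt_def
    by (intro imageI tmap_in[OF x(1)] linear_betweenD(1)[OF f])
qed

lemma tlift2_tfilt:
  assumes U: "csub s U" and b: "bilinear_between s U s' V s'' W b" and jk: "1 \<le> j" "1 \<le> k"
    and X: "X \<in> tfilt s U A j" and Y: "Y \<in> tfilt s' V A k"
  shows "tlift2 s'' W A b X Y \<in> tfilt s'' W A (j + k)"
proof -
  obtain x where x: "x \<in> lists (U \<times> max_ideal_power A j)" "X = tsum s U A x" using X by (rule tfiltE)
  obtain y where y: "y \<in> lists (V \<times> max_ideal_power A k)" "Y = tsum s' V A y" using Y by (rule tfiltE)
  have "tmap2 b A x y \<in> lists (W \<times> max_ideal_power A (j + k))"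
    using x(1) y(1) linear_betweenD(1)[OF bilinear_betweenD(1)[OF b]] max_ideal_power_mult
    by (fastforce simp: tmap2_def)
  then show ?thesis
    unfolding x(2) y(2) tsum_tmap2[OF U b lists_max_ideal_power[OF jk(1) x(1)]
      lists_max_ideal_power[OF jk(2) y(1)], symmetric] tfilt_def by (rule imageI)
qed

text \<open>One index N serves all subspaces V and scalings at once, because it comes from the
  nilpotency of the maximal ideal. The successor of the nilpotency exponent is taken to ensure that
  N is positive.\<close>

lemma tfilt_nilpotent: "\<exists>N\<ge>1. \<forall>(s :: complex \<Rightarrow> 'v::ab_group_add \<Rightarrow> 'v) V. tfilt s V A N = {0}"
proof -
  obtain N0 where N0: "max_ideal_power A N0 = {\<zero>}" using max_ideal_nilpotent by blast
  have "max_ideal_power A (Suc N0) \<subseteq> {\<zero>}" using max_ideal_power_Suc_subset[of N0] N0 by simp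
  have "tsum s V A x = 0" if x: "x \<in> lists (V \<times> max_ideal_power A (Suc N0))"
    for s :: "complex \<Rightarrow> 'v \<Rightarrow> 'v" and V x
  proof
    fix \<phi>
    have "\<phi> p = 0" if "bilin s V A \<phi>" "p \<in> set x" for p
    proof -
      have "fst p \<in> V" "snd p = \<zero>"
        using x that(2) \<open>max_ideal_power A (Suc N0) \<subseteq> {\<zero>}\<close> unfolding in_lists_conv_set
        by (metis mem_Times_iff, metis mem_Times_iff singletonD subsetD)
      then have "p = (fst p, \<zero>)" by (simp add: prod_eq_iff)
      moreover have "\<phi> (fst p, \<zero>) = 0"
        using bilinD(2)[OF that(1) \<open>fst p \<in> V\<close>, of \<zero> \<zero>] by simp
      ultimately show ?thesis by simp
    qed
    then show "tsum s V A x \<phi> = 0 \<phi>" by (simp add: tsum_def cong: map_cong)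
  qed
  moreover have "0 \<in> tfilt s V A (Suc N0)" for s :: "complex \<Rightarrow> 'v \<Rightarrow> 'v" and V
    unfolding tfilt_def by (rule image_eqI[of _ _ "[]"]) auto
  ultimately have "tfilt s V A (Suc N0) = {0}" for s :: "complex \<Rightarrow> 'v \<Rightarrow> 'v" and V
    by (auto simp: tfilt_def simp del: max_ideal_power.simps)
  then show ?thesis by (intro exI[of _ "Suc N0"]) simp
qed

end

section \<open>Nilpotent DGLAs\<close>

text \<open>The filtration starts at index 1, where it is everything. Brackets add indices, so
  bracketing with any element raises the index by at least one; this makes all fixed point equations
  below contracting.\<close>

locale nil_dgla = dgla L
  for L :: "'v::ab_group_add dgla" +
  fixes F :: "nat \<Rightarrow> int \<Rightarrow> 'v set" and N :: nat
  assumes F_csub: "1 \<le> k \<Longrightarrow> csub (gscale L) (F k i)"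
    and F_1: "F 1 i = gcomp L i"
    and F_antimono: "1 \<le> j \<Longrightarrow> j \<le> k \<Longrightarrow> F k i \<subseteq> F j i"
    and F_N: "F N i = {0}" and N: "1 \<le> N"
    and F_diff: "1 \<le> k \<Longrightarrow> x \<in> F k i \<Longrightarrow> diff L i x \<in> F k (i + 1)"
    and F_brkt: "1 \<le> j \<Longrightarrow> 1 \<le> k \<Longrightarrow> x \<in> F j a \<Longrightarrow> y \<in> F k b \<Longrightarrow> brkt L a b x y \<in> F (j + k) (a + b)"

lemma (in art_algebra) nil_dgla_tens:
  assumes "is_dgla L"
  obtains N where "nil_dgla (tens L A) (\<lambda>k i. tfilt (gscale L) (gcomp L i) A k) N"
proof -
  interpret dgla L by unfold_locales fact
  interpret T: dgla "tens L A" by unfold_locales (rule is_dgla_tens[OF assms])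
  obtain N where N: "1 \<le> N" "\<And>V. tfilt (gscale L) V A N = {0}" using tfilt_nilpotent by blast
  have "nil_dgla (tens L A) (\<lambda>k i. tfilt (gscale L) (gcomp L i) A k) N"
  proof (rule nil_dgla.intro[OF T.dgla_axioms], rule nil_dgla_axioms.intro)
    show "csub (gscale (tens L A)) (tfilt (gscale L) (gcomp L i) A k)" if "1 \<le> k" for k i
      unfolding tens_simps by (rule csub_tfilt[OF csub that])
    show "tfilt (gscale L) (gcomp L i) A 1 = gcomp (tens L A) i" for i
      unfolding tens_simps by (rule tfilt_1)
    show "tfilt (gscale L) (gcomp L i) A k \<subseteq> tfilt (gscale L) (gcomp L i) A j" if "j \<le> k" for i j k
      by (rule tfilt_antimono[OF that])
    show "tfilt (gscale L) (gcomp L i) A N = {0}" for i by (rule N(2))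
    show "1 \<le> N" by (rule N(1))
    show "diff (tens L A) i X \<in> tfilt (gscale L) (gcomp L (i + 1)) A k"
      if "1 \<le> k" "X \<in> tfilt (gscale L) (gcomp L i) A k" for k X i
      unfolding tens_simps by (rule tlift_tfilt[OF linear_diff that])
    show "brkt (tens L A) a b X Y \<in> tfilt (gscale L) (gcomp L (a + b)) A (j + k)"
      if "1 \<le> j" "1 \<le> k" "X \<in> tfilt (gscale L) (gcomp L a) A j" "Y \<in> tfilt (gscale L) (gcomp L b) A k"
      for j k X a Y b
      unfolding tens_simps by (rule tlift2_tfilt[OF csub bilinear_brkt that])
  qed
  then show thesis by (rule that)
qed

context nil_dgla
begin

lemma F_in: "1 \<le> k \<Longrightarrow> x \<in> F k i \<Longrightarrow> x \<in> gcomp L i"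
  using F_antimono[of 1 k i] F_1 by auto

lemma F_0: "1 \<le> k \<Longrightarrow> 0 \<in> F k i"
  and F_add: "1 \<le> k \<Longrightarrow> x \<in> F k i \<Longrightarrow> y \<in> F k i \<Longrightarrow> x + y \<in> F k i"
  and F_sub: "1 \<le> k \<Longrightarrow> x \<in> F k i \<Longrightarrow> y \<in> F k i \<Longrightarrow> x - y \<in> F k i"
  and F_minus: "1 \<le> k \<Longrightarrow> x \<in> F k i \<Longrightarrow> - x \<in> F k i"
  and F_scale: "1 \<le> k \<Longrightarrow> x \<in> F k i \<Longrightarrow> gscale L c x \<in> F k i"
  and F_sum: "1 \<le> k \<Longrightarrow> (\<And>a. a \<in> S \<Longrightarrow> f a \<in> F k i) \<Longrightarrow> sum f S \<in> F k i"
proof -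
  assume "1 \<le> k"
  then interpret Fk: csub "gscale L" "F k i" by (rule F_csub)
  show "0 \<in> F k i" "x \<in> F k i \<Longrightarrow> y \<in> F k i \<Longrightarrow> x + y \<in> F k i"
    "x \<in> F k i \<Longrightarrow> y \<in> F k i \<Longrightarrow> x - y \<in> F k i" "x \<in> F k i \<Longrightarrow> - x \<in> F k i"
    "x \<in> F k i \<Longrightarrow> gscale L c x \<in> F k i"
    "(\<And>a. a \<in> S \<Longrightarrow> f a \<in> F k i) \<Longrightarrow> sum f S \<in> F k i"
    by auto
qed

lemma F_le: "1 \<le> j \<Longrightarrow> j \<le> k \<Longrightarrow> x \<in> F k i \<Longrightarrow> x \<in> F j i"
  using F_antimono by blast

lemma F_large: "N \<le> k \<Longrightarrow> x \<in> F k i \<Longrightarrow> x = 0"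
  using F_le[of N k x i] N F_N by auto

lemma F_brkt_right: "1 \<le> k \<Longrightarrow> x \<in> gcomp L a \<Longrightarrow> y \<in> F k b \<Longrightarrow> brkt L a b x y \<in> F (Suc k) (a + b)"
  and F_brkt_left: "1 \<le> k \<Longrightarrow> x \<in> F k a \<Longrightarrow> y \<in> gcomp L b \<Longrightarrow> brkt L a b x y \<in> F (Suc k) (a + b)"
  using F_brkt[of 1 k x a y b] F_brkt[of k 1 x a y b] by (simp_all add: F_1[unfolded One_nat_def])

lemma eq_of_F: "(\<And>k. 1 \<le> k \<Longrightarrow> x - y \<in> F k i) \<Longrightarrow> x = y"
  using F_large[of N "x - y"] N by fastforce

text \<open>The fixed point theorem of Banach for the filtration: consecutive iterates starting from
  0 agree modulo ever higher steps, hence exactly after N of them.\<close>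

lemma contraction_fixpoint:
  assumes G: "\<And>x. x \<in> gcomp L i \<Longrightarrow> G x \<in> gcomp L i"
    and contr: "\<And>k x y. 1 \<le> k \<Longrightarrow> x \<in> gcomp L i \<Longrightarrow> y \<in> gcomp L i \<Longrightarrow> x - y \<in> F k i \<Longrightarrow>
      G x - G y \<in> F (Suc k) i"
  shows contraction_fixpoint_exists: "\<exists>x\<in>gcomp L i. G x = x"
    and contraction_fixpoint_unique: "\<And>x y. x \<in> gcomp L i \<Longrightarrow> y \<in> gcomp L i \<Longrightarrow> G x = x \<Longrightarrow> G y = y \<Longrightarrow> x = y"
proof -
  have in': "(G ^^ n) 0 \<in> gcomp L i" for n by (induction n) (auto intro: G)
  have "(G ^^ Suc n) 0 - (G ^^ n) 0 \<in> F (Suc n) i" for n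
  proof (induction n)
    case 0
    then show ?case using in'[of 1] by (simp add: F_1[unfolded One_nat_def])
  next
    case (Suc n)
    from contr[OF _ in' in' this] show ?case by simp
  qed
  from F_large[OF _ this[of N]] in' show "\<exists>x\<in>gcomp L i. G x = x"
    by (intro bexI[of _ "(G ^^ N) 0"]) auto
  fix x y assume xy: "x \<in> gcomp L i" "y \<in> gcomp L i" "G x = x" "G y = y"
  have "x - y \<in> F (Suc k) i" for k
  proof (induction k)
    case 0
    then show ?case using xy by (simp add: F_1[unfolded One_nat_def])
  next
    case (Suc k)
    from contr[OF _ xy(1,2) this] xy(3,4) show ?case by simp
  qed
  then show "x = y" by (intro eq_of_F[of x y i]) (metis Suc_pred' less_eq_Suc_le One_nat_def)
qed

section \<open>Gauge action\<close>

definition gterm :: "'v \<Rightarrow> 'v \<Rightarrow> nat \<Rightarrow> 'v" where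
  "gterm a x n = (brkt L 0 1 a ^^ n) (brkt L 0 1 a x - diff L 0 a)"

definition gauge :: "'v \<Rightarrow> 'v \<Rightarrow> 'v" where
  "gauge a x = x + (\<Sum>n<N. gscale L (1 / fact (n + 1)) (gterm a x n))"

definition MC :: "'v \<Rightarrow> bool" where
  "MC x \<longleftrightarrow> x \<in> gcomp L 1 \<and> diff L 1 x + gscale L (1 / 2) (brkt L 1 1 x x) = 0"

lemma gterm_Suc: "gterm a x (Suc n) = brkt L 0 1 a (gterm a x n)"
  by (simp add: gterm_def)

lemma gterm_F: "a \<in> gcomp L 0 \<Longrightarrow> x \<in> gcomp L 1 \<Longrightarrow> gterm a x n \<in> F (Suc n) 1"
proof (induction n)
  case 0
  then show ?case using brkt_in[of a 0 x 1 1] diff_in[of a 0 1]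
    by (simp add: gterm_def F_1[unfolded One_nat_def])
next
  case (Suc n)
  then show ?case using F_brkt_right[of "Suc n" a 0 "gterm a x n" 1] by (simp add: gterm_Suc)
qed

lemma gterm_in: "a \<in> gcomp L 0 \<Longrightarrow> x \<in> gcomp L 1 \<Longrightarrow> gterm a x n \<in> gcomp L 1"
  using F_in[OF _ gterm_F] by simp

lemma gauge_in: "a \<in> gcomp L 0 \<Longrightarrow> x \<in> gcomp L 1 \<Longrightarrow> gauge a x \<in> gcomp L 1"
  by (auto simp: gauge_def gterm_in)

text \<open>Allows comparison with partial sums of any greater length, in particular between
  algebras whose nilpotency indices differ.\<close>

lemma gauge_sum:
  assumes "a \<in> gcomp L 0" "x \<in> gcomp L 1" "N \<le> M"
  shows "x + (\<Sum>n<M. gscale L (1 / fact (n + 1)) (gterm a x n)) = gauge a x"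
proof -
  have "gterm a x n = 0" if "N \<le> n" for n
    using F_large[OF _ gterm_F[OF assms(1,2), of n]] that by simp
  then have "(\<Sum>n<M. gscale L (1 / fact (n + 1)) (gterm a x n)) = (\<Sum>n<N. gscale L (1 / fact (n + 1)) (gterm a x n))"
    using assms(3) by (intro sum.mono_neutral_right) auto
  then show ?thesis by (simp add: gauge_def)
qed

text \<open>
  Adjoining the differential to the DGLA turns the gauge action into the exponential of
  \<open>ad\<^sub>a\<close> applied to \<open>x + d\<close>; \<open>gX\<close> lists the iterates (with the coefficient of \<open>d\<close> in \<open>gc\<close>), and
  \<open>gQ\<close> is the bracket of the extended algebra, on which \<open>ad\<^sub>a\<close> acts as a derivation.
\<close>

definition gX :: "'v \<Rightarrow> 'v \<Rightarrow> nat \<Rightarrow> 'v" where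
  "gX a x n = (case n of 0 \<Rightarrow> x | Suc m \<Rightarrow> gterm a x m)"

definition gc :: "nat \<Rightarrow> complex" where
  "gc n = (if n = 0 then 1 else 0)"

definition gQ :: "'v \<Rightarrow> 'v \<Rightarrow> nat \<Rightarrow> nat \<Rightarrow> 'v" where
  "gQ a x i j = brkt L 1 1 (gX a x i) (gX a x j) + gscale L (gc i) (diff L 1 (gX a x j)) +
     gscale L (gc j) (diff L 1 (gX a x i))"

lemma half_eqI:
  assumes "b + d + d = 0"
  shows "d + gscale L (1 / 2) b = 0"
proof -
  have "gscale L (1 / 2) (b + d + d) = gscale L (1 / 2) b + (gscale L (1 / 2) d + gscale L (1 / 2) d)"
    by (simp add: scale_right_distrib)
  also have "gscale L (1 / 2) d + gscale L (1 / 2) d = d"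
    using scale_left_distrib[of "1/2" "1/2" d] by simp
  finally show ?thesis using assms by (simp add: add.commute)
qed

lemma brkt_odd_sym: "x \<in> gcomp L 1 \<Longrightarrow> y \<in> gcomp L 1 \<Longrightarrow> brkt L 1 1 x y = brkt L 1 1 y x"
  using brkt_anti[of x 1 y 1] by (simp add: ksgn_def)

context
  fixes a x assumes a: "a \<in> gcomp L 0" and x: "x \<in> gcomp L 1"
begin

lemma gX_in: "gX a x n \<in> gcomp L 1"
  using x gterm_in[OF a x] by (auto simp: gX_def split: nat.split)

lemma gX_F: "gX a x (Suc n) \<in> F (Suc n) 1"
  using gterm_F[OF a x] by (simp add: gX_def)

text \<open>The extra term at n = 0 comes from the adjoined symbol d, whose bracket with a is -
  da.\<close>

lemma brkt_gX: "brkt L 0 1 a (gX a x n) = gX a x (Suc n) + gscale L (gc n) (diff L 0 a)"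
  by (cases n) (simp_all add: gX_def gc_def gterm_Suc, simp add: gterm_def)

text \<open>The derivation property combines the Jacobi identity for two vectors with the Leibniz
  rule for the terms in d; the brackets with da that the two produce cancel.\<close>

lemma brkt_gQ: "brkt L 0 2 a (gQ a x i j) = gQ a x (Suc i) j + gQ a x i (Suc j)"
proof -
  let ?X = "gX a x" and ?s = "gscale L"
  note X = gX_in
  have da: "diff L 0 a \<in> gcomp L 1" using a by (simp add: diff_in)
  have b2: "brkt L 1 1 u v \<in> gcomp L 2" if "u \<in> gcomp L 1" "v \<in> gcomp L 1" for u v
    using that by (simp add: brkt_in)
  have d2: "diff L 1 u \<in> gcomp L 2" if "u \<in> gcomp L 1" for u using that by (simp add: diff_in)
  have J: "brkt L 0 2 a (brkt L 1 1 (?X i) (?X j)) =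
      brkt L 1 1 (brkt L 0 1 a (?X i)) (?X j) + brkt L 1 1 (?X i) (brkt L 0 1 a (?X j))"
    using jacobi[OF a X[of i] X[of j]] by (simp add: ksgn_def)
  have J1: "brkt L 1 1 (brkt L 0 1 a (?X i)) (?X j) = brkt L 1 1 (?X (Suc i)) (?X j) + ?s (gc i) (brkt L 1 1 (diff L 0 a) (?X j))"
    unfolding brkt_gX using X[of "Suc i"] X[of j] da by (simp add: brkt_left scale_in)
  have J2: "brkt L 1 1 (?X i) (brkt L 0 1 a (?X j)) = brkt L 1 1 (?X i) (?X (Suc j)) + ?s (gc j) (brkt L 1 1 (diff L 0 a) (?X i))"
    unfolding brkt_gX using X[of "Suc j"] X[of i] da by (simp add: brkt_right scale_in brkt_odd_sym[of "?X i" "diff L 0 a"])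
  have D: "brkt L 0 2 a (diff L 1 (?X k)) = diff L 1 (?X (Suc k)) - brkt L 1 1 (diff L 0 a) (?X k)" for k
  proof -
    have "diff L 1 (brkt L 0 1 a (?X k)) = brkt L 1 1 (diff L 0 a) (?X k) + brkt L 0 2 a (diff L 1 (?X k))"
      using leibniz[OF a X[of k]] by (simp add: ksgn_def)
    moreover have "diff L 1 (brkt L 0 1 a (?X k)) = diff L 1 (?X (Suc k))"
      unfolding brkt_gX using X[of "Suc k"] da diff_diff[OF a] by (simp add: diff_add diff_scale scale_in)
    ultimately show ?thesis by (simp add: algebra_simps)
  qed
  have "brkt L 0 2 a (gQ a x i j) = brkt L 0 2 a (brkt L 1 1 (?X i) (?X j)) +
      ?s (gc i) (brkt L 0 2 a (diff L 1 (?X j))) + ?s (gc j) (brkt L 0 2 a (diff L 1 (?X i)))"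
    unfolding gQ_def using a b2[OF X X] d2[OF X] by (simp add: brkt_right add_in scale_in)
  also have "\<dots> = gQ a x (Suc i) j + gQ a x i (Suc j)"
    unfolding J J1 J2 D gQ_def by (simp add: gc_def scale_right_diff_distrib algebra_simps)
  finally show ?thesis .
qed

lemma gQ_in: "gQ a x i j \<in> gcomp L 2"
  unfolding gQ_def using gX_in brkt_in[of _ 1 _ 1 2] diff_in[of _ 1 2] by (intro add_in scale_in) auto

lemma gQ_zero: "N \<le> i + j \<Longrightarrow> gQ a x i j = 0"
proof -
  assume *: "N \<le> i + j"
  show ?thesis
  proof (cases i)
    case i: 0
    then obtain m where j: "j = Suc m" using * N by (cases j) auto
    have "gX a x j = 0" using F_large[OF _ gX_F[of m]] * i j by simp
    then show ?thesis using gX_in[of i] by (simp add: gQ_def j gc_def brkt_right)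
  next
    case i: (Suc k)
    show ?thesis
    proof (cases j)
      case j: 0
      have "gX a x i = 0" using F_large[OF _ gX_F[of k]] * i j by simp
      then show ?thesis using gX_in[of j] by (simp add: gQ_def i gc_def brkt_left)
    next
      case j: (Suc m)
      have "brkt L 1 1 (gX a x i) (gX a x j) \<in> F (i + j) 2"
        using F_brkt[OF _ _ gX_F[of k] gX_F[of m]] i j by simp
      then have "brkt L 1 1 (gX a x i) (gX a x j) = 0" using F_large * by blast
      then show ?thesis by (simp add: gQ_def i j gc_def)
    qed
  qed
qed

text \<open>With d adjoined, the Maurer-Cartan equation says that x + d has zero bracket with
  itself, and e^a preserves this. In components: \<open>T n\<close> is the part of order n in a of
  the bracket of e^a(x + d) with itself, and (n + 1) T(n + 1) = [a, T(n)], so all of them vanish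
  together with \<open>T 0\<close>.\<close>

lemma gauge_MC:
  assumes MC: "MC x"
  shows "MC (gauge a x)"
proof -
  let ?s = "gscale L" and ?X = "gX a x"
  define r where "r k l = ?s (1 / (fact k * fact l)) (gQ a x k l)" for k l
  define T where "T n = (\<Sum>k\<le>n. r k (n - k))" for n
  have r_in: "r k l \<in> gcomp L 2" for k l by (auto simp: r_def gQ_in)
  have br: "brkt L 0 2 a (r k l) = ?s (of_nat (Suc k)) (r (Suc k) l) + ?s (of_nat (Suc l)) (r k (Suc l))" for k l
    using a gQ_in[of k l] by (simp add: r_def brkt_right brkt_gQ scale_right_distrib del: of_nat_Suc)
  \<comment> \<open>At indices 0 both arguments contain d with coefficient 1, so the extended
    bracket is twice the Maurer-Cartan expression.\<close>
  have "gQ a x 0 0 = ?s 2 (diff L 1 x + ?s (1 / 2) (brkt L 1 1 x x))"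
    by (simp add: gQ_def gX_def gc_def scale_right_distrib scale_left_distrib[of 1 1, simplified])
  then have T0: "T 0 = 0" using MC by (simp add: T_def r_def MC_def)
  have T: "T n = 0" for n
  proof (induction n)
    case (Suc n)
    have "brkt L 0 2 a (T n) = (\<Sum>k\<le>n. ?s (of_nat (Suc k)) (r (Suc k) (n - k))) +
        (\<Sum>k\<le>n. ?s (of_nat (Suc (n - k))) (r k (Suc (n - k))))"
      unfolding T_def using a r_in by (simp only: brkt_right br sum.distrib)
    also have "(\<Sum>k\<le>n. ?s (of_nat (Suc k)) (r (Suc k) (n - k))) = (\<Sum>k\<le>Suc n. ?s (of_nat k) (r k (Suc n - k)))"
      by (simp add: sum.atMost_Suc_shift del: of_nat_Suc sum.atMost_Suc)
    also have "(\<Sum>k\<le>n. ?s (of_nat (Suc (n - k))) (r k (Suc (n - k)))) = (\<Sum>k\<le>Suc n. ?s (of_nat (Suc n - k)) (r k (Suc n - k)))"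
    proof -
      have "(\<Sum>k\<le>n. ?s (of_nat (Suc (n - k))) (r k (Suc (n - k)))) = (\<Sum>k\<le>n. ?s (of_nat (Suc n - k)) (r k (Suc n - k)))"
        by (rule sum.cong[OF HOL.refl]) (simp only: Suc_diff_le atMost_iff)
      then show ?thesis by (simp del: of_nat_Suc)
    qed
    also have "(\<Sum>k\<le>Suc n. ?s (of_nat k) (r k (Suc n - k))) + (\<Sum>k\<le>Suc n. ?s (of_nat (Suc n - k)) (r k (Suc n - k))) =
        (\<Sum>k\<le>Suc n. ?s (of_nat (Suc n)) (r k (Suc n - k)))"
      unfolding sum.distrib[symmetric] scale_left_distrib[symmetric] of_nat_add[symmetric]
      by (rule sum.cong) (auto simp del: of_nat_Suc)
    also have "\<dots> = ?s (of_nat (Suc n)) (T (Suc n))"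
      by (simp only: T_def scale_sum_right)
    finally have "?s (of_nat (Suc n)) (T (Suc n)) = 0" using Suc a by (simp add: brkt_right del: of_nat_Suc)
    then show ?case by (simp del: of_nat_Suc)
  qed (rule T0)
  \<comment> \<open>Index k = 0 stands for x itself and k = n + 1 for \<open>gterm a x n\<close>, so
    the sum has one summand more than the series in \<open>gauge\<close>, with the same
    factorials.\<close>
  let ?M = "Suc N"
  let ?Y = "\<Sum>k<?M. ?s (1 / fact k) (?X k)"
  have Y: "?Y = gauge a x"
    by (simp add: gauge_def gX_def sum.lessThan_Suc_shift del: sum.lessThan_Suc fact_Suc)
  have YX: "?s (1 / fact k) (?X k) \<in> gcomp L 1" for k by (simp add: gX_in)
  have Yin: "?Y \<in> gcomp L 1" using YX by blast
  have gQ_less: "gQ a x k l \<noteq> 0 \<Longrightarrow> k + l < ?M" for k l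
    using gQ_zero[of k l] by (cases "N \<le> k + l") auto
  have "(\<Sum>k<?M. \<Sum>l<?M. r k l) = (\<Sum>(k, l)\<in>{..<?M} \<times> {..<?M}. r k l)"
    by (simp only: sum.cartesian_product)
  \<comment> \<open>Outside the triangle the brackets vanish by nilpotency; inside, the summation
    regroups into the diagonals \<open>T n\<close>.\<close>
  also have "\<dots> = (\<Sum>(k, l)\<in>{(k, l). k + l < ?M}. r k l)"
    by (rule sum.mono_neutral_right) (auto simp: r_def dest: gQ_less)
  also have "\<dots> = (\<Sum>n<?M. T n)" unfolding T_def by (rule sum.triangle_reindex)
  also have "\<dots> = 0" by (simp add: T)
  finally have zero: "(\<Sum>k<?M. \<Sum>l<?M. r k l) = 0" .
  have inner: "(\<Sum>l<?M. r k l) = ?s (1 / fact k) (brkt L 1 1 (?X k) ?Y + ?s (gc k) (diff L 1 ?Y) + diff L 1 (?X k))" for k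
  proof -
    have D: "diff L 1 ?Y = (\<Sum>l<?M. ?s (1 / fact l) (diff L 1 (?X l)))"
      using YX gX_in by (simp add: linear_between_sum[OF linear_diff] diff_scale del: sum.lessThan_Suc)
    have B: "brkt L 1 1 (?X k) ?Y = (\<Sum>l<?M. ?s (1 / fact l) (brkt L 1 1 (?X k) (?X l)))"
      using YX gX_in by (simp add: brkt_right(6)[OF gX_in] brkt_right(3)[OF gX_in] del: sum.lessThan_Suc)
    have "(\<Sum>l<?M. ?s (1 / fact l * gc l) (diff L 1 (?X k))) = (\<Sum>l<?M. if l = 0 then diff L 1 (?X k) else 0)"
      by (rule sum.cong) (auto simp: gc_def)
    then have G: "(\<Sum>l<?M. ?s (1 / fact l * gc l) (diff L 1 (?X k))) = diff L 1 (?X k)"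
      by (simp del: sum.lessThan_Suc)
    have "?s (1 / fact k) (brkt L 1 1 (?X k) ?Y + ?s (gc k) (diff L 1 ?Y) + diff L 1 (?X k)) =
        ?s (1 / fact k) ((\<Sum>l<?M. ?s (1 / fact l) (brkt L 1 1 (?X k) (?X l))) +
          ?s (gc k) (\<Sum>l<?M. ?s (1 / fact l) (diff L 1 (?X l))) +
          (\<Sum>l<?M. ?s (1 / fact l * gc l) (diff L 1 (?X k))))"
      by (simp only: B D G)
    also have "\<dots> = (\<Sum>l<?M. r k l)"
      unfolding r_def gQ_def
      by (simp add: scale_sum_right sum.distrib scale_right_distrib mult.commute del: sum.lessThan_Suc)
    finally show ?thesis by (rule HOL.sym)
  qed
  have "(\<Sum>k<?M. \<Sum>l<?M. r k l) = brkt L 1 1 ?Y ?Y + diff L 1 ?Y + diff L 1 ?Y"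
  proof -
    have 1: "diff L 1 ?Y = (\<Sum>l<?M. ?s (1 / fact l) (diff L 1 (?X l)))"
      using YX gX_in by (simp add: linear_between_sum[OF linear_diff] diff_scale del: sum.lessThan_Suc)
    have "brkt L 1 1 (\<Sum>k<?M. ?s (1 / fact k) (?X k)) ?Y = (\<Sum>k<?M. ?s (1 / fact k) (brkt L 1 1 (?X k) ?Y))"
      using YX gX_in by (simp add: brkt_left(6)[OF Yin] brkt_left(3)[OF Yin] del: sum.lessThan_Suc)
    moreover have "(\<Sum>l<?M. ?s (1 / fact l * gc l) (diff L 1 ?Y)) = diff L 1 ?Y"
    proof -
      have "(\<Sum>l<?M. ?s (1 / fact l * gc l) (diff L 1 ?Y)) = (\<Sum>l<?M. if l = 0 then diff L 1 ?Y else 0)"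
        by (rule sum.cong) (auto simp: gc_def)
      then show ?thesis by (simp del: sum.lessThan_Suc)
    qed
    ultimately show ?thesis
      unfolding inner using 1 by (simp add: sum.distrib scale_right_distrib del: sum.lessThan_Suc)
  qed
  with zero have "brkt L 1 1 ?Y ?Y + diff L 1 ?Y + diff L 1 ?Y = 0" by simp
  then have "diff L 1 ?Y + ?s (1 / 2) (brkt L 1 1 ?Y ?Y) = 0" by (rule half_eqI)
  then show ?thesis using Yin unfolding MC_def Y by blast
qed

end

lemma gauge_zero: "x \<in> gcomp L 1 \<Longrightarrow> gauge 0 x = x"
proof -
  assume x: "x \<in> gcomp L 1"
  have "gterm 0 x n = 0" for n
    by (induction n) (use x brkt_left(5)[of _ 1 0] in \<open>simp_all add: gterm_Suc, simp add: gterm_def\<close>)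
  then show ?thesis by (simp add: gauge_def)
qed

text \<open>Every term of index at least 1 has an outer bracket with a, which gains one filtration
  step. The term of index 0 contains - da, where nothing is gained; hence the statement starts at
  \<open>Suc n\<close>.\<close>

lemma gterm_contract:
  assumes a: "a \<in> gcomp L 0" "b \<in> gcomp L 0" and x: "x \<in> gcomp L 1" and k: "1 \<le> k" and ab: "a - b \<in> F k 0"
  shows "gterm a x (Suc n) - gterm b x (Suc n) \<in> F (Suc k) 1"
proof -
  have le: "u \<in> F k 1" if "u \<in> F (Suc k) 1" for u using F_le[OF k _ that] by simp
  have "gterm a x n - gterm b x n \<in> F k 1" for n
  proof (induction n)
    case 0
    have "gterm a x 0 - gterm b x 0 = brkt L 0 1 (a - b) x - diff L 0 (a - b)"
      using a x by (simp add: gterm_def brkt_left diff_sub)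
    moreover have "brkt L 0 1 (a - b) x \<in> F k 1" using F_brkt_left[OF k ab x] le by simp
    moreover have "diff L 0 (a - b) \<in> F k 1" using F_diff[OF k ab] by simp
    ultimately show ?case using F_sub[OF k] by simp
  next
    case (Suc n)
    have "gterm a x (Suc n) - gterm b x (Suc n) =
        brkt L 0 1 (a - b) (gterm a x n) + brkt L 0 1 b (gterm a x n - gterm b x n)"
      using a x gterm_in[OF a(1) x] gterm_in[OF a(2) x] by (simp add: gterm_Suc brkt_left brkt_right)
    moreover have "brkt L 0 1 (a - b) (gterm a x n) \<in> F k 1"
      using F_brkt_left[OF k ab gterm_in[OF a(1) x]] le by simp
    moreover have "brkt L 0 1 b (gterm a x n - gterm b x n) \<in> F k 1"
      using F_brkt_right[OF k a(2) Suc] le by simp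
    ultimately show ?case using F_add[OF k] by simp
  qed
  note D = this
  have "gterm a x (Suc n) - gterm b x (Suc n) =
      brkt L 0 1 (a - b) (gterm a x n) + brkt L 0 1 b (gterm a x n - gterm b x n)"
    using a x gterm_in[OF a(1) x] gterm_in[OF a(2) x] by (simp add: gterm_Suc brkt_left brkt_right)
  moreover have "brkt L 0 1 (a - b) (gterm a x n) \<in> F (Suc k) 1"
    using F_brkt_left[OF k ab gterm_in[OF a(1) x]] by simp
  moreover have "brkt L 0 1 b (gterm a x n - gterm b x n) \<in> F (Suc k) 1"
    using F_brkt_right[OF k a(2) D] by simp
  ultimately show ?thesis using F_add[of "Suc k"] by simp
qed

text \<open>
  On the image of \<open>K\<close> the condition \<open>K (e\<^sup>a * x) = 0\<close> is a fixed point equation for \<open>a\<close>, whose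
  right hand side is contracting for the nilpotent filtration.
\<close>

context
  fixes K :: "'v \<Rightarrow> 'v"
  assumes K_lin: "linear_between (gscale L) (gcomp L 1) (gscale L) (gcomp L 0) K"
    and K_F: "\<And>k x. 1 \<le> k \<Longrightarrow> x \<in> F k 1 \<Longrightarrow> K x \<in> F k 0"
    and KdK: "\<And>x. x \<in> gcomp L 1 \<Longrightarrow> K (diff L 0 (K x)) = - K x"
begin

lemma gauge_fix:
  assumes x: "x \<in> gcomp L 1"
  shows gauge_fix_exists: "\<exists>b\<in>gcomp L 1. K (gauge (K b) x) = 0"
    and gauge_fix_unique: "\<And>b c. b \<in> gcomp L 1 \<Longrightarrow> c \<in> gcomp L 1 \<Longrightarrow> K (gauge (K b) x) = 0 \<Longrightarrow>
      K (gauge (K c) x) = 0 \<Longrightarrow> K b = K c"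
proof -
  note Ks = linear_betweenD[OF K_lin] linear_between_minus[OF K_lin] linear_between_diff[OF K_lin]
  \<comment> \<open>Everything in e^a * x except the term - da, the one that does not
    contract.\<close>
  define R where "R a = x + brkt L 0 1 a x + (\<Sum>n\<in>{1..<N}. gscale L (1 / fact (n + 1)) (gterm a x n))" for a
  have R_in: "R a \<in> gcomp L 1" if "a \<in> gcomp L 0" for a
    unfolding R_def using that x gterm_in[OF that x] brkt_in[of a 0 x 1 1] by (intro add_in sum_in scale_in) auto
  have gauge_R: "gauge a x = R a - diff L 0 a" if "a \<in> gcomp L 0" for a
  proof -
    have "{..<N} = insert 0 {1..<N}" using N by auto
    then have "(\<Sum>n<N. gscale L (1 / fact (n + 1)) (gterm a x n)) =
        gterm a x 0 + (\<Sum>n\<in>{1..<N}. gscale L (1 / fact (n + 1)) (gterm a x n))" by simp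
    then show ?thesis by (simp add: gauge_def R_def gterm_def)
  qed
  define G where "G a = - K (R a)" for a
  have G_in: "G a \<in> gcomp L 0" if "a \<in> gcomp L 0" for a
    using R_in[OF that] Ks(1) by (simp add: G_def)
  have contr: "G a - G b \<in> F (Suc k) 0"
    if k: "1 \<le> k" and ab: "a \<in> gcomp L 0" "b \<in> gcomp L 0" "a - b \<in> F k 0" for k a b
  proof -
    have "R a - R b = brkt L 0 1 (a - b) x +
        (\<Sum>n\<in>{1..<N}. gscale L (1 / fact (n + 1)) (gterm a x n - gterm b x n))"
      using ab x by (simp add: R_def brkt_left scale_right_diff_distrib sum_subtractf)
    moreover have "gterm a x n - gterm b x n \<in> F (Suc k) 1" if "n \<in> {1..<N}" for n
      using gterm_contract[OF ab(1,2) x k ab(3), of "n - 1"] that by simp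
    moreover have "brkt L 0 1 (a - b) x \<in> F (Suc k) 1" using F_brkt_left[OF k ab(3) x] by simp
    ultimately have *: "R a - R b \<in> F (Suc k) 1"
      by (auto intro!: F_add F_sum F_scale)
    have "G a - G b = - K (R a - R b)" using R_in ab by (simp add: G_def Ks)
    with K_F[OF _ *] F_minus[of "Suc k"] show ?thesis by simp
  qed
  \<comment> \<open>For a in the image of \<open>K\<close> the identity KdK = -K sends the separated
    term - da to + a, which gives the fixed point form of the equation.\<close>
  have fix_iff: "K (gauge a x) = 0 \<longleftrightarrow> G a = a" if "b \<in> gcomp L 1" "a = K b" for a b
  proof -
    have a: "a \<in> gcomp L 0" using that Ks(1) by simp
    have "K (gauge a x) = K (R a) - K (diff L 0 a)"
      using R_in[OF a] diff_in[OF a] by (simp add: gauge_R[OF a] Ks)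
    also have "\<dots> = K (R a) + a" using KdK[OF that(1)] that(2) by simp
    finally show ?thesis by (auto simp: G_def eq_neg_iff_add_eq_0 neg_eq_iff_add_eq_0)
  qed
  have "\<exists>a\<in>gcomp L 0. G a = a" by (rule contraction_fixpoint_exists) (auto intro: G_in contr)
  then obtain a where a: "a \<in> gcomp L 0" "G a = a" by blast
  have Rm: "- R a \<in> gcomp L 1" using R_in[OF a(1)] by simp
  \<comment> \<open>A fixed point lies in the image of \<open>K\<close> automatically, so the
    equation may be solved in the whole of degree 0.\<close>
  have "a = K (- R a)" using a R_in[OF a(1)] by (simp add: G_def Ks)
  with fix_iff[OF Rm, of a] a(2) Rm show "\<exists>b\<in>gcomp L 1. K (gauge (K b) x) = 0" by metis
  fix b c assume bc: "b \<in> gcomp L 1" "c \<in> gcomp L 1" "K (gauge (K b) x) = 0" "K (gauge (K c) x) = 0"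
  then have "K b \<in> gcomp L 0" "K c \<in> gcomp L 0" "G (K b) = K b" "G (K c) = K c"
    using fix_iff[OF bc(1) HOL.refl] fix_iff[OF bc(2) HOL.refl] Ks(1) by auto
  then show "K b = K c" by (rule contraction_fixpoint_unique[rotated 2]) (auto intro: G_in contr)
qed

end

end

lemma gauge_hom:
  assumes "nil_dgla L F N" "nil_dgla M F' N'" and f: "dgla_hom f L M"
    and a: "a \<in> gcomp L 0" and x: "x \<in> gcomp L 1"
  shows "f 1 (nil_dgla.gauge L N a x) = nil_dgla.gauge M N' (f 0 a) (f 1 x)"
proof -
  interpret L: nil_dgla L F N by fact
  interpret M: nil_dgla M F' N' by fact
  note l = dgla_homD(1)[OF f]
  note ls = linear_betweenD[OF l] L.linear_between_diff[OF l] L.linear_between_sum[OF l]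
  have fa: "f 0 a \<in> gcomp M 0" and fx: "f 1 x \<in> gcomp M 1" using a x ls(1) by auto
  have t: "f 1 (L.gterm a x n) = M.gterm (f 0 a) (f 1 x) n" for n
  proof (induction n)
    case 0
    have "L.gterm a x 0 = brkt L 0 1 a x - diff L 0 a" by (simp add: L.gterm_def)
    moreover have "f 1 (brkt L 0 1 a x) = brkt M 0 1 (f 0 a) (f 1 x)"
      using dgla_homD(3)[OF f a x] by simp
    moreover have "f 1 (diff L 0 a) = diff M 0 (f 0 a)" using dgla_homD(2)[OF f a] by simp
    ultimately show ?case
      using L.brkt_in[OF a x, of 1] L.diff_in[OF a, of 1] by (simp add: M.gterm_def ls)
  next
    case (Suc n)
    have "f 1 (L.gterm a x (Suc n)) = brkt M 0 1 (f 0 a) (f 1 (L.gterm a x n))"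
      using dgla_homD(3)[OF f a L.gterm_in[OF a x, of n]] by (simp add: L.gterm_Suc)
    then show ?case by (simp add: Suc M.gterm_Suc)
  qed
  \<comment> \<open>The two exponential series are truncated at different indices; both are extended
    to a common length.\<close>
  let ?M = "max N N'"
  have "L.gauge a x = x + (\<Sum>n<?M. gscale L (1 / fact (n + 1)) (L.gterm a x n))"
    using L.gauge_sum[OF a x, of ?M] by simp
  then have "f 1 (L.gauge a x) = f 1 x + (\<Sum>n<?M. gscale M (1 / fact (n + 1)) (M.gterm (f 0 a) (f 1 x) n))"
    using x L.gterm_in[OF a x] by (simp add: ls t)
  then show ?thesis using M.gauge_sum[OF fa fx, of ?M] by simp
qed

lemma MC_hom:
  assumes "nil_dgla L F N" "nil_dgla M F' N'" and f: "dgla_hom f L M" and MC: "nil_dgla.MC L x"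
  shows "nil_dgla.MC M (f 1 x)"
proof -
  interpret L: nil_dgla L F N by fact
  interpret M: nil_dgla M F' N' by fact
  note l = dgla_homD(1)[OF f]
  have x: "x \<in> gcomp L 1" and 0: "diff L 1 x + gscale L (1 / 2) (brkt L 1 1 x x) = 0"
    using MC by (auto simp: L.MC_def)
  have b: "brkt L 1 1 x x \<in> gcomp L 2" and d: "diff L 1 x \<in> gcomp L 2"
    using x by (auto simp: L.brkt_in L.diff_in)
  have "f 2 (diff L 1 x + gscale L (1 / 2) (brkt L 1 1 x x)) = diff M 1 (f 1 x) + gscale M (1 / 2) (brkt M 1 1 (f 1 x) (f 1 x))"
    using dgla_homD(2)[OF f x] dgla_homD(3)[OF f x x] b d
    by (simp add: linear_betweenD(2,3)[OF l])
  then show ?thesis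
    using 0 L.linear_between_0[OF l] linear_betweenD(1)[OF l x] by (simp add: M.MC_def)
qed

section \<open>Transfer of the Maurer-Cartan equation along a contraction\<close>

locale nil_contraction = contraction H V dV \<iota> \<pi> K + nil_dgla H F N
  for H :: "'h::ab_group_add dgla" and V :: "('c::ab_group_add, 'z) graded_scheme"
    and dV \<iota> \<pi> K F N +
  assumes K_F: "1 \<le> k \<Longrightarrow> x \<in> F k i \<Longrightarrow> K i x \<in> F k (i - 1)"
begin

text \<open>The equation arises by applying \<open>K\<close> to the Maurer-Cartan equation under the
  condition K x = 0: the homotopy formula turns K d x into \<iota>\<pi> x - x. Solving it for x is
  the inversion of a Kuranishi map.\<close>

definition lifts :: "'c \<Rightarrow> 'h \<Rightarrow> bool" where
  "lifts v x \<longleftrightarrow> x \<in> gcomp H 1 \<and> x = \<iota> 1 v + gscale H (1 / 2) (K 2 (brkt H 1 1 x x))"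

lemma b2: "x \<in> gcomp H 1 \<Longrightarrow> y \<in> gcomp H 1 \<Longrightarrow> brkt H 1 1 x y \<in> gcomp H 2"
  by (simp add: brkt_in)

lemma K2: "x \<in> gcomp H 2 \<Longrightarrow> K 2 x \<in> gcomp H 1"
  by (simp add: lin_in)

text \<open>The right-hand side is contracting: [x,x] - [y,y] splits into brackets with x - y, each
  of which raises the filtration index, and \<open>K\<close> preserves it.\<close>

lemma lifts_exists: "v \<in> gcomp V 1 \<Longrightarrow> \<exists>x. lifts v x"
  and lifts_unique: "v \<in> gcomp V 1 \<Longrightarrow> lifts v x \<Longrightarrow> lifts v y \<Longrightarrow> x = y"
proof -
  assume v: "v \<in> gcomp V 1"
  define G where "G x = \<iota> 1 v + gscale H (1 / 2) (K 2 (brkt H 1 1 x x))" for x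
  have G: "G x \<in> gcomp H 1" if "x \<in> gcomp H 1" for x
    using that v by (auto simp: G_def lin_in b2 K2)
  have contr: "G x - G y \<in> F (Suc k) 1"
    if "1 \<le> k" "x \<in> gcomp H 1" "y \<in> gcomp H 1" "x - y \<in> F k 1" for k x y
  proof -
    have "brkt H 1 1 x x - brkt H 1 1 y y = brkt H 1 1 (x - y) x + brkt H 1 1 y (x - y)"
      using that by (simp add: brkt_left brkt_right)
    moreover have "brkt H 1 1 (x - y) x + brkt H 1 1 y (x - y) \<in> F (Suc k) 2"
      using F_brkt_left[OF that(1,4,2)] F_brkt_right[OF that(1,3,4)] by (auto intro!: F_add)
    ultimately have "K 2 (brkt H 1 1 x x) - K 2 (brkt H 1 1 y y) \<in> F (Suc k) 1"
      using K_F[of "Suc k" _ 2] that b2 by (simp add: K_simps(4)[symmetric])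
    then show ?thesis
      using F_scale[of "Suc k"] by (simp add: G_def scale_right_diff_distrib[symmetric])
  qed
  have "\<exists>x\<in>gcomp H 1. G x = x" by (rule contraction_fixpoint_exists) (auto intro: G contr)
  then show "\<exists>x. lifts v x" unfolding lifts_def G_def by metis
  assume "lifts v x" "lifts v y"
  then have "x \<in> gcomp H 1" "y \<in> gcomp H 1" "G x = x" "G y = y"
    unfolding lifts_def G_def by metis+
  then show "x = y" by (rule contraction_fixpoint_unique[rotated 2]) (auto intro: G contr)
qed

lemma lifts_proj: "v \<in> gcomp V 1 \<Longrightarrow> lifts v x \<Longrightarrow> \<pi> 1 x = v"
  and lifts_K: "v \<in> gcomp V 1 \<Longrightarrow> lifts v x \<Longrightarrow> K 1 x = 0"
proof -
  assume v: "v \<in> gcomp V 1" and "lifts v x"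
  then have x: "x \<in> gcomp H 1" and eq: "x = \<iota> 1 v + gscale H (1 / 2) (K 2 (brkt H 1 1 x x))"
    by (auto simp: lifts_def)
  have b: "brkt H 1 1 x x \<in> gcomp H 2" by (rule b2[OF x x])
  have "\<pi> 1 x = \<pi> 1 (\<iota> 1 v + gscale H (1 / 2) (K 2 (brkt H 1 1 x x)))" using eq by (rule arg_cong)
  also have "\<dots> = v" using v K2[OF b] proj_K[OF b] by (simp add: proj_simps lin_in proj_incl)
  finally show "\<pi> 1 x = v" .
  have "K 1 x = K 1 (\<iota> 1 v + gscale H (1 / 2) (K 2 (brkt H 1 1 x x)))" using eq by (rule arg_cong)
  also have "\<dots> = 0" using v K2[OF b] K_K[OF b] by (simp add: K_simps lin_in K_incl)
  finally show "K 1 x = 0" .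
qed

lemma MC_lifts:
  assumes "MC x" "K 1 x = 0"
  shows "lifts (\<pi> 1 x) x"
proof -
  have x: "x \<in> gcomp H 1" and "diff H 1 x + gscale H (1 / 2) (brkt H 1 1 x x) = 0"
    using assms by (auto simp: MC_def)
  then have "diff H 1 x = - gscale H (1 / 2) (brkt H 1 1 x x)" by (simp add: eq_neg_iff_add_eq_0)
  then have "K 2 (diff H 1 x) = - gscale H (1 / 2) (K 2 (brkt H 1 1 x x))"
    using b2[OF x x] by (simp add: K_simps)
  with homotopy[OF x] assms(2) have "\<iota> 1 (\<pi> 1 x) - x = - gscale H (1 / 2) (K 2 (brkt H 1 1 x x))"
    by simp
  then show ?thesis using x by (simp add: lifts_def algebra_simps)
qed

text \<open>Let B = [x,x]/2 and let C = dx + B be the curvature. The homotopy formula for B gives C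
  = \<iota>(dv + \<pi>B) - K dB, and the Bianchi identity says dB = [C,x]. If the obstruction dv +
  \<pi>B vanishes, C solves the homogeneous equation C = -K[C,x], which forces C = 0; conversely C =
  0 leaves \<iota> of the obstruction, and \<open>\<pi>\<close> recovers it.\<close>

lemma lifts_MC_iff:
  assumes v: "v \<in> gcomp V 1" and lift: "lifts v x"
  shows "MC x \<longleftrightarrow> dV 1 v + gscale V (1 / 2) (\<pi> 2 (brkt H 1 1 x x)) = 0"
proof -
  have x: "x \<in> gcomp H 1" and eq: "x = \<iota> 1 v + gscale H (1 / 2) (K 2 (brkt H 1 1 x x))"
    using lift by (auto simp: lifts_def)
  define B where "B = gscale H (1 / 2) (brkt H 1 1 x x)"
  define C where "C = diff H 1 x + B"
  have B: "B \<in> gcomp H 2" and Bb: "brkt H 1 1 x x = gscale H 2 B" using b2[OF x x] by (auto simp: B_def)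
  have d2: "diff H 1 x \<in> gcomp H 2" using x by (simp add: diff_in)
  have C: "C \<in> gcomp H 2" using B d2 by (simp add: C_def)
  have xB: "x = \<iota> 1 v + K 2 B" using eq b2[OF x x] by (simp add: B_def K_simps)
  have dVv: "dV 1 v \<in> gcomp V 2" using v by (simp add: lin_in)
  have "diff H 1 x = \<iota> 2 (dV 1 v) + diff H 1 (K 2 B)"
    using xB v diff_incl[OF v] by (metis K2[OF B] diff_add lin_in(1) one_add_one)
  moreover have "diff H 1 (K 2 B) + K 3 (diff H 2 B) = \<iota> 2 (\<pi> 2 B) - B"
    using homotopy[OF B] by simp
  ultimately have 1: "C = \<iota> 2 (dV 1 v + \<pi> 2 B) - K 3 (diff H 2 B)"
    using dVv lin_in(2)[OF B] by (simp add: C_def incl_simps algebra_simps)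
  have b3: "brkt H 2 1 u x \<in> gcomp H 3" if "u \<in> gcomp H 2" for u using that x by (simp add: brkt_in)
  \<comment> \<open>For an odd element the Jacobi identity says three times this bracket is zero,
    and the characteristic is 0.\<close>
  have J: "brkt H 2 1 (brkt H 1 1 x x) x = 0"
  proof -
    define j where "j = brkt H 2 1 (brkt H 1 1 x x) x"
    have j: "j \<in> gcomp H 3" unfolding j_def by (rule b3[OF b2[OF x x]])
    have e1: "brkt H 1 2 x (brkt H 1 1 x x) = j - brkt H 1 2 x (brkt H 1 1 x x)"
      using jacobi[OF x x x] by (simp add: j_def ksgn_def)
    have e2: "brkt H 1 2 x (brkt H 1 1 x x) = - j"
      using brkt_anti[OF x b2[OF x x]] by (simp add: j_def ksgn_def)
    from e1 e2 have "j + j = - j" by simp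
    then have "j + (j + j) = 0" by simp
    then have "gscale H 3 j = 0"
      using scale_left_distrib[of 1 "1 + 1" j] scale_left_distrib[of 1 1 j] by simp
    then show ?thesis by (simp add: j_def)
  qed
  have dB: "diff H 2 B = brkt H 2 1 (diff H 1 x) x"
  proof -
    have "diff H 2 (brkt H 1 1 x x) = brkt H 2 1 (diff H 1 x) x - brkt H 1 2 x (diff H 1 x)"
      using leibniz[OF x x] by (simp add: ksgn_def)
    also have "brkt H 1 2 x (diff H 1 x) = - brkt H 2 1 (diff H 1 x) x"
      using brkt_anti[OF x d2] by (simp add: ksgn_def)
    finally have "diff H 2 (brkt H 1 1 x x) = gscale H 2 (brkt H 2 1 (diff H 1 x) x)"
      using scale_left_distrib[of 1 1 "brkt H 2 1 (diff H 1 x) x"] by simp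
    then show ?thesis using b2[OF x x] by (simp add: B_def diff_scale)
  qed
  have "brkt H 2 1 C x = brkt H 2 1 (diff H 1 x) x + brkt H 2 1 B x"
    using d2 B x by (simp add: C_def brkt_left)
  moreover have "brkt H 2 1 B x = 0" using b2[OF x x] x J by (simp add: B_def brkt_left)
  ultimately have dB': "diff H 2 B = brkt H 2 1 C x" using dB by simp
  have Cfix: "C = \<iota> 2 (dV 1 v + \<pi> 2 B) - K 3 (brkt H 2 1 C x)"
    using 1 unfolding dB' .
  have mc: "dV 1 v + gscale V (1 / 2) (\<pi> 2 (brkt H 1 1 x x)) = dV 1 v + \<pi> 2 B"
    using b2[OF x x] by (simp add: B_def proj_simps)
  have MC: "MC x \<longleftrightarrow> C = 0" using x by (simp add: MC_def C_def B_def)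
  show ?thesis
    unfolding mc MC
  proof
    assume "C = 0"
    then have "\<iota> 2 (dV 1 v + \<pi> 2 B) = 0" using Cfix x by (simp add: brkt_left K_simps)
    then have "\<pi> 2 (\<iota> 2 (dV 1 v + \<pi> 2 B)) = 0" by (simp add: proj_simps)
    then show "dV 1 v + \<pi> 2 B = 0" using dVv lin_in(2)[OF B] by (simp add: proj_incl)
  next
    assume "dV 1 v + \<pi> 2 B = 0"
    then have C': "C = - K 3 (brkt H 2 1 C x)" using Cfix by (simp add: incl_simps)
    \<comment> \<open>Each pass through C = -K[C,x] gains one filtration step.\<close>
    have "C \<in> F (Suc k) 2" for k
    proof (induction k)
      case 0
      show ?case using C by (simp add: F_1[unfolded One_nat_def])
    next
      case (Suc k)
      have "brkt H 2 1 C x \<in> F (Suc (Suc k)) 3" using F_brkt_left[OF _ Suc x] by simp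
      then have "- K 3 (brkt H 2 1 C x) \<in> F (Suc (Suc k)) 2" using K_F[of "Suc (Suc k)" _ 3] F_minus by simp
      then show ?case using C' by simp
    qed
    from F_large[OF _ this[of N]] show "C = 0" by simp
  qed
qed

text \<open>The terms \<open>q\<^sub>2(\<gamma> \<odot> K q\<^sub>2(\<gamma> \<odot> \<dots>))\<close> of the transferred structure, where \<open>q\<^sub>2(x \<odot> y) = - [x,y]\<close> in
  degree one.\<close>

primrec comb :: "'h \<Rightarrow> nat \<Rightarrow> 'h" where
  "comb x 0 = - brkt H 1 1 x x"
| "comb x (Suc n) = - brkt H 1 1 x (K 2 (comb x n))"

lemma comb_in: "x \<in> gcomp H 1 \<Longrightarrow> comb x n \<in> gcomp H 2"
  by (induction n) (auto simp: b2 K2)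

text \<open>Write x = X + \<kappa> with X = \<iota>v. As [\<kappa>,\<kappa>] is invisible to
  \<open>K\<close> and \<open>\<pi>\<close>, the quadratic equation becomes affine: w = -[X,X]/2 -
  [X,\<kappa>] satisfies w = -[X,X]/2 + [X,Kw]. Its Neumann series consists of the terms
  \<open>comb\<close>, where 1/2 stems from [X,X] and the alternating signs from q_2 being minus the
  bracket on degree one.\<close>

lemma MC_comb_iff:
  assumes v: "v \<in> gcomp V 1" and lift: "lifts v x" and M: "N \<le> M"
  shows "MC x \<longleftrightarrow> - dV 1 v + (\<Sum>n<M. gscale V ((- 1) ^ n / 2) (\<pi> 2 (comb (\<iota> 1 v) n))) = 0"
proof -
  have x: "x \<in> gcomp H 1" and eq: "x = \<iota> 1 v + gscale H (1 / 2) (K 2 (brkt H 1 1 x x))"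
    using lift by (auto simp: lifts_def)
  let ?X = "\<iota> 1 v"
  have X: "?X \<in> gcomp H 1" using v by (simp add: lin_in)
  define \<kappa> where "\<kappa> = gscale H (1 / 2) (K 2 (brkt H 1 1 x x))"
  have \<kappa>: "\<kappa> \<in> gcomp H 1" using x by (simp add: \<kappa>_def K2 b2)
  have x\<kappa>: "x = ?X + \<kappa>" using eq by (simp add: \<kappa>_def)
  define w where "w = - gscale H (1 / 2) (brkt H 1 1 ?X ?X) - brkt H 1 1 ?X \<kappa>"
  have w: "w \<in> gcomp H 2" using X \<kappa> by (simp add: w_def b2)
  \<comment> \<open>The correction \<kappa> lies in the image of \<open>K\<close>; this is where the
    special property of the contraction enters.\<close>
  have kk: "K 2 (brkt H 1 1 \<kappa> \<kappa>) = 0" "\<pi> 2 (brkt H 1 1 \<kappa> \<kappa>) = 0"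
  proof -
    define z where "z = gscale H (1 / 2) (brkt H 1 1 x x)"
    have z: "z \<in> gcomp H 2" "\<kappa> = K 2 z" using b2[OF x x] by (auto simp: z_def \<kappa>_def K_simps)
    then show "K 2 (brkt H 1 1 \<kappa> \<kappa>) = 0" "\<pi> 2 (brkt H 1 1 \<kappa> \<kappa>) = 0"
      using K_brkt[OF z(1) z(1)] proj_brkt[OF z(1) z(1)] by auto
  qed
  have sq: "gscale H (1 / 2) (brkt H 1 1 x x) = - w + gscale H (1 / 2) (brkt H 1 1 \<kappa> \<kappa>)"
  proof -
    have "brkt H 1 1 x x = brkt H 1 1 ?X ?X + brkt H 1 1 ?X \<kappa> + (brkt H 1 1 ?X \<kappa> + brkt H 1 1 \<kappa> \<kappa>)"
      unfolding x\<kappa> using X \<kappa> brkt_odd_sym[OF \<kappa> X] by (simp add: brkt_left brkt_right)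
    then show ?thesis
      using scale_left_distrib[of "1/2" "1/2" "brkt H 1 1 ?X \<kappa>"]
      by (simp add: w_def scale_right_distrib algebra_simps)
  qed
  have \<kappa>w: "\<kappa> = - K 2 w"
  proof -
    have "\<kappa> = K 2 (gscale H (1 / 2) (brkt H 1 1 x x))" using b2[OF x x] by (simp add: \<kappa>_def K_simps)
    also have "\<dots> = - K 2 w" unfolding sq using w b2[OF \<kappa> \<kappa>] kk by (simp add: K_simps)
    finally show ?thesis .
  qed
  have \<pi>w: "gscale V (1 / 2) (\<pi> 2 (brkt H 1 1 x x)) = - \<pi> 2 w"
  proof -
    have "gscale V (1 / 2) (\<pi> 2 (brkt H 1 1 x x)) = \<pi> 2 (gscale H (1 / 2) (brkt H 1 1 x x))"
      using b2[OF x x] by (simp add: proj_simps)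
    also have "\<dots> = - \<pi> 2 w" unfolding sq using w b2[OF \<kappa> \<kappa>] kk by (simp add: proj_simps)
    finally show ?thesis .
  qed
  have weq: "w = - gscale H (1 / 2) (brkt H 1 1 ?X ?X) + brkt H 1 1 ?X (K 2 w)"
  proof -
    have *: "brkt H 1 1 ?X \<kappa> = - brkt H 1 1 ?X (K 2 w)"
      by (subst \<kappa>w) (use X K2[OF w] in \<open>simp add: brkt_right\<close>)
    have "w = - gscale H (1 / 2) (brkt H 1 1 ?X ?X) - brkt H 1 1 ?X \<kappa>" by (rule w_def)
    then show ?thesis unfolding * by simp
  qed
  \<comment> \<open>The partial sums of the Neumann series for w; each further summand improves the
    approximation by one filtration step.\<close>
  define S where "S m = (\<Sum>n<m. gscale H ((- 1) ^ n / 2) (comb ?X n))" for m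
  have S: "S m \<in> gcomp H 2" for m using comb_in[OF X] by (auto simp: S_def)
  have S_Suc: "S (Suc m) = - gscale H (1 / 2) (brkt H 1 1 ?X ?X) + brkt H 1 1 ?X (K 2 (S m))" for m
  proof -
    have "K 2 (S m) = (\<Sum>n<m. gscale H ((- 1) ^ n / 2) (K 2 (comb ?X n)))"
      unfolding S_def using comb_in[OF X] by (simp add: linear_between_sum[OF linear_K] K_simps)
    then have "brkt H 1 1 ?X (K 2 (S m)) = (\<Sum>n<m. gscale H ((- 1) ^ n / 2) (brkt H 1 1 ?X (K 2 (comb ?X n))))"
      using K2[OF comb_in[OF X]] by (simp add: brkt_right(6)[OF X] brkt_right(3)[OF X])
    also have "\<dots> = (\<Sum>n<m. gscale H ((- 1) ^ Suc n / 2) (comb ?X (Suc n)))" by simp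
    finally show ?thesis
      unfolding S_def by (subst sum.lessThan_Suc_shift) (simp add: comp_def)
  qed
  have "w - S m \<in> F (Suc m) 2" for m
  proof (induction m)
    case 0
    show ?case using w by (simp add: S_def F_1[unfolded One_nat_def])
  next
    case (Suc m)
    have "w - S (Suc m) = brkt H 1 1 ?X (K 2 w) - brkt H 1 1 ?X (K 2 (S m))"
      unfolding S_Suc by (subst weq) simp
    also have "\<dots> = brkt H 1 1 ?X (K 2 (w - S m))"
      using K2[OF w] K2[OF S] w S X by (simp add: K_simps brkt_right)
    finally show ?case
      using F_brkt_right[OF _ X K_F[OF _ Suc]] by simp
  qed
  from F_large[OF _ this[of M]] M have wS: "w = S M" by simp
  have "\<pi> 2 w = (\<Sum>n<M. gscale V ((- 1) ^ n / 2) (\<pi> 2 (comb ?X n)))"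
    unfolding wS S_def using comb_in[OF X] by (simp add: linear_between_sum[OF linear_proj] proj_simps)
  moreover have "dV 1 v - \<pi> 2 w = 0 \<longleftrightarrow> - dV 1 v + \<pi> 2 w = 0" by auto
  ultimately show ?thesis
    unfolding lifts_MC_iff[OF v lift] \<pi>w by simp
qed

end

section \<open>Multilinear maps on polynomials\<close>

text \<open>Linearity in one slot is phrased by \<open>list_update\<close>. Each slot has its own
  subspace, because the arguments have different degrees.\<close>

definition multilin ::
  "(complex \<Rightarrow> 'v::ab_group_add \<Rightarrow> 'v) \<Rightarrow> 'v set list \<Rightarrow> (complex \<Rightarrow> 'w::ab_group_add \<Rightarrow> 'w) \<Rightarrow> 'w set \<Rightarrow>
   ('v list \<Rightarrow> 'w) \<Rightarrow> bool" where
  "multilin s Vs s' W f \<longleftrightarrow>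
     (\<forall>vs i. list_all2 (\<in>) vs Vs \<and> i < length Vs \<longrightarrow> linear_between s (Vs ! i) s' W (\<lambda>v. f (vs[i := v])))"

lemma multilinD:
  "multilin s Vs s' W f \<Longrightarrow> list_all2 (\<in>) vs Vs \<Longrightarrow> i < length Vs \<Longrightarrow>
   linear_between s (Vs ! i) s' W (\<lambda>v. f (vs[i := v]))"
  by (simp add: multilin_def)

lemma sum_set_Cons: "(\<Sum>x\<in>set_Cons A B. f x) = (\<Sum>(i, x)\<in>A \<times> B. f (i # x))"
proof -
  have "set_Cons A B = (\<lambda>(i, x). i # x) ` (A \<times> B)" by (auto simp: set_Cons_def)
  moreover have "inj_on (\<lambda>(i, x). i # x) (A \<times> B)" by (auto simp: inj_on_def)
  ultimately show ?thesis by (simp add: sum.reindex case_prod_beta' comp_def)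
qed

text \<open>Induction on the slots: the first polynomial is expanded into monomials, and fixing one
  of its coefficients leaves a multilinear map in the remaining slots.\<close>

lemma poly_eval_multiconv:
  assumes s: "\<And>V. V \<in> set Vs \<Longrightarrow> csub s V" and s': "csub s' W"
  shows "multilin s Vs s' W f \<Longrightarrow> list_all2 (\<lambda>p V. p \<in> pcoeffs V) ps Vs \<Longrightarrow>
    poly_eval s' a (poly_multiconv f ps) = f (map (poly_eval s a) ps)"
  using s
proof (induction ps arbitrary: f Vs)
  case Nil
  interpret W: csub s' W by fact
  show ?case by (simp add: poly_multiconv_def W.poly_eval_monom)
next
  case (Cons p ps)
  interpret W: csub s' W by fact
  from Cons.prems(2) obtain V Us where Vs: "Vs = V # Us" "p \<in> pcoeffs V"
    "list_all2 (\<lambda>p V. p \<in> pcoeffs V) ps Us" by (auto simp: list_all2_Cons1)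
  interpret V: csub s V using Cons.prems(3) Vs by simp
  have evs: "list_all2 (\<in>) (map (poly_eval s a) ps) Us"
    using Vs(3) Cons.prems(3) unfolding list_all2_conv_all_nth
    by (auto simp: Vs(1) csub.poly_eval_in)
  have lin0: "linear_between s V s' W (\<lambda>v. f (v # map (poly_eval s a) ps))"
    using multilinD[OF Cons.prems(1), of "0 # map (poly_eval s a) ps" 0] evs by (simp add: Vs(1))
  have ml: "multilin s Us s' W (\<lambda>vs. f (coeff p i # vs))" for i
    unfolding multilin_def
  proof (intro allI impI, elim conjE)
    fix vs k assume vs: "list_all2 (\<in>) vs Us" "k < length Us"
    then show "linear_between s (Us ! k) s' W (\<lambda>v. f (coeff p i # vs[k := v]))"
      using multilinD[OF Cons.prems(1), of "coeff p i # vs" "Suc k"] Vs by simp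
  qed
  have "poly_eval s' a (poly_multiconv f (p # ps)) =
      (\<Sum>(i, is)\<in>{..degree p} \<times> listset (map (\<lambda>p. {..degree p}) ps).
        s' (a ^ (i + sum_list is)) (f (coeff p i # map2 coeff ps is)))"
    by (simp add: poly_multiconv_def W.poly_eval_sum_monom sum_set_Cons case_prod_beta')
  also have "\<dots> = (\<Sum>i\<le>degree p. \<Sum>is\<in>listset (map (\<lambda>p. {..degree p}) ps).
        s' (a ^ (i + sum_list is)) (f (coeff p i # map2 coeff ps is)))"
    by (simp only: sum.cartesian_product)
  also have "\<dots> = (\<Sum>i\<le>degree p. s' (a ^ i) (poly_eval s' a (poly_multiconv (\<lambda>vs. f (coeff p i # vs)) ps)))"
    by (simp add: poly_multiconv_def W.poly_eval_sum_monom W.scale_sum_right power_add)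
  also have "\<dots> = (\<Sum>i\<le>degree p. s' (a ^ i) (f (coeff p i # map (poly_eval s a) ps)))"
    using Cons.IH[OF ml Vs(3)] Cons.prems(3) Vs(1) by simp
  also have "\<dots> = f (poly_eval s a p # map (poly_eval s a) ps)"
    unfolding poly_eval_def[of s a p] using Vs(2)
    by (simp add: V.linear_between_sum[OF lin0] linear_betweenD(3)[OF lin0])
  finally show ?case by simp
qed

lemma linear_between_scale:
  assumes "csub s' W" "linear_between s V s' W f"
  shows "linear_between s V s' W (\<lambda>v. s' c (f v))"
proof -
  interpret csub s' W by fact
  show ?thesis by (intro linear_betweenI)
    (auto simp: linear_betweenD[OF assms(2)] scale_right_distrib mult.commute)
qed

lemma linear_between_sum_fun:
  assumes "csub s' W" "\<And>a. a \<in> S \<Longrightarrow> linear_between s V s' W (f a)"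
  shows "linear_between s V s' W (\<lambda>v. \<Sum>a\<in>S. f a v)"
proof -
  interpret csub s' W by fact
  show ?thesis
    using linear_betweenD[OF assms(2)]
    by (intro linear_betweenI) (auto simp: sum.distrib scale_sum_right)
qed

lemma permute_list_update:
  assumes "\<sigma> permutes {..<length xs}" "j < length xs"
  shows "permute_list \<sigma> (xs[\<sigma> j := v]) = (permute_list \<sigma> xs)[j := v]"
proof (rule nth_equalityI)
  fix k assume "k < length (permute_list \<sigma> (xs[\<sigma> j := v]))"
  then have k: "k < length xs" by simp
  have "\<sigma> k < length xs" "\<sigma> j < length xs" using assms k permutes_in_image[OF assms(1)] by auto
  moreover have "\<sigma> j = \<sigma> k \<longleftrightarrow> j = k" using permutes_inj[OF assms(1)] by (auto simp: inj_def)
  ultimately show "permute_list \<sigma> (xs[\<sigma> j := v]) ! k = (permute_list \<sigma> xs)[j := v] ! k"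
    using assms k by (simp add: permute_list_nth nth_list_update)
qed simp

section \<open>The transferred multiplications\<close>

text \<open>The composite \<open>iterate_q2\<close> of a DGLA with the degrees in a separate list,
  so that for fixed degrees it is a function of the vectors. Shifted degrees of sum n give a value
  in degree n + 2 of \<open>H\<close>, which is the index passed to \<open>K\<close>.\<close>

fun combd :: "'h::ab_group_add dgla \<Rightarrow> (int \<Rightarrow> 'h \<Rightarrow> 'h) \<Rightarrow> int list \<Rightarrow> 'h list \<Rightarrow> 'h" where
  "combd H K (d # e # f # ds) (x # xs) =
     gscale H (ksgn (d + 1)) (brkt H (d + 1) (sum_list (e # f # ds) + 1) x
       (K (sum_list (e # f # ds) + 2) (combd H K (e # f # ds) xs)))"
| "combd H K [d, e] [x, y] = gscale H (ksgn (d + 1)) (brkt H (d + 1) (e + 1) x y)"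
| "combd H K _ _ = 0"

text \<open>At most one degree is nonzero. This covers what the Maurer-Cartan equation of
  \<open>T[s,ds]\<close> produces: all arguments in shifted degree 0, except perhaps one coefficient
  of \<open>ds\<close> in degree -1.\<close>

definition sparse_degrees :: "int list \<Rightarrow> bool" where
  "sparse_degrees ds \<longleftrightarrow> (\<forall>i<length ds. \<forall>j<length ds. i \<noteq> j \<longrightarrow> ds ! i * ds ! j = 0)"

text \<open>What the comparison uses of the cone: the formula for one argument, and that for several
  arguments of sparse degrees, where no Koszul sign remains.\<close>

locale transferred = contraction H T dV \<iota> \<pi> K
  for H :: "'h::ab_group_add dgla" and T :: "'c::ab_group_add linf" and dV \<iota> \<pi> K +
  assumes lmult_1: "v \<in> gcomp T (d + 1) \<Longrightarrow> lmult T [(d, v)] = - dV (d + 1) v"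
    and lmult_ge2: "2 \<le> length ds \<Longrightarrow> length vs = length ds \<Longrightarrow> sparse_degrees ds \<Longrightarrow>
      lmult T (zip ds vs) = gscale T ((- 1) ^ (length ds - 2) / 2)
        (\<Sum>\<sigma> | \<sigma> permutes {..<length ds}. \<pi> (sum_list ds + 2)
          (combd H K (permute_list \<sigma> ds) (map2 (\<lambda>d. \<iota> (d + 1)) (permute_list \<sigma> ds) (permute_list \<sigma> vs))))"

lemma (in cone_data) transferred_cone:
  "transferred H C (cone_diff L N M h g) (\<lambda>i. cone_incl h g (i - 1)) (\<lambda>i. cone_proj M) (\<lambda>i. cone_homotopy M)"
proof -
  interpret contraction H C "cone_diff L N M h g" "\<lambda>i. cone_incl h g (i - 1)" "\<lambda>i. cone_proj M" "\<lambda>i. cone_homotopy M"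
    by (rule contraction_cone)
  let ?q = "lmult (linf_of_dgla H)"
  have length_1: "Suc 0 = length xs \<Longrightarrow> \<exists>x. xs = [x]" for xs :: "('l \<times> 'n \<times> 'm forms) list"
    by (cases xs) auto
  have it: "iterate_q2 ?q (cone_homotopy M) (zip ds xs) = combd H (\<lambda>i. cone_homotopy M) ds xs"
    if "length ds = length xs" for ds :: "int list" and xs :: "('l \<times> 'n \<times> 'm forms) list"
    using that
  proof (induction H "\<lambda>i :: int. cone_homotopy M :: 'l \<times> 'n \<times> 'm forms \<Rightarrow> 'l \<times> 'n \<times> 'm forms" ds xs
      rule: combd.induct)
    case (1 d e f ds x xs)
    obtain y z zs where xs: "xs = y # z # zs" using "1.prems" by (cases xs; cases "tl xs") auto
    with 1 show ?case by (simp add: linf_of_dgla_def algebra_simps)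
  qed (auto simp: linf_of_dgla_def dest!: length_1)
  show ?thesis
  proof (unfold_locales)
    fix d v assume "v \<in> gcomp C (d + 1)"
    then show "lmult C [(d, v)] = - cone_diff L N M h g (d + 1) v"
      by (cases v) (simp add: cone_linf_def Let_def cone_diff_def)
  next
    fix ds :: "int list" and vs :: "('l \<times> 'n \<times> 'm) list"
    assume len: "2 \<le> length ds" "length vs = length ds" and sp: "sparse_degrees ds"
    \<comment> \<open>Every inversion contributes the parity of a product of two degrees at
      different positions, which is zero.\<close>
    have ko: "koszul_sign ds \<sigma> = 1" if "\<sigma> permutes {..<length ds}" for \<sigma>
      unfolding koszul_sign_def
    proof (rule prod.neutral, clarify)
      fix i j assume ij: "i < j" "j < length ds" "\<sigma> j < \<sigma> i"
      then have "\<sigma> i < length ds" "\<sigma> j < length ds" using permutes_in_image[OF that, of i] permutes_in_image[OF that, of j] by auto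
      with sp ij(3) have "ds ! \<sigma> i * ds ! \<sigma> j = 0" by (auto simp: sparse_degrees_def)
      then show "ksgn (ds ! \<sigma> i * ds ! \<sigma> j) = 1" by (auto simp: ksgn_def)
    qed
    obtain p p' zs where z: "zip ds vs = p # p' # zs"
      using len by (cases ds; cases vs; cases "tl ds"; cases "tl vs") auto
    have vs1: "gscale C 1 u = u" for u using V.scale_one by simp
    have "lmult C (zip ds vs) = gscale C ((- 1) ^ (length (zip ds vs) - 2) / 2)
        (\<Sum>\<sigma> | \<sigma> permutes {..<length (zip ds vs)}. gscale C (koszul_sign (map fst (zip ds vs)) \<sigma>)
          (cone_proj M (iterate_q2 ?q (cone_homotopy M)
            (map (\<lambda>i. case zip ds vs ! \<sigma> i of (k, x) \<Rightarrow> (k, cone_incl h g k x)) [0..<length (zip ds vs)]))))"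
      unfolding z by (cases p; cases p') (simp add: cone_linf_def Let_def)
    also have "\<dots> = gscale C ((- 1) ^ (length ds - 2) / 2)
        (\<Sum>\<sigma> | \<sigma> permutes {..<length ds}. cone_proj M
          (combd H (\<lambda>i. cone_homotopy M) (permute_list \<sigma> ds)
            (map2 (\<lambda>d. cone_incl h g (d + 1 - 1)) (permute_list \<sigma> ds) (permute_list \<sigma> vs))))"
    proof -
      have "gscale C (koszul_sign (map fst (zip ds vs)) \<sigma>) (cone_proj M (iterate_q2 ?q (cone_homotopy M)
            (map (\<lambda>i. case zip ds vs ! \<sigma> i of (k, x) \<Rightarrow> (k, cone_incl h g k x)) [0..<length (zip ds vs)]))) =
          cone_proj M (combd H (\<lambda>i. cone_homotopy M) (permute_list \<sigma> ds)
            (map2 (\<lambda>d. cone_incl h g (d + 1 - 1)) (permute_list \<sigma> ds) (permute_list \<sigma> vs)))"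
        if \<sigma>: "\<sigma> permutes {..<length ds}" for \<sigma>
      proof -
        have "map (\<lambda>i. case zip ds vs ! \<sigma> i of (k, x) \<Rightarrow> (k, cone_incl h g k x)) [0..<length (zip ds vs)] =
            zip (permute_list \<sigma> ds) (map2 (\<lambda>d. cone_incl h g (d + 1 - 1)) (permute_list \<sigma> ds) (permute_list \<sigma> vs))"
        proof (rule nth_equalityI)
          fix i assume "i < length (map (\<lambda>i. case zip ds vs ! \<sigma> i of (k, x) \<Rightarrow> (k, cone_incl h g k x)) [0..<length (zip ds vs)])"
          then have i: "i < length ds" using len by simp
          then have "\<sigma> i < length ds" using permutes_in_image[OF \<sigma>, of i] by simp
          then show "map (\<lambda>i. case zip ds vs ! \<sigma> i of (k, x) \<Rightarrow> (k, cone_incl h g k x)) [0..<length (zip ds vs)] ! i =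
            zip (permute_list \<sigma> ds) (map2 (\<lambda>d. cone_incl h g (d + 1 - 1)) (permute_list \<sigma> ds) (permute_list \<sigma> vs)) ! i"
            using i len \<sigma> by (simp add: permute_list_nth)
        qed (use len in simp)
        then show ?thesis using ko[OF \<sigma>] len by (simp add: it vs1)
      qed
      then show ?thesis using len by simp
    qed
    finally show "lmult C (zip ds vs) = gscale C ((- 1) ^ (length ds - 2) / 2)
        (\<Sum>\<sigma> | \<sigma> permutes {..<length ds}. cone_proj M
          (combd H (\<lambda>i. cone_homotopy M) (permute_list \<sigma> ds)
            (map2 (\<lambda>d. cone_incl h g (d + 1 - 1)) (permute_list \<sigma> ds) (permute_list \<sigma> vs))))" .
  qed
qed

context contraction
begin

abbreviation degs :: "int list \<Rightarrow> 'h set list" where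
  "degs ds \<equiv> map (\<lambda>d. gcomp H (d + 1)) ds"

lemma combd_in: "2 \<le> length ds \<Longrightarrow> list_all2 (\<in>) xs (degs ds) \<Longrightarrow> combd H K ds xs \<in> gcomp H (sum_list ds + 2)"
proof (induction ds arbitrary: xs)
  case (Cons d ds)
  from Cons.prems(2) obtain x xs' where xs: "xs = x # xs'" "x \<in> gcomp H (d + 1)" "list_all2 (\<in>) xs' (degs ds)"
    by (auto simp: list_all2_Cons2)
  show ?case
  proof (cases "2 \<le> length ds")
    case True
    then obtain e f es where ds: "ds = e # f # es" by (cases ds; cases "tl ds") auto
    have R: "combd H K ds xs' \<in> gcomp H (sum_list ds + 2)" by (rule Cons.IH[OF True xs(3)])
    then have "K (sum_list ds + 2) (combd H K ds xs') \<in> gcomp H (sum_list ds + 1)" by (simp add: lin_in)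
    with xs(2) have "brkt H (d + 1) (sum_list ds + 1) x (K (sum_list ds + 2) (combd H K ds xs')) \<in> gcomp H (d + sum_list ds + 2)"
      by (simp add: brkt_in)
    then show ?thesis unfolding xs(1) ds by (simp add: algebra_simps)
  next
    case False
    with Cons.prems(1) obtain e where ds: "ds = [e]" by (cases ds; cases "tl ds") auto
    with xs obtain y where "xs' = [y]" "y \<in> gcomp H (e + 1)" by (auto simp: list_all2_Cons2)
    with xs ds show ?thesis by (simp add: brkt_in)
  qed
qed simp

lemma multilin_combd: "2 \<le> length ds \<Longrightarrow>
    multilin (gscale H) (degs ds) (gscale H) (gcomp H (sum_list ds + 2)) (combd H K ds)"
proof (induction ds)
  case (Cons d ds)
  show ?case
    unfolding multilin_def
  proof (intro allI impI, elim conjE)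
    fix xs i assume "list_all2 (\<in>) xs (degs (d # ds))" and i: "i < length (degs (d # ds))"
    then obtain x xs' where xs: "xs = x # xs'" "x \<in> gcomp H (d + 1)" "list_all2 (\<in>) xs' (degs ds)"
      by (auto simp: list_all2_Cons2)
    show "linear_between (gscale H) (degs (d # ds) ! i) (gscale H) (gcomp H (sum_list (d # ds) + 2))
        (\<lambda>v. combd H K (d # ds) (xs[i := v]))"
    proof (cases "2 \<le> length ds")
      case True
      then obtain e f es where ds: "ds = e # f # es" by (cases ds; cases "tl ds") auto
      let ?n = "sum_list ds"
      have idx: "d + 1 + (?n + 1) = sum_list (d # ds) + 2" by simp
      note b = bilinear_brkt[of "d + 1" "?n + 1", unfolded idx]
      have c: "combd H K (d # ds) (y # ys) =
          gscale H (ksgn (d + 1)) (brkt H (d + 1) (?n + 1) y (K (?n + 2) (combd H K ds ys)))" for y ys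
        unfolding ds by simp
      show ?thesis
      proof (cases i)
        case 0
        have "K (?n + 2) (combd H K ds xs') \<in> gcomp H (?n + 1)"
          using combd_in[OF True xs(3)] by (simp add: lin_in)
        then have "linear_between (gscale H) (gcomp H (d + 1)) (gscale H) (gcomp H (sum_list (d # ds) + 2))
            (\<lambda>v. gscale H (ksgn (d + 1)) (brkt H (d + 1) (?n + 1) v (K (?n + 2) (combd H K ds xs'))))"
          by (intro linear_between_scale[OF csub] bilinear_betweenD(2)[OF b])
        then show ?thesis unfolding xs(1) 0 by (simp only: list_update.simps nat.case c list.map nth_Cons_0)
      next
        case (Suc k)
        with i have k: "k < length (degs ds)" by simp
        have idx': "?n + 2 - 1 = ?n + 1" by simp
        have "linear_between (gscale H) (degs ds ! k) (gscale H) (gcomp H (?n + 1))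
            (\<lambda>v. K (?n + 2) (combd H K ds (xs'[k := v])))"
          using linear_between_compose[OF multilinD[OF Cons.IH[OF True] xs(3) k] linear_K[of "?n + 2", unfolded idx']] .
        then have "linear_between (gscale H) (degs ds ! k) (gscale H) (gcomp H (sum_list (d # ds) + 2))
            (\<lambda>v. gscale H (ksgn (d + 1)) (brkt H (d + 1) (?n + 1) x (K (?n + 2) (combd H K ds (xs'[k := v])))))"
          by (intro linear_between_scale[OF csub] linear_between_compose[OF _ bilinear_betweenD(1)[OF b xs(2)]])
        then show ?thesis unfolding xs(1) Suc by (simp only: list_update.simps nat.case c list.map nth_Cons_Suc)
      qed
    next
      case False
      with Cons.prems obtain e where ds: "ds = [e]" by (cases ds; cases "tl ds") auto
      with xs obtain y where y: "xs' = [y]" "y \<in> gcomp H (e + 1)" by (auto simp: list_all2_Cons2)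
      have idx: "d + 1 + (e + 1) = sum_list (d # ds) + 2" using ds by simp
      note b = bilinear_brkt[of "d + 1" "e + 1", unfolded idx]
      from i ds consider "i = 0" | "i = 1" by fastforce
      then show ?thesis
      proof cases
        case 1
        have "linear_between (gscale H) (gcomp H (d + 1)) (gscale H) (gcomp H (sum_list (d # ds) + 2))
            (\<lambda>v. gscale H (ksgn (d + 1)) (brkt H (d + 1) (e + 1) v y))"
          by (intro linear_between_scale[OF csub] bilinear_betweenD(2)[OF b y(2)])
        then show ?thesis unfolding xs(1) y(1) 1 using ds by simp
      next
        case 2
        have "linear_between (gscale H) (gcomp H (e + 1)) (gscale H) (gcomp H (sum_list (d # ds) + 2))
            (\<lambda>v. gscale H (ksgn (d + 1)) (brkt H (d + 1) (e + 1) x v))"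
          by (intro linear_between_scale[OF csub] bilinear_betweenD(1)[OF b xs(2)])
        then show ?thesis unfolding xs(1) y(1) 2 using ds by simp
      qed
    qed
  qed
qed simp

end

context transferred
begin

lemma sum_list_permute: "\<sigma> permutes {..<length ds} \<Longrightarrow> sum_list (permute_list \<sigma> ds) = sum_list (ds :: int list)"
  using mset_permute_list[of \<sigma> ds] by (metis sum_mset_sum_list)

lemma incl_permute_in:
  assumes \<sigma>: "\<sigma> permutes {..<length ds}" and vs: "list_all2 (\<in>) vs (map (\<lambda>d. gcomp T (d + 1)) ds)"
  shows "list_all2 (\<in>) (map2 (\<lambda>d. \<iota> (d + 1)) (permute_list \<sigma> ds) (permute_list \<sigma> vs)) (degs (permute_list \<sigma> ds))"
proof -
  have len: "length vs = length ds" using list_all2_lengthD[OF vs] by simp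
  show ?thesis
    unfolding list_all2_conv_all_nth
  proof (intro conjI allI impI)
    show "length (map2 (\<lambda>d. \<iota> (d + 1)) (permute_list \<sigma> ds) (permute_list \<sigma> vs)) = length (degs (permute_list \<sigma> ds))"
      by (simp add: len)
    fix i assume "i < length (map2 (\<lambda>d. \<iota> (d + 1)) (permute_list \<sigma> ds) (permute_list \<sigma> vs))"
    then have i: "i < length ds" by (simp add: len)
    then have "\<sigma> i < length ds" using permutes_in_image[OF \<sigma>, of i] by simp
    then have "vs ! \<sigma> i \<in> gcomp T (ds ! \<sigma> i + 1)" using vs len by (auto simp: list_all2_conv_all_nth)
    then show "map2 (\<lambda>d. \<iota> (d + 1)) (permute_list \<sigma> ds) (permute_list \<sigma> vs) ! i \<in> degs (permute_list \<sigma> ds) ! i"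
      using i \<sigma> len by (simp add: permute_list_nth lin_in)
  qed
qed

lemma multilin_lmult:
  assumes len: "2 \<le> length ds" and sp: "sparse_degrees ds"
  shows "multilin (gscale T) (map (\<lambda>d. gcomp T (d + 1)) ds) (gscale T) (gcomp T (sum_list ds + 2))
    (\<lambda>vs. lmult T (zip ds vs))"
  unfolding multilin_def
proof (intro allI impI, elim conjE)
  fix vs i assume vs: "list_all2 (\<in>) vs (map (\<lambda>d. gcomp T (d + 1)) ds)" and i: "i < length (map (\<lambda>d. gcomp T (d + 1)) ds)"
  have lv: "length vs = length ds" using list_all2_lengthD[OF vs] by simp
  from i have il: "i < length ds" by simp
  let ?n = "sum_list ds + 2"
  have "linear_between (gscale T) (gcomp T (ds ! i + 1)) (gscale T) (gcomp T ?n)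
      (\<lambda>v. \<pi> ?n (combd H K (permute_list \<sigma> ds) (map2 (\<lambda>d. \<iota> (d + 1)) (permute_list \<sigma> ds) (permute_list \<sigma> (vs[i := v])))))"
    if \<sigma>: "\<sigma> permutes {..<length ds}" for \<sigma>
  proof -
    \<comment> \<open>Varying slot i of the input varies exactly slot j of the permuted list, where
      \<open>combd\<close> is already known to be linear.\<close>
    obtain j where j: "j < length ds" "\<sigma> j = i"
      using permutes_image[OF \<sigma>] il by (metis image_iff lessThan_iff)
    let ?xs = "map2 (\<lambda>d. \<iota> (d + 1)) (permute_list \<sigma> ds) (permute_list \<sigma> vs)"
    have up: "map2 (\<lambda>d. \<iota> (d + 1)) (permute_list \<sigma> ds) (permute_list \<sigma> (vs[i := v])) = ?xs[j := \<iota> (ds ! i + 1) v]" for v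
    proof -
      have "permute_list \<sigma> (vs[i := v]) = (permute_list \<sigma> vs)[j := v]"
        using permute_list_update[of \<sigma> vs j v] \<sigma> j lv by simp
      then show ?thesis
        using j \<sigma> lv by (auto intro!: nth_equalityI simp: nth_list_update permute_list_nth)
    qed
    have ml: "multilin (gscale H) (degs (permute_list \<sigma> ds)) (gscale H) (gcomp H ?n) (combd H K (permute_list \<sigma> ds))"
      using multilin_combd[of "permute_list \<sigma> ds"] len sum_list_permute[OF \<sigma>] by simp
    have dj: "degs (permute_list \<sigma> ds) ! j = gcomp H (ds ! i + 1)"
      using j \<sigma> by (simp add: permute_list_nth)
    have "linear_between (gscale H) (gcomp H (ds ! i + 1)) (gscale H) (gcomp H ?n) (\<lambda>v. combd H K (permute_list \<sigma> ds) (?xs[j := v]))"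
      using multilinD[OF ml incl_permute_in[OF \<sigma> vs], of j] j unfolding dj by simp
    from linear_between_compose[OF linear_between_compose[OF linear_incl this] linear_proj]
    show ?thesis unfolding up .
  qed
  then have "linear_between (gscale T) (gcomp T (ds ! i + 1)) (gscale T) (gcomp T ?n)
      (\<lambda>v. gscale T ((- 1) ^ (length ds - 2) / 2) (\<Sum>\<sigma> | \<sigma> permutes {..<length ds}.
        \<pi> ?n (combd H K (permute_list \<sigma> ds) (map2 (\<lambda>d. \<iota> (d + 1)) (permute_list \<sigma> ds) (permute_list \<sigma> (vs[i := v]))))))"
    by (intro linear_between_scale linear_between_sum_fun csub_of_graded[OF graded_V]) auto
  then show "linear_between (gscale T) (map (\<lambda>d. gcomp T (d + 1)) ds ! i) (gscale T) (gcomp T ?n)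
      (\<lambda>v. lmult T (zip ds (vs[i := v])))"
    using il lv by (simp add: lmult_ge2[OF len _ sp])
qed

end

text \<open>Only multiplications of elements of degree zero (in the shifted grading) enter the
  Maurer-Cartan equation.\<close>

locale transferred0 = contraction H T dV \<iota> \<pi> K
  for H :: "'h::ab_group_add dgla" and T :: "'c::ab_group_add linf" and dV \<iota> \<pi> K +
  assumes lmult0_1: "v \<in> gcomp T 1 \<Longrightarrow> lmult T [(0, v)] = - dV 1 v"
    and lmult0_ge2: "2 \<le> length vs \<Longrightarrow> vs \<in> lists (gcomp T 1) \<Longrightarrow>
      lmult T (map (Pair 0) vs) = gscale T ((- 1) ^ (length vs - 2) / 2)
        (\<Sum>\<sigma> | \<sigma> permutes {..<length vs}. \<pi> 2 (combd H K (replicate (length vs) 0) (map (\<iota> 1) (permute_list \<sigma> vs))))"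

lemma permute_list_replicate: "\<sigma> permutes {..<n} \<Longrightarrow> permute_list \<sigma> (replicate n x) = replicate n x"
  by (rule nth_equalityI) (use permutes_in_image in \<open>force simp: permute_list_def\<close>)+

lemma map2_replicate: "length xs = n \<Longrightarrow> map2 f (replicate n x) xs = map (f x) xs"
  by (induction xs arbitrary: n) auto

lemma zip_replicate_map: "zip (replicate (length vs) x) vs = map (Pair x) vs"
  by (induction vs) auto

lemma sparse_degrees_replicate: "sparse_degrees (replicate n 0)"
  "sparse_degrees ((replicate n 0)[j := d])"
  by (cases "j < n"; auto simp: sparse_degrees_def nth_list_update)+

lemma (in transferred) transferred0: "transferred0 H T dV \<iota> \<pi> K"
proof (unfold_locales)
  show "lmult T [(0, v)] = - dV 1 v" if "v \<in> gcomp T 1" for v using lmult_1[of v 0] that by simp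
  fix vs assume vs: "2 \<le> length vs" "vs \<in> lists (gcomp T 1)"
  show "lmult T (map (Pair 0) vs) = gscale T ((- 1) ^ (length vs - 2) / 2)
        (\<Sum>\<sigma> | \<sigma> permutes {..<length vs}. \<pi> 2 (combd H K (replicate (length vs) 0) (map (\<iota> 1) (permute_list \<sigma> vs))))"
    using lmult_ge2[of "replicate (length vs) 0" vs] vs(1)
    by (simp add: zip_replicate_map sparse_degrees_replicate permute_list_replicate map2_replicate sum_list_replicate)
qed

lemma combd_Cons: "2 \<le> length ds \<Longrightarrow> combd H K (d # ds) (x # xs) =
    gscale H (ksgn (d + 1)) (brkt H (d + 1) (sum_list ds + 1) x (K (sum_list ds + 2) (combd H K ds xs)))"
  by (cases ds; cases "tl ds") auto

lemma sum_list_replicate_update: "j < n \<Longrightarrow> sum_list ((replicate n 0)[j := d]) = (d :: int)"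
  by (induction n arbitrary: j) (auto simp: sum_list_replicate split: nat.split)

lemma (in contraction) proj_neg_sum:
  assumes "\<And>j. j \<in> S \<Longrightarrow> c j \<in> gcomp H i"
  shows "\<pi> i (- sum c S) = - (\<Sum>j\<in>S. \<pi> i (c j))"
proof -
  have "sum c S \<in> gcomp H i" using assms by (rule sum_in)
  then have "\<pi> i (- sum c S) = - \<pi> i (sum c S)" by (rule linear_between_minus[OF linear_proj])
  also have "\<pi> i (sum c S) = (\<Sum>j\<in>S. \<pi> i (c j))" by (rule linear_between_sum[OF linear_proj]) (rule assms)
  finally show ?thesis .
qed

context transferred
begin

abbreviation "form0 a \<equiv> \<lambda>\<omega>. poly_eval (gscale H) a (fst \<omega>)"
abbreviation "form1 a \<equiv> \<lambda>\<omega>. poly_eval (gscale H) a (snd \<omega>)"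

text \<open>The part without \<open>ds\<close> is computed pointwise. In the \<open>ds\<close>-part
  exactly one argument contributes its \<open>ds\<close>-coefficient, because ds ds = 0. The common
  minus sign is that of moving \<open>ds\<close> past an operation of degree one; each further
  composite of \<open>K\<close> and q_2 has degree 0 and adds no sign.\<close>

lemma combd_forms:
  fixes \<omega>s :: "'h forms list"
  assumes "2 \<le> length \<omega>s" "\<omega>s \<in> lists (gcomp (forms_dgla H) 1)"
  defines "r \<equiv> length \<omega>s"
  defines "R \<equiv> combd (forms_dgla H) (forms_map_odd K) (replicate r 0) \<omega>s"
  shows "poly_eval (gscale H) a (fst R) = combd H K (replicate r 0) (map (form0 a) \<omega>s) \<and>
    poly_eval (gscale H) a (snd R) =
      - (\<Sum>j<r. combd H K ((replicate r 0)[j := - 1]) ((map (form0 a) \<omega>s)[j := form1 a (\<omega>s ! j)]))"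
  using assms(1,2) unfolding R_def r_def
proof (induction \<omega>s)
  case (Cons \<omega> \<omega>s)
  interpret F: contraction "forms_dgla H" "linf_forms T" "forms_diff (gscale T) dV" "forms_map \<iota>" "forms_map \<pi>"
    "forms_map_odd K"
    by (rule contraction_forms) (simp_all add: linf_forms_def)
  obtain P Q where \<omega>: "\<omega> = (P, Q)" "P \<in> pcoeffs (gcomp H 1)" "Q \<in> pcoeffs (gcomp H 0)"
    using Cons.prems(2) by (cases \<omega>) (auto simp: forms_dgla_simps)
  have \<omega>s: "\<omega>s \<in> lists (gcomp (forms_dgla H) 1)" using Cons.prems(2) by simp
  have mem: "form0 a \<omega> \<in> gcomp H 1" "form1 a \<omega> \<in> gcomp H 0" if "\<omega> \<in> set \<omega>s" for \<omega>
  proof -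
    have "\<omega> \<in> gcomp (forms_dgla H) 1" using \<omega>s that by (auto simp: in_lists_conv_set)
    then show "form0 a \<omega> \<in> gcomp H 1" "form1 a \<omega> \<in> gcomp H 0"
      by (cases \<omega>; simp add: forms_dgla_simps)+
  qed
  have eP: "poly_eval (gscale H) a P \<in> gcomp H 1" and eQ: "poly_eval (gscale H) a Q \<in> gcomp H 0"
    using \<omega> by auto
  note ev = eval_maps(3) poly_eval_brkt poly_eval_scale_map poly_eval_add poly_eval_minus
  show ?case
  proof (cases "2 \<le> length \<omega>s")
    case True
    let ?r = "length \<omega>s"
    define R where "R = combd (forms_dgla H) (forms_map_odd K) (replicate ?r 0) \<omega>s"
    let ?z = "\<lambda>j. (replicate ?r 0)[j := - 1] :: int list"
    let ?c = "\<lambda>j. combd H K (?z j) ((map (form0 a) \<omega>s)[j := form1 a (\<omega>s ! j)])"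
    have IH: "poly_eval (gscale H) a (fst R) = combd H K (replicate ?r 0) (map (form0 a) \<omega>s)"
      "poly_eval (gscale H) a (snd R) = - (\<Sum>j<?r. ?c j)"
      using Cons.IH[OF True \<omega>s] by (simp_all add: R_def)
    have "R \<in> gcomp (forms_dgla H) 2"
      using F.combd_in[of "replicate ?r 0" \<omega>s] True \<omega>s
      by (simp add: R_def list_all2_conv_all_nth in_lists_conv_set sum_list_replicate)
    then obtain R0 R1 where R: "R = (R0, R1)" "R0 \<in> pcoeffs (gcomp H 2)" "R1 \<in> pcoeffs (gcomp H 1)"
      by (cases R) (auto simp: forms_dgla_simps)
    have KR: "map_poly (K 2) R0 \<in> pcoeffs (gcomp H 1)" "map_poly (K 1) R1 \<in> pcoeffs (gcomp H 0)"
      using R by (simp_all add: map_in)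
    have cj: "?c j \<in> gcomp H 1" if "j < ?r" for j
    proof -
      have "combd H K (?z j) ((map (form0 a) \<omega>s)[j := form1 a (\<omega>s ! j)]) \<in> gcomp H (sum_list (?z j) + 2)"
        using True that mem by (intro combd_in) (auto simp: list_all2_conv_all_nth nth_list_update)
      then show ?thesis using that by (simp add: sum_list_replicate_update)
    qed
    have zj: "2 \<le> length (?z j)" for j using True by simp
    have c0: "combd H K (replicate (length (\<omega> # \<omega>s)) 0) (map (form0 a) (\<omega> # \<omega>s)) =
        - brkt H 1 1 (poly_eval (gscale H) a P) (K 2 (combd H K (replicate ?r 0) (map (form0 a) \<omega>s)))"
      using combd_Cons[of "replicate ?r 0" H K 0] True
      by (simp add: \<omega>(1) sum_list_replicate ksgn_def)
    have c1: "combd H K ((replicate (length (\<omega> # \<omega>s)) 0)[0 := - 1]) ((map (form0 a) (\<omega> # \<omega>s))[0 := form1 a ((\<omega> # \<omega>s) ! 0)]) =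
        brkt H 0 1 (poly_eval (gscale H) a Q) (K 2 (combd H K (replicate ?r 0) (map (form0 a) \<omega>s)))"
      using combd_Cons[of "replicate ?r 0" H K "- 1"] True
      by (simp add: \<omega>(1) sum_list_replicate ksgn_def)
    have c2: "combd H K ((replicate (length (\<omega> # \<omega>s)) 0)[Suc j := - 1]) ((map (form0 a) (\<omega> # \<omega>s))[Suc j := form1 a ((\<omega> # \<omega>s) ! Suc j)]) =
        - brkt H 1 0 (poly_eval (gscale H) a P) (K 1 (?c j))" if "j < ?r" for j
      using combd_Cons[OF zj, of H K 0 j] that
      by (simp add: \<omega>(1) sum_list_replicate_update ksgn_def)
    have F: "combd (forms_dgla H) (forms_map_odd K) (replicate (length (\<omega> # \<omega>s)) 0) (\<omega> # \<omega>s) =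
        gscale (forms_dgla H) (- 1) (brkt (forms_dgla H) 1 1 (P, Q) (map_poly (K 2) R0, - map_poly (K 1) R1))"
      using combd_Cons[of "replicate ?r 0" "forms_dgla H" "forms_map_odd K" 0 \<omega> \<omega>s] True R(1)
      by (simp add: \<omega>(1) sum_list_replicate ksgn_def flip: R_def)
    have K1: "brkt H 1 0 (poly_eval (gscale H) a P) (K 1 (poly_eval (gscale H) a R1)) =
        - (\<Sum>j<?r. brkt H 1 0 (poly_eval (gscale H) a P) (K 1 (?c j)))"
    proof -
      have "K 1 (poly_eval (gscale H) a R1) = - (\<Sum>j<?r. K 1 (?c j))"
      proof -
        have S: "(\<Sum>j<?r. ?c j) \<in> gcomp H 1" using cj by (intro sum_in) auto
        have "K 1 (\<Sum>j<?r. ?c j) = (\<Sum>j<?r. K 1 (?c j))"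
          by (rule linear_between_sum[OF linear_K]) (use cj in auto)
        then show ?thesis
          using linear_between_minus[OF linear_K S] IH(2) R(1) by simp
      qed
      moreover have "K 1 (?c j) \<in> gcomp H 0" if "j < ?r" for j
        using lin_in(3)[OF cj[OF that], of 0] by simp
      moreover from this have "(\<Sum>j<?r. K 1 (?c j)) \<in> gcomp H 0" by (intro sum_in) auto
      ultimately show ?thesis
        using brkt_right(4)[OF eP, of "\<Sum>j<?r. K 1 (?c j)" 0]
          brkt_right(6)[OF eP, of "{..<?r}" "\<lambda>j. K 1 (?c j)" 0] by simp
    qed
    have K_in: "K 2 (poly_eval (gscale H) a R0) \<in> gcomp H 1" "K 1 (poly_eval (gscale H) a R1) \<in> gcomp H 0"
      using R by (simp_all add: lin_in)
    show ?thesis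
    proof
      show "poly_eval (gscale H) a (fst (combd (forms_dgla H) (forms_map_odd K) (replicate (length (\<omega> # \<omega>s)) 0) (\<omega> # \<omega>s))) =
          combd H K (replicate (length (\<omega> # \<omega>s)) 0) (map (form0 a) (\<omega> # \<omega>s))"
        unfolding F c0 using \<omega> KR R IH(1) by (simp add: forms_dgla_simps ev)
      have "poly_eval (gscale H) a (snd (combd (forms_dgla H) (forms_map_odd K) (replicate (length (\<omega> # \<omega>s)) 0) (\<omega> # \<omega>s))) =
          - brkt H 1 0 (poly_eval (gscale H) a P) (K 1 (poly_eval (gscale H) a R1))
          - brkt H 0 1 (poly_eval (gscale H) a Q) (K 2 (poly_eval (gscale H) a R0))"
        unfolding F using \<omega> KR R eP K_in by (simp add: forms_dgla_simps ev ksgn_def brkt_right scale_right_distrib)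
      also have "\<dots> = - (\<Sum>j<Suc ?r. combd H K ((replicate (length (\<omega> # \<omega>s)) 0)[j := - 1])
          ((map (form0 a) (\<omega> # \<omega>s))[j := form1 a ((\<omega> # \<omega>s) ! j)]))"
        unfolding sum.lessThan_Suc_shift c1 K1
        using c2 IH(1) R(1) by (simp add: sum_negf del: map_map list.map list_update.simps)
      finally show "poly_eval (gscale H) a (snd (combd (forms_dgla H) (forms_map_odd K) (replicate (length (\<omega> # \<omega>s)) 0) (\<omega> # \<omega>s))) =
          - (\<Sum>j<length (\<omega> # \<omega>s). combd H K ((replicate (length (\<omega> # \<omega>s)) 0)[j := - 1])
          ((map (form0 a) (\<omega> # \<omega>s))[j := form1 a ((\<omega> # \<omega>s) ! j)]))" by simp
    qed
  next
    case False
    with Cons.prems(1) obtain \<eta> where \<eta>: "\<omega>s = [\<eta>]" by (cases \<omega>s; cases "tl \<omega>s") auto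
    obtain P' Q' where \<eta>': "\<eta> = (P', Q')" "P' \<in> pcoeffs (gcomp H 1)" "Q' \<in> pcoeffs (gcomp H 0)"
      using \<omega>s \<eta> by (cases \<eta>) (auto simp: forms_dgla_simps)
    show ?thesis
      using \<omega> \<eta>' unfolding \<eta>
      by (simp add: forms_dgla_simps ev ksgn_def scale_right_distrib numeral_2_eq_2)
  qed
qed simp

text \<open>For arguments of shifted degree 0, extending the operations of \<open>T\<close> by forms
  and transferring from \<open>H[s,ds]\<close> give the same result; this is checked at every point.
  In the \<open>ds\<close>-part \<open>linf_forms\<close> sums over the slots of the given list,
  \<open>combd_forms\<close> over the slots of the permuted one, and both carry the overall sign
  -1.\<close>

lemma transferred0_forms:
  "transferred0 (forms_dgla H) (linf_forms T) (forms_diff (gscale T) dV) (forms_map \<iota>) (forms_map \<pi>) (forms_map_odd K)"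
proof -
  have T': "gcomp (linf_forms T) = forms_comp (gcomp T)" "gscale (linf_forms T) = forms_scale (gscale T)"
    by (simp_all add: linf_forms_def)
  interpret F: contraction "forms_dgla H" "linf_forms T" "forms_diff (gscale T) dV" "forms_map \<iota>" "forms_map \<pi>"
    "forms_map_odd K"
    by (rule contraction_forms[OF T'])
  let ?e = "poly_eval (gscale T)"
  have cT: "csub (gscale T) (gcomp T i)" for i by (rule csub_of_graded[OF graded_V])
  note Tev = V.poly_eval_add V.poly_eval_diff V.poly_eval_minus V_eval_scale V.poly_eval_sum
  have ml1: "multilin (gscale T) [gcomp T (d + 1)] (gscale T) (gcomp T (d + 2)) (\<lambda>vs. lmult T (zip [d] vs))" for d
    unfolding multilin_def
  proof (intro allI impI, elim conjE)
    fix vs i assume "list_all2 (\<in>) vs [gcomp T (d + 1)]" "i < length [gcomp T (d + 1)]"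
    then obtain v where v: "vs = [v]" "i = 0" by (auto simp: list_all2_Cons2)
    have "dV (d + 1) v \<in> gcomp T (d + 2)" if "v \<in> gcomp T (d + 1)" for v
      using that by (simp add: lin_in)
    then have "linear_between (gscale T) (gcomp T (d + 1)) (gscale T) (gcomp T (d + 2)) (\<lambda>v. lmult T [(d, v)])"
      by (intro linear_betweenI) (simp_all add: lmult_1 dV_simps)
    then show "linear_between (gscale T) ([gcomp T (d + 1)] ! i) (gscale T) (gcomp T (d + 2)) (\<lambda>v. lmult T (zip [d] (vs[i := v])))"
      by (simp add: v)
  qed
  show ?thesis
  proof (rule transferred0.intro[OF F.contraction_axioms], rule transferred0_axioms.intro)
    fix \<omega> assume "\<omega> \<in> gcomp (linf_forms T) 1"
    then obtain p q where \<omega>: "\<omega> = (p, q)" "p \<in> pcoeffs (gcomp T 1)" "q \<in> pcoeffs (gcomp T 0)"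
      by (cases \<omega>) (auto simp: T')
    have e0: "?e a (poly_multiconv (\<lambda>vs. lmult T (zip [0] vs)) [p]) = - dV 1 (?e a p)" for a
      using poly_eval_multiconv[OF _ cT ml1[of 0], of "[p]" a] \<omega>(2) cT lmult_1[of "?e a p" 0] by simp
    have e1: "?e a (poly_multiconv (\<lambda>vs. lmult T (zip [- 1] vs)) [q]) = - dV 0 (?e a q)" for a
      using poly_eval_multiconv[OF _ cT ml1[of "- 1"], of "[q]" a] \<omega>(3) cT lmult_1[of "?e a q" "- 1"] by simp
    have "lmult (linf_forms T) [(0, \<omega>)] =
        (poly_multiconv (\<lambda>vs. lmult T (zip [0] vs)) [p],
         map_poly (gscale T (ksgn 1)) (poly_multiconv (\<lambda>vs. lmult T (zip [- 1] vs)) [q]) - poly_deriv (gscale T) p)"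
      by (simp add: linf_forms_def \<omega>(1))
    also have "\<dots> = - forms_diff (gscale T) dV 1 \<omega>"
      using \<omega>(2,3) by (auto simp: \<omega>(1) intro!: V.poly_eqI_eval simp: Tev e0 e1 eval_maps ksgn_def)
    finally show "lmult (linf_forms T) [(0, \<omega>)] = - forms_diff (gscale T) dV 1 \<omega>" .
  next
    fix \<omega>s :: "'c forms list"
    assume len: "2 \<le> length \<omega>s" and "\<omega>s \<in> lists (gcomp (linf_forms T) 1)"
    then have \<omega>s: "fst \<omega> \<in> pcoeffs (gcomp T 1)" "snd \<omega> \<in> pcoeffs (gcomp T 0)" if "\<omega> \<in> set \<omega>s" for \<omega>
      using that by (cases \<omega>; auto simp: T' in_lists_conv_set)+
    define r where "r = length \<omega>s"
    define ps where "ps = map fst \<omega>s"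
    define qs where "qs = map snd \<omega>s"
    have lens: "length ps = r" "length qs = r" "2 \<le> r" using len by (simp_all add: ps_def qs_def r_def)
    let ?z = "\<lambda>j. (replicate r 0)[j := - 1] :: int list"
    let ?perms = "{\<sigma>. \<sigma> permutes {..<r}}"
    let ?c = "(- 1) ^ (r - 2) / 2 :: complex"
    define G where "G \<sigma> = combd (forms_dgla H) (forms_map_odd K) (replicate r 0) (map (forms_map \<iota> 1) (permute_list \<sigma> \<omega>s))" for \<sigma>
    have map_fst: "map fst (map (Pair 0) \<omega>s) = replicate r (0 :: int)"
      by (simp add: r_def map_replicate_const comp_def)
    have LHS: "lmult (linf_forms T) (map (Pair 0) \<omega>s) =
        (poly_multiconv (\<lambda>vs. lmult T (zip (replicate r 0) vs)) ps,
         (\<Sum>j<r. map_poly (gscale T (ksgn 1)) (poly_multiconv (\<lambda>vs. lmult T (zip (?z j) vs)) (ps[j := qs ! j]))))"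
    proof -
      have e: "map (fst \<circ> snd) (map (Pair (0 :: int)) \<omega>s) = ps" "map (snd \<circ> snd) (map (Pair (0 :: int)) \<omega>s) = qs"
        "length (map (Pair (0 :: int)) \<omega>s) = r"
        by (simp_all add: ps_def qs_def r_def comp_def)
      have "lmult (linf_forms T) xs =
        (poly_multiconv (\<lambda>vs. lmult T (zip (map fst xs) vs)) (map (fst \<circ> snd) xs),
         (\<Sum>j<length xs. map_poly (gscale T (ksgn (1 + (\<Sum>i<j. map fst xs ! i))))
           (poly_multiconv (\<lambda>vs. lmult T (zip ((map fst xs)[j := map fst xs ! j - 1]) vs))
             ((map (fst \<circ> snd) xs)[j := map (snd \<circ> snd) xs ! j]))) -
         (if length xs = 1 then poly_deriv (gscale T) (hd (map (fst \<circ> snd) xs)) else 0))" for xs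
        by (simp add: linf_forms_def Let_def)
      from this[of "map (Pair 0) \<omega>s"] show ?thesis
        unfolding e map_fst using lens by (auto intro!: sum.cong)
    qed
    have perm_len: "length (permute_list \<sigma> \<omega>s) = r" for \<sigma> by (simp add: r_def)
    have perm_set: "set (permute_list \<sigma> \<omega>s) = set \<omega>s" if "\<sigma> \<in> ?perms" for \<sigma>
      using that by (intro set_permute_list) (simp add: r_def)
    have inc: "map (forms_map \<iota> 1) (permute_list \<sigma> \<omega>s) \<in> lists (gcomp (forms_dgla H) 1)" if "\<sigma> \<in> ?perms" for \<sigma>
    proof -
      have "forms_map \<iota> 1 \<omega> \<in> gcomp (forms_dgla H) 1" if "\<omega> \<in> set \<omega>s" for \<omega>
        using \<omega>s[OF that] by (cases \<omega>) (simp add: forms_dgla_simps map_in)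
      then show ?thesis using perm_set[OF that] by (auto simp: in_lists_conv_set)
    qed
    have f0: "map (form0 a) (map (forms_map \<iota> 1) (permute_list \<sigma> \<omega>s)) = map (\<iota> 1) (permute_list \<sigma> (map (?e a) ps))"
      and f1: "j < r \<Longrightarrow> form1 a (forms_map \<iota> 1 (permute_list \<sigma> \<omega>s ! j)) = \<iota> 0 (?e a (qs ! \<sigma> j))"
      if \<sigma>: "\<sigma> \<in> ?perms" for \<sigma> a j
    proof -
      have "map (form0 a) (map (forms_map \<iota> 1) (permute_list \<sigma> \<omega>s)) = map (\<lambda>\<omega>. \<iota> 1 (?e a (fst \<omega>))) (permute_list \<sigma> \<omega>s)"
        using \<omega>s perm_set[OF \<sigma>] by (auto simp: forms_map_def eval_maps case_prod_beta')
      also have "\<dots> = map (\<iota> 1) (permute_list \<sigma> (map (?e a) ps))"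
        using \<sigma> by (simp add: ps_def permute_list_map r_def comp_def)
      finally show "map (form0 a) (map (forms_map \<iota> 1) (permute_list \<sigma> \<omega>s)) = map (\<iota> 1) (permute_list \<sigma> (map (?e a) ps))" .
      assume j: "j < r"
      then have "\<sigma> j < r" using permutes_in_image[of \<sigma> "{..<r}" j] \<sigma> by simp
      moreover from this have "snd (\<omega>s ! \<sigma> j) \<in> pcoeffs (gcomp T 0)" using \<omega>s(2)[of "\<omega>s ! \<sigma> j"] by (simp add: r_def)
      ultimately show "form1 a (forms_map \<iota> 1 (permute_list \<sigma> \<omega>s ! j)) = \<iota> 0 (?e a (qs ! \<sigma> j))"
        using j \<sigma> by (simp add: permute_list_nth r_def qs_def forms_map_def case_prod_beta' eval_maps)
    qed
    have G_in: "fst (G \<sigma>) \<in> pcoeffs (gcomp H 2)" "snd (G \<sigma>) \<in> pcoeffs (gcomp H 1)" if "\<sigma> \<in> ?perms" for \<sigma>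
    proof -
      have "G \<sigma> \<in> gcomp (forms_dgla H) 2"
        using F.combd_in[of "replicate r 0" "map (forms_map \<iota> 1) (permute_list \<sigma> \<omega>s)"] lens inc[OF that] perm_len
        by (simp add: G_def list_all2_conv_all_nth in_lists_conv_set sum_list_replicate)
      then show "fst (G \<sigma>) \<in> pcoeffs (gcomp H 2)" "snd (G \<sigma>) \<in> pcoeffs (gcomp H 1)"
        by (cases "G \<sigma>"; simp add: forms_dgla_simps)+
    qed
    have G0: "poly_eval (gscale H) a (fst (G \<sigma>)) = combd H K (replicate r 0) (map (\<iota> 1) (permute_list \<sigma> (map (?e a) ps)))"
      and G1: "poly_eval (gscale H) a (snd (G \<sigma>)) =
        - (\<Sum>j<r. combd H K (?z j) ((map (\<iota> 1) (permute_list \<sigma> (map (?e a) ps)))[j := \<iota> 0 (?e a (qs ! \<sigma> j))]))"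
      if \<sigma>: "\<sigma> \<in> ?perms" for \<sigma> a
      using combd_forms[of "map (forms_map \<iota> 1) (permute_list \<sigma> \<omega>s)" a] inc[OF \<sigma>] lens perm_len[of \<sigma>]
      unfolding f0[OF \<sigma>] by (simp_all add: G_def f1[OF \<sigma>])
    have RHS: "gscale (linf_forms T) ?c (\<Sum>\<sigma>\<in>?perms. forms_map \<pi> 2 (G \<sigma>)) =
        (map_poly (gscale T ?c) (\<Sum>\<sigma>\<in>?perms. map_poly (\<pi> 2) (fst (G \<sigma>))),
         map_poly (gscale T ?c) (\<Sum>\<sigma>\<in>?perms. map_poly (\<pi> 1) (snd (G \<sigma>))))"
      unfolding T' forms_scale_def forms_map_def by (simp add: case_prod_beta' fst_sum snd_sum)
    have ps_in: "list_all2 (\<lambda>p V. p \<in> pcoeffs V) ps (map (\<lambda>d. gcomp T (d + 1)) (replicate r 0))"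
      using \<omega>s lens by (auto simp: list_all2_conv_all_nth ps_def r_def)
    have qj: "qs ! j \<in> pcoeffs (gcomp T 0)" if "j < r" for j
      using \<omega>s(2)[of "\<omega>s ! j"] that by (simp add: qs_def r_def)
    have psj_in: "list_all2 (\<lambda>p V. p \<in> pcoeffs V) (ps[j := qs ! j]) (map (\<lambda>d. gcomp T (d + 1)) (?z j))" if "j < r" for j
      unfolding list_all2_conv_all_nth
    proof (intro conjI allI impI)
      show "length (ps[j := qs ! j]) = length (map (\<lambda>d. gcomp T (d + 1)) (?z j))" using lens by simp
      fix i assume "i < length (ps[j := qs ! j])"
      then have "i < r" "ps ! i \<in> pcoeffs (gcomp T 1)" using ps_in lens by (auto simp: list_all2_conv_all_nth)
      then show "ps[j := qs ! j] ! i \<in> pcoeffs (map (\<lambda>d. gcomp T (d + 1)) (?z j) ! i)"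
        using lens qj[OF that] that by (cases "i = j") auto
    qed
    have sz: "sum_list (?z j) = - 1" if "j < r" for j using that by (simp add: sum_list_replicate_update)
    have E0: "?e a (poly_multiconv (\<lambda>vs. lmult T (zip (replicate r 0) vs)) ps) =
        gscale T ?c (\<Sum>\<sigma>\<in>?perms. \<pi> 2 (combd H K (replicate r 0) (map (\<iota> 1) (permute_list \<sigma> (map (?e a) ps)))))" for a
    proof -
      have "?e a (poly_multiconv (\<lambda>vs. lmult T (zip (replicate r 0) vs)) ps) = lmult T (zip (replicate r 0) (map (?e a) ps))"
        by (rule poly_eval_multiconv[OF _ cT multilin_lmult ps_in]) (use lens cT in \<open>auto simp: sparse_degrees_replicate\<close>)
      also have "\<dots> = gscale T ?c (\<Sum>\<sigma>\<in>?perms. \<pi> 2 (combd H K (replicate r 0) (map (\<iota> 1) (permute_list \<sigma> (map (?e a) ps)))))"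
        using lmult_ge2[of "replicate r 0" "map (?e a) ps"] lens
        by (simp add: sparse_degrees_replicate permute_list_replicate map2_replicate sum_list_replicate)
      finally show ?thesis .
    qed
    have E1: "?e a (poly_multiconv (\<lambda>vs. lmult T (zip (?z j) vs)) (ps[j := qs ! j])) =
        gscale T ?c (\<Sum>\<sigma>\<in>?perms. \<pi> 1 (combd H K (permute_list \<sigma> (?z j))
          (map2 (\<lambda>d. \<iota> (d + 1)) (permute_list \<sigma> (?z j)) (permute_list \<sigma> ((map (?e a) ps)[j := ?e a (qs ! j)])))))"
      if j: "j < r" for a j
    proof -
      have "?e a (poly_multiconv (\<lambda>vs. lmult T (zip (?z j) vs)) (ps[j := qs ! j])) = lmult T (zip (?z j) (map (?e a) (ps[j := qs ! j])))"
        by (rule poly_eval_multiconv[OF _ cT multilin_lmult psj_in[OF j]]) (use lens cT in \<open>auto simp: sparse_degrees_replicate\<close>)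
      also have "\<dots> = gscale T ?c (\<Sum>\<sigma>\<in>?perms. \<pi> (sum_list (?z j) + 2) (combd H K (permute_list \<sigma> (?z j))
          (map2 (\<lambda>d. \<iota> (d + 1)) (permute_list \<sigma> (?z j)) (permute_list \<sigma> ((map (?e a) ps)[j := ?e a (qs ! j)])))))"
        using lmult_ge2[of "?z j" "map (?e a) (ps[j := qs ! j])"] lens
        by (simp add: sparse_degrees_replicate map_update)
      finally show ?thesis using sz[OF j] by simp
    qed
    \<comment> \<open>If slot \<sigma> i of the given list carries \<open>ds\<close>, then slot i of
      the permuted list does.\<close>
    have perm_term: "combd H K (permute_list \<sigma> (?z (\<sigma> i)))
          (map2 (\<lambda>d. \<iota> (d + 1)) (permute_list \<sigma> (?z (\<sigma> i))) (permute_list \<sigma> ((map (?e a) ps)[\<sigma> i := ?e a (qs ! \<sigma> i)]))) =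
        combd H K (?z i) ((map (\<iota> 1) (permute_list \<sigma> (map (?e a) ps)))[i := \<iota> 0 (?e a (qs ! \<sigma> i))])"
      if \<sigma>: "\<sigma> \<in> ?perms" and i: "i < r" for \<sigma> i a
    proof -
      have z: "permute_list \<sigma> (?z (\<sigma> i)) = ?z i"
        using permute_list_update[of \<sigma> "replicate r 0" i "- 1"] \<sigma> i by (simp add: permute_list_replicate)
      have p: "permute_list \<sigma> ((map (?e a) ps)[\<sigma> i := ?e a (qs ! \<sigma> i)]) = (permute_list \<sigma> (map (?e a) ps))[i := ?e a (qs ! \<sigma> i)]"
        using permute_list_update[of \<sigma> "map (?e a) ps" i] \<sigma> i lens by simp
      have "map2 (\<lambda>d. \<iota> (d + 1)) (?z i) ((permute_list \<sigma> (map (?e a) ps))[i := ?e a (qs ! \<sigma> i)]) =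
          (map (\<iota> 1) (permute_list \<sigma> (map (?e a) ps)))[i := \<iota> 0 (?e a (qs ! \<sigma> i))]"
        using i lens by (auto intro!: nth_equalityI simp: nth_list_update)
      then show ?thesis unfolding z p by simp
    qed
    \<comment> \<open>For each permutation the sum over slots j is rewritten with j = \<sigma> i,
      the way \<open>combd_forms\<close> counts them.\<close>
    have swap: "(\<Sum>j<r. \<Sum>\<sigma>\<in>?perms. X j \<sigma>) = (\<Sum>\<sigma>\<in>?perms. \<Sum>i<r. X (\<sigma> i) \<sigma>)" for X :: "nat \<Rightarrow> (nat \<Rightarrow> nat) \<Rightarrow> 'c"
    proof -
      have "(\<Sum>j<r. X j \<sigma>) = (\<Sum>i<r. X (\<sigma> i) \<sigma>)" if "\<sigma> \<in> ?perms" for \<sigma>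
        using sum.permute[of \<sigma> "{..<r}" "\<lambda>j. X j \<sigma>"] that by (simp add: comp_def)
      then show ?thesis by (subst sum.swap) simp
    qed
    have zi_in: "combd H K (?z i) ((map (\<iota> 1) (permute_list \<sigma> (map (?e a) ps)))[i := \<iota> 0 (?e a (qs ! \<sigma> i))]) \<in> gcomp H 1"
      if \<sigma>: "\<sigma> \<in> ?perms" and i: "i < r" for \<sigma> i a
    proof -
      have \<sigma>i: "\<sigma> k < r" if "k < r" for k using permutes_in_image[of \<sigma> "{..<r}" k] \<sigma> that by simp
      have "ps ! k \<in> pcoeffs (gcomp T 1)" if "k < r" for k
        using ps_in lens that by (auto simp: list_all2_conv_all_nth)
      then have "combd H K (?z i) ((map (\<iota> 1) (permute_list \<sigma> (map (?e a) ps)))[i := \<iota> 0 (?e a (qs ! \<sigma> i))])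
          \<in> gcomp H (sum_list (?z i) + 2)"
        using \<sigma> i lens \<sigma>i qj
        by (intro combd_in) (auto simp: list_all2_conv_all_nth nth_list_update permute_list_nth lin_in)
      then show ?thesis using sz[OF i] by simp
    qed
    show "lmult (linf_forms T) (map (Pair 0) \<omega>s) = gscale (linf_forms T) ((- 1) ^ (length \<omega>s - 2) / 2)
        (\<Sum>\<sigma> | \<sigma> permutes {..<length \<omega>s}. forms_map \<pi> 2
          (combd (forms_dgla H) (forms_map_odd K) (replicate (length \<omega>s) 0) (map (forms_map \<iota> 1) (permute_list \<sigma> \<omega>s))))"
      unfolding r_def[symmetric] G_def[symmetric] RHS LHS
    proof (intro arg_cong2[of _ _ _ _ Pair] V.poly_eqI_eval)
      fix a
      show "?e a (poly_multiconv (\<lambda>vs. lmult T (zip (replicate r 0) vs)) ps) =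
          ?e a (map_poly (gscale T ?c) (\<Sum>\<sigma>\<in>?perms. map_poly (\<pi> 2) (fst (G \<sigma>))))"
        unfolding E0 Tev by (intro arg_cong[where f = "gscale T ?c"] sum.cong) (simp_all add: eval_maps G_in G0)
      have "?e a (\<Sum>j<r. map_poly (gscale T (ksgn 1)) (poly_multiconv (\<lambda>vs. lmult T (zip (?z j) vs)) (ps[j := qs ! j]))) =
          (\<Sum>j<r. - gscale T ?c (\<Sum>\<sigma>\<in>?perms. \<pi> 1 (combd H K (permute_list \<sigma> (?z j))
          (map2 (\<lambda>d. \<iota> (d + 1)) (permute_list \<sigma> (?z j)) (permute_list \<sigma> ((map (?e a) ps)[j := ?e a (qs ! j)]))))))"
        unfolding Tev by (rule sum.cong) (simp_all add: E1 ksgn_def)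
      also have "\<dots> = - gscale T ?c (\<Sum>j<r. \<Sum>\<sigma>\<in>?perms. \<pi> 1 (combd H K (permute_list \<sigma> (?z j))
          (map2 (\<lambda>d. \<iota> (d + 1)) (permute_list \<sigma> (?z j)) (permute_list \<sigma> ((map (?e a) ps)[j := ?e a (qs ! j)])))))"
        by (simp only: sum_negf V.scale_sum_right)
      also have "\<dots> = - gscale T ?c (\<Sum>\<sigma>\<in>?perms. \<Sum>i<r. \<pi> 1 (combd H K (?z i) ((map (\<iota> 1) (permute_list \<sigma> (map (?e a) ps)))[i := \<iota> 0 (?e a (qs ! \<sigma> i))])))"
        unfolding swap by (simp add: perm_term)
      also have "\<dots> = gscale T ?c (\<Sum>\<sigma>\<in>?perms. \<pi> 1 (poly_eval (gscale H) a (snd (G \<sigma>))))"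
      proof -
        have "\<pi> 1 (poly_eval (gscale H) a (snd (G \<sigma>))) =
            - (\<Sum>i<r. \<pi> 1 (combd H K (?z i) ((map (\<iota> 1) (permute_list \<sigma> (map (?e a) ps)))[i := \<iota> 0 (?e a (qs ! \<sigma> i))])))"
          if "\<sigma> \<in> ?perms" for \<sigma>
          unfolding G1[OF that] by (rule proj_neg_sum) (use zi_in[OF that] in simp)
        then show ?thesis by (simp add: sum_negf)
      qed
      also have "\<dots> = ?e a (map_poly (gscale T ?c) (\<Sum>\<sigma>\<in>?perms. map_poly (\<pi> 1) (snd (G \<sigma>))))"
        unfolding Tev by (intro arg_cong[where f = "gscale T ?c"] sum.cong) (simp_all add: eval_maps G_in)
      finally show "?e a (\<Sum>j<r. map_poly (gscale T (ksgn 1)) (poly_multiconv (\<lambda>vs. lmult T (zip (?z j) vs)) (ps[j := qs ! j]))) =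
          ?e a (map_poly (gscale T ?c) (\<Sum>\<sigma>\<in>?perms. map_poly (\<pi> 1) (snd (G \<sigma>))))" .
    qed
  qed
qed

end

section \<open>The Maurer-Cartan equation of the transferred structure\<close>

lemma sum_list_map_concat_map:
  "sum_list (map f (concat (map g xs))) = sum_list (map (\<lambda>x. sum_list (map f (g x))) xs)"
  by (induction xs) auto

lemma sum_n_lists_Suc:
  "sum_list (map f (List.n_lists (Suc n) xs)) =
   sum_list (map (\<lambda>ys. sum_list (map (\<lambda>y. f (y # ys)) xs)) (List.n_lists n xs))"
  by (simp add: sum_list_map_concat_map comp_def)

lemma n_lists_map: "List.n_lists n (map f xs) = map (map f) (List.n_lists n xs)"
  by (induction n) (simp_all add: map_concat comp_def)

text \<open>Entries of xs may coincide, so the permutation is carried out on words of indices; these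
  are all distinct, and \<open>permute_list \<sigma>\<close> is a bijection on them.\<close>

lemma mset_n_lists_permute:
  assumes \<sigma>: "\<sigma> permutes {..<n}"
  shows "mset (map (permute_list \<sigma>) (List.n_lists n xs)) = mset (List.n_lists n xs)"
proof -
  let ?I = "List.n_lists n [0..<length xs]"
  have set: "set ?I = {is. length is = n \<and> set is \<subseteq> {0..<length xs}}"
    by (simp add: set_n_lists)
  have inv: "permute_list (inv_into UNIV \<sigma>) (permute_list \<sigma> is) = is" "permute_list \<sigma> (permute_list (inv_into UNIV \<sigma>) is) = is"
    if "length is = n" for "is" :: "nat list"
    using permute_list_compose[of "inv_into UNIV \<sigma>" "is" \<sigma>] permute_list_compose[of \<sigma> "is" "inv_into UNIV \<sigma>"] that
      permutes_inv[OF \<sigma>] \<sigma> permutes_inv_o[OF \<sigma>] by simp_all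
  have img: "permute_list \<sigma> ` set ?I = set ?I"
  proof
    show "permute_list \<sigma> ` set ?I \<subseteq> set ?I" using \<sigma> by (auto simp: set)
    show "set ?I \<subseteq> permute_list \<sigma> ` set ?I"
    proof
      fix js assume "js \<in> set ?I"
      then have "permute_list (inv_into UNIV \<sigma>) js \<in> set ?I" "js = permute_list \<sigma> (permute_list (inv_into UNIV \<sigma>) js)"
        using inv(2)[of js] permutes_inv[OF \<sigma>] by (auto simp: set)
      then show "js \<in> permute_list \<sigma> ` set ?I" by blast
    qed
  qed
  have inj: "inj_on (permute_list \<sigma>) (set ?I)"
    using inv(1) by (intro inj_on_inverseI[of _ "permute_list (inv_into UNIV \<sigma>)"]) (auto simp: set)
  have "distinct ?I" by (simp add: distinct_n_lists)
  then have "mset (map (permute_list \<sigma>) ?I) = mset ?I"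
    using img inj by (intro set_eq_iff_mset_eq_distinct[THEN iffD1]) (simp_all add: distinct_map)
  then have "image_mset (map ((!) xs)) (mset (map (permute_list \<sigma>) ?I)) = image_mset (map ((!) xs)) (mset ?I)"
    by simp
  then have "mset (map (\<lambda>is. map ((!) xs) (permute_list \<sigma> is)) ?I) = mset (map (map ((!) xs)) ?I)"
    by (simp add: multiset.map_comp comp_def)
  moreover have "map (\<lambda>is. map ((!) xs) (permute_list \<sigma> is)) ?I = map (\<lambda>is. permute_list \<sigma> (map ((!) xs) is)) ?I"
    using \<sigma> by (auto simp: set permute_list_map)
  moreover have "List.n_lists n xs = map (map ((!) xs)) ?I"
    by (simp add: n_lists_map[symmetric] map_nth)
  ultimately show ?thesis by (simp add: comp_def)
qed

lemma sum_n_lists_permute: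
  fixes f :: "_ \<Rightarrow> 'x::comm_monoid_add"
  assumes \<sigma>: "\<sigma> permutes {..<n}"
  shows "sum_list (map (\<lambda>ws. f (permute_list \<sigma> ws)) (List.n_lists n xs)) = sum_list (map f (List.n_lists n xs))"
proof -
  have "sum_list (map (\<lambda>ws. f (permute_list \<sigma> ws)) (List.n_lists n xs)) =
      sum_mset (image_mset f (mset (map (permute_list \<sigma>) (List.n_lists n xs))))"
    by (simp add: sum_mset_sum_list[symmetric] multiset.map_comp comp_def)
  also have "\<dots> = sum_list (map f (List.n_lists n xs))"
    unfolding mset_n_lists_permute[OF \<sigma>] by (simp add: sum_mset_sum_list[symmetric])
  finally show ?thesis .
qed

definition tprod :: "'a calgebra \<Rightarrow> ('v, 'a) fsum \<Rightarrow> 'a" where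
  "tprod A ws = foldr (\<lambda>w b. snd w \<otimes>\<^bsub>A\<^esub> b) ws \<one>\<^bsub>A\<^esub>"

lemma tprod_simps [simp]: "tprod A [] = \<one>\<^bsub>A\<^esub>" "tprod A (w # ws) = snd w \<otimes>\<^bsub>A\<^esub> tprod A ws"
  by (simp_all add: tprod_def)

text \<open>The counterpart of \<open>comb\<close> on formal sums, through which the terms of
  \<open>tpower\<close> are compared with brackets in the tensored DGLA.\<close>

primrec comb_list :: "'h::ab_group_add dgla \<Rightarrow> 'a calgebra \<Rightarrow> ('h \<Rightarrow> 'h) \<Rightarrow> ('h, 'a) fsum \<Rightarrow> nat \<Rightarrow> ('h, 'a) fsum" where
  "comb_list H A k y 0 = tmap uminus (tmap2 (brkt H 1 1) A y y)"
| "comb_list H A k y (Suc n) = tmap uminus (tmap2 (brkt H 1 1) A y (tmap k (comb_list H A k y n)))"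

context art_algebra
begin

lemma tprod_carrier: "ws \<in> lists (V \<times> \<mm>) \<Longrightarrow> tprod A ws \<in> carrier A"
  by (induction ws) auto

lemma tprod_in: "ws \<in> lists (V \<times> \<mm>) \<Longrightarrow> ws \<noteq> [] \<Longrightarrow> tprod A ws \<in> \<mm>"
  using tprod_carrier[of "tl ws" V] by (cases ws) auto

lemma tprod_mset: "mset ws = mset ws' \<Longrightarrow> ws \<in> lists (V \<times> \<mm>) \<Longrightarrow> tprod A ws = tprod A ws'"
proof (induction ws arbitrary: ws')
  case (Cons w ws)
  then have "w \<in> set ws'" by (metis list.set_intros(1) set_mset_mset)
  then obtain us vs where ws': "ws' = us @ w # vs" by (meson split_list)
  have "set ws' = set (w # ws)" using Cons.prems(1) by (metis set_mset_mset)
  then have l: "ws' \<in> lists (V \<times> \<mm>)" using Cons.prems(2) by (auto simp: in_lists_conv_set)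
  have "tprod A (us @ w # vs) = snd w \<otimes> tprod A (us @ vs)"
    using l unfolding ws'
  proof (induction us)
    case (Cons u us)
    then have "us @ vs \<in> lists (V \<times> \<mm>)" by simp
    then have "tprod A (us @ vs) \<in> carrier A" by (rule tprod_carrier)
    with Cons show ?case by (auto simp: m_lcomm)
  qed simp
  moreover have "tprod A ws = tprod A (us @ vs)"
    using Cons.prems ws' by (intro Cons.IH) auto
  ultimately show ?case by (simp add: ws')
qed simp

lemma tsum_uminus:
  assumes "vector_space s" "x \<in> lists (V \<times> \<mm>)"
  shows "tsum s V A (tmap uminus x) = - tsum s V A x"
proof -
  interpret vector_space s by fact
  have "s (- 1) = uminus" by (intro ext) simp
  then have "tsum s V A (tmap uminus x) = tscale (- 1) (tsum s V A x)"
    unfolding tsum_scale[OF assms(2)] by simp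
  also have "\<dots> = - tsum s V A x" by (auto simp: fun_eq_iff)
  finally show ?thesis .
qed

lemma bilin_sum:
  assumes V: "csub s V" and \<phi>: "bilin s V A \<phi>" and a: "a \<in> \<mm>"
  shows "(\<And>i. i \<in> S \<Longrightarrow> f i \<in> V) \<Longrightarrow> \<phi> (sum f S, a) = (\<Sum>i\<in>S. \<phi> (f i, a))"
proof -
  interpret csub s V by fact
  show "(\<And>i. i \<in> S \<Longrightarrow> f i \<in> V) \<Longrightarrow> \<phi> (sum f S, a) = (\<Sum>i\<in>S. \<phi> (f i, a))"
    by (induction S rule: infinite_finite_induct)
      (auto simp: bilin_simps(1)[OF V \<phi> a] bilinD(1)[OF \<phi> _ _ a])
qed

text \<open>Fixed once for each algebra, so that the theory of nilpotent DGLAs can be instantiated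
  with a definite index.\<close>

definition nil_index :: "'v::ab_group_add dgla \<Rightarrow> nat" where
  "nil_index L = (SOME N. nil_dgla (tens L A) (\<lambda>k i. tfilt (gscale L) (gcomp L i) A k) N)"

lemma nil_dgla_tens':
  "is_dgla L \<Longrightarrow> nil_dgla (tens L A) (\<lambda>k i. tfilt (gscale L) (gcomp L i) A k) (nil_index L)"
  unfolding nil_index_def by (rule someI_ex, erule nil_dgla_tens, blast)

lemma nil_contraction_tens:
  assumes "contraction H V dV \<iota> \<pi> K"
  shows "nil_contraction (tens H A) (tens_space V A)
    (\<lambda>i. tlift (gscale V) (gcomp V (i + 1)) A (dV i))
    (\<lambda>i. tlift (gscale H) (gcomp H i) A (\<iota> i))
    (\<lambda>i. tlift (gscale V) (gcomp V i) A (\<pi> i))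
    (\<lambda>i. tlift (gscale H) (gcomp H (i - 1)) A (K i))
    (\<lambda>k i. tfilt (gscale H) (gcomp H i) A k) (nil_index H)"
proof -
  interpret contraction H V dV \<iota> \<pi> K by fact
  show ?thesis
    by (rule nil_contraction.intro[OF contraction_tens[OF assms] nil_dgla_tens'[OF dgla]],
      rule nil_contraction_axioms.intro, rule tlift_tfilt[OF linear_K])
qed

end

lemma tpower_eq: "tpower T A k x = map (\<lambda>ws. (lmult T (map (Pair 0) (map fst ws)), tprod A ws)) (List.n_lists k x)"
  by (simp add: tpower_def tprod_def comp_def)

lemma sum_list_map_sum_swap:
  "sum_list (map (\<lambda>w. \<Sum>\<sigma>\<in>S. f w \<sigma>) ws) = (\<Sum>\<sigma>\<in>S. sum_list (map (\<lambda>w. f w \<sigma>) ws))"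
  for f :: "_ \<Rightarrow> _ \<Rightarrow> 'x::comm_monoid_add"
  by (induction ws) (simp_all add: sum.distrib)

locale art_transferred = A: art_algebra A + transferred0 H T dV \<iota> \<pi> K
  for A :: "'a calgebra" and H :: "'h::ab_group_add dgla" and T :: "'c::ab_group_add linf" and dV \<iota> \<pi> K
begin

sublocale NC: nil_contraction "tens H A" "tens_space T A"
    "\<lambda>i. tlift (gscale T) (gcomp T (i + 1)) A (dV i)"
    "\<lambda>i. tlift (gscale H) (gcomp H i) A (\<iota> i)"
    "\<lambda>i. tlift (gscale T) (gcomp T i) A (\<pi> i)"
    "\<lambda>i. tlift (gscale H) (gcomp H (i - 1)) A (K i)"
    "\<lambda>k i. tfilt (gscale H) (gcomp H i) A k" "A.nil_index H"
  by (rule A.nil_contraction_tens[OF contraction_axioms])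

abbreviation "semT i \<equiv> tsum (gscale T) (gcomp T i) A"
abbreviation "semH i \<equiv> tsum (gscale H) (gcomp H i) A"

lemma csub_T [simp]: "csub (gscale T) (gcomp T i)"
  by (rule csub_of_graded[OF graded_V])

context
  fixes x :: "('c, 'a) fsum"
  assumes x: "x \<in> lists (gcomp T 1 \<times> max_ideal A)"
begin

lemma incl_list: "tmap (\<iota> 1) x \<in> lists (gcomp H 1 \<times> max_ideal A)"
  by (rule tmap_in[OF x]) (simp add: lin_in)

lemma comb_list_in: "comb_list H A (K 2) (tmap (\<iota> 1) x) n \<in> lists (gcomp H 2 \<times> max_ideal A)"
proof (induction n)
  case 0
  have "tmap2 (brkt H 1 1) A (tmap (\<iota> 1) x) (tmap (\<iota> 1) x) \<in> lists (gcomp H 2 \<times> max_ideal A)"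
    using A.tmap2_in[OF bilinear_brkt[of 1 1] incl_list incl_list] by simp
  then have "tmap uminus (tmap2 (brkt H 1 1) A (tmap (\<iota> 1) x) (tmap (\<iota> 1) x)) \<in> lists (gcomp H 2 \<times> max_ideal A)"
    by (rule tmap_in) simp
  then show ?case by simp
next
  case (Suc n)
  have "tmap (K 2) (comb_list H A (K 2) (tmap (\<iota> 1) x) n) \<in> lists (gcomp H 1 \<times> max_ideal A)"
    by (rule tmap_in[OF Suc]) (simp add: lin_in)
  from A.tmap2_in[OF bilinear_brkt[of 1 1] incl_list this]
  have "tmap2 (brkt H 1 1) A (tmap (\<iota> 1) x) (tmap (K 2) (comb_list H A (K 2) (tmap (\<iota> 1) x) n)) \<in> lists (gcomp H 2 \<times> max_ideal A)"
    by simp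
  then have "tmap uminus (tmap2 (brkt H 1 1) A (tmap (\<iota> 1) x) (tmap (K 2) (comb_list H A (K 2) (tmap (\<iota> 1) x) n))) \<in> lists (gcomp H 2 \<times> max_ideal A)"
    by (rule tmap_in) simp
  then show ?case by simp
qed

lemma semH_comb_list: "semH 2 (comb_list H A (K 2) (tmap (\<iota> 1) x) n) = NC.comb (semH 1 (tmap (\<iota> 1) x)) n"
proof (induction n)
  case 0
  have i: "tmap2 (brkt H 1 1) A (tmap (\<iota> 1) x) (tmap (\<iota> 1) x) \<in> lists (gcomp H 2 \<times> max_ideal A)"
    using A.tmap2_in[OF bilinear_brkt[of 1 1] incl_list incl_list] by simp
  have "semH 2 (tmap2 (brkt H 1 1) A (tmap (\<iota> 1) x) (tmap (\<iota> 1) x)) =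
      brkt (tens H A) 1 1 (semH 1 (tmap (\<iota> 1) x)) (semH 1 (tmap (\<iota> 1) x))"
    using A.tsum_tmap2[OF csub bilinear_brkt[of 1 1] incl_list incl_list] by (simp add: tens_simps)
  then show ?case by (simp add: A.tsum_uminus[OF vector_space_axioms i])
next
  case (Suc n)
  let ?k = "tmap (K 2) (comb_list H A (K 2) (tmap (\<iota> 1) x) n)"
  have k: "?k \<in> lists (gcomp H 1 \<times> max_ideal A)"
    by (rule tmap_in[OF comb_list_in]) (simp add: lin_in)
  have i: "tmap2 (brkt H 1 1) A (tmap (\<iota> 1) x) ?k \<in> lists (gcomp H 2 \<times> max_ideal A)"
    using A.tmap2_in[OF bilinear_brkt[of 1 1] incl_list k] by simp
  have "semH 2 (tmap2 (brkt H 1 1) A (tmap (\<iota> 1) x) ?k) = brkt (tens H A) 1 1 (semH 1 (tmap (\<iota> 1) x)) (semH 1 ?k)"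
    using A.tsum_tmap2[OF csub bilinear_brkt[of 1 1] incl_list k] by (simp add: tens_simps)
  moreover have "semH 1 ?k = tlift (gscale H) (gcomp H 1) A (K 2) (semH 2 (comb_list H A (K 2) (tmap (\<iota> 1) x) n))"
    using A.tsum_tmap[OF linear_K[of 2] comb_list_in] by simp
  ultimately show ?case using Suc by (simp add: A.tsum_uminus[OF vector_space_axioms i])
qed

text \<open>Expanding the nested brackets gives one term for every word of length n + 2 in the
  entries of x. The functional is arbitrary because the induction applies the claim to functionals
  precomposed with a bracket.\<close>

lemma sum_comb_list:
  fixes \<psi> :: "'h \<times> 'a \<Rightarrow> complex"
  shows "sum_list (map \<psi> (comb_list H A (K 2) (tmap (\<iota> 1) x) n)) =
    sum_list (map (\<lambda>ws. \<psi> (combd H K (replicate (n + 2) 0) (map (\<lambda>w. \<iota> 1 (fst w)) ws), tprod A ws))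
      (List.n_lists (n + 2) x))"
proof (induction n arbitrary: \<psi>)
  case 0
  have c: "snd p \<in> carrier A" if "p \<in> set x" for p using x that by (auto simp: in_lists_conv_set)
  have "sum_list (map \<psi> (comb_list H A (K 2) (tmap (\<iota> 1) x) 0)) =
      sum_list (map (\<lambda>p. sum_list (map (\<lambda>q. \<psi> (- brkt H 1 1 (\<iota> 1 (fst p)) (\<iota> 1 (fst q)), snd p \<otimes>\<^bsub>A\<^esub> snd q)) x)) x)"
    by (simp add: sum_list_map_tmap sum_list_map_tmap2)
  also have "\<dots> = sum_list (map (\<lambda>q. sum_list (map (\<lambda>p. \<psi> (- brkt H 1 1 (\<iota> 1 (fst p)) (\<iota> 1 (fst q)), snd p \<otimes>\<^bsub>A\<^esub> (snd q \<otimes>\<^bsub>A\<^esub> \<one>\<^bsub>A\<^esub>))) x)) x)"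
    using c by (subst sum_list_map_swap) (simp cong: map_cong)
  also have "\<dots> = sum_list (map (\<lambda>ws. \<psi> (combd H K (replicate (0 + 2) 0) (map (\<lambda>w. \<iota> 1 (fst w)) ws), tprod A ws))
      (List.n_lists (0 + 2) x))"
    by (simp add: numeral_2_eq_2 sum_list_map_concat_map comp_def ksgn_def del: One_nat_def)
  finally show ?case .
next
  case (Suc n)
  have rep: "replicate (Suc n + 2) (0::int) = 0 # replicate (n + 2) 0" by simp
  have cc: "combd H K (replicate (Suc n + 2) 0) (map (\<lambda>w. \<iota> 1 (fst w)) (p # ws)) =
      - brkt H 1 1 (\<iota> 1 (fst p)) (K 2 (combd H K (replicate (n + 2) 0) (map (\<lambda>w. \<iota> 1 (fst w)) ws)))" for p ws
    unfolding rep list.map by (subst combd_Cons) (simp_all add: sum_list_replicate ksgn_def del: replicate.simps)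
  have "sum_list (map \<psi> (comb_list H A (K 2) (tmap (\<iota> 1) x) (Suc n))) =
      sum_list (map (\<lambda>p. sum_list (map (\<lambda>q. \<psi> (- brkt H 1 1 (\<iota> 1 (fst p)) (K 2 (fst q)), snd p \<otimes>\<^bsub>A\<^esub> snd q))
        (comb_list H A (K 2) (tmap (\<iota> 1) x) n))) x)"
    by (simp add: sum_list_map_tmap sum_list_map_tmap2)
  also have "\<dots> = sum_list (map (\<lambda>p. sum_list (map (\<lambda>ws. \<psi> (- brkt H 1 1 (\<iota> 1 (fst p))
        (K 2 (combd H K (replicate (n + 2) 0) (map (\<lambda>w. \<iota> 1 (fst w)) ws))), snd p \<otimes>\<^bsub>A\<^esub> tprod A ws)) (List.n_lists (n + 2) x))) x)"
    unfolding Suc.IH by simp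
  also have "\<dots> = sum_list (map (\<lambda>ws. \<psi> (combd H K (replicate (Suc n + 2) 0) (map (\<lambda>w. \<iota> 1 (fst w)) ws), tprod A ws))
      (List.n_lists (Suc n + 2) x))"
    unfolding add_Suc sum_n_lists_Suc by (subst sum_list_map_swap) (simp only: cc[unfolded add_Suc] tprod_simps)
  finally show ?case .
qed

lemma n_lists_in:
  assumes "ws \<in> set (List.n_lists r x)"
  shows "length ws = r" "ws \<in> lists (gcomp T 1 \<times> max_ideal A)" "map fst ws \<in> lists (gcomp T 1)"
    and "1 \<le> r \<Longrightarrow> tprod A ws \<in> max_ideal A"
proof -
  have *: "length ws = r" "set ws \<subseteq> set x" using assms by (auto simp: set_n_lists)
  then show l: "ws \<in> lists (gcomp T 1 \<times> max_ideal A)" using x by (auto simp: in_lists_conv_set)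
  then show "map fst ws \<in> lists (gcomp T 1)" by (auto simp: in_lists_conv_set)
  show "length ws = r" by (rule *(1))
  show "1 \<le> r \<Longrightarrow> tprod A ws \<in> max_ideal A" using A.tprod_in[OF l] *(1) by (cases ws) auto
qed

lemma comb_term_in:
  assumes "2 \<le> length vs" "vs \<in> lists (gcomp T 1)"
  shows "\<pi> 2 (combd H K (replicate (length vs) 0) (map (\<iota> 1) vs)) \<in> gcomp T 2"
proof -
  have "combd H K (replicate (length vs) 0) (map (\<iota> 1) vs) \<in> gcomp H (sum_list (replicate (length vs) 0) + 2)"
    using assms by (intro combd_in) (auto simp: list_all2_conv_all_nth in_lists_conv_set lin_in)
  then show ?thesis by (simp add: sum_list_replicate lin_in)
qed

lemma perm_lists:
  "\<sigma> permutes {..<length vs} \<Longrightarrow> vs \<in> lists V \<Longrightarrow> permute_list \<sigma> vs \<in> lists V"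
  by (simp add: in_lists_conv_set)

lemma lmult_in:
  assumes "2 \<le> length vs" "vs \<in> lists (gcomp T 1)"
  shows "lmult T (map (Pair 0) vs) \<in> gcomp T 2"
  unfolding lmult0_ge2[OF assms]
  using comb_term_in[of "permute_list _ vs"] assms perm_lists[OF _ assms(2)]
  by (intro V.scale_in V.sum_in) auto

lemma tpower_in: "1 \<le> r \<Longrightarrow> tpower T A r x \<in> lists (gcomp T 2 \<times> max_ideal A)"
proof -
  assume r: "1 \<le> r"
  have "lmult T (map (Pair 0) (map fst ws)) \<in> gcomp T 2" if ws: "ws \<in> set (List.n_lists r x)" for ws
  proof (cases "r = 1")
    case True
    with n_lists_in(1,2)[OF ws] obtain v a where "ws = [(v, a)]" "v \<in> gcomp T 1" by (cases ws) auto
    then show ?thesis using lmult0_1[of v] lin_in(4)[of v 1 2] by simp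
  next
    case False
    with r n_lists_in(1,3)[OF ws] show ?thesis by (intro lmult_in) auto
  qed
  then show ?thesis
    unfolding tpower_eq using n_lists_in(4)[OF _ r] by (auto simp: in_lists_conv_set)
qed

lemma semT_tpower_1: "semT 2 (tpower T A 1 x) = - tlift (gscale T) (gcomp T 2) A (dV 1) (semT 1 x)"
proof -
  have "tpower T A 1 x = map (\<lambda>w. (- dV 1 (fst w), snd w)) x"
    unfolding tpower_eq using x lmult0_1
    by (auto simp: in_lists_conv_set)
  then have "tpower T A 1 x = tmap uminus (tmap (dV 1) x)"
    by (simp add: tmap_def comp_def case_prod_beta')
  moreover have d: "tmap (dV 1) x \<in> lists (gcomp T 2 \<times> max_ideal A)"
    by (rule tmap_in[OF x]) (simp add: lin_in)
  ultimately show ?thesis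
    using A.tsum_tmap[OF linear_dV[of 1] x] A.tsum_uminus[OF V.vector_space_axioms d] by simp
qed

text \<open>Commutativity of \<open>A\<close> makes \<open>tprod\<close> symmetric, so each of the
  (n + 2)! permutations in the multiplication contributes the same sum over words. The resulting
  factorial will cancel the one in the Maurer-Cartan series.\<close>

lemma semT_tpower:
  "semT 2 (tpower T A (n + 2) x) = tscale (fact (n + 2) * ((- 1) ^ n / 2))
     (tlift (gscale T) (gcomp T 2) A (\<pi> 2) (NC.comb (tlift (gscale H) (gcomp H 1) A (\<iota> 1) (semT 1 x)) n))"
proof -
  let ?r = "n + 2"
  let ?c = "(- 1) ^ n / 2 :: complex"
  have y: "tlift (gscale H) (gcomp H 1) A (\<iota> 1) (semT 1 x) = semH 1 (tmap (\<iota> 1) x)"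
    by (rule A.tsum_tmap[OF linear_incl x, symmetric])
  have z: "tlift (gscale T) (gcomp T 2) A (\<pi> 2) (semH 2 (comb_list H A (K 2) (tmap (\<iota> 1) x) n)) =
      semT 2 (tmap (\<pi> 2) (comb_list H A (K 2) (tmap (\<iota> 1) x) n))"
    by (rule A.tsum_tmap[OF linear_proj comb_list_in, symmetric])
  show ?thesis
    unfolding y semH_comb_list[symmetric] z
  proof
    fix \<phi>
    show "semT 2 (tpower T A ?r x) \<phi> = tscale (fact ?r * ?c) (semT 2 (tmap (\<pi> 2) (comb_list H A (K 2) (tmap (\<iota> 1) x) n))) \<phi>"
    proof (cases "bilin (gscale T) (gcomp T 2) A \<phi>")
      case \<phi>: True
      define \<Psi> where "\<Psi> ws = \<phi> (\<pi> 2 (combd H K (replicate ?r 0) (map (\<lambda>w. \<iota> 1 (fst w)) ws)), tprod A ws)" for ws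
      have eq_term: "\<phi> (lmult T (map (Pair 0) (map fst ws)), tprod A ws) =
          ?c * (\<Sum>\<sigma> | \<sigma> permutes {..<?r}. \<Psi> (permute_list \<sigma> ws))" if ws: "ws \<in> set (List.n_lists ?r x)" for ws
      proof -
        note w = n_lists_in[OF ws]
        have a: "tprod A ws \<in> max_ideal A" using w(4) by simp
        have cin: "\<pi> 2 (combd H K (replicate ?r 0) (map (\<iota> 1) (permute_list \<sigma> (map fst ws)))) \<in> gcomp T 2"
          if "\<sigma> permutes {..<?r}" for \<sigma>
          using comb_term_in[of "permute_list \<sigma> (map fst ws)"] perm_lists[OF _ w(3), of \<sigma>] w(1) that by simp
        have "lmult T (map (Pair 0) (map fst ws)) = gscale T ?c (\<Sum>\<sigma> | \<sigma> permutes {..<?r}.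
            \<pi> 2 (combd H K (replicate ?r 0) (map (\<iota> 1) (permute_list \<sigma> (map fst ws)))))"
          using lmult0_ge2[OF _ w(3)] w(1) by simp
        then have "\<phi> (lmult T (map (Pair 0) (map fst ws)), tprod A ws) = ?c * (\<Sum>\<sigma> | \<sigma> permutes {..<?r}.
            \<phi> (\<pi> 2 (combd H K (replicate ?r 0) (map (\<iota> 1) (permute_list \<sigma> (map fst ws)))), tprod A ws))"
        proof -
          let ?S = "\<Sum>\<sigma> | \<sigma> permutes {..<?r}. \<pi> 2 (combd H K (replicate ?r 0) (map (\<iota> 1) (permute_list \<sigma> (map fst ws))))"
          have "?S \<in> gcomp T 2" by (rule V.sum_in) (use cin in simp)
          then have "\<phi> (gscale T ?c ?S, tprod A ws) = ?c * \<phi> (?S, tprod A ws)"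
            using a by (rule bilinD(3)[OF \<phi>])
          also have "\<phi> (?S, tprod A ws) = (\<Sum>\<sigma> | \<sigma> permutes {..<?r}.
            \<phi> (\<pi> 2 (combd H K (replicate ?r 0) (map (\<iota> 1) (permute_list \<sigma> (map fst ws)))), tprod A ws))"
            by (rule A.bilin_sum[OF csub_T \<phi> a]) (use cin in simp)
          finally show ?thesis using \<open>lmult T (map (Pair 0) (map fst ws)) = _\<close> by simp
        qed
        also have "(\<Sum>\<sigma> | \<sigma> permutes {..<?r}.
            \<phi> (\<pi> 2 (combd H K (replicate ?r 0) (map (\<iota> 1) (permute_list \<sigma> (map fst ws)))), tprod A ws)) =
            (\<Sum>\<sigma> | \<sigma> permutes {..<?r}. \<Psi> (permute_list \<sigma> ws))"
        proof (rule sum.cong[OF HOL.refl])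
          fix \<sigma> assume "\<sigma> \<in> {\<sigma>. \<sigma> permutes {..<?r}}"
          then have \<sigma>: "\<sigma> permutes {..<length ws}" using w(1) by simp
          have "tprod A (permute_list \<sigma> ws) = tprod A ws"
            using A.tprod_mset[OF _ w(2), of "permute_list \<sigma> ws"] mset_permute_list[OF \<sigma>] by simp
          then show "\<phi> (\<pi> 2 (combd H K (replicate ?r 0) (map (\<iota> 1) (permute_list \<sigma> (map fst ws)))), tprod A ws) =
              \<Psi> (permute_list \<sigma> ws)"
            using \<sigma> by (simp add: \<Psi>_def permute_list_map comp_def)
        qed
        finally show ?thesis .
      qed
      have card: "card {\<sigma>. \<sigma> permutes {..<?r}} = fact ?r" by (rule card_permutations) simp_all
      have "semT 2 (tpower T A ?r x) \<phi> = sum_list (map (\<lambda>ws. \<phi> (lmult T (map (Pair 0) (map fst ws)), tprod A ws)) (List.n_lists ?r x))"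
        by (simp add: A.tsum_apply[OF \<phi>] tpower_eq comp_def del: List.n_lists.simps)
      also have "\<dots> = sum_list (map (\<lambda>ws. ?c * (\<Sum>\<sigma> | \<sigma> permutes {..<?r}. \<Psi> (permute_list \<sigma> ws))) (List.n_lists ?r x))"
        by (rule A.sum_list_map_cong) (rule eq_term)
      also have "\<dots> = ?c * (\<Sum>\<sigma> | \<sigma> permutes {..<?r}. sum_list (map (\<lambda>ws. \<Psi> (permute_list \<sigma> ws)) (List.n_lists ?r x)))"
        by (simp only: sum_list_const_mult sum_list_map_sum_swap)
      also have "\<dots> = ?c * (\<Sum>\<sigma> | \<sigma> permutes {..<?r}. sum_list (map \<Psi> (List.n_lists ?r x)))"
        by (intro arg_cong[where f = "(*) ?c"] sum.cong[OF HOL.refl] sum_n_lists_permute) simp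
      also have "\<dots> = ?c * (fact ?r * sum_list (map \<Psi> (List.n_lists ?r x)))"
        by (simp only: sum_constant card of_nat_fact)
      also have "sum_list (map \<Psi> (List.n_lists ?r x)) =
          sum_list (map (\<lambda>p. \<phi> (\<pi> 2 (fst p), snd p)) (comb_list H A (K 2) (tmap (\<iota> 1) x) n))"
        unfolding sum_comb_list \<Psi>_def by simp
      also have "\<dots> = semT 2 (tmap (\<pi> 2) (comb_list H A (K 2) (tmap (\<iota> 1) x) n)) \<phi>"
        by (simp add: A.tsum_apply[OF \<phi>] sum_list_map_tmap)
      finally show ?thesis by (simp only: mult.assoc mult.left_commute[of ?c] tscale_apply)
    qed (simp add: tsum_def)
  qed
qed

lemma tsum_concat: "tsum s V A (concat (map f [0..<n])) = (\<Sum>i<n. tsum s V A (f i))"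
  by (induction n) simp_all

text \<open>A partial sum of the series that is long enough vanishes exactly if the unique lift is
  Maurer-Cartan, so the eventual condition in \<open>tseries\<close> does not depend on the
  cutoff.\<close>

lemma MC_eq_linf_iff: "MC_eq_linf T A x \<longleftrightarrow> (\<exists>Y. NC.lifts (semT 1 x) Y \<and> NC.MC Y)"
proof -
  let ?X = "semT 1 x"
  let ?f = "\<lambda>n. tmap (gscale T (1 / fact (n + 1))) (tpower T A (n + 1) x)"
  have X: "?X \<in> gcomp (tens_space T A) 1" unfolding tens_simps by (rule tsetI[OF x])
  obtain Y where Y: "NC.lifts ?X Y" using NC.lifts_exists[OF X] by blast
  have f_in: "?f n \<in> lists (gcomp T 2 \<times> max_ideal A)" for n
    by (rule tmap_in[OF tpower_in]) simp_all
  have f0: "semT 2 (?f 0) = - tlift (gscale T) (gcomp T 2) A (dV 1) ?X"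
  proof -
    have "?f 0 = tpower T A 1 x" by (simp add: tmap_def)
    then show ?thesis by (simp only: semT_tpower_1)
  qed
  have fS: "semT 2 (?f (Suc n)) = tscale ((- 1) ^ n / 2)
     (tlift (gscale T) (gcomp T 2) A (\<pi> 2) (NC.comb (tlift (gscale H) (gcomp H 1) A (\<iota> 1) ?X) n))" for n
  proof -
    have "Suc n + 1 = n + 2" by simp
    then have "semT 2 (?f (Suc n)) = tscale (1 / fact (n + 2)) (semT 2 (tpower T A (n + 2) x))"
      using A.tsum_scale[OF tpower_in[of "n + 2"], of "1 / fact (n + 2)" "gscale T"] by (simp only:)
    also have "\<dots> = tscale ((- 1) ^ n / 2)
     (tlift (gscale T) (gcomp T 2) A (\<pi> 2) (NC.comb (tlift (gscale H) (gcomp H 1) A (\<iota> 1) ?X) n))"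
      unfolding semT_tpower by (simp add: fun_eq_iff del: fact_Suc)
    finally show ?thesis .
  qed
  have sum: "semT 2 (concat (map ?f [0..<Suc M])) = - tlift (gscale T) (gcomp T 2) A (dV 1) ?X +
     (\<Sum>n<M. tscale ((- 1) ^ n / 2) (tlift (gscale T) (gcomp T 2) A (\<pi> 2)
       (NC.comb (tlift (gscale H) (gcomp H 1) A (\<iota> 1) ?X) n)))" for M
    unfolding tsum_concat sum.lessThan_Suc_shift f0 fS ..
  have teq_iff: "teq T A 2 (concat (map ?f [0..<M])) [] \<longleftrightarrow> semT 2 (concat (map ?f [0..<M])) = 0" for M
  proof -
    have "concat (map ?f [0..<M]) \<in> lists (gcomp T 2 \<times> max_ideal A)"
      using f_in by (induction M) auto
    then show ?thesis
      using A.teq_of_tsum_eq[OF csub_T[of 2], of "concat (map ?f [0..<M])" "[]"]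
        A.tsum_eq_of_teq[OF csub_T[of 2], of "concat (map ?f [0..<M])" "[]"] by auto
  qed
  \<comment> \<open>The first M + 1 terms of the series are the linear one and M iterated
    brackets.\<close>
  have step: "teq T A 2 (concat (map ?f [0..<Suc M])) [] \<longleftrightarrow> NC.MC Y" if "A.nil_index H \<le> M" for M
    unfolding teq_iff sum using NC.MC_comb_iff[OF X Y that] by (simp add: tens_simps)
  have "MC_eq_linf T A x \<longleftrightarrow> NC.MC Y"
  proof
    assume "MC_eq_linf T A x"
    then obtain M0 where "\<And>M. M0 \<le> M \<Longrightarrow> teq T A 2 (concat (map ?f [0..<M])) []"
      unfolding MC_eq_linf_def tseries_def eventually_sequentially by blast
    from this[of "Suc (max M0 (A.nil_index H))"] step[of "max M0 (A.nil_index H)"]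
    show "NC.MC Y" by simp
  next
    assume MC: "NC.MC Y"
    have "teq T A 2 (concat (map ?f [0..<M])) []" if "Suc (A.nil_index H) \<le> M" for M
    proof -
      from that obtain M' where "M = Suc M'" "A.nil_index H \<le> M'" by (cases M) auto
      with step MC show ?thesis by simp
    qed
    then show "MC_eq_linf T A x"
      unfolding MC_eq_linf_def tseries_def eventually_sequentially by blast
  qed
  then show ?thesis using Y NC.lifts_unique[OF X] by blast
qed

end

end

section \<open>Gauge equivalence and polynomial homotopy\<close>

context art_algebra
begin

lemma tlift_uminus:
  assumes "csub s' W" "linear_between s V s' W f" "X \<in> tset s V A"
  shows "tlift s' W A (\<lambda>v. - f v) X = - tlift s' W A f X"
proof -
  interpret csub s' W by fact
  have n: "linear_between s V s' W (\<lambda>v. - f v)" and z: "linear_between s V s' W (\<lambda>v. 0)"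
    by (intro linear_betweenI; simp add: linear_betweenD[OF assms(2)])+
  have "tlift s' W A (\<lambda>v. 0) X = tlift s' W A f X + tlift s' W A (\<lambda>v. - f v) X"
    by (rule tlift_add[OF assms(2) n z assms(3)]) simp
  then show ?thesis using tlift_zero[OF assms(1,3)] by (simp add: eq_neg_iff_add_eq_0 add.commute)
qed

end

locale art_dgla = A: art_algebra A + dgla L
  for A :: "'a calgebra" and L :: "'v::ab_group_add dgla"
begin

sublocale N: nil_dgla "tens L A" "\<lambda>k i. tfilt (gscale L) (gcomp L i) A k" "A.nil_index L"
  by (rule A.nil_dgla_tens'[OF dgla])

sublocale Fo: dgla "forms_dgla L"
  by unfold_locales (rule is_dgla_forms[OF dgla])

sublocale P: nil_dgla "tens (forms_dgla L) A" "\<lambda>k i. tfilt (gscale (forms_dgla L)) (gcomp (forms_dgla L) i) A k"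
    "A.nil_index (forms_dgla L)"
  by (rule A.nil_dgla_tens'[OF Fo.dgla])

definition ev :: "complex \<Rightarrow> int \<Rightarrow> ('v forms, 'a) tensor \<Rightarrow> ('v, 'a) tensor" where
  "ev c i = tlift (gscale L) (gcomp L i) A (forms_eval (gscale L) c)"

lemma linear_forms_eval: "linear_between (gscale (forms_dgla L)) (gcomp (forms_dgla L) i) (gscale L) (gcomp L i) (forms_eval (gscale L) c)"
  using dgla_homD(1)[OF dgla_hom_forms_eval[OF dgla]] .

lemma ev_hom: "dgla_hom (ev c) (tens (forms_dgla L) A) (tens L A)"
  using A.dgla_hom_tens[OF Fo.dgla dgla dgla_hom_forms_eval[OF dgla]] unfolding ev_def .

lemma ev_in: "X \<in> gcomp (tens (forms_dgla L) A) i \<Longrightarrow> ev c i X \<in> gcomp (tens L A) i"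
  by (rule linear_betweenD(1)[OF dgla_homD(1)[OF ev_hom]])

lemmas ev_gauge = gauge_hom[OF P.nil_dgla_axioms N.nil_dgla_axioms ev_hom]
lemmas ev_MC = MC_hom[OF P.nil_dgla_axioms N.nil_dgla_axioms ev_hom]

lemma constant_path:
  assumes "N.MC x"
  shows "\<exists>\<Xi>. P.MC \<Xi> \<and> (\<forall>c. ev c 1 \<Xi> = x)"
proof -
  let ?c = "\<lambda>i. tlift (gscale (forms_dgla L)) (gcomp (forms_dgla L) i) A (\<lambda>v. ([:v:], 0))"
  have hom: "dgla_hom ?c (tens L A) (tens (forms_dgla L) A)"
    by (rule A.dgla_hom_tens[OF dgla Fo.dgla dgla_hom_const])
  have x: "x \<in> tset (gscale L) (gcomp L 1) A" using assms by (simp add: N.MC_def tens_simps)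
  have "P.MC (?c 1 x)" by (rule MC_hom[OF N.nil_dgla_axioms P.nil_dgla_axioms hom assms])
  moreover have "ev c 1 (?c 1 x) = x" for c
    unfolding ev_def A.tlift_comp[OF linear_forms_eval] forms_eval_const by (rule A.tlift_id[OF x])
  ultimately show ?thesis by blast
qed

text \<open>Gauging by s a, a parameter linear in s, leaves the start of the path fixed and
  transforms its end by a.\<close>

lemma gauge_path:
  assumes \<Xi>: "P.MC \<Xi>" and a: "a \<in> gcomp (tens L A) 0"
  shows "\<exists>\<Xi>'. P.MC \<Xi>' \<and> ev 0 1 \<Xi>' = ev 0 1 \<Xi> \<and> ev 1 1 \<Xi>' = N.gauge a (ev 1 1 \<Xi>)"
proof -
  let ?S = "tlift (gscale (forms_dgla L)) (gcomp (forms_dgla L) 0) A line_scale a"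
  note a' = a[unfolded tens_simps]
  have \<Xi>1: "\<Xi> \<in> gcomp (tens (forms_dgla L) A) 1" using \<Xi> by (simp add: P.MC_def)
  have S: "?S \<in> gcomp (tens (forms_dgla L) A) 0"
    unfolding tens_simps by (rule linear_betweenD(1)[OF A.linear_tlift[OF linear_line_scale] a'])
  have "ev 0 0 ?S = tlift (gscale L) (gcomp L 0) A (\<lambda>v. 0) a"
    unfolding ev_def A.tlift_comp[OF linear_forms_eval] forms_eval_line_scale ..
  then have S0: "ev 0 0 ?S = 0" using A.tlift_zero[OF csub a'] by simp
  have S1: "ev 1 0 ?S = a"
    unfolding ev_def A.tlift_comp[OF linear_forms_eval] forms_eval_line_scale by (rule A.tlift_id[OF a'])
  have "P.MC (P.gauge ?S \<Xi>)" by (rule P.gauge_MC[OF S \<Xi>1 \<Xi>])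
  moreover have "ev 0 1 (P.gauge ?S \<Xi>) = ev 0 1 \<Xi>"
    using ev_gauge[OF S \<Xi>1, of 0] S0 N.gauge_zero[OF ev_in[OF \<Xi>1]] by simp
  moreover have "ev 1 1 (P.gauge ?S \<Xi>) = N.gauge a (ev 1 1 \<Xi>)"
    using ev_gauge[OF S \<Xi>1, of 1] S1 by simp
  ultimately show ?thesis by blast
qed

definition Ks :: "('v forms, 'a) tensor \<Rightarrow> ('v forms, 'a) tensor" where
  "Ks = tlift (gscale (forms_dgla L)) (gcomp (forms_dgla L) 0) A line_homotopy"

lemma linear_line_homotopy_1: "linear_between (gscale (forms_dgla L)) (gcomp (forms_dgla L) 1)
    (gscale (forms_dgla L)) (gcomp (forms_dgla L) 0) line_homotopy"
  using linear_line_homotopy[of 1] by simp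

text \<open>A path killed by \<open>Ks\<close> has no \<open>ds\<close>-part, hence its integral and
  that of its bracket with itself vanish. By the Maurer-Cartan equation so does the integral of its
  differential, and Stokes equates the endpoints.\<close>

lemma path_endpoints_eq:
  assumes Y: "P.MC Y" and KY: "Ks Y = 0"
  shows "ev 0 1 Y = ev 1 1 Y"
proof -
  let ?F = "forms_dgla L"
  let ?I = "forms_integral (gscale L) 0 1"
  have Y1: "Y \<in> gcomp (tens ?F A) 1" and mc: "diff (tens ?F A) 1 Y + gscale (tens ?F A) (1 / 2) (brkt (tens ?F A) 1 1 Y Y) = 0"
    using Y by (auto simp: P.MC_def)
  note Yt = Y1[unfolded tens_simps]
  have J1: "linear_between (gscale ?F) (gcomp ?F 0) (gscale ?F) (gcomp ?F 1) form_dt_deriv"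
    using linear_form_dt_deriv[of 1] by simp
  have id: "linear_between (gscale ?F) (gcomp ?F 1) (gscale ?F) (gcomp ?F 1) (\<lambda>v. v)"
    by (intro linear_betweenI) auto
  have I2: "linear_between (gscale ?F) (gcomp ?F 2) (gscale L) (gcomp L 1) ?I"
    and I1: "linear_between (gscale ?F) (gcomp ?F 1) (gscale L) (gcomp L 0) ?I"
    using linear_forms_integral[of 2] linear_forms_integral[of 1] by simp_all
  have d1: "linear_between (gscale ?F) (gcomp ?F 1) (gscale ?F) (gcomp ?F 2) (diff ?F 1)"
    and d0: "linear_between (gscale L) (gcomp L 0) (gscale L) (gcomp L 1) (diff L 0)"
    using Fo.linear_diff[of 1] linear_diff[of 0] by simp_all
  have part: "tlift (gscale ?F) (gcomp ?F 1) A form_part0 Y = Y"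
  proof -
    have "tlift (gscale ?F) (gcomp ?F 1) A (\<lambda>v. v) Y = tlift (gscale ?F) (gcomp ?F 1) A form_part0 Y +
        tlift (gscale ?F) (gcomp ?F 1) A (\<lambda>v. form_dt_deriv (line_homotopy v)) Y"
      by (rule A.tlift_add[OF linear_form_part0 linear_between_compose[OF linear_line_homotopy_1 J1] id Yt])
        (simp add: form_decomposition)
    moreover have "tlift (gscale ?F) (gcomp ?F 1) A (\<lambda>v. form_dt_deriv (line_homotopy v)) Y = 0"
      using KY A.tlift_comp[OF J1, where f = line_homotopy and X = Y] unfolding Ks_def by (simp add: tlift_additive)
    ultimately show ?thesis using A.tlift_id[OF Yt] by simp
  qed
  have "tlift (gscale L) (gcomp L 0) A ?I Y = - tlift (gscale L) (gcomp L 0) A (\<lambda>v. forms_eval (gscale L) 1 (line_homotopy v)) Y"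
    using A.tlift_uminus[OF csub linear_between_compose[OF linear_line_homotopy_1 linear_forms_eval, of 1] Yt]
    unfolding forms_integral_line_homotopy .
  then have IY: "tlift (gscale L) (gcomp L 0) A ?I Y = 0"
    using KY A.tlift_comp[OF linear_forms_eval[of 0 1], where f = line_homotopy and X = Y] unfolding Ks_def by (simp add: tlift_additive)
  have IYY: "tlift (gscale L) (gcomp L 1) A ?I (brkt (tens ?F A) 1 1 Y Y) = 0"
  proof -
    have b2: "bilinear_between (gscale ?F) (gcomp ?F 1) (gscale ?F) (gcomp ?F 1) (gscale ?F) (gcomp ?F 2) (brkt ?F 1 1)"
      using Fo.bilinear_brkt[of 1 1] by simp
    note b = A.bilinear_compose2[OF b2 linear_form_part0 linear_form_part0]
    have "brkt (tens ?F A) 1 1 Y Y = brkt (tens ?F A) 1 1 (tlift (gscale ?F) (gcomp ?F 1) A form_part0 Y) (tlift (gscale ?F) (gcomp ?F 1) A form_part0 Y)"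
      unfolding part ..
    also have "\<dots> = tlift2 (gscale ?F) (gcomp ?F 2) A (\<lambda>v w. brkt ?F 1 1 (form_part0 v) (form_part0 w)) Y Y"
      using A.tlift2_tlift[OF Fo.csub Fo.csub b2 b linear_form_part0 linear_form_part0 Yt Yt] by (simp add: tens_simps)
    finally have "tlift (gscale L) (gcomp L 1) A ?I (brkt (tens ?F A) 1 1 Y Y) =
        tlift2 (gscale L) (gcomp L 1) A (\<lambda>v w. ?I (brkt ?F 1 1 (form_part0 v) (form_part0 w))) Y Y"
      by (simp only: A.tlift_tlift2[OF I2])
    also have "\<dots> = tlift2 (gscale L) (gcomp L 1) A (\<lambda>v w. 0) Y Y"
    proof (rule A.tlift2_cong[OF Fo.csub A.bilinear_compose[OF b I2] _ Yt Yt])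
      show "bilinear_between (gscale ?F) (gcomp ?F 1) (gscale ?F) (gcomp ?F 1) (gscale L) (gcomp L 1) (\<lambda>v w. 0)"
        unfolding bilinear_between_def by (auto intro!: linear_betweenI)
    qed (rule forms_integral_part0_brkt)
    also have "\<dots> = 0" by (rule A.tlift2_zero[OF Fo.csub csub Yt Yt])
    finally show ?thesis .
  qed
  have "diff (tens ?F A) 1 Y = - tscale (1 / 2) (brkt (tens ?F A) 1 1 Y Y)"
    using mc by (simp add: tens_simps eq_neg_iff_add_eq_0)
  then have "diff (tens ?F A) 1 Y = tscale (- (1 / 2)) (brkt (tens ?F A) 1 1 Y Y)"
    by (simp add: fun_eq_iff)
  then have "tlift (gscale L) (gcomp L 1) A ?I (diff (tens ?F A) 1 Y) = tscale (- (1 / 2)) (tlift (gscale L) (gcomp L 1) A ?I (brkt (tens ?F A) 1 1 Y Y))"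
    by (simp only: tlift_additive)
  then have "tlift (gscale L) (gcomp L 1) A ?I (diff (tens ?F A) 1 Y) = 0" by (simp add: IYY fun_eq_iff)
  then have IdY: "tlift (gscale L) (gcomp L 1) A (\<lambda>v. ?I (diff ?F 1 v)) Y = 0"
    by (simp add: tens_simps A.tlift_comp[OF I2])
  have dIY: "tlift (gscale L) (gcomp L 1) A (\<lambda>v. diff L 0 (?I v)) Y = 0"
    using IY A.tlift_comp[OF d0, where f = ?I and X = Y] by (simp add: tlift_additive)
  note l1 = linear_between_compose[OF d1 I2] and l2 = linear_between_compose[OF I1 d0]
  have l3: "linear_between (gscale ?F) (gcomp ?F 1) (gscale L) (gcomp L 1) (\<lambda>v. ?I (diff ?F 1 v) + diff L 0 (?I v))"
    using linear_betweenD[OF l1] linear_betweenD[OF l2]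
    by (intro linear_betweenI) (auto simp: scale_right_distrib)
  have "tlift (gscale L) (gcomp L 1) A (\<lambda>v. ?I (diff ?F 1 v) + diff L 0 (?I v)) Y = 0"
    using A.tlift_add[OF l1 l2 l3 Yt] IdY dIY by simp
  moreover have "tlift (gscale L) (gcomp L 1) A (forms_eval (gscale L) 1) Y =
      tlift (gscale L) (gcomp L 1) A (forms_eval (gscale L) 0) Y +
      tlift (gscale L) (gcomp L 1) A (\<lambda>v. ?I (diff ?F 1 v) + diff L 0 (?I v)) Y"
  proof (rule A.tlift_add[OF linear_forms_eval l3 linear_forms_eval Yt])
    fix v assume "v \<in> gcomp ?F 1"
    from forms_stokes[OF this] show "forms_eval (gscale L) 1 v = forms_eval (gscale L) 0 v + (?I (diff ?F 1 v) + diff L 0 (?I v))"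
      by (simp add: algebra_simps)
  qed
  ultimately show ?thesis by (simp add: ev_def)
qed

text \<open>A parameter in the image of \<open>Ks\<close> turns the path into one with equal
  endpoints. It is 0 at s = 0, so the start is unmoved and equals the transformed end; this fixes
  the direction of the statement.\<close>

lemma path_gauge:
  assumes \<Xi>: "P.MC \<Xi>"
  shows "\<exists>c\<in>gcomp (tens L A) 0. ev 0 1 \<Xi> = N.gauge c (ev 1 1 \<Xi>)"
proof -
  let ?F = "forms_dgla L"
  have \<Xi>1: "\<Xi> \<in> gcomp (tens ?F A) 1" using \<Xi> by (simp add: P.MC_def)
  have K_lin: "linear_between (gscale (tens ?F A)) (gcomp (tens ?F A) 1) (gscale (tens ?F A)) (gcomp (tens ?F A) 0) Ks"
    unfolding tens_simps Ks_def by (rule A.linear_tlift[OF linear_line_homotopy_1])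
  have d0: "linear_between (gscale ?F) (gcomp ?F 0) (gscale ?F) (gcomp ?F 1) (diff ?F 0)"
    using Fo.linear_diff[of 0] by simp
  have KdK: "Ks (diff (tens ?F A) 0 (Ks X)) = - Ks X" if X: "X \<in> gcomp (tens ?F A) 1" for X
  proof -
    note Xt = X[unfolded tens_simps]
    note l = linear_between_compose[OF linear_between_compose[OF linear_line_homotopy_1 d0] linear_line_homotopy_1]
    have n: "linear_between (gscale ?F) (gcomp ?F 1) (gscale ?F) (gcomp ?F 0) (\<lambda>v. - line_homotopy v)"
      using linear_betweenD[OF linear_line_homotopy_1] by (intro linear_betweenI) auto
    have "Ks (diff (tens ?F A) 0 (Ks X)) = tlift (gscale ?F) (gcomp ?F 0) A (\<lambda>v. line_homotopy (diff ?F 0 (line_homotopy v))) X"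
      by (simp add: Ks_def tens_simps A.tlift_comp[OF d0] A.tlift_comp[OF linear_line_homotopy_1])
    also have "\<dots> = tlift (gscale ?F) (gcomp ?F 0) A (\<lambda>v. - line_homotopy v) X"
      by (rule A.tlift_cong[OF l n Xt]) (use line_homotopy_diff[of _ 1] in simp)
    also have "\<dots> = - Ks X" unfolding Ks_def by (rule A.tlift_uminus[OF Fo.csub linear_line_homotopy_1 Xt])
    finally show ?thesis .
  qed
  have K_F: "Ks x \<in> tfilt (gscale ?F) (gcomp ?F 0) A k" if "1 \<le> k" "x \<in> tfilt (gscale ?F) (gcomp ?F 1) A k" for k x
    unfolding Ks_def by (rule A.tlift_tfilt[OF linear_line_homotopy_1 that])
  obtain b where b: "b \<in> gcomp (tens ?F A) 1" "Ks (P.gauge (Ks b) \<Xi>) = 0"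
    using P.gauge_fix_exists[OF K_lin K_F KdK \<Xi>1] by blast
  have Kb: "Ks b \<in> gcomp (tens ?F A) 0" by (rule linear_betweenD(1)[OF K_lin b(1)])
  have "P.MC (P.gauge (Ks b) \<Xi>)" by (rule P.gauge_MC[OF Kb \<Xi>1 \<Xi>])
  from path_endpoints_eq[OF this b(2)]
  have "N.gauge (ev 0 0 (Ks b)) (ev 0 1 \<Xi>) = N.gauge (ev 1 0 (Ks b)) (ev 1 1 \<Xi>)"
    by (simp only: ev_gauge[OF Kb \<Xi>1])
  moreover have "ev 0 0 (Ks b) = 0"
  proof -
    have "ev 0 0 (Ks b) = tlift (gscale L) (gcomp L 0) A (\<lambda>v. 0) b"
      unfolding ev_def Ks_def A.tlift_comp[OF linear_forms_eval] forms_eval_line_homotopy ..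
    then show ?thesis using A.tlift_zero[OF csub b(1)[unfolded tens_simps]] by simp
  qed
  ultimately have "ev 0 1 \<Xi> = N.gauge (ev 1 0 (Ks b)) (ev 1 1 \<Xi>)"
    using N.gauge_zero[OF ev_in[OF \<Xi>1]] by simp
  then show ?thesis using ev_in[OF Kb] by blast
qed

text \<open>Symmetry is \<open>path_gauge\<close> applied to the path from x to e^a * x. For
  transitivity that path is gauged once more by s b, which moves its end only.\<close>

lemma gauge_equivalence:
  assumes "N.MC x"
  shows gauge_sym: "a \<in> gcomp (tens L A) 0 \<Longrightarrow> \<exists>c\<in>gcomp (tens L A) 0. x = N.gauge c (N.gauge a x)"
    and gauge_trans: "a \<in> gcomp (tens L A) 0 \<Longrightarrow> b \<in> gcomp (tens L A) 0 \<Longrightarrow>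
      \<exists>c\<in>gcomp (tens L A) 0. N.gauge b (N.gauge a x) = N.gauge c x"
    and gauge_homotopy: "a \<in> gcomp (tens L A) 0 \<Longrightarrow> \<exists>\<Xi>. P.MC \<Xi> \<and> ev 0 1 \<Xi> = x \<and> ev 1 1 \<Xi> = N.gauge a x"
proof -
  obtain \<Xi> where \<Xi>: "P.MC \<Xi>" "\<And>c. ev c 1 \<Xi> = x" using constant_path[OF assms] by blast
  show path: "\<exists>\<Xi>. P.MC \<Xi> \<and> ev 0 1 \<Xi> = x \<and> ev 1 1 \<Xi> = N.gauge a x" if "a \<in> gcomp (tens L A) 0" for a
    using gauge_path[OF \<Xi>(1) that] by (simp add: \<Xi>(2))
  show sym: "\<exists>c\<in>gcomp (tens L A) 0. x = N.gauge c (N.gauge a x)" if "a \<in> gcomp (tens L A) 0" for a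
    using path[OF that] path_gauge by metis
  assume a: "a \<in> gcomp (tens L A) 0" and b: "b \<in> gcomp (tens L A) 0"
  from path[OF a] obtain \<Xi>1 where 1: "P.MC \<Xi>1" "ev 0 1 \<Xi>1 = x" "ev 1 1 \<Xi>1 = N.gauge a x" by blast
  from gauge_path[OF 1(1) b] obtain \<Xi>2 where 2: "P.MC \<Xi>2" "ev 0 1 \<Xi>2 = x" "ev 1 1 \<Xi>2 = N.gauge b (N.gauge a x)"
    by (auto simp: 1)
  from path_gauge[OF 2(1)] obtain d where d: "d \<in> gcomp (tens L A) 0" "x = N.gauge d (N.gauge b (N.gauge a x))"
    by (auto simp: 2)
  have z: "N.MC (N.gauge b (N.gauge a x))" using ev_MC[OF 2(1), of 1] by (simp add: 2)
  \<comment> \<open>So far x is expressed as a transform of the end. Gauging the constant path at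
    the end by s d and applying \<open>path_gauge\<close> again reverses the direction.\<close>
  obtain \<Xi>' where \<Xi>': "P.MC \<Xi>'" "\<And>c. ev c 1 \<Xi>' = N.gauge b (N.gauge a x)" using constant_path[OF z] by blast
  from gauge_path[OF \<Xi>'(1) d(1)] obtain \<Xi>3 where 3: "P.MC \<Xi>3" "ev 0 1 \<Xi>3 = N.gauge b (N.gauge a x)" "ev 1 1 \<Xi>3 = x"
    by (auto simp: \<Xi>'(2) d(2)[symmetric])
  from path_gauge[OF 3(1)] show "\<exists>c\<in>gcomp (tens L A) 0. N.gauge b (N.gauge a x) = N.gauge c x" by (simp add: 3)
qed

section \<open>Formal sums and their classes\<close>

abbreviation "sem i \<equiv> tsum (gscale L) (gcomp L i) A"

lemma sem_in: "x \<in> fsums L A i \<Longrightarrow> sem i x \<in> gcomp (tens L A) i"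
  unfolding fsums_def tens_simps by (rule tsetI)

lemma sem_surj: "X \<in> gcomp (tens L A) i \<Longrightarrow> \<exists>x\<in>fsums L A i. X = sem i x"
  unfolding fsums_def tens_simps by (auto elim: tsetE)

lemma teq_iff_sem: "x \<in> fsums L A i \<Longrightarrow> y \<in> fsums L A i \<Longrightarrow> teq L A i x y \<longleftrightarrow> sem i x = sem i y"
  unfolding fsums_def using A.teq_of_tsum_eq[OF csub] A.tsum_eq_of_teq[OF csub] by blast

lemma sem_tbrkt:
  assumes "x \<in> fsums L A i" "y \<in> fsums L A j" "k = i + j"
  shows "tbrkt L A i j x y \<in> fsums L A k" "sem k (tbrkt L A i j x y) = brkt (tens L A) i j (sem i x) (sem j y)"
  using A.tmap2_in[OF bilinear_brkt] A.tsum_tmap2[OF csub bilinear_brkt] assms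
  by (auto simp: fsums_def tbrkt_eq_tmap2 tens_simps)

lemma sem_diff:
  assumes "x \<in> fsums L A i" "k = i + 1"
  shows "tmap (diff L i) x \<in> fsums L A k" "sem k (tmap (diff L i) x) = diff (tens L A) i (sem i x)"
  using tmap_in[of x "gcomp L i" "max_ideal A" "diff L i" "gcomp L (i + 1)"] A.tsum_tmap[OF linear_diff] assms
  by (auto simp: fsums_def tens_simps diff_in)

lemma sem_scale:
  assumes "x \<in> fsums L A i"
  shows "tmap (gscale L c) x \<in> fsums L A i" "sem i (tmap (gscale L c) x) = tscale c (sem i x)"
  using tmap_in[of x "gcomp L i" "max_ideal A" "gscale L c" "gcomp L i"] A.tsum_scale[of x "gcomp L i" c "gscale L"] assms
  unfolding fsums_def by simp_all

lemma sem_uminus: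
  assumes "x \<in> fsums L A i"
  shows "tmap uminus x \<in> fsums L A i" "sem i (tmap uminus x) = - sem i x"
  using tmap_in[of x "gcomp L i" "max_ideal A" uminus "gcomp L i"] A.tsum_uminus[OF vector_space_axioms, of x "gcomp L i"] assms
  unfolding fsums_def by simp_all

lemma MC_eq_dgla_iff:
  assumes x: "x \<in> fsums L A 1"
  shows "MC_eq_dgla L A x \<longleftrightarrow> N.MC (sem 1 x)"
proof -
  have b: "tbrkt L A 1 1 x x \<in> fsums L A 2" "sem 2 (tbrkt L A 1 1 x x) = brkt (tens L A) 1 1 (sem 1 x) (sem 1 x)"
    using sem_tbrkt[OF x x, of 2] by simp_all
  have d: "tmap (diff L 1) x \<in> fsums L A 2" "sem 2 (tmap (diff L 1) x) = diff (tens L A) 1 (sem 1 x)"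
    using sem_diff[OF x, of 2] by simp_all
  have "tmap (diff L 1) x @ tmap (gscale L (1 / 2)) (tbrkt L A 1 1 x x) \<in> fsums L A 2" "[] \<in> fsums L A 2"
    using d(1) sem_scale(1)[OF b(1)] by (auto simp: fsums_def)
  then show ?thesis
    unfolding MC_eq_dgla_def N.MC_def using sem_in[OF x] sem_scale(2)[OF b(1)]
    by (simp add: teq_iff_sem b d tens_simps(2))
qed

text \<open>The partial sums are stationary from \<open>nil_index\<close> on, so the existentially
  quantified z is, up to congruence, the difference of e^a * x and x.\<close>

lemma gauge_act_iff:
  assumes a: "a \<in> fsums L A 0" and x: "x \<in> fsums L A 1" and y: "y \<in> fsums L A 1"
  shows "gauge_act L A a x y \<longleftrightarrow> sem 1 y = N.gauge (sem 0 a) (sem 1 x)"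
proof -
  define u where "u = tbrkt L A 0 1 a x @ tmap (\<lambda>v. - diff L 0 v) a"
  let ?a = "sem 0 a" and ?x = "sem 1 x"
  have b: "tbrkt L A 0 1 a x \<in> fsums L A 1" "sem 1 (tbrkt L A 0 1 a x) = brkt (tens L A) 0 1 ?a ?x"
    using sem_tbrkt[OF a x, of 1] by simp_all
  have d: "tmap (diff L 0) a \<in> fsums L A 1" "sem 1 (tmap (diff L 0) a) = diff (tens L A) 0 ?a"
    using sem_diff[OF a, of 1] by simp_all
  have nd: "tmap (\<lambda>v. - diff L 0 v) a = tmap uminus (tmap (diff L 0) a)" by simp
  have u: "u \<in> fsums L A 1" "sem 1 u = N.gterm ?a ?x 0"
    using b d sem_uminus[OF d(1)] unfolding u_def nd by (auto simp: fsums_def N.gterm_def simp del: tmap_simps)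
  have un: "(tbrkt L A 0 1 a ^^ n) u \<in> fsums L A 1 \<and> sem 1 ((tbrkt L A 0 1 a ^^ n) u) = N.gterm ?a ?x n" for n
  proof (induction n)
    case (Suc n)
    then show ?case using sem_tbrkt[OF a, of "(tbrkt L A 0 1 a ^^ n) u" 1 1] by (simp add: N.gterm_Suc)
  qed (simp add: u)
  let ?f = "\<lambda>n. tmap (gscale L (1 / fact (n + 1))) ((tbrkt L A 0 1 a ^^ n) u)"
  have f: "?f n \<in> fsums L A 1" "sem 1 (?f n) = tscale (1 / fact (n + 1)) (N.gterm ?a ?x n)" for n
    using sem_scale[of "(tbrkt L A 0 1 a ^^ n) u" 1] un by simp_all
  have c: "concat (map ?f [0..<M]) \<in> fsums L A 1" for M
    using f(1) by (induction M) (auto simp: fsums_def)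
  have sc: "sem 1 (concat (map ?f [0..<M])) = (\<Sum>n<M. tscale (1 / fact (n + 1)) (N.gterm ?a ?x n))" for M
    using f(2) by (induction M) simp_all
  have ser: "tseries L A 1 ?f z \<longleftrightarrow> sem 1 z = N.gauge ?a ?x - ?x" if z: "z \<in> fsums L A 1" for z
  proof -
    have *: "teq L A 1 (concat (map ?f [0..<M])) z \<longleftrightarrow> sem 1 z = N.gauge ?a ?x - ?x" if "A.nil_index L \<le> M" for M
    proof -
      have "?x + (\<Sum>n<M. tscale (1 / fact (n + 1)) (N.gterm ?a ?x n)) = N.gauge ?a ?x"
        using N.gauge_sum[OF sem_in[OF a] sem_in[OF x] that] by (simp add: tens_simps(2))
      then have "(\<Sum>n<M. tscale (1 / fact (n + 1)) (N.gterm ?a ?x n)) = N.gauge ?a ?x - ?x"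
        unfolding eq_diff_eq by (subst add.commute)
      then show ?thesis unfolding teq_iff_sem[OF c z] sc by (simp only: eq_commute)
    qed
    show ?thesis
      unfolding tseries_def eventually_sequentially
    proof
      assume "\<exists>M0. \<forall>M\<ge>M0. teq L A 1 (concat (map ?f [0..<M])) z"
      then obtain M0 where "\<And>M. M0 \<le> M \<Longrightarrow> teq L A 1 (concat (map ?f [0..<M])) z" by blast
      from this[of "max M0 (A.nil_index L)"] *[of "max M0 (A.nil_index L)"]
      show "sem 1 z = N.gauge ?a ?x - ?x" by simp
    qed (use * in blast)
  qed
  have "gauge_act L A a x y \<longleftrightarrow> (\<exists>z\<in>fsums L A 1. tseries L A 1 ?f z \<and> teq L A 1 y (x @ z))"
    unfolding gauge_act_def Let_def u_def[symmetric] ..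
  also have "\<dots> \<longleftrightarrow> (\<exists>z\<in>fsums L A 1. sem 1 z = N.gauge ?a ?x - ?x \<and> sem 1 y = ?x + sem 1 z)"
  proof (rule bex_cong[OF HOL.refl])
    fix z assume z: "z \<in> fsums L A 1"
    have xz: "x @ z \<in> fsums L A 1" using x z by (auto simp: fsums_def)
    have "sem 1 (x @ z) = ?x + sem 1 z" by simp
    then show "(tseries L A 1 ?f z \<and> teq L A 1 y (x @ z)) \<longleftrightarrow> (sem 1 z = N.gauge ?a ?x - ?x \<and> sem 1 y = ?x + sem 1 z)"
      by (simp only: ser[OF z] teq_iff_sem[OF y xz])
  qed
  also have "\<dots> \<longleftrightarrow> sem 1 y = N.gauge ?a ?x"
  proof
    assume y: "sem 1 y = N.gauge ?a ?x"
    have "N.gauge ?a ?x - ?x \<in> gcomp (tens L A) 1"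
      using N.gauge_in[OF sem_in[OF a] sem_in[OF x]] sem_in[OF x] by (rule csub.diff_in[OF N.csub])
    from sem_surj[OF this] obtain z where "z \<in> fsums L A 1" "N.gauge ?a ?x - ?x = sem 1 z" by blast
    with y show "\<exists>z\<in>fsums L A 1. sem 1 z = N.gauge ?a ?x - ?x \<and> sem 1 y = ?x + sem 1 z"
      by (intro bexI[of _ z]) (auto simp: algebra_simps)
  qed auto
  finally show ?thesis .
qed

end

section \<open>Normal forms for the gauge action\<close>

context nil_contraction
begin

lemma linear_K1: "linear_between (gscale H) (gcomp H 1) (gscale H) (gcomp H 0) (K 1)"
  using linear_K[of 1] by simp

lemma K1_F: "1 \<le> k \<Longrightarrow> x \<in> F k 1 \<Longrightarrow> K 1 x \<in> F k 0"
  using K_F[of k x 1] by simp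

text \<open>The homotopy formula for K x, where K K = 0 and \<pi> K = 0 remove all terms but
  two.\<close>

lemma K1_diff_K1:
  assumes x: "x \<in> gcomp H 1"
  shows "K 1 (diff H 0 (K 1 x)) = - K 1 x"
proof -
  have "K 1 x \<in> gcomp H 0" "K 0 (K 1 x) = 0" "\<pi> 0 (K 1 x) = 0"
    using x K_K[OF x] proj_K[OF x] by (simp_all add: lin_in)
  then show ?thesis using homotopy[of "K 1 x" 0] incl_simps(5)[of 0] by simp
qed

lemma gauge_normal_exists: "x \<in> gcomp H 1 \<Longrightarrow> \<exists>b\<in>gcomp H 1. K 1 (gauge (K 1 b) x) = 0"
  by (rule gauge_fix_exists[OF linear_K1 K1_F K1_diff_K1])

text \<open>The parameters 0 and K b both bring x into the kernel of \<open>K\<close>, and such a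
  parameter in the image of \<open>K\<close> is unique.\<close>

lemma gauge_normal_unique:
  assumes "x \<in> gcomp H 1" "b \<in> gcomp H 1" "K 1 x = 0" "K 1 (gauge (K 1 b) x) = 0"
  shows "K 1 b = 0"
proof -
  have "K 1 0 = 0" by (rule linear_between_0[OF linear_K1])
  then show ?thesis
    using gauge_fix_unique[OF linear_K1 K1_F K1_diff_K1 assms(1,2) _ assms(4), of 0] assms(1,3) gauge_zero by simp
qed

end

definition linf_homotopic :: "'c::ab_group_add linf \<Rightarrow> 'a calgebra \<Rightarrow> ('c, 'a) fsum \<Rightarrow> ('c, 'a) fsum \<Rightarrow> bool" where
  "linf_homotopic T A x y \<longleftrightarrow> (\<exists>\<xi>\<in>fsums (linf_forms T) A 1. MC_eq_linf (linf_forms T) A \<xi> \<and>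
    teq T A 1 (tmap (forms_eval (gscale T) 0) \<xi>) x \<and> teq T A 1 (tmap (forms_eval (gscale T) 1) \<xi>) y)"

definition dgla_gauge_equivalent :: "'h::ab_group_add dgla \<Rightarrow> 'a calgebra \<Rightarrow> ('h, 'a) fsum \<Rightarrow> ('h, 'a) fsum \<Rightarrow> bool" where
  "dgla_gauge_equivalent H A x y \<longleftrightarrow> (\<exists>a\<in>fsums H A 0. gauge_act H A a x y)"

text \<open>The equation of \<open>lifts\<close> on formal sums. It involves \<open>A\<close> only
  through the bracket and the congruence, so morphisms of algebras preserve it and no lifts have to
  be chosen.\<close>

definition mc_lift :: "'h::ab_group_add dgla \<Rightarrow> (int \<Rightarrow> 'c \<Rightarrow> 'h) \<Rightarrow> (int \<Rightarrow> 'h \<Rightarrow> 'h) \<Rightarrow> 'a calgebra \<Rightarrow>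
    ('c, 'a) fsum \<Rightarrow> ('h, 'a) fsum \<Rightarrow> bool" where
  "mc_lift H \<iota> K A x y \<longleftrightarrow>
    teq H A 1 y (tmap (\<iota> 1) x @ tmap (gscale H (1 / 2)) (tmap (K 2) (tbrkt H A 1 1 y y)))"

section \<open>Homotopy and gauge equivalence over a fixed algebra\<close>

locale art_cone = A: art_algebra A + transferred H T dV \<iota> \<pi> K
  for A :: "'a calgebra" and H :: "'h::ab_group_add dgla" and T :: "'c::ab_group_add linf" and dV \<iota> \<pi> K
begin

sublocale B: art_transferred A H T dV \<iota> \<pi> K
  by (intro art_transferred.intro A.art_algebra_axioms transferred0)

sublocale F: art_transferred A "forms_dgla H" "linf_forms T" "forms_diff (gscale T) dV"
    "forms_map \<iota>" "forms_map \<pi>" "forms_map_odd K"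
  by (intro art_transferred.intro A.art_algebra_axioms transferred0_forms)

sublocale D: art_dgla A H
  by (intro art_dgla.intro A.art_algebra_axioms dgla_axioms)

lemma linear_evalT: "linear_between (gscale (linf_forms T)) (gcomp (linf_forms T) i) (gscale T) (gcomp T i) (forms_eval (gscale T) c)"
  by (rule linear_betweenI)
    (auto simp: linf_forms_def forms_comp_def forms_eval_def forms_scale_def V.poly_eval_add V_eval_scale
      intro!: V.poly_eval_in pcoeffsI)

definition evT :: "complex \<Rightarrow> ('c forms, 'a) tensor \<Rightarrow> ('c, 'a) tensor" where
  "evT c = tlift (gscale T) (gcomp T 1) A (forms_eval (gscale T) c)"

abbreviation "projA \<equiv> tlift (gscale T) (gcomp T 1) A (\<pi> 1)"
abbreviation "KA \<equiv> tlift (gscale H) (gcomp H 0) A (K 1)"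
abbreviation "projF \<equiv> tlift (gscale (linf_forms T)) (gcomp (linf_forms T) 1) A (forms_map \<pi> 1)"
abbreviation "KF \<equiv> tlift (gscale (forms_dgla H)) (gcomp (forms_dgla H) 0) A (forms_map_odd K 1)"

text \<open>Evaluation reads the function part, on which \<open>forms_map_odd\<close> carries no
  sign.\<close>

lemma ev_K:
  assumes X: "X \<in> gcomp (tens (forms_dgla H) A) 1"
  shows "D.ev c 0 (KF X) = KA (D.ev c 1 X)"
proof -
  have l: "linear_between (gscale (forms_dgla H)) (gcomp (forms_dgla H) 1) (gscale (forms_dgla H)) (gcomp (forms_dgla H) 0) (forms_map_odd K 1)"
    using F.linear_K[of 1] by simp
  have k: "linear_between (gscale H) (gcomp H 1) (gscale H) (gcomp H 0) (K 1)"
    using linear_K[of 1] by simp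
  show ?thesis
    unfolding D.ev_def A.tlift_comp[OF D.linear_forms_eval] A.tlift_comp[OF k]
  proof (rule A.tlift_cong[OF linear_between_compose[OF l D.linear_forms_eval] linear_between_compose[OF D.linear_forms_eval k] X[unfolded tens_simps]])
    fix v assume "v \<in> gcomp (forms_dgla H) 1"
    then obtain p q where "v = (p, q)" "p \<in> pcoeffs (gcomp H 1)"
      by (auto simp: forms_dgla_simps forms_comp_def intro: pcoeffsI)
    then show "forms_eval (gscale H) c (forms_map_odd K 1 v) = K 1 (forms_eval (gscale H) c v)"
      by (simp add: forms_eval_def eval_maps)
  qed
qed

lemma ev_proj:
  assumes X: "X \<in> gcomp (tens (forms_dgla H) A) 1"
  shows "evT c (projF X) = projA (D.ev c 1 X)"
  unfolding D.ev_def evT_def A.tlift_comp[OF linear_evalT] A.tlift_comp[OF linear_proj]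
proof (rule A.tlift_cong[OF linear_between_compose[OF F.linear_proj linear_evalT] linear_between_compose[OF D.linear_forms_eval linear_proj] X[unfolded tens_simps]])
  fix v assume "v \<in> gcomp (forms_dgla H) 1"
  then obtain p q where "v = (p, q)" "p \<in> pcoeffs (gcomp H 1)"
    by (auto simp: forms_dgla_simps forms_comp_def intro: pcoeffsI)
  then show "forms_eval (gscale T) c (forms_map \<pi> 1 v) = \<pi> 1 (forms_eval (gscale H) c v)"
    by (simp add: forms_eval_def eval_maps)
qed

lemma lifts_lists:
  assumes "X \<in> gcomp (tens_space T A) 1" "B.NC.lifts X x" "B.NC.MC x"
  shows "KA x = 0" "projA x = X"
  using B.NC.lifts_K[OF assms(1,2)] B.NC.lifts_proj[OF assms(1,2)] by simp_all

lemma homotopy_iff_gauge: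
  assumes X: "X \<in> gcomp (tens_space T A) 1" "B.NC.lifts X x" "B.NC.MC x"
    and Y: "Y \<in> gcomp (tens_space T A) 1" "B.NC.lifts Y y" "B.NC.MC y"
  shows "(\<exists>\<Xi>\<in>gcomp (tens_space (linf_forms T) A) 1. (\<exists>Z. F.NC.lifts \<Xi> Z \<and> F.NC.MC Z) \<and> evT 0 \<Xi> = X \<and> evT 1 \<Xi> = Y)
    \<longleftrightarrow> (\<exists>a\<in>gcomp (tens H A) 0. y = B.NC.gauge a x)"
proof
  assume "\<exists>\<Xi>\<in>gcomp (tens_space (linf_forms T) A) 1. (\<exists>Z. F.NC.lifts \<Xi> Z \<and> F.NC.MC Z) \<and> evT 0 \<Xi> = X \<and> evT 1 \<Xi> = Y"
  then obtain \<Xi> Z where \<Xi>: "\<Xi> \<in> gcomp (tens_space (linf_forms T) A) 1" "F.NC.lifts \<Xi> Z" "F.NC.MC Z"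
      "evT 0 \<Xi> = X" "evT 1 \<Xi> = Y" by blast
  have Z1: "Z \<in> gcomp (tens (forms_dgla H) A) 1" using \<Xi>(3) by (simp add: F.NC.MC_def)
  have KZ: "KF Z = 0" and pZ: "projF Z = \<Xi>"
    using F.NC.lifts_K[OF \<Xi>(1,2)] F.NC.lifts_proj[OF \<Xi>(1,2)] by simp_all
  have "D.ev c 0 0 = 0" for c unfolding D.ev_def by (rule tlift_additive)
  \<comment> \<open>Every point of the path is killed by \<open>K\<close> and is therefore the lift
    of its own projection. At 0 and 1 uniqueness of lifts identifies it with x and y.\<close>
  then have "KA (D.ev c 1 Z) = 0" for c using ev_K[OF Z1, of c] KZ by simp
  moreover have "B.NC.MC (D.ev c 1 Z)" for c by (rule D.ev_MC[OF \<Xi>(3)])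
  ultimately have l: "B.NC.lifts (projA (D.ev c 1 Z)) (D.ev c 1 Z)" for c
    using B.NC.MC_lifts[of "D.ev c 1 Z"] by simp
  have "D.ev 0 1 Z = x"
    using l[of 0] X(1,2) by (simp add: ev_proj[OF Z1, symmetric] pZ \<Xi>(4) B.NC.lifts_unique)
  moreover have "D.ev 1 1 Z = y"
    using l[of 1] Y(1,2) by (simp add: ev_proj[OF Z1, symmetric] pZ \<Xi>(5) B.NC.lifts_unique)
  ultimately obtain c where c: "c \<in> gcomp (tens H A) 0" "x = B.NC.gauge c y"
    using D.path_gauge[OF \<Xi>(3)] by auto
  \<comment> \<open>\<open>path_gauge\<close> yields x as a transform of y; symmetry gives the
    required direction.\<close>
  from D.gauge_sym[OF Y(3) c(1)] c(2) show "\<exists>a\<in>gcomp (tens H A) 0. y = B.NC.gauge a x" by simp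
next
  assume "\<exists>a\<in>gcomp (tens H A) 0. y = B.NC.gauge a x"
  then obtain a where a: "a \<in> gcomp (tens H A) 0" "y = B.NC.gauge a x" by blast
  from D.gauge_homotopy[OF X(3) a(1)] obtain \<Xi> where
    \<Xi>: "F.NC.MC \<Xi>" "D.ev 0 1 \<Xi> = x" "D.ev 1 1 \<Xi> = y" by (auto simp: a)
  have \<Xi>1: "\<Xi> \<in> gcomp (tens (forms_dgla H) A) 1" using \<Xi>(1) by (simp add: F.NC.MC_def)
  obtain b where b: "b \<in> gcomp (tens (forms_dgla H) A) 1" "KF (F.NC.gauge (KF b) \<Xi>) = 0"
    using F.NC.gauge_normal_exists[OF \<Xi>1] by auto
  have Kb: "KF b \<in> gcomp (tens (forms_dgla H) A) 0"
    using linear_betweenD(1)[OF F.NC.linear_K1 b(1)] by simp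
  define \<Xi>2 where "\<Xi>2 = F.NC.gauge (KF b) \<Xi>"
  have \<Xi>2: "F.NC.MC \<Xi>2" unfolding \<Xi>2_def by (rule F.NC.gauge_MC[OF Kb \<Xi>1 \<Xi>(1)])
  then have \<Xi>21: "\<Xi>2 \<in> gcomp (tens (forms_dgla H) A) 1" by (simp add: F.NC.MC_def)
  \<comment> \<open>Where the path is already in the kernel of \<open>K\<close>, uniqueness of the
    normalising parameter makes its value there 0.\<close>
  have e: "D.ev c 1 \<Xi>2 = D.ev c 1 \<Xi>" if "KA (D.ev c 1 \<Xi>) = 0" for c
  proof -
    have eb: "D.ev c 1 b \<in> gcomp (tens H A) 1" and e\<Xi>: "D.ev c 1 \<Xi> \<in> gcomp (tens H A) 1"
      by (rule D.ev_in[OF b(1)], rule D.ev_in[OF \<Xi>1])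
    have g: "D.ev c 1 \<Xi>2 = B.NC.gauge (KA (D.ev c 1 b)) (D.ev c 1 \<Xi>)"
      unfolding \<Xi>2_def D.ev_gauge[OF Kb \<Xi>1] ev_K[OF b(1)] ..
    have "KA (D.ev c 1 \<Xi>2) = D.ev c 0 (KF \<Xi>2)" by (rule ev_K[OF \<Xi>21, symmetric])
    also have "\<dots> = 0" using b(2) unfolding \<Xi>2_def D.ev_def by (simp only: tlift_additive)
    finally have "KA (D.ev c 1 b) = 0"
      using B.NC.gauge_normal_unique[OF e\<Xi> eb] that g by simp
    with g show ?thesis using B.NC.gauge_zero[OF e\<Xi>] by simp
  qed
  have "F.NC.lifts (projF \<Xi>2) \<Xi>2"
    using F.NC.MC_lifts[OF \<Xi>2] b(2) unfolding \<Xi>2_def by simp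
  moreover have "projF \<Xi>2 \<in> gcomp (tens_space (linf_forms T) A) 1"
    by (rule F.NC.lin_in(2)[OF \<Xi>21])
  moreover have "evT 0 (projF \<Xi>2) = X" "evT 1 (projF \<Xi>2) = Y"
    using lifts_lists[OF X] lifts_lists[OF Y] e[of 0] e[of 1] by (simp_all add: ev_proj[OF \<Xi>21] \<Xi>)
  ultimately show "\<exists>\<Xi>\<in>gcomp (tens_space (linf_forms T) A) 1. (\<exists>Z. F.NC.lifts \<Xi> Z \<and> F.NC.MC Z) \<and> evT 0 \<Xi> = X \<and> evT 1 \<Xi> = Y"
    using \<Xi>2 by blast
qed

abbreviation "homotopic \<equiv> linf_homotopic T A"

lemma teq_T_iff: "x \<in> fsums T A 1 \<Longrightarrow> y \<in> fsums T A 1 \<Longrightarrow> teq T A 1 x y \<longleftrightarrow> B.semT 1 x = B.semT 1 y"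
  unfolding fsums_def using A.teq_of_tsum_eq[OF B.csub_T] A.tsum_eq_of_teq[OF B.csub_T] by blast

lemma semT_in: "x \<in> fsums T A 1 \<Longrightarrow> B.semT 1 x \<in> gcomp (tens_space T A) 1"
  unfolding fsums_def tens_simps by (rule tsetI)

lemma homotopic_iff:
  assumes x: "x \<in> fsums T A 1" "B.NC.lifts (B.semT 1 x) X" "B.NC.MC X"
    and y: "y \<in> fsums T A 1" "B.NC.lifts (B.semT 1 y) Y" "B.NC.MC Y"
  shows "homotopic x y \<longleftrightarrow> (\<exists>a\<in>gcomp (tens H A) 0. Y = B.NC.gauge a X)"
proof -
  have ev: "tmap (forms_eval (gscale T) c) \<xi> \<in> fsums T A 1"
      "B.semT 1 (tmap (forms_eval (gscale T) c) \<xi>) = evT c (F.semT 1 \<xi>)" if "\<xi> \<in> fsums (linf_forms T) A 1" for c \<xi>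
    unfolding fsums_def evT_def using that[unfolded fsums_def] linear_betweenD(1)[OF linear_evalT]
    by - (rule tmap_in, assumption, blast, rule A.tsum_tmap[OF linear_evalT], assumption)
  have "homotopic x y \<longleftrightarrow> (\<exists>\<xi>\<in>fsums (linf_forms T) A 1. (\<exists>Z. F.NC.lifts (F.semT 1 \<xi>) Z \<and> F.NC.MC Z) \<and>
      evT 0 (F.semT 1 \<xi>) = B.semT 1 x \<and> evT 1 (F.semT 1 \<xi>) = B.semT 1 y)"
    unfolding linf_homotopic_def
    by (rule bex_cong[OF HOL.refl]) (simp only: teq_T_iff[OF ev(1) x(1)] teq_T_iff[OF ev(1) y(1)] ev(2) F.MC_eq_linf_iff[unfolded fsums_def[symmetric]])
  also have "\<dots> \<longleftrightarrow> (\<exists>\<Xi>\<in>gcomp (tens_space (linf_forms T) A) 1. (\<exists>Z. F.NC.lifts \<Xi> Z \<and> F.NC.MC Z) \<and>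
      evT 0 \<Xi> = B.semT 1 x \<and> evT 1 \<Xi> = B.semT 1 y)" (is "?l \<longleftrightarrow> ?r")
  proof
    assume ?l
    then show ?r unfolding fsums_def tens_simps using tsetI by blast
  next
    assume ?r
    then obtain \<Xi> where \<Xi>: "\<Xi> \<in> tset (gscale (linf_forms T)) (gcomp (linf_forms T) 1) A"
      "(\<exists>Z. F.NC.lifts \<Xi> Z \<and> F.NC.MC Z) \<and> evT 0 \<Xi> = B.semT 1 x \<and> evT 1 \<Xi> = B.semT 1 y"
      unfolding tens_simps by blast
    from \<Xi>(1) obtain \<xi> where "\<xi> \<in> fsums (linf_forms T) A 1" "\<Xi> = F.semT 1 \<xi>"
      unfolding fsums_def by (rule tsetE)
    with \<Xi>(2) show ?l by blast
  qed
  also have "\<dots> \<longleftrightarrow> (\<exists>a\<in>gcomp (tens H A) 0. Y = B.NC.gauge a X)"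
    by (rule homotopy_iff_gauge[OF semT_in[OF x(1)] x(2,3) semT_in[OF y(1)] y(2,3)])
  finally show ?thesis .
qed

abbreviation "lift_eq \<equiv> mc_lift H \<iota> K A"

lemma lift_eq_iff:
  assumes x: "x \<in> fsums T A 1" and y: "y \<in> fsums H A 1"
  shows "lift_eq x y \<longleftrightarrow> B.NC.lifts (B.semT 1 x) (D.sem 1 y)"
proof -
  have b: "tbrkt H A 1 1 y y \<in> fsums H A 2" "D.sem 2 (tbrkt H A 1 1 y y) = brkt (tens H A) 1 1 (D.sem 1 y) (D.sem 1 y)"
    using D.sem_tbrkt[OF y y, of 2] by simp_all
  have k2: "linear_between (gscale H) (gcomp H 2) (gscale H) (gcomp H 1) (K 2)" using linear_K[of 2] by simp
  have k: "tmap (K 2) (tbrkt H A 1 1 y y) \<in> fsums H A 1"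
      "D.sem 1 (tmap (K 2) (tbrkt H A 1 1 y y)) = tlift (gscale H) (gcomp H 1) A (K 2) (D.sem 2 (tbrkt H A 1 1 y y))"
    unfolding fsums_def using b(1)[unfolded fsums_def] linear_betweenD(1)[OF k2]
    by - (rule tmap_in, assumption, blast, rule A.tsum_tmap[OF k2], assumption)
  have i: "tmap (\<iota> 1) x \<in> fsums H A 1" "D.sem 1 (tmap (\<iota> 1) x) = tlift (gscale H) (gcomp H 1) A (\<iota> 1) (B.semT 1 x)"
    unfolding fsums_def using x[unfolded fsums_def] lin_in(1)
    by - (rule tmap_in, assumption, blast, rule A.tsum_tmap[OF linear_incl], assumption)
  have a: "tmap (\<iota> 1) x @ tmap (gscale H (1 / 2)) (tmap (K 2) (tbrkt H A 1 1 y y)) \<in> fsums H A 1"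
    using i(1) D.sem_scale(1)[OF k(1)] by (auto simp: fsums_def)
  have s: "D.sem 1 (tmap (\<iota> 1) x @ tmap (gscale H (1 / 2)) (tmap (K 2) (tbrkt H A 1 1 y y))) =
      tlift (gscale H) (gcomp H 1) A (\<iota> 1) (B.semT 1 x) +
      tscale (1 / 2) (tlift (gscale H) (gcomp H 1) A (K 2) (brkt (tens H A) 1 1 (D.sem 1 y) (D.sem 1 y)))"
    unfolding tsum_append i(2) D.sem_scale(2)[OF k(1)] k(2) b(2) ..
  show ?thesis
    unfolding mc_lift_def D.teq_iff_sem[OF y a] s B.NC.lifts_def using D.sem_in[OF y] by (simp add: tens_simps)
qed

lemma MC_eq_iff: "x \<in> fsums T A 1 \<Longrightarrow> MC_eq_linf T A x \<longleftrightarrow> (\<exists>Y. B.NC.lifts (B.semT 1 x) Y \<and> B.NC.MC Y)"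
  by (rule B.MC_eq_linf_iff) (simp add: fsums_def)

lemma lift_eq_exists: "x \<in> fsums T A 1 \<Longrightarrow> \<exists>y\<in>fsums H A 1. lift_eq x y"
  using B.NC.lifts_exists[OF semT_in] D.sem_surj lift_eq_iff unfolding B.NC.lifts_def by (metis (no_types, lifting))

lemma lift_eq_MC:
  assumes "x \<in> fsums T A 1" "y \<in> fsums H A 1" "lift_eq x y"
  shows "MC_eq_linf T A x \<longleftrightarrow> MC_eq_dgla H A y"
  using assms B.NC.lifts_unique[OF semT_in[OF assms(1)]]
  unfolding MC_eq_iff[OF assms(1)] D.MC_eq_dgla_iff[OF assms(2)] lift_eq_iff[OF assms(1,2)] by blast

abbreviation "gauge_equivalent \<equiv> dgla_gauge_equivalent H A"

lemma gauge_equivalent_iff: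
  assumes x: "x \<in> fsums H A 1" and y: "y \<in> fsums H A 1"
  shows "gauge_equivalent x y \<longleftrightarrow> (\<exists>a\<in>gcomp (tens H A) 0. D.sem 1 y = B.NC.gauge a (D.sem 1 x))"
proof -
  have "gauge_equivalent x y \<longleftrightarrow> (\<exists>a\<in>fsums H A 0. D.sem 1 y = B.NC.gauge (D.sem 0 a) (D.sem 1 x))"
    unfolding dgla_gauge_equivalent_def by (rule bex_cong[OF HOL.refl]) (rule D.gauge_act_iff[OF _ x y])
  also have "\<dots> \<longleftrightarrow> (\<exists>a\<in>gcomp (tens H A) 0. D.sem 1 y = B.NC.gauge a (D.sem 1 x))"
    using D.sem_in[of _ 0] D.sem_surj[of _ 0] by metis
  finally show ?thesis .
qed

lemma lift_eq_equivalent: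
  assumes x: "x \<in> fsums T A 1" "y \<in> fsums H A 1" "lift_eq x y" "MC_eq_linf T A x"
    and x': "x' \<in> fsums T A 1" "y' \<in> fsums H A 1" "lift_eq x' y'" "MC_eq_linf T A x'"
  shows "homotopic x x' \<longleftrightarrow> gauge_equivalent y y'"
proof -
  have l: "B.NC.lifts (B.semT 1 x) (D.sem 1 y)" "B.NC.MC (D.sem 1 y)"
    and l': "B.NC.lifts (B.semT 1 x') (D.sem 1 y')" "B.NC.MC (D.sem 1 y')"
    using x x' lift_eq_MC[OF x(1-3)] lift_eq_MC[OF x'(1-3)]
    by (simp_all add: lift_eq_iff D.MC_eq_dgla_iff)
  show ?thesis
    unfolding homotopic_iff[OF x(1) l x'(1) l'] gauge_equivalent_iff[OF x(2) x'(2)] ..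
qed

text \<open>A Maurer-Cartan element is a lift only if \<open>K\<close> kills it; its gauge normal
  form has this property, and its projection is the element looked for.\<close>

lemma lift_eq_surj:
  assumes y: "y \<in> fsums H A 1" and MC: "MC_eq_dgla H A y"
  shows "\<exists>x\<in>fsums T A 1. \<exists>y'\<in>fsums H A 1. lift_eq x y' \<and> MC_eq_linf T A x \<and> gauge_equivalent y y'"
proof -
  have m: "B.NC.MC (D.sem 1 y)" using D.MC_eq_dgla_iff[OF y] MC by simp
  note Y = D.sem_in[OF y]
  obtain b where b: "b \<in> gcomp (tens H A) 1" "KA (B.NC.gauge (KA b) (D.sem 1 y)) = 0"
    using B.NC.gauge_normal_exists[OF Y] by auto
  have Kb: "KA b \<in> gcomp (tens H A) 0"
    using linear_betweenD(1)[OF B.NC.linear_K1 b(1)] by simp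
  let ?Y = "B.NC.gauge (KA b) (D.sem 1 y)"
  have m': "B.NC.MC ?Y" by (rule B.NC.gauge_MC[OF Kb Y m])
  have Y': "?Y \<in> gcomp (tens H A) 1" by (rule B.NC.gauge_in[OF Kb Y])
  then obtain y' where y': "y' \<in> fsums H A 1" "?Y = D.sem 1 y'" using D.sem_surj by blast
  have "projA ?Y \<in> tset (gscale T) (gcomp T 1) A"
    using B.NC.lin_in(2)[OF Y'] by (simp add: tens_simps)
  then obtain x where x: "x \<in> fsums T A 1" "projA ?Y = B.semT 1 x"
    unfolding fsums_def by (rule tsetE)
  have "B.NC.lifts (projA ?Y) ?Y" using B.NC.MC_lifts[OF m'] b(2) by simp
  then have l: "lift_eq x y'" using lift_eq_iff[OF x(1) y'(1)] x(2) y'(2) by simp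
  have "MC_eq_dgla H A y'" using D.MC_eq_dgla_iff[OF y'(1)] m' y'(2) by simp
  then have "MC_eq_linf T A x" using lift_eq_MC[OF x(1) y'(1) l] by simp
  moreover have "gauge_equivalent y y'"
    unfolding gauge_equivalent_iff[OF y y'(1)] using Kb y'(2) by metis
  ultimately show ?thesis using x(1) y'(1) l by blast
qed

lemma gauge_equivalent_equiv:
  assumes "x \<in> fsums H A 1" "MC_eq_dgla H A x" "y \<in> fsums H A 1" "z \<in> fsums H A 1"
  shows "gauge_equivalent x x"
    and "gauge_equivalent x y \<Longrightarrow> gauge_equivalent y x"
    and "gauge_equivalent x y \<Longrightarrow> gauge_equivalent y z \<Longrightarrow> gauge_equivalent x z"
proof -
  have m: "B.NC.MC (D.sem 1 x)" using D.MC_eq_dgla_iff assms(1,2) by simp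
  have "0 \<in> gcomp (tens H A) 0" by (rule csub.zero_in[OF B.NC.csub])
  then show "gauge_equivalent x x"
    unfolding gauge_equivalent_iff[OF assms(1,1)] using B.NC.gauge_zero[OF D.sem_in[OF assms(1)]] by metis
  show "gauge_equivalent x y \<Longrightarrow> gauge_equivalent y x"
    unfolding gauge_equivalent_iff[OF assms(1,3)] gauge_equivalent_iff[OF assms(3,1)]
    using D.gauge_sym[OF m] by metis
  show "gauge_equivalent x y \<Longrightarrow> gauge_equivalent y z \<Longrightarrow> gauge_equivalent x z"
    unfolding gauge_equivalent_iff[OF assms(1,3)] gauge_equivalent_iff[OF assms(3,4)] gauge_equivalent_iff[OF assms(1,4)]
    using D.gauge_trans[OF m] by metis
qed

text \<open>Lifts translate homotopy into gauge equivalence, where the laws are available; no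
  homotopies are concatenated.\<close>

lemma homotopic_equiv:
  assumes "x \<in> fsums T A 1" "MC_eq_linf T A x" "y \<in> fsums T A 1" "MC_eq_linf T A y" "z \<in> fsums T A 1" "MC_eq_linf T A z"
  shows "homotopic x x"
    and "homotopic x y \<Longrightarrow> homotopic y x"
    and "homotopic x y \<Longrightarrow> homotopic y z \<Longrightarrow> homotopic x z"
proof -
  obtain x' y' z' where l: "x' \<in> fsums H A 1" "lift_eq x x'" "y' \<in> fsums H A 1" "lift_eq y y'" "z' \<in> fsums H A 1" "lift_eq z z'"
    using lift_eq_exists assms by metis
  note e = lift_eq_equivalent[OF assms(1) l(1,2) assms(2)] lift_eq_equivalent[OF assms(3) l(3,4) assms(4)]
    lift_eq_equivalent[OF assms(5) l(5,6) assms(6)]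
  note m = lift_eq_MC[OF assms(1) l(1,2)] lift_eq_MC[OF assms(3) l(3,4)]
  note ee = gauge_equivalent_equiv[OF l(1) _ l(3) l(5)]
  show "homotopic x x" using e(1)[OF assms(1) l(1,2) assms(2)] ee(1) m assms by simp
  show "homotopic x y \<Longrightarrow> homotopic y x"
    using e(1)[OF assms(3) l(3,4) assms(4)] e(2)[OF assms(1) l(1,2) assms(2)] ee(2) m assms by simp
  show "homotopic x y \<Longrightarrow> homotopic y z \<Longrightarrow> homotopic x z"
    using e(1)[OF assms(3) l(3,4) assms(4)] e(2)[OF assms(5) l(5,6) assms(6)] e(1)[OF assms(5) l(5,6) assms(6)] ee(3) m assms by simp
qed

lemma homotopic_cong: "teq T A 1 x x' \<Longrightarrow> teq T A 1 y y' \<Longrightarrow> homotopic x y \<Longrightarrow> homotopic x' y'"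
  unfolding linf_homotopic_def
  by (elim bexE conjE, rule bexI, intro conjI, assumption, erule tensor_eq.trans, assumption,
    erule tensor_eq.trans, assumption, assumption)

lemma MC_eq_linf_cong: "teq T A 1 x x' \<Longrightarrow> MC_eq_linf T A x \<Longrightarrow> MC_eq_linf T A x'"
  using A.teq_lists[OF B.csub_T, of 1 x x'] MC_eq_iff[of x] MC_eq_iff[of x'] teq_T_iff[of x x']
  unfolding fsums_def by simp

lemma gauge_equivalent_cong:
  assumes "teq H A 1 x x'" "teq H A 1 y y'" "gauge_equivalent x y"
  shows "gauge_equivalent x' y'"
proof -
  have l: "x \<in> fsums H A 1" "x' \<in> fsums H A 1" "y \<in> fsums H A 1" "y' \<in> fsums H A 1"
    using A.teq_lists[OF csub] assms(1,2) unfolding fsums_def by auto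
  with assms show ?thesis by (simp add: gauge_equivalent_iff D.teq_iff_sem)
qed

lemma MC_eq_dgla_cong: "teq H A 1 x x' \<Longrightarrow> MC_eq_dgla H A x \<Longrightarrow> MC_eq_dgla H A x'"
  using A.teq_lists[OF csub, of 1 x x'] D.MC_eq_dgla_iff[of x] D.MC_eq_dgla_iff[of x'] D.teq_iff_sem[of x 1 x']
  unfolding fsums_def by simp

end

section \<open>Functoriality\<close>

definition coeff_map :: "('a \<Rightarrow> 'a) \<Rightarrow> ('v, 'a) fsum \<Rightarrow> ('v, 'a) fsum" where
  "coeff_map f x = map (\<lambda>(v, a). (v, f a)) x"

lemma coeff_map_simps [simp]:
  "coeff_map f [] = []" "coeff_map f ((v, a) # x) = (v, f a) # coeff_map f x"
  "coeff_map f (x @ y) = coeff_map f x @ coeff_map f y"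
  "coeff_map f (concat xs) = concat (map (coeff_map f) xs)"
  "coeff_map f (tmap g x) = tmap g (coeff_map f x)"
  "coeff_map (\<lambda>a. a) x = x" "coeff_map (k \<circ> f) x = coeff_map k (coeff_map f x)"
  by (simp_all add: coeff_map_def[abs_def] tmap_def map_concat comp_def case_prod_beta')

lemma tpush_eq: "tpush V B i f X = (\<Union>x\<in>X. tclass V B i (coeff_map f x))"
  by (simp add: tpush_def coeff_map_def)

locale art_morphism = A: art_algebra A + B: art_algebra B
  for A B :: "'a calgebra" and f +
  assumes hom: "f \<in> Art_hom A B"
begin

lemma f_ring_hom: "f \<in> ring_hom A B"
  using hom by (simp add: Art_hom_def)

lemma f_simps:
  "a \<in> carrier A \<Longrightarrow> b \<in> carrier A \<Longrightarrow> f (a \<otimes>\<^bsub>A\<^esub> b) = f a \<otimes>\<^bsub>B\<^esub> f b"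
  "a \<in> carrier A \<Longrightarrow> b \<in> carrier A \<Longrightarrow> f (a \<oplus>\<^bsub>A\<^esub> b) = f a \<oplus>\<^bsub>B\<^esub> f b"
  "a \<in> carrier A \<Longrightarrow> f (c \<odot>\<^bsub>A\<^esub> a) = c \<odot>\<^bsub>B\<^esub> f a"
  "f \<one>\<^bsub>A\<^esub> = \<one>\<^bsub>B\<^esub>"
  using f_ring_hom hom by (auto simp: ring_hom_def Art_hom_def)

lemma f_ideal: "a \<in> max_ideal A \<Longrightarrow> f a \<in> max_ideal B"
  by (rule max_ideal_image[OF A.A_Art B.A_Art hom])

lemma coeff_map_in: "x \<in> lists (V \<times> max_ideal A) \<Longrightarrow> coeff_map f x \<in> lists (V \<times> max_ideal B)"
  by (induction x) (auto simp: f_ideal)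

lemma coeff_map_fsums: "x \<in> fsums V A i \<Longrightarrow> coeff_map f x \<in> fsums V B i"
  unfolding fsums_def by (rule coeff_map_in)

lemma teq_coeff_map: "tensor_eq s V A x y \<Longrightarrow> tensor_eq s V B (coeff_map f x) (coeff_map f y)"
proof (induction rule: tensor_eq.induct)
  case (sym x y)
  show ?case by (rule tensor_eq.sym[OF sym.IH])
next
  case (trans x y z)
  show ?case by (rule tensor_eq.trans[OF trans.IH])
next
  case (add_right v a b)
  then show ?case using tensor_eq.add_right[of v V "f a" B "f b" s] by (simp add: f_ideal f_simps)
next
  case (scale v a c)
  then show ?case using tensor_eq.scale[of v V "f a" B s c] by (simp add: f_ideal f_simps)
qed (simp_all add: tensor_eq.refl tensor_eq.append tensor_eq.comm tensor_eq.zero tensor_eq.add_left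
    coeff_map_in f_ideal)

lemma tpush_tclass:
  assumes "x \<in> fsums V A i"
  shows "tpush V B i f (tclass V A i x) = tclass V B i (coeff_map f x)"
proof
  show "tpush V B i f (tclass V A i x) \<subseteq> tclass V B i (coeff_map f x)"
    unfolding tpush_eq tclass_def by (auto intro: tensor_eq.trans[OF teq_coeff_map])
  have "x \<in> tclass V A i x" using assms unfolding tclass_def fsums_def by (simp add: tensor_eq.refl)
  then show "tclass V B i (coeff_map f x) \<subseteq> tpush V B i f (tclass V A i x)"
    unfolding tpush_eq by blast
qed

text \<open>This coarser condition is preserved by brackets in arbitrary degrees and is what the
  rules for ring homomorphisms ask of the coefficients, so naturality can be computed on
  representatives.\<close>

lemma fsums_carrier: "x \<in> fsums V A i \<Longrightarrow> x \<in> lists (UNIV \<times> carrier A)"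
  unfolding fsums_def by (induction x) (auto simp: A.m_closed)

lemma tbrkt_carrier:
  "x \<in> lists (UNIV \<times> carrier A) \<Longrightarrow> y \<in> lists (UNIV \<times> carrier A) \<Longrightarrow>
    tbrkt L A i j x y \<in> lists (UNIV \<times> carrier A)"
  by (fastforce simp: tbrkt_eq_tmap2 tmap2_def in_lists_conv_set)

lemma coeff_map_tbrkt:
  assumes "x \<in> lists (UNIV \<times> carrier A)" "y \<in> lists (UNIV \<times> carrier A)"
  shows "coeff_map f (tbrkt L A i j x y) = tbrkt L B i j (coeff_map f x) (coeff_map f y)"
proof -
  have "snd p \<in> carrier A" "snd q \<in> carrier A" if "p \<in> set x" "q \<in> set y" for p q
    using assms that by (auto simp: in_lists_conv_set)
  then show ?thesis
    unfolding tbrkt_eq_tmap2 tmap2_def coeff_map_def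
    by (auto simp: map_concat comp_def case_prod_beta' f_simps intro!: arg_cong[where f = concat])
qed

lemma coeff_map_tprod: "ws \<in> lists (UNIV \<times> carrier A) \<Longrightarrow> f (tprod A ws) = tprod B (coeff_map f ws) \<and> tprod A ws \<in> carrier A"
  by (induction ws) (auto simp: f_simps)

lemma coeff_map_tpower:
  assumes "x \<in> lists (UNIV \<times> carrier A)"
  shows "coeff_map f (tpower T A k x) = tpower T B k (coeff_map f x)"
proof -
  have "ws \<in> lists (UNIV \<times> carrier A)" if "ws \<in> set (List.n_lists k x)" for ws
    using that assms by (auto simp: set_n_lists in_lists_conv_set)
  then have "f (tprod A ws) = tprod B (coeff_map f ws)" if "ws \<in> set (List.n_lists k x)" for ws
    using coeff_map_tprod that by blast
  then show ?thesis
    unfolding tpower_eq by (simp add: coeff_map_def n_lists_map comp_def case_prod_beta')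
qed

lemma tseries_coeff_map:
  assumes "tseries V A i F y"
  shows "tseries V B i (\<lambda>n. coeff_map f (F n)) (coeff_map f y)"
  using assms teq_coeff_map[of "gscale V" "gcomp V i" "concat (map F [0..<n])" y for n]
  unfolding tseries_def by (auto elim!: eventually_mono simp: comp_def)

lemma MC_eq_dgla_coeff_map:
  assumes x: "x \<in> fsums L A 1" and MC: "MC_eq_dgla L A x"
  shows "MC_eq_dgla L B (coeff_map f x)"
  using teq_coeff_map[OF MC[unfolded MC_eq_dgla_def]] fsums_carrier[OF x]
  unfolding MC_eq_dgla_def by (simp add: coeff_map_tbrkt del: tmap_simps(4))

lemma MC_eq_linf_coeff_map:
  assumes x: "x \<in> fsums T A 1" and MC: "MC_eq_linf T A x"
  shows "MC_eq_linf T B (coeff_map f x)"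
  using tseries_coeff_map[OF MC[unfolded MC_eq_linf_def]] fsums_carrier[OF x]
  unfolding MC_eq_linf_def by (simp add: coeff_map_tpower del: tmap_simps(4) fact_Suc)

lemma gauge_act_coeff_map:
  assumes a: "a \<in> fsums L A 0" and x: "x \<in> fsums L A 1" and g: "gauge_act L A a x y"
  shows "gauge_act L B (coeff_map f a) (coeff_map f x) (coeff_map f y)"
proof -
  define u where "u = tbrkt L A 0 1 a x @ tmap (\<lambda>v. - diff L 0 v) a"
  note c = fsums_carrier[OF a] fsums_carrier[OF x]
  have "tmap (\<lambda>v. - diff L 0 v) a \<in> lists (UNIV \<times> carrier A)"
    using c(1) by (induction a) (auto simp: tmap_def)
  then have u: "u \<in> lists (UNIV \<times> carrier A)"
    unfolding u_def using tbrkt_carrier[OF c] by simp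
  have n: "coeff_map f ((tbrkt L A 0 1 a ^^ n) u) = (tbrkt L B 0 1 (coeff_map f a) ^^ n) (coeff_map f u) \<and>
      (tbrkt L A 0 1 a ^^ n) u \<in> lists (UNIV \<times> carrier A)" for n
  proof (induction n)
    case (Suc n)
    then show ?case
      using coeff_map_tbrkt[OF c(1), of "(tbrkt L A 0 1 a ^^ n) u" L 0 1]
        tbrkt_carrier[OF c(1), of "(tbrkt L A 0 1 a ^^ n) u" L 0 1] by (simp only: funpow.simps o_def)
  qed (simp add: u)
  have cu: "coeff_map f u = tbrkt L B 0 1 (coeff_map f a) (coeff_map f x) @ tmap (\<lambda>v. - diff L 0 v) (coeff_map f a)"
    using coeff_map_tbrkt[OF c] by (simp add: u_def)
  obtain z where z: "z \<in> fsums L A 1"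
      "tseries L A 1 (\<lambda>n. tmap (gscale L (1 / fact (n + 1))) ((tbrkt L A 0 1 a ^^ n) u)) z"
      "teq L A 1 y (x @ z)"
    using g unfolding gauge_act_def Let_def u_def[symmetric] by blast
  have "tseries L B 1 (\<lambda>n. tmap (gscale L (1 / fact (n + 1)))
      ((tbrkt L B 0 1 (coeff_map f a) ^^ n) (coeff_map f u))) (coeff_map f z)"
    using tseries_coeff_map[OF z(2)] n by (simp del: fact_Suc)
  moreover have "teq L B 1 (coeff_map f y) (coeff_map f x @ coeff_map f z)"
    using teq_coeff_map[OF z(3)] by simp
  ultimately show ?thesis
    unfolding gauge_act_def Let_def cu[symmetric] using coeff_map_fsums[OF z(1)] by blast
qed

lemma gauge_equivalent_coeff_map:
  "x \<in> fsums L A 1 \<Longrightarrow> dgla_gauge_equivalent L A x y \<Longrightarrow>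
    dgla_gauge_equivalent L B (coeff_map f x) (coeff_map f y)"
  unfolding dgla_gauge_equivalent_def using coeff_map_fsums gauge_act_coeff_map by blast

lemma homotopic_coeff_map:
  assumes "linf_homotopic T A x y"
  shows "linf_homotopic T B (coeff_map f x) (coeff_map f y)"
proof -
  obtain \<xi> where \<xi>: "\<xi> \<in> fsums (linf_forms T) A 1" "MC_eq_linf (linf_forms T) A \<xi>"
    "teq T A 1 (tmap (forms_eval (gscale T) 0) \<xi>) x" "teq T A 1 (tmap (forms_eval (gscale T) 1) \<xi>) y"
    using assms unfolding linf_homotopic_def by blast
  show ?thesis
    unfolding linf_homotopic_def
    using coeff_map_fsums[OF \<xi>(1)] MC_eq_linf_coeff_map[OF \<xi>(1,2)] teq_coeff_map[OF \<xi>(3)] teq_coeff_map[OF \<xi>(4)]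
    by (intro bexI[of _ "coeff_map f \<xi>"]) simp_all
qed

lemma mc_lift_coeff_map:
  assumes "y \<in> fsums H A 1" "mc_lift H \<iota> K A x y"
  shows "mc_lift H \<iota> K B (coeff_map f x) (coeff_map f y)"
  using teq_coeff_map[OF assms(2)[unfolded mc_lift_def]] fsums_carrier[OF assms(1)]
  unfolding mc_lift_def by (simp add: coeff_map_tbrkt del: tmap_simps(4))

end

lemma Art_hom_id: "(\<lambda>a. a) \<in> Art_hom A A"
  by (simp add: Art_hom_def ring_hom_def)

lemma Art_hom_comp:
  assumes "f \<in> Art_hom A B" "k \<in> Art_hom B C"
  shows "k \<circ> f \<in> Art_hom A C"
proof -
  have r: "f \<in> ring_hom A B" "k \<in> ring_hom B C" using assms by (simp_all add: Art_hom_def)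
  have "f a \<in> carrier B" if "a \<in> carrier A" for a using ring_hom_closed[OF r(1) that] .
  then show ?thesis using assms ring_hom_trans[OF r] by (simp add: Art_hom_def)
qed

section \<open>Functors of equivalence classes and isomorphisms between them\<close>

locale quotient_functor =
  fixes F :: "'a calgebra \<Rightarrow> 'x set" and r :: "'a calgebra \<Rightarrow> ('x \<times> 'x) set"
    and p :: "'a calgebra \<Rightarrow> ('a \<Rightarrow> 'a) \<Rightarrow> 'x \<Rightarrow> 'x"
  assumes equiv: "A \<in> Art \<Longrightarrow> equiv (F A) (r A)"
    and push_rel: "A \<in> Art \<Longrightarrow> B \<in> Art \<Longrightarrow> f \<in> Art_hom A B \<Longrightarrow> (x, y) \<in> r A \<Longrightarrow> (p B f x, p B f y) \<in> r B"
    and push_id: "A \<in> Art \<Longrightarrow> x \<in> F A \<Longrightarrow> p A (\<lambda>a. a) x = x"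
    and push_cong: "A \<in> Art \<Longrightarrow> B \<in> Art \<Longrightarrow> f \<in> Art_hom A B \<Longrightarrow> f' \<in> Art_hom A B \<Longrightarrow>
      (\<And>a. a \<in> carrier A \<Longrightarrow> f a = f' a) \<Longrightarrow> x \<in> F A \<Longrightarrow> p B f x = p B f' x"
    and push_comp: "A \<in> Art \<Longrightarrow> B \<in> Art \<Longrightarrow> C \<in> Art \<Longrightarrow> f \<in> Art_hom A B \<Longrightarrow> k \<in> Art_hom B C \<Longrightarrow>
      x \<in> F A \<Longrightarrow> p C (k \<circ> f) x = p C k (p B f x)"
begin

definition quotient :: "('a, 'x set) art_functor" where
  "quotient = \<lparr> fobj = (\<lambda>A. F A // r A), fmap = (\<lambda>A B f. quot_push (r B) (p B f)) \<rparr>"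

lemma refl_rel: "A \<in> Art \<Longrightarrow> x \<in> F A \<Longrightarrow> (x, x) \<in> r A"
  using equiv by (meson equivE refl_onD)

lemma rel_in: "A \<in> Art \<Longrightarrow> (x, y) \<in> r A \<Longrightarrow> x \<in> F A \<and> y \<in> F A"
  using equiv_type[OF equiv] by blast

lemma push_in: "A \<in> Art \<Longrightarrow> B \<in> Art \<Longrightarrow> f \<in> Art_hom A B \<Longrightarrow> x \<in> F A \<Longrightarrow> p B f x \<in> F B"
  using push_rel refl_rel rel_in by blast

lemma push_class:
  assumes A: "A \<in> Art" and B: "B \<in> Art" and f: "f \<in> Art_hom A B" and x: "x \<in> F A"
  shows "quot_push (r B) (p B f) (r A `` {x}) = r B `` {p B f x}"
proof -
  have "r B `` {p B f y} = r B `` {p B f x}" if "(x, y) \<in> r A" for y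
    using equiv_class_eq[OF equiv[OF B] push_rel[OF A B f that]] by simp
  then show ?thesis
    unfolding quot_push_def using refl_rel[OF A x] by blast
qed

lemma class_cases:
  assumes "c \<in> F A // r A"
  obtains x where "x \<in> F A" "c = r A `` {x}"
  using assms by (rule quotientE)

lemma is_functor_quotient: "is_functor quotient"
  unfolding is_functor_def quotient_def art_functor.simps
proof (intro conjI ballI impI)
  fix A c assume A: "A \<in> Art" and c: "c \<in> F A // r A"
  from c obtain x where x: "x \<in> F A" "c = r A `` {x}" by (rule class_cases)
  then show "quot_push (r A) (p A (\<lambda>a. a)) c = c" using push_class[OF A A Art_hom_id x(1)] push_id[OF A x(1)] by simp
next
  fix A B f c assume AB: "A \<in> Art" "B \<in> Art" "f \<in> Art_hom A B" and c: "c \<in> F A // r A"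
  from c obtain x where x: "x \<in> F A" "c = r A `` {x}" by (rule class_cases)
  then show "quot_push (r B) (p B f) c \<in> F B // r B"
    using push_class[OF AB x(1)] push_in[OF AB x(1)] by (simp add: quotientI)
next
  fix A B f f' c assume AB: "A \<in> Art" "B \<in> Art" "f \<in> Art_hom A B" "f' \<in> Art_hom A B"
    and e: "\<forall>a\<in>carrier A. f a = f' a" and c: "c \<in> F A // r A"
  from c obtain x where x: "x \<in> F A" "c = r A `` {x}" by (rule class_cases)
  then show "quot_push (r B) (p B f) c = quot_push (r B) (p B f') c"
    using push_class[OF AB(1,2,3) x(1)] push_class[OF AB(1,2,4) x(1)] push_cong[OF AB _ x(1)] e by simp
next
  fix A B C f k c assume AB: "A \<in> Art" "B \<in> Art" "C \<in> Art" "f \<in> Art_hom A B" "k \<in> Art_hom B C"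
    and c: "c \<in> F A // r A"
  note kf = Art_hom_comp[OF AB(4,5)]
  from c obtain x where x: "x \<in> F A" "c = r A `` {x}" by (rule class_cases)
  then show "quot_push (r C) (p C (k \<circ> f)) c = quot_push (r C) (p C k) (quot_push (r B) (p B f) c)"
    using push_class[OF AB(1,3) kf x(1)] push_class[OF AB(1,2,4) x(1)]
      push_class[OF AB(2,3,5) push_in[OF AB(1,2,4) x(1)]] push_comp[OF AB x(1)] by simp
qed

end

text \<open>A correspondence that is total, surjective up to \<open>s\<close>, and matches the two
  relations induces a bijection of quotients; choosing partners naturally is thereby
  avoided.\<close>

lemma functor_iso_quotients:
  fixes \<Psi> :: "'a calgebra \<Rightarrow> ('x \<times> 'y) set"
  assumes F: "quotient_functor F r p" and G: "quotient_functor G s q"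
    and sub: "\<And>A. A \<in> Art \<Longrightarrow> \<Psi> A \<subseteq> F A \<times> G A"
    and total: "\<And>A x. A \<in> Art \<Longrightarrow> x \<in> F A \<Longrightarrow> \<exists>y. (x, y) \<in> \<Psi> A"
    and surj: "\<And>A y. A \<in> Art \<Longrightarrow> y \<in> G A \<Longrightarrow> \<exists>x y'. (x, y') \<in> \<Psi> A \<and> (y, y') \<in> s A"
    and rel: "\<And>A x y x' y'. A \<in> Art \<Longrightarrow> (x, y) \<in> \<Psi> A \<Longrightarrow> (x', y') \<in> \<Psi> A \<Longrightarrow> (x, x') \<in> r A \<longleftrightarrow> (y, y') \<in> s A"
    and nat: "\<And>A B f x y. A \<in> Art \<Longrightarrow> B \<in> Art \<Longrightarrow> f \<in> Art_hom A B \<Longrightarrow> (x, y) \<in> \<Psi> A \<Longrightarrow> (p B f x, q B f y) \<in> \<Psi> B"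
  shows "functor_iso (quotient_functor.quotient F r p) (quotient_functor.quotient G s q)"
proof -
  interpret F: quotient_functor F r p by fact
  interpret G: quotient_functor G s q by fact
  \<comment> \<open>Saturation under \<open>s A\<close> makes the result independent of the
    representative and of its partner.\<close>
  define \<Phi> where "\<Phi> A c = s A `` (\<Psi> A `` c)" for A c
  have \<Phi>: "\<Phi> A (r A `` {x}) = s A `` {y}" if A: "A \<in> Art" and xy: "(x, y) \<in> \<Psi> A" for A x y
  proof -
    have x: "x \<in> F A" using sub[OF A] xy by auto
    have "s A `` {y'} = s A `` {y}" if "(x, x') \<in> r A" "(x', y') \<in> \<Psi> A" for x' y'
      using rel[OF A xy that(2)] that(1) equiv_class_eq[OF G.equiv[OF A]] by blast
    then show ?thesis unfolding \<Phi>_def using F.refl_rel[OF A x] xy by blast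
  qed
  have bij: "bij_betw (\<Phi> A) (F A // r A) (G A // s A)" if A: "A \<in> Art" for A
  proof (rule bij_betw_imageI)
    show "inj_on (\<Phi> A) (F A // r A)"
    proof (rule inj_onI)
      fix c c' assume "c \<in> F A // r A" "c' \<in> F A // r A" and e: "\<Phi> A c = \<Phi> A c'"
      then obtain x x' where x: "x \<in> F A" "c = r A `` {x}" and x': "x' \<in> F A" "c' = r A `` {x'}"
        by (meson F.class_cases)
      obtain y y' where y: "(x, y) \<in> \<Psi> A" and y': "(x', y') \<in> \<Psi> A"
        using total[OF A x(1)] total[OF A x'(1)] by blast
      have "y' \<in> G A" using sub[OF A] y' by auto
      then have "(y, y') \<in> s A"
        using e \<Phi>[OF A y] \<Phi>[OF A y'] G.refl_rel[OF A] unfolding x(2) x'(2) by blast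
      then show "c = c'"
        unfolding x(2) x'(2) using rel[OF A y y'] equiv_class_eq[OF F.equiv[OF A]] by blast
    qed
    show "\<Phi> A ` (F A // r A) = G A // s A"
    proof
      show "\<Phi> A ` (F A // r A) \<subseteq> G A // s A"
      proof
        fix d assume "d \<in> \<Phi> A ` (F A // r A)"
        then obtain x where x: "x \<in> F A" "d = \<Phi> A (r A `` {x})" by (auto elim: F.class_cases)
        obtain y where y: "(x, y) \<in> \<Psi> A" using total[OF A x(1)] by blast
        then show "d \<in> G A // s A" using x(2) \<Phi>[OF A y] sub[OF A] by (auto intro: quotientI)
      qed
      show "G A // s A \<subseteq> \<Phi> A ` (F A // r A)"
      proof
        fix d assume "d \<in> G A // s A"
        then obtain y where y: "y \<in> G A" "d = s A `` {y}" by (rule G.class_cases)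
        obtain x y' where xy': "(x, y') \<in> \<Psi> A" "(y, y') \<in> s A" using surj[OF A y(1)] by blast
        have "d = \<Phi> A (r A `` {x})"
          unfolding y(2) \<Phi>[OF A xy'(1)] by (rule equiv_class_eq[OF G.equiv[OF A] xy'(2)])
        moreover have "r A `` {x} \<in> F A // r A" using sub[OF A] xy'(1) by (auto intro: quotientI)
        ultimately show "d \<in> \<Phi> A ` (F A // r A)" by blast
      qed
    qed
  qed
  have nat': "\<Phi> B (quot_push (r B) (p B f) c) = quot_push (s B) (q B f) (\<Phi> A c)"
    if AB: "A \<in> Art" "B \<in> Art" "f \<in> Art_hom A B" and c: "c \<in> F A // r A" for A B f c
  proof -
    obtain x where x: "x \<in> F A" "c = r A `` {x}" using c by (rule F.class_cases)
    obtain y where y: "(x, y) \<in> \<Psi> A" using total[OF AB(1) x(1)] by blast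
    have yG: "y \<in> G A" using sub[OF AB(1)] y by auto
    show ?thesis
      unfolding x(2) F.push_class[OF AB x(1)] \<Phi>[OF AB(1) y] G.push_class[OF AB yG] \<Phi>[OF AB(2) nat[OF AB y]] ..
  qed
  then have "\<exists>\<Phi>. (\<forall>A\<in>Art. bij_betw (\<Phi> A) (F A // r A) (G A // s A)) \<and>
      (\<forall>A\<in>Art. \<forall>B\<in>Art. \<forall>f\<in>Art_hom A B. \<forall>c\<in>F A // r A.
        \<Phi> B (quot_push (r B) (p B f) c) = quot_push (s B) (q B f) (\<Phi> A c))"
    using bij by (intro exI[of _ \<Phi>]) simp
  then show ?thesis
    unfolding functor_iso_def
    using F.is_functor_quotient G.is_functor_quotient
    unfolding F.quotient_def G.quotient_def by simp
qed

text \<open>The common frame of both deformation functors: a predicate and a relation on formal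
  sums, both invariant under congruence. Being an equivalence is demanded on solutions of P, where
  the Maurer-Cartan equation is at hand.\<close>

locale tensor_functor =
  fixes V :: "('v::ab_group_add, 'z) graded_scheme"
    and P :: "'a calgebra \<Rightarrow> ('v, 'a) fsum \<Rightarrow> bool"
    and R :: "'a calgebra \<Rightarrow> ('v, 'a) fsum \<Rightarrow> ('v, 'a) fsum \<Rightarrow> bool"
  assumes graded: "graded_space V"
    and P_cong: "A \<in> Art \<Longrightarrow> teq V A 1 x x' \<Longrightarrow> P A x \<Longrightarrow> P A x'"
    and R_cong: "A \<in> Art \<Longrightarrow> teq V A 1 x x' \<Longrightarrow> teq V A 1 y y' \<Longrightarrow> R A x y \<Longrightarrow> R A x' y'"
    and R_equiv: "A \<in> Art \<Longrightarrow> x \<in> fsums V A 1 \<Longrightarrow> P A x \<Longrightarrow> R A x x"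
      "A \<in> Art \<Longrightarrow> x \<in> fsums V A 1 \<Longrightarrow> P A x \<Longrightarrow> y \<in> fsums V A 1 \<Longrightarrow> P A y \<Longrightarrow> R A x y \<Longrightarrow> R A y x"
      "A \<in> Art \<Longrightarrow> x \<in> fsums V A 1 \<Longrightarrow> P A x \<Longrightarrow> y \<in> fsums V A 1 \<Longrightarrow> P A y \<Longrightarrow>
        z \<in> fsums V A 1 \<Longrightarrow> P A z \<Longrightarrow> R A x y \<Longrightarrow> R A y z \<Longrightarrow> R A x z"
    and P_push: "art_morphism A B f \<Longrightarrow> x \<in> fsums V A 1 \<Longrightarrow> P A x \<Longrightarrow> P B (coeff_map f x)"
    and R_push: "art_morphism A B f \<Longrightarrow> x \<in> fsums V A 1 \<Longrightarrow> y \<in> fsums V A 1 \<Longrightarrow> R A x y \<Longrightarrow>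
      R B (coeff_map f x) (coeff_map f y)"
begin

definition mc_classes :: "'a calgebra \<Rightarrow> ('v, 'a) fsum set set" where
  "mc_classes A = {tclass V A 1 x | x. x \<in> fsums V A 1 \<and> P A x}"

definition class_rel :: "'a calgebra \<Rightarrow> (('v, 'a) fsum set \<times> ('v, 'a) fsum set) set" where
  "class_rel A = {(tclass V A 1 x, tclass V A 1 y) | x y.
     tclass V A 1 x \<in> mc_classes A \<and> tclass V A 1 y \<in> mc_classes A \<and> x \<in> fsums V A 1 \<and> y \<in> fsums V A 1 \<and> R A x y}"

lemma tclass_eq: "x \<in> fsums V A 1 \<Longrightarrow> y \<in> fsums V A 1 \<Longrightarrow> tclass V A 1 x = tclass V A 1 y \<longleftrightarrow> teq V A 1 x y"
proof
  assume "x \<in> fsums V A 1" "y \<in> fsums V A 1"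
  then have y: "y \<in> tclass V A 1 y" by (simp add: tclass_def fsums_def tensor_eq.refl)
  assume "tclass V A 1 x = tclass V A 1 y"
  with y show "teq V A 1 x y" by (auto simp: tclass_def)
next
  assume "teq V A 1 x y"
  then show "tclass V A 1 x = tclass V A 1 y"
    unfolding tclass_def by (blast intro: tensor_eq.trans tensor_eq.sym)
qed

lemma tclass_classes_iff:
  assumes "A \<in> Art" "x \<in> fsums V A 1"
  shows "tclass V A 1 x \<in> mc_classes A \<longleftrightarrow> P A x"
proof
  assume "tclass V A 1 x \<in> mc_classes A"
  then obtain x' where x': "x' \<in> fsums V A 1" "P A x'" "tclass V A 1 x' = tclass V A 1 x"
    unfolding mc_classes_def by force
  then have "teq V A 1 x' x" using tclass_eq[OF x'(1) assms(2)] by simp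
  then show "P A x" by (rule P_cong[OF assms(1) _ x'(2)])
qed (use assms(2) in \<open>auto simp: mc_classes_def\<close>)

lemma class_rel_iff:
  assumes A: "A \<in> Art" and x: "x \<in> fsums V A 1" and y: "y \<in> fsums V A 1"
  shows "(tclass V A 1 x, tclass V A 1 y) \<in> class_rel A \<longleftrightarrow> P A x \<and> P A y \<and> R A x y"
proof
  assume "(tclass V A 1 x, tclass V A 1 y) \<in> class_rel A"
  then obtain x' y' where x': "tclass V A 1 x = tclass V A 1 x'" "tclass V A 1 y = tclass V A 1 y'"
    "tclass V A 1 x' \<in> mc_classes A" "tclass V A 1 y' \<in> mc_classes A" "x' \<in> fsums V A 1" "y' \<in> fsums V A 1" "R A x' y'"
    unfolding class_rel_def by blast
  then have "teq V A 1 x' x" "teq V A 1 y' y" using x y by (simp_all add: tclass_eq tensor_eq.sym)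
  then have "R A x y" by (rule R_cong[OF A _ _ x'(7)])
  with x' x y show "P A x \<and> P A y \<and> R A x y" by (simp add: tclass_classes_iff[OF A, symmetric])
next
  assume "P A x \<and> P A y \<and> R A x y"
  then show "(tclass V A 1 x, tclass V A 1 y) \<in> class_rel A"
    unfolding class_rel_def using tclass_classes_iff[OF A] x y by blast
qed

lemma classes_cases:
  assumes "X \<in> mc_classes A"
  obtains x where "x \<in> fsums V A 1" "P A x" "X = tclass V A 1 x"
  using assms unfolding mc_classes_def by blast

lemma class_rel_cases:
  assumes "A \<in> Art" "(X, Y) \<in> class_rel A"
  obtains x y where "x \<in> fsums V A 1" "y \<in> fsums V A 1" "P A x" "P A y" "R A x y"
    "X = tclass V A 1 x" "Y = tclass V A 1 y"
  using assms(2) tclass_classes_iff[OF assms(1)] that unfolding class_rel_def by blast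

sublocale quotient_functor mc_classes class_rel "\<lambda>B f. tpush V B 1 f"
proof
  fix A :: "'a calgebra" assume A: "A \<in> Art"
  show "equiv (mc_classes A) (class_rel A)"
  proof (rule equivI)
    show "class_rel A \<subseteq> mc_classes A \<times> mc_classes A" unfolding class_rel_def by blast
    show "refl_on (mc_classes A) (class_rel A)"
    proof (rule refl_onI)
      fix X assume "X \<in> mc_classes A"
      then obtain x where "x \<in> fsums V A 1" "P A x" "X = tclass V A 1 x" by (rule classes_cases)
      then show "(X, X) \<in> class_rel A" using class_rel_iff[OF A] R_equiv(1)[OF A] by simp
    qed
    show "Relation.sym (class_rel A)"
    proof (rule symI)
      fix X Y assume "(X, Y) \<in> class_rel A"
      then obtain x y where *: "x \<in> fsums V A 1" "y \<in> fsums V A 1" "P A x" "P A y" "R A x y"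
        "X = tclass V A 1 x" "Y = tclass V A 1 y" by (rule class_rel_cases[OF A])
      then show "(Y, X) \<in> class_rel A" using class_rel_iff[OF A] R_equiv(2)[OF A] by simp
    qed
    show "Relation.trans (class_rel A)"
    proof (rule transI)
      fix X Y Z assume "(X, Y) \<in> class_rel A" and YZ: "(Y, Z) \<in> class_rel A"
      then obtain x y where *: "x \<in> fsums V A 1" "y \<in> fsums V A 1" "P A x" "P A y" "R A x y"
        "X = tclass V A 1 x" "Y = tclass V A 1 y" by (meson class_rel_cases[OF A])
      from YZ obtain z where z: "z \<in> fsums V A 1" "Z = tclass V A 1 z" by (meson class_rel_cases[OF A])
      have "P A z" "R A y z" using YZ unfolding z(2) *(7) class_rel_iff[OF A *(2) z(1)] by simp_all
      then show "(X, Z) \<in> class_rel A"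
        unfolding z(2) *(6) class_rel_iff[OF A *(1) z(1)]
        using R_equiv(3)[OF A *(1,3,2,4) z(1) _ *(5)] *(3) by simp
    qed
  qed
  fix X assume "X \<in> mc_classes A"
  then obtain x where x: "x \<in> fsums V A 1" "P A x" "X = tclass V A 1 x" by (rule classes_cases)
  interpret I: art_morphism A A "\<lambda>a. a" by unfold_locales (rule A, rule Art_hom_id)
  show "tpush V A 1 (\<lambda>a. a) X = X" unfolding x(3) I.tpush_tclass[OF x(1)] by simp
next
  fix A B :: "'a calgebra" and f X Y
  assume AB: "A \<in> Art" "B \<in> Art" "f \<in> Art_hom A B" and XY: "(X, Y) \<in> class_rel A"
  interpret f: art_morphism A B f by unfold_locales (rule AB)+
  from XY obtain x y where *: "x \<in> fsums V A 1" "y \<in> fsums V A 1" "P A x" "P A y" "R A x y"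
    "X = tclass V A 1 x" "Y = tclass V A 1 y" by (rule class_rel_cases[OF AB(1)])
  show "(tpush V B 1 f X, tpush V B 1 f Y) \<in> class_rel B"
    unfolding *(6,7) f.tpush_tclass[OF *(1)] f.tpush_tclass[OF *(2)]
      class_rel_iff[OF AB(2) f.coeff_map_fsums[OF *(1)] f.coeff_map_fsums[OF *(2)]]
    using P_push[OF f.art_morphism_axioms] R_push[OF f.art_morphism_axioms] * by simp
next
  fix A B :: "'a calgebra" and f f' X
  assume AB: "A \<in> Art" "B \<in> Art" "f \<in> Art_hom A B" "f' \<in> Art_hom A B"
    and e: "\<And>a. a \<in> carrier A \<Longrightarrow> f a = f' a" and X: "X \<in> mc_classes A"
  interpret f: art_morphism A B f by unfold_locales (rule AB)+
  interpret f': art_morphism A B f' by unfold_locales (rule AB)+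
  from X obtain x where x: "x \<in> fsums V A 1" "P A x" "X = tclass V A 1 x" by (rule classes_cases)
  have "coeff_map f x = coeff_map f' x"
    using f.fsums_carrier[OF x(1)] e by (auto simp: coeff_map_def in_lists_conv_set)
  then show "tpush V B 1 f X = tpush V B 1 f' X"
    unfolding x(3) f.tpush_tclass[OF x(1)] f'.tpush_tclass[OF x(1)] by simp
next
  fix A B C :: "'a calgebra" and f k X
  assume AB: "A \<in> Art" "B \<in> Art" "C \<in> Art" "f \<in> Art_hom A B" "k \<in> Art_hom B C" and X: "X \<in> mc_classes A"
  note kf = Art_hom_comp[OF AB(4,5)]
  interpret f: art_morphism A B f by unfold_locales (rule AB)+
  interpret k: art_morphism B C k by unfold_locales (rule AB)+
  interpret kf: art_morphism A C "k \<circ> f" by unfold_locales (rule kf)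
  from X obtain x where x: "x \<in> fsums V A 1" "P A x" "X = tclass V A 1 x" by (rule classes_cases)
  show "tpush V C 1 (k \<circ> f) X = tpush V C 1 k (tpush V B 1 f X)"
    unfolding x(3) kf.tpush_tclass[OF x(1)] f.tpush_tclass[OF x(1)] k.tpush_tclass[OF f.coeff_map_fsums[OF x(1)]]
    by simp
qed

end

section \<open>The isomorphism of deformation functors\<close>

context transferred
begin

lemma art_cone: "A \<in> Art \<Longrightarrow> art_cone A H T dV \<iota> \<pi> K"
  by (intro art_cone.intro art_algebra.intro transferred_axioms)

lemma tensor_functor_T: "tensor_functor T (MC_eq_linf T) (linf_homotopic T)"
proof
  show "graded_space T" by (rule graded_V)
next
  fix A :: "'x calgebra" and x y z x' y' assume "A \<in> Art"
  then interpret art_cone A H T dV \<iota> \<pi> K by (rule art_cone)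
  show "teq T A 1 x x' \<Longrightarrow> MC_eq_linf T A x \<Longrightarrow> MC_eq_linf T A x'" by (rule MC_eq_linf_cong)
  show "teq T A 1 x x' \<Longrightarrow> teq T A 1 y y' \<Longrightarrow> linf_homotopic T A x y \<Longrightarrow> linf_homotopic T A x' y'"
    by (rule homotopic_cong)
  show "x \<in> fsums T A 1 \<Longrightarrow> MC_eq_linf T A x \<Longrightarrow> linf_homotopic T A x x" by (rule homotopic_equiv(1))
  show "x \<in> fsums T A 1 \<Longrightarrow> MC_eq_linf T A x \<Longrightarrow> y \<in> fsums T A 1 \<Longrightarrow> MC_eq_linf T A y \<Longrightarrow>
      linf_homotopic T A x y \<Longrightarrow> linf_homotopic T A y x" by (rule homotopic_equiv(2))
  show "x \<in> fsums T A 1 \<Longrightarrow> MC_eq_linf T A x \<Longrightarrow> y \<in> fsums T A 1 \<Longrightarrow> MC_eq_linf T A y \<Longrightarrow>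
      z \<in> fsums T A 1 \<Longrightarrow> MC_eq_linf T A z \<Longrightarrow>
      linf_homotopic T A x y \<Longrightarrow> linf_homotopic T A y z \<Longrightarrow> linf_homotopic T A x z" by (rule homotopic_equiv(3))
qed (rule art_morphism.MC_eq_linf_coeff_map art_morphism.homotopic_coeff_map; assumption)+

lemma tensor_functor_H: "tensor_functor H (MC_eq_dgla H) (dgla_gauge_equivalent H)"
proof
  show "graded_space H" using dgla by (simp add: is_dgla_def)
next
  fix A :: "'x calgebra" and x y z x' y' assume "A \<in> Art"
  then interpret art_cone A H T dV \<iota> \<pi> K by (rule art_cone)
  show "teq H A 1 x x' \<Longrightarrow> MC_eq_dgla H A x \<Longrightarrow> MC_eq_dgla H A x'" by (rule MC_eq_dgla_cong)
  show "teq H A 1 x x' \<Longrightarrow> teq H A 1 y y' \<Longrightarrow> dgla_gauge_equivalent H A x y \<Longrightarrow> dgla_gauge_equivalent H A x' y'"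
    by (rule gauge_equivalent_cong)
  show "x \<in> fsums H A 1 \<Longrightarrow> MC_eq_dgla H A x \<Longrightarrow> dgla_gauge_equivalent H A x x" by (rule gauge_equivalent_equiv(1))
  show "x \<in> fsums H A 1 \<Longrightarrow> MC_eq_dgla H A x \<Longrightarrow> y \<in> fsums H A 1 \<Longrightarrow> MC_eq_dgla H A y \<Longrightarrow>
      dgla_gauge_equivalent H A x y \<Longrightarrow> dgla_gauge_equivalent H A y x" by (rule gauge_equivalent_equiv(2))
  show "x \<in> fsums H A 1 \<Longrightarrow> MC_eq_dgla H A x \<Longrightarrow> y \<in> fsums H A 1 \<Longrightarrow> MC_eq_dgla H A y \<Longrightarrow>
      z \<in> fsums H A 1 \<Longrightarrow> MC_eq_dgla H A z \<Longrightarrow>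
      dgla_gauge_equivalent H A x y \<Longrightarrow> dgla_gauge_equivalent H A y z \<Longrightarrow> dgla_gauge_equivalent H A x z"
    by (rule gauge_equivalent_equiv(3))
qed (rule art_morphism.MC_eq_dgla_coeff_map art_morphism.gauge_equivalent_coeff_map; assumption)+

text \<open>Existence of lifts gives totality, the gauge normal form surjectivity up to gauge, the
  comparison of homotopies with gauge transformations compatibility with the relations, and
  invariance of the lifting equation under coefficient maps naturality.\<close>

theorem functor_iso: "functor_iso (Def_linf T :: ('x, ('c, 'x) fsum set set) art_functor) (Def_dgla H)"
proof -
  interpret FT: tensor_functor T "MC_eq_linf T :: 'x calgebra \<Rightarrow> _" "linf_homotopic T" by (rule tensor_functor_T)
  interpret FH: tensor_functor H "MC_eq_dgla H :: 'x calgebra \<Rightarrow> _" "dgla_gauge_equivalent H" by (rule tensor_functor_H)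
  have MC: "FT.mc_classes = MC_linf T" "FH.mc_classes = MC_dgla H"
    by (auto simp: fun_eq_iff FT.mc_classes_def MC_linf_def FH.mc_classes_def MC_dgla_def)
  have rel: "FT.class_rel = homotopy_rel T" "FH.class_rel = gauge_rel H"
    unfolding fun_eq_iff FT.class_rel_def FH.class_rel_def MC homotopy_rel_def gauge_rel_def
      linf_homotopic_def dgla_gauge_equivalent_def by simp_all
  \<comment> \<open>A relation between classes of elements and classes of their lifts;
    well-definedness on the quotients follows from its compatibility with homotopy and gauge
    equivalence.\<close>
  define \<Psi> :: "'x calgebra \<Rightarrow> _" where "\<Psi> A = {(tclass T A 1 x, tclass H A 1 y) | x y.
    x \<in> fsums T A 1 \<and> y \<in> fsums H A 1 \<and> mc_lift H \<iota> K A x y \<and> MC_eq_linf T A x \<and> MC_eq_dgla H A y}" for A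
  have "functor_iso FT.quotient FH.quotient"
  proof (rule functor_iso_quotients[OF FT.quotient_functor_axioms FH.quotient_functor_axioms, of \<Psi>])
    fix A :: "'x calgebra" assume A: "A \<in> Art"
    then interpret art_cone A H T dV \<iota> \<pi> K by (rule art_cone)
    show "\<Psi> A \<subseteq> FT.mc_classes A \<times> FH.mc_classes A"
      unfolding \<Psi>_def FT.mc_classes_def FH.mc_classes_def by blast
    show "\<exists>Y. (X, Y) \<in> \<Psi> A" if X: "X \<in> FT.mc_classes A" for X
    proof -
      obtain x where x: "x \<in> fsums T A 1" "MC_eq_linf T A x" "X = tclass T A 1 x"
        using X by (rule FT.classes_cases)
      obtain y where y: "y \<in> fsums H A 1" "mc_lift H \<iota> K A x y" using lift_eq_exists[OF x(1)] by blast
      have "MC_eq_dgla H A y" using lift_eq_MC[OF x(1) y] x(2) by simp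
      with x y show ?thesis unfolding \<Psi>_def by blast
    qed
    show "\<exists>X Y'. (X, Y') \<in> \<Psi> A \<and> (Y, Y') \<in> FH.class_rel A" if Y: "Y \<in> FH.mc_classes A" for Y
    proof -
      obtain y where y: "y \<in> fsums H A 1" "MC_eq_dgla H A y" "Y = tclass H A 1 y"
        using Y by (rule FH.classes_cases)
      obtain x y' where x: "x \<in> fsums T A 1" "y' \<in> fsums H A 1" "mc_lift H \<iota> K A x y'" "MC_eq_linf T A x"
          "dgla_gauge_equivalent H A y y'"
        using lift_eq_surj[OF y(1,2)] by blast
      have m: "MC_eq_dgla H A y'" using lift_eq_MC[OF x(1-3)] x(4) by simp
      have "(tclass T A 1 x, tclass H A 1 y') \<in> \<Psi> A" unfolding \<Psi>_def using x m by blast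
      moreover have "(Y, tclass H A 1 y') \<in> FH.class_rel A"
        unfolding y(3) FH.class_rel_iff[OF A y(1) x(2)] using y(2) m x(5) by simp
      ultimately show ?thesis by blast
    qed
    show "(X, X') \<in> FT.class_rel A \<longleftrightarrow> (Y, Y') \<in> FH.class_rel A" if XY: "(X, Y) \<in> \<Psi> A" "(X', Y') \<in> \<Psi> A" for X Y X' Y'
    proof -
      from XY(1) obtain x y where x: "x \<in> fsums T A 1" "y \<in> fsums H A 1" "mc_lift H \<iota> K A x y"
        "MC_eq_linf T A x" "MC_eq_dgla H A y" and X: "X = tclass T A 1 x" "Y = tclass H A 1 y"
        unfolding \<Psi>_def by blast
      from XY(2) obtain x' y' where x': "x' \<in> fsums T A 1" "y' \<in> fsums H A 1" "mc_lift H \<iota> K A x' y'"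
        "MC_eq_linf T A x'" "MC_eq_dgla H A y'" and X': "X' = tclass T A 1 x'" "Y' = tclass H A 1 y'"
        unfolding \<Psi>_def by blast
      show ?thesis
        unfolding X X' FT.class_rel_iff[OF A x(1) x'(1)] FH.class_rel_iff[OF A x(2) x'(2)]
        using lift_eq_equivalent[OF x(1-4) x'(1-4)] x(4,5) x'(4,5) by simp
    qed
  next
    fix A B :: "'x calgebra" and f X Y
    assume AB: "A \<in> Art" "B \<in> Art" "f \<in> Art_hom A B" and XY: "(X, Y) \<in> \<Psi> A"
    interpret f: art_morphism A B f by unfold_locales (rule AB)+
    from XY obtain x y where x: "x \<in> fsums T A 1" "y \<in> fsums H A 1" "mc_lift H \<iota> K A x y"
        "MC_eq_linf T A x" "MC_eq_dgla H A y" and X: "X = tclass T A 1 x" "Y = tclass H A 1 y"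
      unfolding \<Psi>_def by blast
    show "(tpush T B 1 f X, tpush H B 1 f Y) \<in> \<Psi> B"
      unfolding X f.tpush_tclass[OF x(1)] f.tpush_tclass[OF x(2)] \<Psi>_def
      using f.coeff_map_fsums[OF x(1)] f.coeff_map_fsums[OF x(2)] f.mc_lift_coeff_map[OF x(2,3)]
        f.MC_eq_linf_coeff_map[OF x(1,4)] f.MC_eq_dgla_coeff_map[OF x(2,5)] by blast
  qed
  moreover have "FT.quotient = Def_linf T" "FH.quotient = Def_dgla H"
    using FT.quotient_def FH.quotient_def unfolding Def_linf_def Def_dgla_def MC rel by simp_all
  ultimately show ?thesis by simp
qed

end

theorem corollary6p13:
  fixes L :: "'l::ab_group_add dgla"
    and N :: "'n::ab_group_add dgla"
    and M :: "'m::ab_group_add dgla"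
    and h :: "int \<Rightarrow> 'l \<Rightarrow> 'm"
    and g :: "int \<Rightarrow> 'n \<Rightarrow> 'm"
  assumes "is_dgla L" and "is_dgla N" and "is_dgla M"
    and "dgla_hom h L M" and "dgla_hom g N M"
  shows "functor_iso
    (Def_linf (cone_linf L N M h g) :: ('a, ('l \<times> 'n \<times> 'm, 'a) fsum set set) art_functor)
    (Def_dgla (H_dgla L N M h g) :: ('a, ('l \<times> 'n \<times> 'm forms, 'a) fsum set set) art_functor)"
proof -
  interpret cone_data L N M h g using assms by unfold_locales
  interpret transferred H C "cone_diff L N M h g" "\<lambda>i. cone_incl h g (i - 1)" "\<lambda>i. cone_proj M" "\<lambda>i. cone_homotopy M"
    by (rule transferred_cone)
  show ?thesis by (rule functor_iso)
qed

end
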